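(* Let $b,\sigma:\mathbb{R}\to\mathbb{R}$ and $K\in L^2_{\mathrm{loc}}(\mathbb{R}_+)$. Suppose there are constants $C,C^*>0$, exponents $\chi_b,\chi_\sigma\in(0,1]$ and $\gamma,\gamma_*>0$ such that $$|b(y)-b(x)|\le C|y-x|^{\chi_b},\quad |\sigma(y)-\sigma(x)|\le C|y-x|^{\chi_\sigma}\quad (x,y\in\mathbb{R}),\qquad C^*t^{2\gamma_*}\le\int_0^tK(s)^2\,\mathrm{d}s\le Ct^{2\gamma}\quad (t\in(0,1]).$$ Let $(x_n)_{n\ge1}\subset\mathbb{R}$ with $x_n\to\overline{x}\in\mathbb{R}$ and $\sigma(\overline{x})\neq0$. For each $n\ge1$ let $X^{x_n}$ be a continuous weak solution, defined on some filtered probability space carrying a Brownian motion $B$ (both may depend on $n$), of $$X_t=x_n+\int_0^tK(t-s)\,b(X_s)\,\mathrm{d}s+\int_0^tK(t-s)\,\sigma(X_s)\,\mathrm{d}B_s,\qquad t\in\mathbb{R}_+.$$ Put $\lambda(n)=\big(\int_0^{1/n}K(r)^2\,\mathrm{d}r\big)^{-1}$. Fix $N\in\mathbb{N}$ and time points $0<t_1<\dots<t_N$, and suppose: (i) $\gamma_*<\min\{\gamma+\tfrac12,\ \gamma(1+\chi_\sigma)\}$; (ii) there exists $\overline{K}\in L^2_{\mathrm{loc}}(\mathbb{R}_+)$ such that for all $0\le s\le t\le\max\{1,t_N\}$ $$\lim_{n\to\infty}\lambda(n)\int_0^{s/n}K((t-s)/n+r)K(r)\,\mathrm{d}r=\int_0^s\overline{K}(t-s+r)\overline{K}(r)\,\mathrm{d}r.$$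 Let $Y^{\sigma,\infty}_t=\sigma(\overline{x})\int_0^t\overline{K}(t-s)\,\mathrm{d}B_s$ with $B$ a Brownian motion. (a) If $f\in C^1(\mathbb{R};\mathbb{R})$, then as $n\to\infty$ $$\Big(\sqrt{\lambda(n)}\,\big(f(X^{x_n}_{t_j/n})-f(x_n)\big)\Big)_{j=1,\dots,N}\ \xrightarrow{\ d\ }\ f'(\overline{x})\,\big(Y^{\sigma,\infty}_{t_j}\big)_{j=1,\dots,N}.$$ (b) If $f\in C^2(\mathbb{R};\mathbb{R})$, $f'(\overline{x})=0$ and $\lim_{n\to\infty}\sqrt{\lambda(n)}\,f'(x_n)=0$, then as $n\to\infty$ $$\Big(\lambda(n)\,\big(f(X^{x_n}_{t_j/n})-f(x_n)\big)\Big)_{j=1,\dots,N}\ \xrightarrow{\ d\ }\ \frac{f''(\overline{x})}{2}\,\Big(\big(Y^{\sigma,\infty}_{t_j}\big)^2\Big)_{j=1,\dots,N},$$ and so the one-dimensional marginals of the limit follow a scaled $\chi^2$-distribution with one degree of freedom.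
   Context: $\mathbb{R}_+=[0,\infty)$. $\xrightarrow{d}$ denotes convergence in distribution. A continuous weak solution is a process with continuous sample paths, adapted on some filtered probability space carrying a real-valued Brownian motion, satisfying the integral equation. *)

theory Defs
  imports "HOL-Probability.Probability"
begin

section \<open>Kernels\<close>

definition L2_loc :: "(real \<Rightarrow> real) \<Rightarrow> bool" where
  "L2_loc K \<longleftrightarrow> set_borel_measurable borel {0..} K \<and>
     (\<forall>T\<ge>0. set_integrable lborel {0..T} (\<lambda>s. (K s)\<^sup>2))"

definition scale_rate :: "(real \<Rightarrow> real) \<Rightarrow> nat \<Rightarrow> real" where
  "scale_rate K n = inverse (LBINT r:{0..1 / real n}. (K r)\<^sup>2)"

section \<open>Brownian motion on a filtered probability space\<close>

text \<open>Time is \<^term>\<open>{0..} :: real set\<close>; values of families \<open>F\<close>, \<open>B\<close>, \<open>X\<close> at negative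
  times are irrelevant. The filtration is not required to satisfy the usual conditions.\<close>

locale filtered_prob_space = prob_space M for M :: "'a measure" +
  fixes F :: "real \<Rightarrow> 'a measure"
  assumes subalgebra_F: "0 \<le> t \<Longrightarrow> subalgebra M (F t)"
    and mono_F: "0 \<le> s \<Longrightarrow> s \<le> t \<Longrightarrow> sets (F s) \<subseteq> sets (F t)"

definition adapted :: "(real \<Rightarrow> 'a measure) \<Rightarrow> (real \<Rightarrow> 'a \<Rightarrow> real) \<Rightarrow> bool" where
  "adapted F X \<longleftrightarrow> (\<forall>t\<ge>0. X t \<in> borel_measurable (F t))"

locale brownian_motion = filtered_prob_space M F
  for M :: "'a measure" and F :: "real \<Rightarrow> 'a measure" +
  fixes B :: "real \<Rightarrow> 'a \<Rightarrow> real"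
  assumes adapted_B: "adapted F B"
    and start_B: "AE \<omega> in M. B 0 \<omega> = 0"
    and continuous_B: "AE \<omega> in M. continuous_on {0..} (\<lambda>t. B t \<omega>)"
    and indep_B: "0 \<le> s \<Longrightarrow> s < t \<Longrightarrow>
      indep_set (sets (F s)) (sets (vimage_algebra (space M) (\<lambda>\<omega>. B t \<omega> - B s \<omega>) borel))"
    and normal_B: "0 \<le> s \<Longrightarrow> s < t \<Longrightarrow>
      distributed M lborel (\<lambda>\<omega>. B t \<omega> - B s \<omega>) (normal_density 0 (sqrt (t - s)))"

section \<open>The Ito integral\<close>

text \<open>A simple process is coded by a triple \<open>(k, u, \<xi>)\<close> standing for
  \<open>H\<^sub>s = (\<Sum>i<k. \<xi>\<^sub>i 1\<^bsub>(u\<^sub>i, u\<^sub>i\<^sub>+\<^sub>1]\<^esub>(s))\<close>.\<close>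

type_synonym 'a simple_code = "nat \<times> (nat \<Rightarrow> real) \<times> (nat \<Rightarrow> 'a \<Rightarrow> real)"

fun simple_process :: "'a measure \<Rightarrow> (real \<Rightarrow> 'a measure) \<Rightarrow> 'a simple_code \<Rightarrow> bool" where
  "simple_process M F (k, u, \<xi>) \<longleftrightarrow> 0 \<le> u 0 \<and>
     (\<forall>i<k. u i < u (Suc i) \<and> \<xi> i \<in> borel_measurable (F (u i)) \<and>
            (\<exists>c. \<forall>\<omega>\<in>space M. \<bar>\<xi> i \<omega>\<bar> \<le> c))"

fun simple_value :: "'a simple_code \<Rightarrow> real \<Rightarrow> 'a \<Rightarrow> real" where
  "simple_value (k, u, \<xi>) s \<omega> = (\<Sum>i<k. \<xi> i \<omega> * indicator {u i<..u (Suc i)} s)"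

fun simple_integral :: "(real \<Rightarrow> 'a \<Rightarrow> real) \<Rightarrow> 'a simple_code \<Rightarrow> real \<Rightarrow> 'a \<Rightarrow> real" where
  "simple_integral B (k, u, \<xi>) t \<omega> =
     (\<Sum>i<k. \<xi> i \<omega> * (B (min (u (Suc i)) t) \<omega> - B (min (u i) t) \<omega>))"

definition progressively_measurable_upto ::
    "(real \<Rightarrow> 'a measure) \<Rightarrow> (real \<Rightarrow> 'a \<Rightarrow> real) \<Rightarrow> real \<Rightarrow> bool" where
  "progressively_measurable_upto F H t \<longleftrightarrow>
     (\<forall>s\<in>{0..t}. (\<lambda>(r, \<omega>). H r \<omega>) \<in> borel_measurable (restrict_space borel {0..s} \<Otimes>\<^sub>M F s))"

text \<open>\<open>I\<close> is a version of \<open>\<integral>\<^sub>0\<^sup>t H\<^sub>s dB\<^sub>s\<close>, for progressive \<open>H\<close> with \<open>\<integral>\<^sub>0\<^sup>t H\<^sub>s\<^sup>2 ds < \<infinity>\<close> almost surely: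
  the limit in probability of the integrals of simple processes \<open>S\<^sub>m\<close> such that
  \<open>\<integral>\<^sub>0\<^sup>t (H\<^sub>s - S\<^sub>m\<^sub>,\<^sub>s)\<^sup>2 ds \<rightarrow> 0\<close> in probability. The integrals over time are taken in
  \<^typ>\<open>ennreal\<close>, so that divergent ones are not silently \<open>0\<close>.\<close>

definition has_ito_integral ::
    "'a measure \<Rightarrow> (real \<Rightarrow> 'a measure) \<Rightarrow> (real \<Rightarrow> 'a \<Rightarrow> real) \<Rightarrow>
     (real \<Rightarrow> 'a \<Rightarrow> real) \<Rightarrow> real \<Rightarrow> ('a \<Rightarrow> real) \<Rightarrow> bool" where
  "has_ito_integral M F B H t I \<longleftrightarrow>
     progressively_measurable_upto F H t \<and>
     (AE \<omega> in M. (\<integral>\<^sup>+s\<in>{0..t}. ennreal ((H s \<omega>)\<^sup>2) \<partial>lborel) < \<infinity>) \<and>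
     I \<in> borel_measurable M \<and>
     (\<exists>S. (\<forall>m. simple_process M F (S m)) \<and>
        (\<forall>\<epsilon>>0. (\<lambda>m. measure M {\<omega>\<in>space M.
            ennreal \<epsilon> < (\<integral>\<^sup>+s\<in>{0..t}. ennreal ((H s \<omega> - simple_value (S m) s \<omega>)\<^sup>2) \<partial>lborel)})
          \<longlonglongrightarrow> 0) \<and>
        (\<forall>\<epsilon>>0. (\<lambda>m. measure M {\<omega>\<in>space M. \<epsilon> < \<bar>I \<omega> - simple_integral B (S m) t \<omega>\<bar>})
          \<longlonglongrightarrow> 0))"

section \<open>Stochastic Volterra equation\<close>

definition continuous_weak_solution ::
    "(real \<Rightarrow> real) \<Rightarrow> (real \<Rightarrow> real) \<Rightarrow> (real \<Rightarrow> real) \<Rightarrow> real \<Rightarrow>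
     'a measure \<Rightarrow> (real \<Rightarrow> 'a measure) \<Rightarrow> (real \<Rightarrow> 'a \<Rightarrow> real) \<Rightarrow>
     (real \<Rightarrow> 'a \<Rightarrow> real) \<Rightarrow> bool" where
  "continuous_weak_solution K b \<sigma> x M F B X \<longleftrightarrow>
     brownian_motion M F B \<and> adapted F X \<and>
     (\<forall>\<omega>\<in>space M. continuous_on {0..} (\<lambda>t. X t \<omega>)) \<and>
     (\<forall>t\<ge>0. \<exists>I. has_ito_integral M F B (\<lambda>s \<omega>. K (t - s) * \<sigma> (X s \<omega>)) t I \<and>
        (AE \<omega> in M. X t \<omega> = x + (LBINT s:{0..t}. K (t - s) * b (X s \<omega>)) + I \<omega>))"

section \<open>Convergence in distribution and chi-square laws\<close>

text \<open>The random variables may live on different probability spaces, and the finitely many first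
  members of the sequence are irrelevant.\<close>

definition converges_in_distribution ::
    "(nat \<Rightarrow> 'a measure) \<Rightarrow> (nat \<Rightarrow> 'a \<Rightarrow> 'c::metric_space) \<Rightarrow>
     'b measure \<Rightarrow> ('b \<Rightarrow> 'c) \<Rightarrow> bool" where
  "converges_in_distribution M Z M' Z' \<longleftrightarrow>
     (\<forall>\<^sub>F n in sequentially. prob_space (M n) \<and> Z n \<in> borel_measurable (M n)) \<and>
     prob_space M' \<and> Z' \<in> borel_measurable M' \<and>
     (\<forall>g :: 'c \<Rightarrow> real. continuous_on UNIV g \<and> bounded (range g) \<longrightarrow>
        (\<lambda>n. \<integral>\<omega>. g (Z n \<omega>) \<partial>M n) \<longlonglongrightarrow> (\<integral>\<omega>. g (Z' \<omega>) \<partial>M'))"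

definition chi_square :: "nat \<Rightarrow> real measure" where
  "chi_square d =
     distr (\<Pi>\<^sub>M i\<in>{..<d}. density lborel std_normal_density) borel (\<lambda>z. \<Sum>i<d. (z i)\<^sup>2)"

end

theory Submission
  imports Defs
begin

text \<open>
  On the time scale \<open>1/n\<close> a solution only feels the value of \<open>\<sigma>\<close> at its starting point.
  Let \<open>\<kappa>\<close> be the integral of \<open>K\<^sup>2\<close> over \<open>[0, T/n]\<close>, where \<open>T\<close> is the largest time point; by the
  assumption on \<open>Kbar\<close> it is at most a constant times \<open>1/\<lambda>(n)\<close>. For times up to \<open>T/n\<close> the second
  moment of \<open>X - x\<^sub>n\<close> is at most of order \<open>\<kappa>\<close> (\<open>localized_second_moment_bound\<close>). Hence the drift contributes a
  second moment of order \<open>\<kappa>/n\<close>, by Cauchy--Schwarz, and replacing \<open>\<sigma>(X)\<close> by \<open>\<sigma>(x\<^sub>n)\<close> costs one of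
  order \<open>\<kappa>\<^bsup>1+\<chi>\<^esup>\<close> with \<open>\<chi>\<close> the Hoelder exponent of \<open>\<sigma>\<close> (\<open>increment_approximation\<close>); after multiplication by \<open>\<lambda>(n)\<close> both
  vanish. What is left is the integral of the deterministic function \<open>\<sigma>(x\<^sub>n) K(t - s)\<close> against
  Brownian motion. At the times \<open>t\<^sub>j/n\<close> this is a centred Gaussian vector, and its covariance matrix
  times \<open>\<lambda>(n)\<close> tends to that of \<open>Y\<close> by the assumption on \<open>Kbar\<close>.

  The Ito integral is defined as a limit in probability, and moments of the solution are not given.
  Both difficulties are met by an inequality that is restricted to the event that the path has
  stayed in a bounded region: there the second moment of the difference of an Ito integral and a
  simple integral is at most the expected energy of the difference of the integrands
  (\<open>localized_ito_bound\<close>). The bounds obtained from it do not depend on the region, which may then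
  exhaust the line.

  Convergence of characteristic functions gives convergence in distribution
  (\<open>converges_in_distribution_if_cos\<close>), because after a change of variables trigonometric polynomials
  are dense by the Stone--Weierstrass theorem on a torus and bounded second moments control the rest.
  Errors that vanish in probability do not matter (\<open>slutsky\<close>). Taylor's formula reduces
  \<open>f(X) - f(x\<^sub>n)\<close> to its first or second order term with a remainder that is small whenever
  \<open>X - x\<^sub>n\<close> is (\<open>delta_method\<close>). Finally, \<open>Y\<close> has a positive variance at every time point, so that
  its square is a scaled chi-square variable: if the limit of the energy ratios vanished, the energy
  would decay faster than its power lower bound permits (\<open>energy_ratio_limit_positive\<close>).
\<close>

section \<open>Convergence in distribution of random vectors\<close>

text \<open>The functions whose expectations are determined by the characteristic function. Having a phase
  \<open>d\<close> avoids complex numbers: \<open>sin\<close> is \<open>cos\<close> shifted by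
  \<open>-\<pi>/2\<close>, and constants arise from \<open>a = 0\<close>.\<close>
inductive_set trig :: "('v::real_inner \<Rightarrow> real) set" where
  cos: "(\<lambda>x. c * cos (a \<bullet> x + d)) \<in> trig"
| add: "r \<in> trig \<Longrightarrow> s \<in> trig \<Longrightarrow> (\<lambda>x. r x + s x) \<in> trig"

text \<open>The product-to-sum formula makes the trigonometric polynomials an algebra, as the
  Stone--Weierstrass theorem requires.\<close>
lemma trig_mult:
  assumes "r \<in> trig" "s \<in> trig"
  shows "(\<lambda>x. r x * s x) \<in> trig"
  using assms
proof (induction r rule: trig.induct)
  case (cos c a d)
  show ?case using cos
  proof (induction s rule: trig.induct)
    case (cos c' a' d')
    have "(\<lambda>x. (c * c' / 2) * cos ((a + a') \<bullet> x + (d + d')) + (c * c' / 2) * cos ((a - a') \<bullet> x + (d - d'))) \<in> trig"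
      by (intro trig.intros)
    also have "(\<lambda>x. (c * c' / 2) * cos ((a + a') \<bullet> x + (d + d')) + (c * c' / 2) * cos ((a - a') \<bullet> x + (d - d'))) =
       (\<lambda>x. c * cos (a \<bullet> x + d) * (c' * cos (a' \<bullet> x + d')))"
    proof
      fix x
      have e: "(a + a') \<bullet> x + (d + d') = (a \<bullet> x + d) + (a' \<bullet> x + d')"
        "(a - a') \<bullet> x + (d - d') = (a \<bullet> x + d) - (a' \<bullet> x + d')"
        by (auto simp: algebra_simps)
      show "(c * c' / 2) * cos ((a + a') \<bullet> x + (d + d')) + (c * c' / 2) * cos ((a - a') \<bullet> x + (d - d')) =
        c * cos (a \<bullet> x + d) * (c' * cos (a' \<bullet> x + d'))"
        unfolding e cos_add cos_diff by (simp add: field_simps)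
    qed
    finally show ?case .
  next
    case (add r s)
    then show ?case by (simp add: distrib_left trig.add)
  qed
next
  case (add r s)
  then show ?case by (simp add: distrib_right trig.add)
qed

lemma one_minus_prod_le:
  fixes p :: "'i \<Rightarrow> real"
  assumes "finite I" "\<And>i. i \<in> I \<Longrightarrow> 0 \<le> p i \<and> p i \<le> 1"
  shows "1 - (\<Prod>i\<in>I. p i) \<le> (\<Sum>i\<in>I. 1 - p i)"
  using assms
proof (induction I rule: finite_induct)
  case (insert i I)
  have P: "0 \<le> (\<Prod>i\<in>I. p i)" "(\<Prod>i\<in>I. p i) \<le> 1" using insert by (auto intro!: prod_nonneg prod_le_1)
  have "(1 - p i) * (\<Prod>i\<in>I. p i) \<le> (1 - p i) * 1"
    by (intro mult_left_mono) (use insert P in auto)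
  then show ?case using insert by (auto simp: algebra_simps)
qed auto

lemma one_minus_cos_le: "1 - cos y \<le> (y::real)\<^sup>2"
proof -
  have "1 - cos y = 2 * (sin (y / 2))\<^sup>2" using cos_double_sin[of "y / 2"] by simp
  also have "(sin (y/2))\<^sup>2 \<le> (y/2)\<^sup>2" by (metis abs_le_square_iff abs_sin_x_le_abs_x)
  finally show ?thesis by (auto simp: power_divide)
    (smt (verit) field_sum_of_halves power2_less_0)
qed

text \<open>The map that sends \<open>x\<close> to the point with coordinates \<open>cis (x\<^sub>j /
  L)\<close> takes values in a compact torus, on which polynomials in the coordinates are dense; pulled back,
  they are trigonometric polynomials. Multiplied by the product of the functions \<open>max 0 (cos (x\<^sub>j
  / L))\<close>, the function \<open>g\<close> becomes periodic without losing continuity: the cut-off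
  vanishes where a coordinate leaves \<open>[-\<pi>L/2, \<pi>L/2]\<close>, and inside this cube
  \<open>x\<^sub>j\<close> is recovered from \<open>sin (x\<^sub>j / L)\<close> by \<open>arcsin\<close>. The
  cut-off changes \<open>g\<close> by at most a multiple of the squared norm of \<open>x / L\<close>; this is
  the quadratic term.\<close>
lemma trig_approximation:
  fixes g :: "real^'n \<Rightarrow> real"
  assumes g: "continuous_on UNIV g" "\<And>x. \<bar>g x\<bar> \<le> c" and L: "L > 0" and e: "e > 0"
  obtains r where "r \<in> trig" "\<And>x. \<bar>g x - r x\<bar> \<le> e + 2 * c * (\<Sum>j\<in>UNIV. (x $ j)\<^sup>2) / L\<^sup>2"
proof -
  have c0: "c \<ge> 0" using g(2)[of 0] by linarith
  define S where "S = {z::complex^'n. \<forall>j. norm (z $ j) = 1}"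
  define \<theta> :: "real^'n \<Rightarrow> complex^'n" where "\<theta> = (\<lambda>x. \<chi> j. cis (x $ j / L))"
  define R where "R = {r. continuous_on S r \<and> (\<lambda>x. r (\<theta> x)) \<in> trig}"
  have \<theta>S: "\<theta> x \<in> S" for x by (auto simp: \<theta>_def S_def)
  have cl: "closed S"
  proof -
    have "S = (\<Inter>j. {z. norm (z $ j) = 1})" by (auto simp: S_def)
    moreover have "closed {z::complex^'n. norm (z $ j) = 1}" for j
      by (intro closed_Collect_eq continuous_intros)
    ultimately show ?thesis by auto
  qed
  have bd: "bounded S"
  proof (rule boundedI)
    fix z assume "z \<in> S"
    then have "norm z \<le> (\<Sum>j\<in>(UNIV::'n set). 1)"
      unfolding S_def norm_vec_def by (intro order_trans[OF L2_set_le_sum]) auto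
    then show "norm z \<le> CARD('n)" by simp
  qed
  interpret function_ring_on R S
  proof
    show "compact S" using cl bd by (simp add: compact_eq_bounded_closed)
    show "f \<in> R \<Longrightarrow> continuous_on S f" for f by (simp add: R_def)
    show "f \<in> R \<Longrightarrow> g \<in> R \<Longrightarrow> (\<lambda>x. f x + g x) \<in> R" for f g
      by (auto simp: R_def intro!: continuous_intros trig.add)
    show "f \<in> R \<Longrightarrow> g \<in> R \<Longrightarrow> (\<lambda>x. f x * g x) \<in> R" for f g
      by (auto simp: R_def intro!: continuous_intros trig_mult)
    show "(\<lambda>_. k) \<in> R" for k
      using trig.cos[of k 0 0] by (auto simp: R_def)
    fix z w assume zw: "z \<in> S" "w \<in> S" "z \<noteq> w"
    then obtain j where "z $ j \<noteq> w $ j" by (auto simp: vec_eq_iff)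
    then consider "Re (z $ j) \<noteq> Re (w $ j)" | "Im (z $ j) \<noteq> Im (w $ j)"
      using complex_eq_iff by blast
    then show "\<exists>f\<in>R. f z \<noteq> f w"
    proof cases
      case 1
      have "(\<lambda>x. Re (\<theta> x $ j)) \<in> trig"
        using trig.cos[of 1 "axis j (1 / L) :: real^'n" 0] by (simp add: \<theta>_def inner_axis')
      then have "(\<lambda>z. Re (z $ j)) \<in> R" unfolding R_def by (intro CollectI conjI continuous_intros)
      then show ?thesis using 1 by (intro bexI[of _ "\<lambda>z. Re (z $ j)"])
    next
      case 2
      have "(\<lambda>x. Im (\<theta> x $ j)) \<in> trig"
        using trig.cos[of 1 "axis j (1 / L) :: real^'n" "- pi / 2"]
        by (simp add: \<theta>_def inner_axis' cos_diff)
      then have "(\<lambda>z. Im (z $ j)) \<in> R" unfolding R_def by (intro CollectI conjI continuous_intros)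
      then show ?thesis using 2 by (intro bexI[of _ "\<lambda>z. Im (z $ j)"])
    qed
  qed
  (* the cut-off function, written on the torus *)
  define q where "q = (\<lambda>z::complex^'n. g (\<chi> j. L * arcsin (Im (z $ j))) * (\<Prod>j\<in>UNIV. max 0 (Re (z $ j))))"
  have ImS: "-1 \<le> Im (z $ j) \<and> Im (z $ j) \<le> 1" "Re (z $ j) \<le> 1" if "z \<in> S" for z j
    using that abs_Im_le_cmod[of "z $ j"] abs_Re_le_cmod[of "z $ j"] by (auto simp: S_def abs_le_iff)
  have "continuous_on S q"
    unfolding q_def
    by (intro continuous_on_mult continuous_on_compose2[OF g(1)] continuous_on_vec_lambda
        continuous_on_arcsin' continuous_intros) (use ImS in auto)
  then obtain r0 where r0: "r0 \<in> R" "\<And>z. z \<in> S \<Longrightarrow> \<bar>q z - r0 z\<bar> < e"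
    using Stone_Weierstrass_basic[OF _ e] by blast
  show ?thesis
  proof
    show "(\<lambda>x. r0 (\<theta> x)) \<in> trig" using r0 by (simp add: R_def)
    fix x :: "real^'n"
    have sumeq: "(\<Sum>j\<in>UNIV. (x $ j)\<^sup>2) / L\<^sup>2 = (\<Sum>j\<in>UNIV. (x $ j / L)\<^sup>2)"
      by (simp add: sum_divide_distrib power_divide)
    define P where "P = (\<Prod>j\<in>UNIV. max 0 (cos (x $ j / L)))"
    have P: "0 \<le> P" "P \<le> 1" unfolding P_def by (auto intro!: prod_nonneg prod_le_1)
    have qx: "q (\<theta> x) = g (\<chi> j. L * arcsin (sin (x $ j / L))) * P"
      by (simp add: q_def \<theta>_def P_def)
    have "\<bar>g x - q (\<theta> x)\<bar> \<le> 2 * c * (\<Sum>j\<in>UNIV. (x $ j / L)\<^sup>2)"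
    proof (cases "\<forall>j. \<bar>x $ j / L\<bar> \<le> pi / 2")
      case True
      have "arcsin (sin (x $ j / L)) = x $ j / L" for j
        using True[rule_format, of j] by (intro arcsin_sin) linarith+
      then have "(\<chi> j. L * arcsin (sin (x $ j / L))) = x" using L by (simp add: vec_eq_iff)
      then have q: "q (\<theta> x) = g x * P" using qx by simp
      have "1 - P \<le> (\<Sum>j\<in>UNIV. 1 - max 0 (cos (x $ j / L)))"
        unfolding P_def by (intro one_minus_prod_le) auto
      also have "\<dots> \<le> (\<Sum>j\<in>UNIV. (x $ j / L)\<^sup>2)"
        by (intro sum_mono) (smt (verit) one_minus_cos_le)
      finally have 1: "1 - P \<le> (\<Sum>j\<in>UNIV. (x $ j / L)\<^sup>2)" .
      have "\<bar>g x - q (\<theta> x)\<bar> = \<bar>g x\<bar> * (1 - P)"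
      proof -
        have "g x - q (\<theta> x) = g x * (1 - P)" unfolding q by (simp add: right_diff_distrib)
        then show ?thesis using P by (simp add: abs_mult)
      qed
      also have "\<dots> \<le> c * (\<Sum>j\<in>UNIV. (x $ j / L)\<^sup>2)"
        by (intro mult_mono g 1 c0) (use P in auto)
      also have "\<dots> \<le> 2 * c * (\<Sum>j\<in>UNIV. (x $ j / L)\<^sup>2)"
        by (intro mult_right_mono) (use c0 in \<open>auto intro!: sum_nonneg\<close>)
      finally show ?thesis .
    next
      case False
      then obtain j where j: "\<bar>x $ j / L\<bar> > pi / 2" by (meson not_le)
      then have "\<bar>x $ j / L\<bar> \<ge> 1" using pi_gt3 by linarith
      then have "1 \<le> (x $ j / L)\<^sup>2" by (metis one_le_power power2_abs)
      also have "\<dots> \<le> (\<Sum>j\<in>UNIV. (x $ j / L)\<^sup>2)" by (rule member_le_sum) auto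
      finally have 1: "1 \<le> (\<Sum>j\<in>UNIV. (x $ j / L)\<^sup>2)" .
      have "\<bar>q (\<theta> x)\<bar> \<le> c * 1" unfolding qx abs_mult
        by (intro mult_mono g c0) (use P in auto)
      then have "\<bar>g x - q (\<theta> x)\<bar> \<le> 2 * c * 1" using g(2)[of x] by linarith
      also have "\<dots> \<le> 2 * c * (\<Sum>j\<in>UNIV. (x $ j / L)\<^sup>2)"
        by (intro mult_left_mono 1) (use c0 in auto)
      finally show ?thesis .
    qed
    with r0(2)[OF \<theta>S[of x]] show "\<bar>g x - r0 (\<theta> x)\<bar> \<le> e + 2 * c * (\<Sum>j\<in>UNIV. (x $ j)\<^sup>2) / L\<^sup>2"
      using sumeq by (simp add: mult.assoc times_divide_eq_right[symmetric] del: times_divide_eq_right)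
  qed
qed

lemma continuous_trig: "r \<in> trig \<Longrightarrow> continuous_on UNIV r"
  by (induction rule: trig.induct) (auto intro!: continuous_intros)

lemma bounded_trig: "r \<in> trig \<Longrightarrow> \<exists>c. \<forall>x. \<bar>r x\<bar> \<le> c"
proof (induction rule: trig.induct)
  case (cos c a d)
  have "\<bar>c * cos (a \<bullet> x + d)\<bar> \<le> \<bar>c\<bar>" for x
    by (simp add: abs_mult mult_left_le)
  then show ?case by blast
next
  case (add r s)
  then obtain c c' where "\<And>x. \<bar>r x\<bar> \<le> c" "\<And>x. \<bar>s x\<bar> \<le> c'" by blast
  then have "\<bar>r x + s x\<bar> \<le> c + c'" for x using abs_triangle_ineq[of "r x" "s x"] add_mono order_trans by blast
  then show ?case by blast
qed

lemma (in prob_space) integrable_continuous_bounded: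
  fixes Z :: "'a \<Rightarrow> 'v::metric_space"
  assumes "Z \<in> borel_measurable M" "continuous_on UNIV g" "\<And>x. \<bar>g x\<bar> \<le> (c::real)"
  shows "integrable M (\<lambda>\<omega>. g (Z \<omega>))"
proof -
  have [measurable]: "g \<in> borel_measurable borel" using assms(2) by (rule borel_measurable_continuous_onI)
  note [measurable] = assms(1)
  show ?thesis by (rule integrable_const_bound[of _ c]) (use assms(3) in auto)
qed

lemma trig_tendsto:
  fixes Z :: "nat \<Rightarrow> 'a \<Rightarrow> 'v::euclidean_space" and Z' :: "'b \<Rightarrow> 'v"
  assumes Z: "\<forall>\<^sub>F n in sequentially. prob_space (M n) \<and> Z n \<in> borel_measurable (M n)"
    and Z': "prob_space M'" "Z' \<in> borel_measurable M'"
    and cos: "\<And>a d. (\<lambda>n. \<integral>\<omega>. cos (a \<bullet> Z n \<omega> + d) \<partial>M n) \<longlonglongrightarrow> (\<integral>\<omega>. cos (a \<bullet> Z' \<omega> + d) \<partial>M')"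
    and r: "r \<in> trig"
  shows "(\<lambda>n. \<integral>\<omega>. r (Z n \<omega>) \<partial>M n) \<longlonglongrightarrow> (\<integral>\<omega>. r (Z' \<omega>) \<partial>M')"
  using r
proof (induction rule: trig.induct)
  case (cos c a d)
  show ?case by (simp add: tendsto_mult_left assms(4))
next
  case (add r s)
  have int: "prob_space N \<Longrightarrow> Y \<in> borel_measurable N \<Longrightarrow> integrable N (\<lambda>\<omega>. r (Y \<omega>)) \<and> integrable N (\<lambda>\<omega>. s (Y \<omega>))"
    for N :: "'c measure" and Y
    using bounded_trig[OF add(1)] bounded_trig[OF add(2)] continuous_trig[OF add(1)] continuous_trig[OF add(2)]
    by (metis prob_space.integrable_continuous_bounded)
  have "(\<lambda>n. (\<integral>\<omega>. r (Z n \<omega>) \<partial>M n) + (\<integral>\<omega>. s (Z n \<omega>) \<partial>M n)) \<longlonglongrightarrow> (\<integral>\<omega>. r (Z' \<omega>) \<partial>M') + (\<integral>\<omega>. s (Z' \<omega>) \<partial>M')"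
    by (intro tendsto_add add)
  moreover have "\<forall>\<^sub>F n in sequentially. (\<integral>\<omega>. r (Z n \<omega>) + s (Z n \<omega>) \<partial>M n) = (\<integral>\<omega>. r (Z n \<omega>) \<partial>M n) + (\<integral>\<omega>. s (Z n \<omega>) \<partial>M n)"
    using Z
  proof (rule eventually_mono)
    fix n assume "prob_space (M n) \<and> Z n \<in> borel_measurable (M n)"
    then show "(\<integral>\<omega>. r (Z n \<omega>) + s (Z n \<omega>) \<partial>M n) = (\<integral>\<omega>. r (Z n \<omega>) \<partial>M n) + (\<integral>\<omega>. s (Z n \<omega>) \<partial>M n)"
      using bounded_trig[OF add(1)] bounded_trig[OF add(2)] continuous_trig[OF add(1)] continuous_trig[OF add(2)]
      by (intro Bochner_Integration.integral_add) (metis prob_space.integrable_continuous_bounded)+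
  qed
  moreover have "(\<integral>\<omega>. r (Z' \<omega>) + s (Z' \<omega>) \<partial>M') = (\<integral>\<omega>. r (Z' \<omega>) \<partial>M') + (\<integral>\<omega>. s (Z' \<omega>) \<partial>M')"
    using bounded_trig[OF add(1)] bounded_trig[OF add(2)] continuous_trig[OF add(1)] continuous_trig[OF add(2)] Z'
      by (intro Bochner_Integration.integral_add) (metis prob_space.integrable_continuous_bounded)+
  ultimately show ?case by (simp add: tendsto_cong)
qed

text \<open>A continuity theorem in several dimensions. Bounded second moments replace the tightness argument:
  they bound the expectation of the quadratic error of \<open>trig_approximation\<close>, uniformly in
  \<open>n\<close>, by a multiple of \<open>1 / L\<^sup>2\<close>.\<close>
lemma converges_in_distribution_if_cos:
  fixes Z :: "nat \<Rightarrow> 'a \<Rightarrow> real^'n" and Z' :: "'b \<Rightarrow> real^'n"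
  assumes Z: "\<forall>\<^sub>F n in sequentially. prob_space (M n) \<and> Z n \<in> borel_measurable (M n)"
    and Z': "prob_space M'" "Z' \<in> borel_measurable M'"
    and cos: "\<And>a d. (\<lambda>n. \<integral>\<omega>. cos (a \<bullet> Z n \<omega> + d) \<partial>M n) \<longlonglongrightarrow> (\<integral>\<omega>. cos (a \<bullet> Z' \<omega> + d) \<partial>M')"
    and sq: "\<forall>\<^sub>F n in sequentially. \<forall>j. integrable (M n) (\<lambda>\<omega>. (Z n \<omega> $ j)\<^sup>2) \<and> (\<integral>\<omega>. (Z n \<omega> $ j)\<^sup>2 \<partial>M n) \<le> m"
    and sq': "\<And>j. integrable M' (\<lambda>\<omega>. (Z' \<omega> $ j)\<^sup>2)"
  shows "converges_in_distribution M Z M' Z'"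
proof -
  have "(\<lambda>n. \<integral>\<omega>. g (Z n \<omega>) \<partial>M n) \<longlonglongrightarrow> (\<integral>\<omega>. g (Z' \<omega>) \<partial>M')"
    if g: "continuous_on UNIV g" "bounded (range g)" for g :: "real^'n \<Rightarrow> real"
  proof (rule LIMSEQ_I)
    fix e :: real assume e: "e > 0"
    from g(2) obtain c where c: "\<And>x. \<bar>g x\<bar> \<le> c" by (auto simp: bounded_iff)
    have c0: "c \<ge> 0" using c[of 0] by linarith
    define m' where "m' = max 1 (max (CARD('n) * m) (\<Sum>j\<in>UNIV. \<integral>\<omega>. (Z' \<omega> $ j)\<^sup>2 \<partial>M'))"
    (* chosen so that the quadratic error has expectation at most e / 4 for all laws at once *)
    define L where "L = sqrt (8 * (c + 1) * m' / e)"
    have m'1: "m' \<ge> 1" by (simp add: m'_def)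
    have L0: "L > 0" using e c0 m'1 by (simp add: L_def)
    have L2: "L\<^sup>2 = 8 * (c + 1) * m' / e" using e c0 m'1 by (simp add: L_def)
    have small: "2 * c * m' / L\<^sup>2 \<le> e / 4"
    proof -
      have "e / 4 * L\<^sup>2 = 2 * (c + 1) * m'" unfolding L2 using e by simp
      moreover have "2 * c * m' \<le> 2 * (c + 1) * m'" using m'1 by (intro mult_right_mono) auto
      ultimately show ?thesis using L0 by (subst divide_le_eq) simp
    qed
    obtain r where r: "r \<in> trig" "\<And>x. \<bar>g x - r x\<bar> \<le> e/8 + 2 * c * (\<Sum>j\<in>UNIV. (x $ j)\<^sup>2) / L\<^sup>2"
      using trig_approximation[OF g(1) c L0, of "e/8"] e by auto
    have close: "\<bar>(\<integral>\<omega>. g (Y \<omega>) \<partial>N) - (\<integral>\<omega>. r (Y \<omega>) \<partial>N)\<bar> \<le> e / 8 + e / 4"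
      if N: "prob_space N" "Y \<in> borel_measurable N" and Y: "\<And>j. integrable N (\<lambda>\<omega>. (Y \<omega> $ j)\<^sup>2)"
        and Y2: "(\<Sum>j\<in>UNIV. \<integral>\<omega>. (Y \<omega> $ j)\<^sup>2 \<partial>N) \<le> m'" for N :: "'c measure" and Y :: "'c \<Rightarrow> real^'n"
    proof -
      interpret N: prob_space N by fact
      have ig: "integrable N (\<lambda>\<omega>. g (Y \<omega>))" by (rule N.integrable_continuous_bounded[OF N(2) g(1) c])
      have ir: "integrable N (\<lambda>\<omega>. r (Y \<omega>))"
        using bounded_trig[OF r(1)] continuous_trig[OF r(1)] N.integrable_continuous_bounded[OF N(2)] by blast
      have "\<bar>(\<integral>\<omega>. g (Y \<omega>) \<partial>N) - (\<integral>\<omega>. r (Y \<omega>) \<partial>N)\<bar> = \<bar>\<integral>\<omega>. g (Y \<omega>) - r (Y \<omega>) \<partial>N\<bar>"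
        using ig ir by simp
      also have "\<dots> \<le> (\<integral>\<omega>. \<bar>g (Y \<omega>) - r (Y \<omega>)\<bar> \<partial>N)" by (rule integral_abs_bound)
      also have "\<dots> \<le> (\<integral>\<omega>. e/8 + 2 * c * (\<Sum>j\<in>UNIV. (Y \<omega> $ j)\<^sup>2) / L\<^sup>2 \<partial>N)"
        using ig ir Y r(2) by (intro integral_mono) auto
      also have "\<dots> = e/8 + 2 * c * (\<Sum>j\<in>UNIV. \<integral>\<omega>. (Y \<omega> $ j)\<^sup>2 \<partial>N) / L\<^sup>2"
        using Y by (simp add: N.prob_space)
      also have "\<dots> \<le> e/8 + 2 * c * m' / L\<^sup>2"
        using Y2 c0 by (intro add_left_mono divide_right_mono mult_left_mono) auto
      finally show ?thesis using small by linarith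
    qed
    have lim: "\<bar>(\<integral>\<omega>. g (Z' \<omega>) \<partial>M') - (\<integral>\<omega>. r (Z' \<omega>) \<partial>M')\<bar> \<le> e/8 + e/4"
      by (intro close Z' sq') (simp add: m'_def)
    have "\<forall>\<^sub>F n in sequentially. \<bar>(\<integral>\<omega>. r (Z n \<omega>) \<partial>M n) - (\<integral>\<omega>. r (Z' \<omega>) \<partial>M')\<bar> < e / 8"
      using tendstoD[OF trig_tendsto[OF Z Z' cos r(1)], of "e/8"] e by (simp add: dist_real_def)
    moreover have "\<forall>\<^sub>F n in sequentially. \<bar>(\<integral>\<omega>. g (Z n \<omega>) \<partial>M n) - (\<integral>\<omega>. r (Z n \<omega>) \<partial>M n)\<bar> \<le> e/8 + e/4"
      using Z sq
    proof eventually_elim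
      case (elim n)
      have "(\<Sum>j\<in>UNIV. \<integral>\<omega>. (Z n \<omega> $ j)\<^sup>2 \<partial>M n) \<le> (\<Sum>j\<in>(UNIV::'n set). m)"
        using elim by (intro sum_mono) auto
      also have "\<dots> \<le> m'" by (simp add: m'_def)
      finally show ?case using elim by (intro close) auto
    qed
    ultimately have "\<forall>\<^sub>F n in sequentially. norm ((\<integral>\<omega>. g (Z n \<omega>) \<partial>M n) - (\<integral>\<omega>. g (Z' \<omega>) \<partial>M')) < e"

    proof eventually_elim
      case (elim n)
      then show ?case using lim e
        unfolding real_norm_def by linarith
    qed
    then show "\<exists>no. \<forall>n\<ge>no. norm ((\<integral>\<omega>. g (Z n \<omega>) \<partial>M n) - (\<integral>\<omega>. g (Z' \<omega>) \<partial>M')) < e"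
      by (simp add: eventually_sequentially)
  qed
  then show ?thesis using Z Z' by (simp add: converges_in_distribution_def)
qed

lemma converges_in_distribution_continuous_map:
  fixes V :: "nat \<Rightarrow> 'a \<Rightarrow> 'v::metric_space" and V' :: "'b \<Rightarrow> 'v" and \<phi> :: "'v \<Rightarrow> 'w::metric_space"
  assumes V: "converges_in_distribution M V M' V'" and \<phi>: "continuous_on UNIV \<phi>"
  shows "converges_in_distribution M (\<lambda>n \<omega>. \<phi> (V n \<omega>)) M' (\<lambda>\<omega>. \<phi> (V' \<omega>))"
proof -
  have [measurable]: "\<phi> \<in> borel_measurable borel" using \<phi> by (rule borel_measurable_continuous_onI)
  have "(\<lambda>n. \<integral>\<omega>. g (\<phi> (V n \<omega>)) \<partial>M n) \<longlonglongrightarrow> (\<integral>\<omega>. g (\<phi> (V' \<omega>)) \<partial>M')"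
    if "continuous_on UNIV g" "bounded (range g)" for g :: "'w \<Rightarrow> real"
  proof -
    have "continuous_on UNIV (\<lambda>x. g (\<phi> x))"
      by (rule continuous_on_compose2[OF that(1) \<phi>]) auto
    moreover have "bounded (range (\<lambda>x. g (\<phi> x)))" by (rule bounded_subset[OF that(2)]) auto
    ultimately show ?thesis using V unfolding converges_in_distribution_def by blast
  qed
  moreover have "\<forall>\<^sub>F n in sequentially. prob_space (M n) \<and> (\<lambda>\<omega>. \<phi> (V n \<omega>)) \<in> borel_measurable (M n)"
    using V unfolding converges_in_distribution_def by (auto elim!: eventually_mono)
  ultimately show ?thesis using V unfolding converges_in_distribution_def by auto
qed

text \<open>Tightness of a single law, with a continuous function in place of the indicator of a large norm,
  so that it can be transferred along convergence in distribution.\<close>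
lemma (in prob_space) expectation_truncated_norm_tendsto_0:
  fixes V :: "'a \<Rightarrow> 'v::euclidean_space"
  assumes [measurable]: "V \<in> borel_measurable M"
  shows "(\<lambda>k::nat. \<integral>\<omega>. min 1 (max 0 (norm (V \<omega>) - real k)) \<partial>M) \<longlonglongrightarrow> 0"
proof -
  have "(\<lambda>k::nat. \<integral>\<omega>. min 1 (max 0 (norm (V \<omega>) - real k)) \<partial>M) \<longlonglongrightarrow> (\<integral>\<omega>. 0 \<partial>M)"
  proof (rule integral_dominated_convergence[where w = "\<lambda>_. 1"])
    show "AE \<omega> in M. (\<lambda>k::nat. min 1 (max 0 (norm (V \<omega>) - real k))) \<longlonglongrightarrow> 0"
    proof (rule AE_I2)
      fix \<omega>
      obtain N :: nat where "norm (V \<omega>) \<le> N" using real_arch_simple by blast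
      then have "\<forall>\<^sub>F k in sequentially. min 1 (max 0 (norm (V \<omega>) - real k)) = 0"
        by (intro eventually_sequentiallyI[of N]) auto
      then show "(\<lambda>k::nat. min 1 (max 0 (norm (V \<omega>) - real k))) \<longlonglongrightarrow> 0"
        by (rule tendsto_eventually)
    qed
  qed auto
  then show ?thesis by simp
qed

text \<open>A bounded continuous function is uniformly continuous on balls only. The limit law puts little
  mass outside a large ball, and a continuous tent function passes this on to the laws of \<open>V n\<close>;
  inside the ball uniform continuity applies unless \<open>U n\<close> and \<open>V n\<close> differ
  noticeably.\<close>
lemma slutsky:
  fixes V U :: "nat \<Rightarrow> 'a \<Rightarrow> 'v::euclidean_space" and V' :: "'b \<Rightarrow> 'v"
  assumes V: "converges_in_distribution M V M' V'"
    and U: "\<forall>\<^sub>F n in sequentially. U n \<in> borel_measurable (M n)"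
    and UV: "\<And>e. e > 0 \<Longrightarrow> (\<lambda>n. measure (M n) {\<omega>\<in>space (M n). e < norm (U n \<omega> - V n \<omega>)}) \<longlonglongrightarrow> 0"
  shows "converges_in_distribution M U M' V'"
proof -
  have V1: "\<forall>\<^sub>F n in sequentially. prob_space (M n) \<and> V n \<in> borel_measurable (M n)"
    and V': "prob_space M'" "V' \<in> borel_measurable M'"
    and V2: "\<And>g::'v \<Rightarrow> real. continuous_on UNIV g \<Longrightarrow> bounded (range g) \<Longrightarrow> (\<lambda>n. \<integral>\<omega>. g (V n \<omega>) \<partial>M n) \<longlonglongrightarrow> (\<integral>\<omega>. g (V' \<omega>) \<partial>M')"
    using V by (auto simp: converges_in_distribution_def)
  interpret M': prob_space M' by fact
  have "(\<lambda>n. \<integral>\<omega>. g (U n \<omega>) \<partial>M n) \<longlonglongrightarrow> (\<integral>\<omega>. g (V' \<omega>) \<partial>M')"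
    if g: "continuous_on UNIV g" "bounded (range g)" for g :: "'v \<Rightarrow> real"
  proof (rule LIMSEQ_I)
    fix e :: real assume e: "e > 0"
    from g(2) obtain c where c: "\<And>x. \<bar>g x\<bar> \<le> c" by (auto simp: bounded_iff)
    have c0: "c \<ge> 0" using c[of 0] by linarith
    define \<eta> where "\<eta> = e / (8 * (c + 1))"
    have \<eta>: "\<eta> > 0" "2 * c * \<eta> \<le> e / 4" using e c0 by (auto simp: \<eta>_def field_simps)
    define tent where "tent k x = min 1 (max 0 (norm x - real k))" for k and x :: 'v
    have "\<forall>\<^sub>F k in sequentially. (\<integral>\<omega>. tent k (V' \<omega>) \<partial>M') < \<eta>"
      using order_tendstoD(2)[OF M'.expectation_truncated_norm_tendsto_0[OF V'(2)] \<eta>(1)] by (simp add: tent_def)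
    then obtain k where k: "(\<integral>\<omega>. tent k (V' \<omega>) \<partial>M') < \<eta>" by (auto simp: eventually_sequentially)
    have tc: "continuous_on UNIV (tent k)" unfolding tent_def by (intro continuous_intros)
    have tb: "\<bar>tent k x\<bar> \<le> 1" for x by (auto simp: tent_def)
    have "(\<lambda>n. \<integral>\<omega>. tent k (V n \<omega>) \<partial>M n) \<longlonglongrightarrow> (\<integral>\<omega>. tent k (V' \<omega>) \<partial>M')"
      using tc tb by (intro V2) (auto simp: bounded_iff)
    from order_tendstoD(2)[OF this k] have ev1: "\<forall>\<^sub>F n in sequentially. (\<integral>\<omega>. tent k (V n \<omega>) \<partial>M n) < \<eta>" .
    have uc: "uniformly_continuous_on (cball 0 (real k + 2)) g"
      by (intro compact_uniformly_continuous continuous_on_subset[OF g(1)]) auto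
    have "e/4 > 0" using e by simp
    from uc[unfolded uniformly_continuous_on_def, rule_format, OF this]
    obtain \<delta> where \<delta>: "\<delta> > 0" "\<And>x y. x \<in> cball 0 (real k + 2) \<Longrightarrow> y \<in> cball 0 (real k + 2) \<Longrightarrow> dist y x < \<delta> \<Longrightarrow> dist (g y) (g x) < e/4"
      by blast
    define d where "d = min 1 (\<delta> / 2)"
    have d: "d > 0" "d \<le> 1" "d < \<delta>" using \<delta>(1) by (auto simp: d_def min_def)
    have ev2: "\<forall>\<^sub>F n in sequentially. measure (M n) {\<omega>\<in>space (M n). d < norm (U n \<omega> - V n \<omega>)} < \<eta>"
      using order_tendstoD(2)[OF UV[OF d(1)] \<eta>(1)] .
    have ev3: "\<forall>\<^sub>F n in sequentially. \<bar>(\<integral>\<omega>. g (V n \<omega>) \<partial>M n) - (\<integral>\<omega>. g (V' \<omega>) \<partial>M')\<bar> < e / 4"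
      using tendstoD[OF V2[OF g], of "e/4"] e by (simp add: dist_real_def)
    have "\<forall>\<^sub>F n in sequentially. norm ((\<integral>\<omega>. g (U n \<omega>) \<partial>M n) - (\<integral>\<omega>. g (V' \<omega>) \<partial>M')) < e"
      using ev1 ev2 ev3 V1 U
    proof eventually_elim
      case (elim n)
      interpret N: prob_space "M n" using elim by blast
      have [measurable]: "U n \<in> borel_measurable (M n)" "V n \<in> borel_measurable (M n)" using elim by auto
      have ig: "integrable (M n) (\<lambda>\<omega>. g (U n \<omega>))" "integrable (M n) (\<lambda>\<omega>. g (V n \<omega>))"
        by (rule N.integrable_continuous_bounded[OF _ g(1) c]; simp)+
      have it: "integrable (M n) (\<lambda>\<omega>. tent k (V n \<omega>))"
        by (rule N.integrable_continuous_bounded[OF _ tc tb]; simp)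
      let ?A = "{\<omega>\<in>space (M n). d < norm (U n \<omega> - V n \<omega>)}"
      have A: "?A \<in> sets (M n)" by measurable
      have iA: "integrable (M n) (indicator ?A :: _ \<Rightarrow> real)" using A
        by (intro integrable_real_indicator) (auto simp: less_top[symmetric] simp del: Collect_conj_eq)
      have pw: "\<bar>g (U n \<omega>) - g (V n \<omega>)\<bar> \<le> e/4 + 2 * c * (tent k (V n \<omega>) + indicator ?A \<omega>)"
        if \<omega>: "\<omega> \<in> space (M n)" for \<omega>
      (* the tent equals 1 where the norm is at least k + 1; a distance of at most 1 keeps U n in the ball of radius k + 2 *)
      proof (cases "norm (V n \<omega>) \<le> k + 1 \<and> \<omega> \<notin> ?A")
        case True
        then have "norm (U n \<omega> - V n \<omega>) \<le> d" using \<omega> by auto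
        moreover have "norm (U n \<omega>) \<le> norm (U n \<omega> - V n \<omega>) + norm (V n \<omega>)"
          using norm_triangle_ineq[of "U n \<omega> - V n \<omega>" "V n \<omega>"] by simp
        ultimately have "dist (g (U n \<omega>)) (g (V n \<omega>)) < e/4"
          using True d by (intro \<delta>) (auto simp: dist_norm)
        moreover have "0 \<le> 2 * c * (tent k (V n \<omega>) + indicator ?A \<omega>)"
          using c0 by (intro mult_nonneg_nonneg add_nonneg_nonneg) (auto simp: tent_def)
        ultimately show ?thesis by (simp add: dist_real_def)
      next
        case False
        then have "1 \<le> tent k (V n \<omega>) + indicator ?A \<omega>"
          by (auto simp: tent_def indicator_def)
        then have "2 * c * 1 \<le> 2 * c * (tent k (V n \<omega>) + indicator ?A \<omega>)"
          using c0 by (intro mult_left_mono) auto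
        then show ?thesis using c[of "U n \<omega>"] c[of "V n \<omega>"] e by linarith
      qed
      have "\<bar>(\<integral>\<omega>. g (U n \<omega>) \<partial>M n) - (\<integral>\<omega>. g (V n \<omega>) \<partial>M n)\<bar> = \<bar>\<integral>\<omega>. g (U n \<omega>) - g (V n \<omega>) \<partial>M n\<bar>"
        using ig by simp
      also have "\<dots> \<le> (\<integral>\<omega>. \<bar>g (U n \<omega>) - g (V n \<omega>)\<bar> \<partial>M n)" by (rule integral_abs_bound)
      also have "\<dots> \<le> (\<integral>\<omega>. e/4 + 2 * c * (tent k (V n \<omega>) + indicator ?A \<omega>) \<partial>M n)"
        using ig it iA pw by (intro integral_mono) auto
      also have "\<dots> = e/4 + 2 * c * ((\<integral>\<omega>. tent k (V n \<omega>) \<partial>M n) + measure (M n) ?A)"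
        using it iA A by (simp add: N.prob_space)
      also have "\<dots> \<le> e/4 + 2 * c * (\<eta> + \<eta>)"
        using elim c0 by (intro add_left_mono mult_left_mono) auto
      also have "\<dots> \<le> e/4 + e/2" using \<eta>(2) by (simp add: algebra_simps)
      finally show ?case using elim(3) unfolding real_norm_def by linarith
    qed
    then show "\<exists>no. \<forall>n\<ge>no. norm ((\<integral>\<omega>. g (U n \<omega>) \<partial>M n) - (\<integral>\<omega>. g (V' \<omega>) \<partial>M')) < e"
      by (simp add: eventually_sequentially)
  qed
  moreover have "\<forall>\<^sub>F n in sequentially. prob_space (M n) \<and> U n \<in> borel_measurable (M n)"
    using V1 U by eventually_elim auto
  ultimately show ?thesis using V' by (simp add: converges_in_distribution_def)
qed

section \<open>Step functions are dense in L2\<close>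

definition square_integrable :: "(real \<Rightarrow> real) \<Rightarrow> bool" where
  "square_integrable f \<longleftrightarrow> f \<in> borel_measurable borel \<and> integrable lborel (\<lambda>s. (f s)\<^sup>2)"

lemma square_integrable_mult:
  assumes "square_integrable f" "square_integrable g"
  shows "integrable lborel (\<lambda>s. f s * g s)"
proof (rule Bochner_Integration.integrable_bound)
  show "integrable lborel (\<lambda>s. (f s)\<^sup>2 + (g s)\<^sup>2)" using assms by (auto simp: square_integrable_def)
  show "(\<lambda>s. f s * g s) \<in> borel_measurable lborel" using assms by (auto simp: square_integrable_def)
  show "AE s in lborel. norm (f s * g s) \<le> norm ((f s)\<^sup>2 + (g s)\<^sup>2)"
  proof (rule AE_I2)
    fix s
    have "2 * \<bar>f s\<bar> * \<bar>g s\<bar> \<le> (f s)\<^sup>2 + (g s)\<^sup>2" using sum_squares_bound[of "\<bar>f s\<bar>" "\<bar>g s\<bar>"] by simp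
    moreover have "0 \<le> \<bar>f s\<bar> * \<bar>g s\<bar>" by simp
    ultimately have "\<bar>f s\<bar> * \<bar>g s\<bar> \<le> (f s)\<^sup>2 + (g s)\<^sup>2" by linarith
    then show "norm (f s * g s) \<le> norm ((f s)\<^sup>2 + (g s)\<^sup>2)" by (simp add: abs_mult)
  qed
qed

lemma square_integrable_add:
  assumes "square_integrable f" "square_integrable g"
  shows "square_integrable (\<lambda>s. f s + g s)"
  using assms square_integrable_mult[OF assms]
  by (auto simp: square_integrable_def power2_sum mult.assoc)

lemma square_integrable_cmult:
  "square_integrable f \<Longrightarrow> square_integrable (\<lambda>s. c * f s)"
  by (auto simp: square_integrable_def power_mult_distrib)

lemma square_integrable_diff:
  assumes "square_integrable f" "square_integrable g"
  shows "square_integrable (\<lambda>s. f s - g s)"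
  using square_integrable_add[OF assms(1) square_integrable_cmult[OF assms(2), of "-1"]] by simp

lemma square_integrable_sum:
  "(\<And>j. j \<in> A \<Longrightarrow> square_integrable (f j)) \<Longrightarrow> square_integrable (\<lambda>s. \<Sum>j\<in>A. f j s)"
  by (induction A rule: infinite_finite_induct)
     (auto intro: square_integrable_add simp: square_integrable_def[of "\<lambda>s. 0"])

lemma square_integral_add_le:
  assumes "square_integrable f" "square_integrable g"
  shows "(\<integral>s. (f s + g s)\<^sup>2 \<partial>lborel) \<le> 2 * (\<integral>s. (f s)\<^sup>2 \<partial>lborel) + 2 * (\<integral>s. (g s)\<^sup>2 \<partial>lborel)"
proof -
  have "(\<integral>s. (f s + g s)\<^sup>2 \<partial>lborel) \<le> (\<integral>s. 2 * (f s)\<^sup>2 + 2 * (g s)\<^sup>2 \<partial>lborel)"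
  proof (rule integral_mono)
    show "integrable lborel (\<lambda>s. (f s + g s)\<^sup>2)" using square_integrable_add[OF assms] by (simp add: square_integrable_def)
    show "integrable lborel (\<lambda>s. 2 * (f s)\<^sup>2 + 2 * (g s)\<^sup>2)" using assms by (auto simp: square_integrable_def)
    show "(f s + g s)\<^sup>2 \<le> 2 * (f s)\<^sup>2 + 2 * (g s)\<^sup>2" for s
      using sum_squares_bound[of "f s" "g s"] by (simp add: power2_sum)
  qed
  also have "\<dots> = 2 * (\<integral>s. (f s)\<^sup>2 \<partial>lborel) + 2 * (\<integral>s. (g s)\<^sup>2 \<partial>lborel)"
    using assms by (simp add: square_integrable_def)
  finally show ?thesis .
qed

text \<open>Young's inequality in the form \<open>\<bar>f\<^sup>2 - g\<^sup>2\<bar> \<le> \<eta> g\<^sup>2 +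
  (1 + 1/\<eta>) (f - g)\<^sup>2\<close>, where \<open>\<eta>\<close> is fixed before \<open>n\<close> grows,
  avoids the triangle inequality of the L2 norm.\<close>
lemma square_integral_tendsto:
  fixes f g :: "nat \<Rightarrow> real \<Rightarrow> real"
  assumes f: "\<forall>\<^sub>F n in sequentially. square_integrable (f n)" and g: "\<forall>\<^sub>F n in sequentially. square_integrable (g n)"
    and fg: "(\<lambda>n. \<integral>s. (f n s - g n s)\<^sup>2 \<partial>lborel) \<longlonglongrightarrow> 0"
    and v: "(\<lambda>n. \<integral>s. (g n s)\<^sup>2 \<partial>lborel) \<longlonglongrightarrow> v"
  shows "(\<lambda>n. \<integral>s. (f n s)\<^sup>2 \<partial>lborel) \<longlonglongrightarrow> v"
proof -
  have "(\<lambda>n. (\<integral>s. (f n s)\<^sup>2 \<partial>lborel) - (\<integral>s. (g n s)\<^sup>2 \<partial>lborel)) \<longlonglongrightarrow> 0"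
  proof (rule LIMSEQ_I)
    fix e :: real assume e: "e > 0"
    define \<eta> where "\<eta> = e / (2 * (\<bar>v\<bar> + 1))"
    have \<eta>: "\<eta> > 0" "\<eta> * (\<bar>v\<bar> + 1) = e / 2" using e by (auto simp: \<eta>_def field_simps)
    have "\<forall>\<^sub>F n in sequentially. (\<integral>s. (g n s)\<^sup>2 \<partial>lborel) < \<bar>v\<bar> + 1" by (rule order_tendstoD(2)[OF v]) auto
    moreover have "\<forall>\<^sub>F n in sequentially. (1 + 1 / \<eta>) * (\<integral>s. (f n s - g n s)\<^sup>2 \<partial>lborel) < e / 2"
      by (rule order_tendstoD(2)[OF tendsto_mult_right_zero[OF fg]]) (use e in auto)
    ultimately have "\<forall>\<^sub>F n in sequentially. norm ((\<integral>s. (f n s)\<^sup>2 \<partial>lborel) - (\<integral>s. (g n s)\<^sup>2 \<partial>lborel)) < e"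
      using f g
    proof eventually_elim
      case (elim n)
      have i: "integrable lborel (\<lambda>s. (f n s)\<^sup>2)" "integrable lborel (\<lambda>s. (g n s)\<^sup>2)" "integrable lborel (\<lambda>s. (f n s - g n s)\<^sup>2)"
        using elim(3,4) square_integrable_diff[OF elim(3,4)] by (auto simp: square_integrable_def)
      have "\<bar>(\<integral>s. (f n s)\<^sup>2 \<partial>lborel) - (\<integral>s. (g n s)\<^sup>2 \<partial>lborel)\<bar> = \<bar>\<integral>s. (f n s)\<^sup>2 - (g n s)\<^sup>2 \<partial>lborel\<bar>" using i by simp
      also have "\<dots> \<le> (\<integral>s. \<bar>(f n s)\<^sup>2 - (g n s)\<^sup>2\<bar> \<partial>lborel)" by (rule integral_abs_bound)
      also have "\<dots> \<le> (\<integral>s. \<eta> * (g n s)\<^sup>2 + (1 + 1 / \<eta>) * (f n s - g n s)\<^sup>2 \<partial>lborel)"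
      proof (rule integral_mono)
        fix s
        define p q where "p = g n s" and "q = f n s - g n s"
        have fs: "f n s = p + q" by (simp add: p_def q_def)
        have "0 \<le> (sqrt \<eta> * p - q / sqrt \<eta>)\<^sup>2" "0 \<le> (sqrt \<eta> * p + q / sqrt \<eta>)\<^sup>2" by auto
        then have "2 * (p * q) \<le> \<eta> * p\<^sup>2 + q\<^sup>2 / \<eta>" "- (2 * (p * q)) \<le> \<eta> * p\<^sup>2 + q\<^sup>2 / \<eta>" using \<eta>(1)
          by (simp_all add: power2_diff power2_sum power_mult_distrib power_divide)
        moreover have "(p + q)\<^sup>2 - p\<^sup>2 = 2 * (p * q) + q\<^sup>2" by (simp add: power2_sum)
        moreover have "(1 + 1 / \<eta>) * q\<^sup>2 = q\<^sup>2 + q\<^sup>2 / \<eta>" by (simp add: algebra_simps)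
        moreover have "0 \<le> q\<^sup>2" by simp
        ultimately have "\<bar>(p + q)\<^sup>2 - p\<^sup>2\<bar> \<le> \<eta> * p\<^sup>2 + (1 + 1 / \<eta>) * q\<^sup>2" by linarith
        then show "\<bar>(f n s)\<^sup>2 - (g n s)\<^sup>2\<bar> \<le> \<eta> * (g n s)\<^sup>2 + (1 + 1 / \<eta>) * (f n s - g n s)\<^sup>2"
          by (simp add: p_def q_def)
      qed (use i in auto)
      also have "\<dots> = \<eta> * (\<integral>s. (g n s)\<^sup>2 \<partial>lborel) + (1 + 1 / \<eta>) * (\<integral>s. (f n s - g n s)\<^sup>2 \<partial>lborel)" using i by simp
      also have "\<dots> < \<eta> * (\<bar>v\<bar> + 1) + e / 2"
        using elim(1,2) \<eta>(1) by (intro add_strict_mono mult_strict_left_mono) auto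
      finally show ?case using \<eta>(2) by simp
    qed
    then show "\<exists>no. \<forall>n\<ge>no. norm ((\<integral>s. (f n s)\<^sup>2 \<partial>lborel) - (\<integral>s. (g n s)\<^sup>2 \<partial>lborel) - 0) < e"
      by (simp add: eventually_sequentially)
  qed
  from tendsto_add[OF this v] show ?thesis by simp
qed

definition step_function :: "nat \<Rightarrow> (nat \<Rightarrow> real) \<Rightarrow> (nat \<Rightarrow> real) \<Rightarrow> real \<Rightarrow> real" where
  "step_function k u c s = (\<Sum>i<k. c i * indicator {u i<..u (Suc i)} s)"

lemma square_integrable_step_function:
  "square_integrable (step_function k u c)"
proof -
  have 1: "square_integrable (\<lambda>s. indicator {a<..b::real} s)" for a b
  proof -
    have "(indicator {a<..b} s :: real)\<^sup>2 = indicator {a<..b} s" for s by (simp add: indicator_def)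
    moreover have "emeasure lborel {a<..b} < \<infinity>" by (cases "a \<le> b") auto
    then have "integrable lborel (indicator {a<..b} :: real \<Rightarrow> real)"
      by (intro integrable_real_indicator) auto
    ultimately show ?thesis by (simp add: square_integrable_def)
  qed
  show ?thesis unfolding step_function_def by (intro square_integrable_sum square_integrable_cmult 1)
qed

lemma continuous_step_approximation:
  fixes g :: "real \<Rightarrow> real"
  assumes g: "continuous_on {0..T} g" and T: "T > 0" and e: "e > 0"
  obtains k u c where "u 0 = 0" "\<And>i. i < k \<Longrightarrow> u i < u (Suc i)" "\<And>i. i \<le> k \<Longrightarrow> u i \<le> T"
    "\<And>s. 0 < s \<Longrightarrow> s \<le> T \<Longrightarrow> \<bar>g s - step_function k u c s\<bar> \<le> e"
proof -
  have "uniformly_continuous_on {0..T} g" using g by (intro compact_uniformly_continuous) auto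
  from this[unfolded uniformly_continuous_on_def, rule_format, OF e]
  obtain \<delta> where \<delta>: "\<delta> > 0" "\<And>x y. x \<in> {0..T} \<Longrightarrow> y \<in> {0..T} \<Longrightarrow> dist y x < \<delta> \<Longrightarrow> dist (g y) (g x) < e" by blast
  obtain k :: nat where k: "T / \<delta> < k" using reals_Archimedean2 by blast
  have k0: "k > 0" using k T \<delta> by (metis divide_pos_pos gr0I less_asym of_nat_0)
  define h where "h = T / k"
  have h: "h > 0" "h < \<delta>" "real k * h = T" using k T \<delta> k0 by (auto simp: h_def field_simps)
  define u where "u = (\<lambda>i::nat. real i * h)"
  show ?thesis
  proof (rule that[of u k "\<lambda>i. g (u i)"])
    show "u 0 = 0" by (simp add: u_def)
    show "u i < u (Suc i)" for i using h by (simp add: u_def algebra_simps)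
    show "u i \<le> T" if "i \<le> k" for i
      unfolding h(3)[symmetric] u_def using that h by (intro mult_right_mono) auto
    fix s assume s: "0 < s" "s \<le> T"
    define j where "j = nat (\<lceil>s / h\<rceil> - 1)"
    have "0 < \<lceil>s / h\<rceil>" using s h by simp
    then have rj: "real j = \<lceil>s / h\<rceil> - 1" by (simp add: j_def)
    have 1: "real j < s / h" "s / h \<le> real j + 1" unfolding rj by linarith+
    then have j: "u j < s" "s \<le> u (Suc j)" using h by (auto simp: u_def field_simps)
    have "real j < real k"
    proof -
      have "real j * h < s" using 1(1) h by (simp add: field_simps)
      then have "real j * h < real k * h" using s h by simp
      then show ?thesis using h(1) by simp
    qed
    then have jk: "j < k" by simp
    have "step_function k u (\<lambda>i. g (u i)) s = (\<Sum>i<k. if i = j then g (u j) else 0)"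
      unfolding step_function_def
    proof (intro sum.cong refl)
      fix i
      have "s \<notin> {u i<..u (Suc i)}" if "i \<noteq> j"
      proof (cases "i < j")
        case True
        then have "u (Suc i) \<le> u j" using h unfolding u_def by (intro mult_right_mono) auto
        then show ?thesis using j by auto
      next
        case False
        then have "u (Suc j) \<le> u i" using h that unfolding u_def by (intro mult_right_mono) auto
        then show ?thesis using j by auto
      qed
      then show "g (u i) * indicator {u i<..u (Suc i)} s = (if i = j then g (u j) else 0)" using j by auto
    qed
    also have "\<dots> = g (u j)" using jk by simp
    finally have st: "step_function k u (\<lambda>i. g (u i)) s = g (u j)" .
    have "0 \<le> u j" using h by (simp add: u_def)
    moreover have "dist s (u j) < \<delta>" using j h by (simp add: dist_real_def u_def algebra_simps)
    ultimately have "dist (g s) (g (u j)) < e" using s j by (intro \<delta>) auto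
    then show "\<bar>g s - step_function k u (\<lambda>i. g (u i)) s\<bar> \<le> e" unfolding st by (simp add: dist_real_def)
  qed
qed

text \<open>A measurable function is an almost everywhere limit of continuous ones; clipping these at the
  bound \<open>c\<close> of \<open>f\<close> provides the dominating constant.\<close>
lemma bounded_continuous_approximation:
  fixes f :: "real \<Rightarrow> real"
  assumes f: "f \<in> borel_measurable borel" "\<And>s. \<bar>f s\<bar> \<le> c" and e: "e > 0"
  obtains g where "continuous_on UNIV g" "\<And>s. \<bar>g s\<bar> \<le> c" "(LBINT s:{0..T}. (f s - g s)\<^sup>2) < e"
proof -
  have c0: "c \<ge> 0" using f(2)[of 0] by linarith
  have "f measurable_on UNIV"
    by (rule lebesgue_measurable_imp_measurable_on_real) (use f in \<open>auto simp: measurable_completion\<close>)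
  then obtain N g where N: "negligible N" and g: "\<And>n. continuous_on UNIV (g n)"
    and lim: "\<And>x. x \<notin> N \<Longrightarrow> (\<lambda>n. g n x) \<longlonglongrightarrow> f x"
    unfolding measurable_on_def by auto
  define G where "G n s = max (- c) (min c (g n s))" for n :: nat and s
  have G: "continuous_on UNIV (G n)" for n unfolding G_def by (intro continuous_intros g)
  have Gb: "\<bar>G n s\<bar> \<le> c" for n s using c0 by (auto simp: G_def)
  have [measurable]: "G n \<in> borel_measurable borel" for n using G by (rule borel_measurable_continuous_onI)
  note [measurable] = f(1)
  have "(\<lambda>n. LINT s|lborel. indicator {0..T} s *\<^sub>R (f s - G n s)\<^sup>2) \<longlonglongrightarrow> (LINT (s::real)|lborel. 0)"
  proof (rule integral_dominated_convergence[where w = "\<lambda>s. indicator {0..T} s * (2 * c)\<^sup>2"])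
    show "integrable lborel (\<lambda>s. indicator {0..T} s * (2 * c)\<^sup>2)"
      by (intro integrable_mult_left integrable_real_indicator) (auto simp: emeasure_lborel_Icc_eq)
    have "AE s in lebesgue. s \<notin> N" using N by (simp add: negligible_iff_null_sets AE_not_in)
    then have "AE s in lborel. s \<notin> N" by (simp add: AE_completion_iff)
    then show "AE s in lborel. (\<lambda>n. indicator {0..T} s *\<^sub>R (f s - G n s)\<^sup>2) \<longlonglongrightarrow> 0"
    proof eventually_elim
      case (elim s)
      have "(\<lambda>n. G n s) \<longlonglongrightarrow> max (- c) (min c (f s))" unfolding G_def by (intro tendsto_intros lim elim)
      moreover have "max (- c) (min c (f s)) = f s" using f(2)[of s] by auto
      ultimately have "(\<lambda>n. indicator {0..T} s *\<^sub>R (f s - G n s)\<^sup>2) \<longlonglongrightarrow> indicator {0..T} s *\<^sub>R (f s - f s)\<^sup>2"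
        by (intro tendsto_intros) simp
      then show ?case by simp
    qed
    show "AE s in lborel. norm (indicator {0..T} s *\<^sub>R (f s - G n s)\<^sup>2) \<le> indicator {0..T} s * (2 * c)\<^sup>2" for n
    proof (rule AE_I2)
      fix s
      have "\<bar>f s - G n s\<bar> \<le> \<bar>2 * c\<bar>" using f(2)[of s] Gb[of n s] by linarith
      then have "(f s - G n s)\<^sup>2 \<le> (2 * c)\<^sup>2" by (simp only: abs_le_square_iff)
      then show "norm (indicator {0..T} s *\<^sub>R (f s - G n s)\<^sup>2) \<le> indicator {0..T} s * (2 * c)\<^sup>2"
        by (simp add: indicator_def)
    qed
  qed simp_all
  then have "\<forall>\<^sub>F n in sequentially. (LINT s|lborel. indicator {0..T} s *\<^sub>R (f s - G n s)\<^sup>2) < e"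
    using e by (intro order_tendstoD(2)) auto
  then obtain n where "(LINT s|lborel. indicator {0..T} s *\<^sub>R (f s - G n s)\<^sup>2) < e"
    by (auto simp: eventually_sequentially)
  then show ?thesis using that[of "G n"] G Gb by (simp add: set_lebesgue_integral_def)
qed

lemma truncation_approximation:
  assumes f: "square_integrable f" and e: "e > 0"
  obtains c :: nat where "(\<integral>s. (f s - max (- real c) (min (real c) (f s)))\<^sup>2 \<partial>lborel) < e"
proof -
  have [measurable]: "f \<in> borel_measurable borel" using f by (simp add: square_integrable_def)
  have "(\<lambda>c::nat. \<integral>s. (f s - max (- real c) (min (real c) (f s)))\<^sup>2 \<partial>lborel) \<longlonglongrightarrow> (\<integral>(s::real). 0 \<partial>lborel)"
  proof (rule integral_dominated_convergence[where w = "\<lambda>s. (f s)\<^sup>2"])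
    show "AE s in lborel. (\<lambda>c::nat. (f s - max (- real c) (min (real c) (f s)))\<^sup>2) \<longlonglongrightarrow> 0"
    proof (rule AE_I2)
      fix s
      obtain n :: nat where "\<bar>f s\<bar> \<le> n" using real_arch_simple by blast
      then show "(\<lambda>c::nat. (f s - max (- real c) (min (real c) (f s)))\<^sup>2) \<longlonglongrightarrow> 0"
        by (intro tendsto_eventually eventually_sequentiallyI[of n]) auto
    qed
    show "AE s in lborel. norm ((f s - max (- real c) (min (real c) (f s)))\<^sup>2) \<le> (f s)\<^sup>2" for c
    proof (rule AE_I2)
      fix s
      have "\<bar>f s - max (- real c) (min (real c) (f s))\<bar> \<le> \<bar>f s\<bar>" by (auto simp: max_def min_def)
      then have "(f s - max (- real c) (min (real c) (f s)))\<^sup>2 \<le> (f s)\<^sup>2" by (simp only: abs_le_square_iff)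
      then show "norm ((f s - max (- real c) (min (real c) (f s)))\<^sup>2) \<le> (f s)\<^sup>2" by simp
    qed
  qed (use f in \<open>auto simp: square_integrable_def\<close>)
  then have "\<forall>\<^sub>F c in sequentially. (\<integral>s. (f s - max (- real c) (min (real c) (f s)))\<^sup>2 \<partial>lborel) < e"
    using e by (intro order_tendstoD(2)) auto
  then show ?thesis using that by (auto simp: eventually_sequentially)
qed

text \<open>Three approximations in turn: truncation to a bounded function, a continuous function on the
  interval, a step function by uniform continuity.\<close>
lemma step_function_dense:
  assumes f: "square_integrable f" and T: "T > 0" and supp: "\<And>s. s \<notin> {0..T} \<Longrightarrow> f s = 0" and e: "e > 0"
  obtains k u c where "u 0 = 0" "\<And>i. i < k \<Longrightarrow> u i < u (Suc i)" "\<And>i. i \<le> k \<Longrightarrow> u i \<le> T"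
    "(\<integral>s. (f s - step_function k u c s)\<^sup>2 \<partial>lborel) < e"
proof -
  have [measurable]: "f \<in> borel_measurable borel" using f by (simp add: square_integrable_def)
  obtain m :: nat where m: "(\<integral>s. (f s - max (- real m) (min (real m) (f s)))\<^sup>2 \<partial>lborel) < e / 8"
    using truncation_approximation[OF f, of "e/8"] e by auto
  define F where "F = (\<lambda>s. max (- real m) (min (real m) (f s)))"
  have [measurable]: "F \<in> borel_measurable borel" unfolding F_def by measurable
  obtain g where g: "continuous_on UNIV g" "(LBINT s:{0..T}. (F s - g s)\<^sup>2) < e / 16"
  proof -
    have "\<bar>F s\<bar> \<le> real m" for s by (auto simp: F_def)
    moreover have "e / 16 > 0" using e by simp
    ultimately show ?thesis using bounded_continuous_approximation[of F "real m" "e/16" T] that by auto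
  qed
  have gm [measurable]: "g \<in> borel_measurable borel" using g(1) by (rule borel_measurable_continuous_onI)
  define \<epsilon> where "\<epsilon> = sqrt (e / (16 * T))"
  have \<epsilon>: "\<epsilon> > 0" "\<epsilon>\<^sup>2 * T = e / 16" using e T by (auto simp: \<epsilon>_def)
  obtain k u c where st: "u 0 = 0" "\<And>i. i < k \<Longrightarrow> u i < u (Suc i)" "\<And>i. i \<le> k \<Longrightarrow> u i \<le> T"
    "\<And>s. 0 < s \<Longrightarrow> s \<le> T \<Longrightarrow> \<bar>g s - step_function k u c s\<bar> \<le> \<epsilon>"
    using continuous_step_approximation[OF continuous_on_subset[OF g(1)] T \<epsilon>(1)] by (metis subset_UNIV)
  define h where "h = step_function k u c"
  have mono: "0 \<le> u i" if "i \<le> k" for i using that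
  proof (induction i)
    case (Suc i)
    then have "i < k" by simp
    from st(2)[OF this] Suc show ?case by simp
  qed (simp add: st(1))
  have hsupp: "h s = 0" if "s \<notin> {0<..T}" for s
    unfolding h_def step_function_def
  proof (intro sum.neutral ballI)
    fix i assume "i \<in> {..<k}"
    then show "c i * indicator {u i<..u (Suc i)} s = 0"
      using that st(3)[of "Suc i"] mono[of i] by (auto simp: indicator_def)
  qed
  have hs: "square_integrable h" unfolding h_def by (rule square_integrable_step_function)
  have [measurable]: "h \<in> borel_measurable borel" using hs by (simp add: square_integrable_def)
  have Fs: "square_integrable F"
  proof -
    have "integrable lborel (\<lambda>s. (F s)\<^sup>2)"
    proof (rule Bochner_Integration.integrable_bound[of lborel "\<lambda>s. (f s)\<^sup>2"])
      show "AE s in lborel. norm ((F s)\<^sup>2) \<le> norm ((f s)\<^sup>2)"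
      proof (rule AE_I2)
        fix s
        have "\<bar>F s\<bar> \<le> \<bar>f s\<bar>" by (auto simp: F_def max_def min_def)
        then have "(F s)\<^sup>2 \<le> (f s)\<^sup>2" by (simp only: abs_le_square_iff)
        then show "norm ((F s)\<^sup>2) \<le> norm ((f s)\<^sup>2)" by simp
      qed
    qed (use f in \<open>auto simp: square_integrable_def\<close>)
    then show ?thesis by (simp add: square_integrable_def)
  qed
  have Fh: "(\<integral>s. (F s - h s)\<^sup>2 \<partial>lborel) \<le> e / 4"
  proof -
    have gi: "set_integrable lborel {0..T} (\<lambda>s. (F s - g s)\<^sup>2)"
    proof -
      have "bounded (g ` {0..T})"
        by (intro compact_imp_bounded compact_continuous_image continuous_on_subset[OF g(1)]) auto
      then obtain b where "\<forall>s\<in>{0..T}. \<bar>g s\<bar> \<le> b" by (auto simp only: bounded_iff ball_simps real_norm_def)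
      then have b: "\<And>s. s \<in> {0..T} \<Longrightarrow> \<bar>g s\<bar> \<le> b" by blast
      show ?thesis unfolding set_integrable_def
      proof (rule Bochner_Integration.integrable_bound[of lborel "\<lambda>s. indicator {0..T} s * (real m + b)\<^sup>2"])
        show "integrable lborel (\<lambda>s. indicator {0..T} s * (real m + b)\<^sup>2)"
          by (intro integrable_mult_left integrable_real_indicator) (auto simp: emeasure_lborel_Icc_eq)
        show "AE s in lborel. norm (indicator {0..T} s *\<^sub>R (F s - g s)\<^sup>2) \<le> norm (indicator {0..T} s * (real m + b)\<^sup>2)"
        proof (rule AE_I2)
          fix s
          have "(F s - g s)\<^sup>2 \<le> (real m + b)\<^sup>2" if "s \<in> {0..T}"
          proof -
            have "\<bar>F s\<bar> \<le> real m" by (auto simp: F_def)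
            then have "\<bar>F s - g s\<bar> \<le> \<bar>real m + b\<bar>" using b[OF that] by linarith
            then show ?thesis by (simp only: abs_le_square_iff)
          qed
          then show "norm (indicator {0..T} s *\<^sub>R (F s - g s)\<^sup>2) \<le> norm (indicator {0..T} s * (real m + b)\<^sup>2)"
            by (auto simp: indicator_def)
        qed
      qed simp
    qed
    have "(\<integral>s. (F s - h s)\<^sup>2 \<partial>lborel) \<le> (\<integral>s. 2 * (indicator {0..T} s *\<^sub>R (F s - g s)\<^sup>2) + 2 * (indicator {0..T} s * \<epsilon>\<^sup>2) \<partial>lborel)"
    proof (rule integral_mono_AE)
      show "integrable lborel (\<lambda>s. (F s - h s)\<^sup>2)" using square_integrable_diff[OF Fs hs] by (simp add: square_integrable_def)
      show "integrable lborel (\<lambda>s. 2 * (indicator {0..T} s *\<^sub>R (F s - g s)\<^sup>2) + 2 * (indicator {0..T} s * \<epsilon>\<^sup>2))"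
        using gi unfolding set_integrable_def
        by (intro Bochner_Integration.integrable_add integrable_mult_right integrable_mult_left integrable_real_indicator) (auto simp: emeasure_lborel_Icc_eq)
      have "AE s in lborel. s \<noteq> (0::real)" by (rule AE_lborel_singleton)
      then show "AE s in lborel. (F s - h s)\<^sup>2 \<le> 2 * (indicator {0..T} s *\<^sub>R (F s - g s)\<^sup>2) + 2 * (indicator {0..T} s * \<epsilon>\<^sup>2)"
      proof eventually_elim
        case (elim s)
        show ?case
        proof (cases "s \<in> {0..T}")
          case True
          then have "\<bar>g s - h s\<bar> \<le> \<bar>\<epsilon>\<bar>" using st(4)[of s] elim \<epsilon>(1) by (auto simp: h_def)
          then have "(g s - h s)\<^sup>2 \<le> \<epsilon>\<^sup>2" by (simp only: abs_le_square_iff)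
          moreover have "(F s - h s)\<^sup>2 \<le> 2 * (F s - g s)\<^sup>2 + 2 * (g s - h s)\<^sup>2"
            using sum_squares_bound[of "F s - g s" "g s - h s"] power2_sum[of "F s - g s" "g s - h s"] by simp
          ultimately show ?thesis using True by simp
        next
          case False
          then show ?thesis using supp[of s] hsupp[of s] by (auto simp: F_def)
        qed
      qed
    qed
    also have "\<dots> = 2 * (LBINT s:{0..T}. (F s - g s)\<^sup>2) + 2 * (T * \<epsilon>\<^sup>2)"
      using gi T unfolding set_integrable_def set_lebesgue_integral_def
      by (subst Bochner_Integration.integral_add) (auto intro!: integrable_mult_right integrable_mult_left integrable_real_indicator simp: emeasure_lborel_Icc_eq)
    also have "\<dots> \<le> e / 4" using g(2) \<epsilon>(2) by (simp add: mult.commute)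
    finally show ?thesis .
  qed
  have "(\<integral>s. (f s - h s)\<^sup>2 \<partial>lborel) = (\<integral>s. ((f s - F s) + (F s - h s))\<^sup>2 \<partial>lborel)" by simp
  also have "\<dots> \<le> 2 * (\<integral>s. (f s - F s)\<^sup>2 \<partial>lborel) + 2 * (\<integral>s. (F s - h s)\<^sup>2 \<partial>lborel)"
    by (rule square_integral_add_le) (intro square_integrable_diff f Fs hs)+
  also have "\<dots> < e" using m Fh e by (simp add: F_def)
  finally show ?thesis using that[of u k c] st by (simp add: h_def)
qed

section \<open>Remainders in probability, Taylor bounds and chi-square laws\<close>

lemma borel_measurable_vec_lambda:
  fixes f :: "'n::finite \<Rightarrow> 'a \<Rightarrow> real"
  assumes "\<And>j. f j \<in> borel_measurable M"
  shows "(\<lambda>\<omega>. \<chi> j. f j \<omega>) \<in> borel_measurable M"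
proof (subst borel_measurable_euclidean_space, rule ballI)
  fix i :: "real^'n" assume "i \<in> Basis"
  then obtain j where i: "i = axis j 1" by (auto simp: Basis_vec_def)
  show "(\<lambda>\<omega>. (\<chi> j. f j \<omega>) \<bullet> i) \<in> borel_measurable M"
    unfolding i inner_axis using assms[of j] by simp
qed

lemma in_probability_vec:
  fixes D :: "nat \<Rightarrow> 'n::finite \<Rightarrow> 'a \<Rightarrow> real"
  assumes m: "\<forall>\<^sub>F n in sequentially. prob_space (M n) \<and> (\<forall>j. D n j \<in> borel_measurable (M n))"
    and D: "\<And>j e. e > 0 \<Longrightarrow> (\<lambda>n. measure (M n) {\<omega>\<in>space (M n). e < \<bar>D n j \<omega>\<bar>}) \<longlonglongrightarrow> 0"
    and e: "e > 0"
  shows "(\<lambda>n. measure (M n) {\<omega>\<in>space (M n). e < norm (\<chi> j. D n j \<omega>)}) \<longlonglongrightarrow> 0"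
proof (rule tendsto_sandwich[where f = "\<lambda>_. 0"])
  let ?d = "e / CARD('n)"
  have d: "?d > 0" using e by simp
  show "(\<lambda>n. \<Sum>j\<in>UNIV. measure (M n) {\<omega>\<in>space (M n). ?d < \<bar>D n j \<omega>\<bar>}) \<longlonglongrightarrow> 0"
    using tendsto_sum[of UNIV "\<lambda>j n. measure (M n) {\<omega>\<in>space (M n). ?d < \<bar>D n j \<omega>\<bar>}" "\<lambda>_. 0"] D[OF d] by simp
  show "\<forall>\<^sub>F n in sequentially. measure (M n) {\<omega>\<in>space (M n). e < norm (\<chi> j. D n j \<omega>)} \<le>
     (\<Sum>j\<in>UNIV. measure (M n) {\<omega>\<in>space (M n). ?d < \<bar>D n j \<omega>\<bar>})"
    using m
  proof eventually_elim
    case (elim n)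
    interpret prob_space "M n" using elim by blast
    have [measurable]: "\<And>j. D n j \<in> borel_measurable (M n)" using elim by blast
    have "{\<omega>\<in>space (M n). e < norm (\<chi> j. D n j \<omega>)} \<subseteq> (\<Union>j. {\<omega>\<in>space (M n). ?d < \<bar>D n j \<omega>\<bar>})"
    proof (safe, rule ccontr)
      fix \<omega> assume \<omega>: "\<omega> \<in> space (M n)" "e < norm (\<chi> j. D n j \<omega>)" "\<omega> \<notin> (\<Union>j. {\<omega>\<in>space (M n). ?d < \<bar>D n j \<omega>\<bar>})"
      then have "\<bar>D n j \<omega>\<bar> \<le> ?d" for j by (auto simp: not_less)
      then have "(\<Sum>j\<in>UNIV. \<bar>D n j \<omega>\<bar>) \<le> (\<Sum>j\<in>(UNIV::'n set). ?d)" by (intro sum_mono)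
      also have "\<dots> = e" by simp
      finally have "norm (\<chi> j. D n j \<omega>) \<le> e" using norm_le_l1_cart[of "\<chi> j. D n j \<omega>"] by simp
      then show False using \<omega> by simp
    qed
    then have "measure (M n) {\<omega>\<in>space (M n). e < norm (\<chi> j. D n j \<omega>)} \<le> measure (M n) (\<Union>j. {\<omega>\<in>space (M n). ?d < \<bar>D n j \<omega>\<bar>})"
      by (intro finite_measure_mono sets.finite_UN) auto
    also have "\<dots> \<le> (\<Sum>j\<in>UNIV. measure (M n) {\<omega>\<in>space (M n). ?d < \<bar>D n j \<omega>\<bar>})"
      by (intro finite_measure_subadditive_finite) auto
    finally show ?case .
  qed
qed (auto intro: always_eventually)

lemma (in prob_space) prob_ge_le:
  assumes [measurable]: "f \<in> borel_measurable M" and q: "(\<integral>\<^sup>+\<omega>. ennreal (f \<omega>) \<partial>M) \<le> ennreal q" "0 \<le> q" and a: "0 < a"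
  shows "measure M {\<omega>\<in>space M. a \<le> f \<omega>} \<le> q / a"
proof -
  have "emeasure M {\<omega>\<in>space M. a \<le> f \<omega>} \<le> emeasure M {\<omega>\<in>space M. 1 \<le> ennreal (1 / a) * ennreal (f \<omega>)}"
  proof (rule emeasure_mono, safe)
    fix \<omega> assume "a \<le> f \<omega>"
    then have "1 \<le> 1 / a * f \<omega>" using a by (simp add: field_simps)
    then have "ennreal 1 \<le> ennreal (1 / a * f \<omega>)" by (rule ennreal_leI)
    then show "1 \<le> ennreal (1 / a) * ennreal (f \<omega>)" using a \<open>a \<le> f \<omega>\<close> by (subst ennreal_mult[symmetric]) auto
  qed measurable
  also have "\<dots> \<le> ennreal (1 / a) * (\<integral>\<^sup>+\<omega>. ennreal (f \<omega>) * indicator (space M) \<omega> \<partial>M)"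
    by (rule nn_integral_Markov_inequality) auto
  also have "(\<integral>\<^sup>+\<omega>. ennreal (f \<omega>) * indicator (space M) \<omega> \<partial>M) = (\<integral>\<^sup>+\<omega>. ennreal (f \<omega>) \<partial>M)"
    by (intro nn_integral_cong) simp
  also have "ennreal (1 / a) * \<dots> \<le> ennreal (1 / a) * ennreal q" by (intro mult_left_mono q) simp
  also have "\<dots> = ennreal (q / a)" using a q by (simp add: ennreal_mult[symmetric])
  finally show ?thesis using a q unfolding emeasure_eq_measure by (subst (asm) ennreal_le_iff) auto
qed

text \<open>The general form of an error estimate by Taylor's formula. The remainder \<open>D\<close> is
  controlled only where \<open>\<Delta>\<close> is small, and \<open>\<Delta>\<close> is small with high
  probability since its second moment \<open>q\<close> vanishes. On that event Markov's inequality for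
  \<open>\<eta> (1 + \<mu> \<Delta>\<^sup>2)\<close> gives a probability of order \<open>\<eta>\<close>, as
  \<open>\<mu> q\<close> stays bounded.\<close>
lemma in_probability_if_quadratic_remainder:
  fixes \<Delta> D :: "nat \<Rightarrow> 'a \<Rightarrow> real" and q \<mu> :: "nat \<Rightarrow> real"
  assumes m: "\<forall>\<^sub>F n in sequentially. prob_space (M n) \<and> \<Delta> n \<in> borel_measurable (M n) \<and> D n \<in> borel_measurable (M n)
       \<and> (\<integral>\<^sup>+\<omega>. ennreal ((\<Delta> n \<omega>)\<^sup>2) \<partial>M n) \<le> ennreal (q n) \<and> 0 \<le> q n \<and> 0 \<le> \<mu> n \<and> \<mu> n * q n \<le> Q"
    and q: "q \<longlonglongrightarrow> 0" and Q: "0 \<le> Q"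
    and rem: "\<And>\<eta>. \<eta> > 0 \<Longrightarrow> \<exists>\<delta>>0. \<forall>\<^sub>F n in sequentially. \<forall>\<omega>\<in>space (M n). \<bar>\<Delta> n \<omega>\<bar> \<le> \<delta> \<longrightarrow> \<bar>D n \<omega>\<bar> \<le> \<eta> * (1 + \<mu> n * (\<Delta> n \<omega>)\<^sup>2)"
    and e: "e > 0"
  shows "(\<lambda>n. measure (M n) {\<omega>\<in>space (M n). e < \<bar>D n \<omega>\<bar>}) \<longlonglongrightarrow> 0"
proof (rule LIMSEQ_I)
  fix r :: real assume r: "r > 0"
  define \<eta> where "\<eta> = r * e / 2 / (1 + Q)"
  have "1 + Q > 0" using Q by simp
  then have "\<eta> * (1 + Q) = r * e / 2" by (simp add: \<eta>_def del: divide_divide_eq_left)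
  then have "\<eta> * (1 + Q) / e = (r * e / 2) / e" by (simp only:)
  then have \<eta>: "\<eta> > 0" "\<eta> * (1 + Q) / e = r / 2" using r e Q by (auto simp: \<eta>_def simp del: divide_divide_eq_left)
  from rem[OF \<eta>(1)] obtain \<delta> where \<delta>: "\<delta> > 0"
    and ev: "\<forall>\<^sub>F n in sequentially. \<forall>\<omega>\<in>space (M n). \<bar>\<Delta> n \<omega>\<bar> \<le> \<delta> \<longrightarrow> \<bar>D n \<omega>\<bar> \<le> \<eta> * (1 + \<mu> n * (\<Delta> n \<omega>)\<^sup>2)" by blast
  have "\<forall>\<^sub>F n in sequentially. q n < \<delta>\<^sup>2 * (r / 2)"
    using \<delta> r by (intro order_tendstoD(2)[OF q]) auto
  then have "\<forall>\<^sub>F n in sequentially. norm (measure (M n) {\<omega>\<in>space (M n). e < \<bar>D n \<omega>\<bar>} - 0) < r"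
    using m ev
  proof eventually_elim
    case (elim n)
    interpret prob_space "M n" using elim by blast
    have [measurable]: "\<Delta> n \<in> borel_measurable (M n)" "D n \<in> borel_measurable (M n)" using elim by auto
    have q0: "0 \<le> q n" and \<mu>0: "0 \<le> \<mu> n" and \<mu>q: "\<mu> n * q n \<le> Q" using elim by auto
    have A: "measure (M n) {\<omega>\<in>space (M n). \<delta>\<^sup>2 \<le> (\<Delta> n \<omega>)\<^sup>2} \<le> q n / \<delta>\<^sup>2"
      using elim \<delta> by (intro prob_ge_le) auto
    also have "\<dots> < r / 2" using elim(1) \<delta> by (simp add: field_simps)
    finally have A: "measure (M n) {\<omega>\<in>space (M n). \<delta>\<^sup>2 \<le> (\<Delta> n \<omega>)\<^sup>2} < r / 2" .
    have "(\<integral>\<^sup>+\<omega>. ennreal (\<eta> * (1 + \<mu> n * (\<Delta> n \<omega>)\<^sup>2)) \<partial>M n) = (\<integral>\<^sup>+\<omega>. ennreal \<eta> + ennreal (\<eta> * \<mu> n) * ennreal ((\<Delta> n \<omega>)\<^sup>2) \<partial>M n)"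
      using \<eta>(1) \<mu>0 by (intro nn_integral_cong) (simp add: ennreal_plus[symmetric] ennreal_mult[symmetric] algebra_simps del: ennreal_plus)
    also have "\<dots> = ennreal \<eta> + ennreal (\<eta> * \<mu> n) * (\<integral>\<^sup>+\<omega>. ennreal ((\<Delta> n \<omega>)\<^sup>2) \<partial>M n)"
      by (simp add: nn_integral_add nn_integral_cmult emeasure_space_1)
    also have "\<dots> \<le> ennreal \<eta> + ennreal (\<eta> * \<mu> n) * ennreal (q n)"
      using elim by (intro add_left_mono mult_left_mono) auto
    also have "\<dots> = ennreal (\<eta> + \<eta> * (\<mu> n * q n))" using \<eta>(1) \<mu>0 q0 by (simp add: ennreal_plus ennreal_mult mult.assoc)
    also have "\<dots> \<le> ennreal (\<eta> * (1 + Q))"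
    proof (rule ennreal_leI)
      have "\<eta> * (\<mu> n * q n) \<le> \<eta> * Q" using \<eta>(1) \<mu>q by (intro mult_left_mono) auto
      then show "\<eta> + \<eta> * (\<mu> n * q n) \<le> \<eta> * (1 + Q)" by (simp add: algebra_simps)
    qed
    finally have "measure (M n) {\<omega>\<in>space (M n). e \<le> \<eta> * (1 + \<mu> n * (\<Delta> n \<omega>)\<^sup>2)} \<le> \<eta> * (1 + Q) / e"
      using \<eta>(1) Q e by (intro prob_ge_le) auto
    then have Bb: "measure (M n) {\<omega>\<in>space (M n). e \<le> \<eta> * (1 + \<mu> n * (\<Delta> n \<omega>)\<^sup>2)} \<le> r / 2" using \<eta>(2) by simp
    have "measure (M n) {\<omega>\<in>space (M n). e < \<bar>D n \<omega>\<bar>} \<le>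
      measure (M n) ({\<omega>\<in>space (M n). \<delta>\<^sup>2 \<le> (\<Delta> n \<omega>)\<^sup>2} \<union> {\<omega>\<in>space (M n). e \<le> \<eta> * (1 + \<mu> n * (\<Delta> n \<omega>)\<^sup>2)})"
    proof (rule finite_measure_mono)
      show "{\<omega>\<in>space (M n). e < \<bar>D n \<omega>\<bar>} \<subseteq> {\<omega>\<in>space (M n). \<delta>\<^sup>2 \<le> (\<Delta> n \<omega>)\<^sup>2} \<union> {\<omega>\<in>space (M n). e \<le> \<eta> * (1 + \<mu> n * (\<Delta> n \<omega>)\<^sup>2)}"
      proof
        fix \<omega> assume \<omega>: "\<omega> \<in> {\<omega>\<in>space (M n). e < \<bar>D n \<omega>\<bar>}"
        show "\<omega> \<in> {\<omega>\<in>space (M n). \<delta>\<^sup>2 \<le> (\<Delta> n \<omega>)\<^sup>2} \<union> {\<omega>\<in>space (M n). e \<le> \<eta> * (1 + \<mu> n * (\<Delta> n \<omega>)\<^sup>2)}"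
        proof (cases "\<bar>\<Delta> n \<omega>\<bar> \<le> \<delta>")
          case True
          then have "\<bar>D n \<omega>\<bar> \<le> \<eta> * (1 + \<mu> n * (\<Delta> n \<omega>)\<^sup>2)" using elim(3) \<omega> by auto
          then show ?thesis using \<omega> by auto
        next
          case False
          then have "\<bar>\<delta>\<bar> \<le> \<bar>\<Delta> n \<omega>\<bar>" using \<delta> by simp
          then have "\<delta>\<^sup>2 \<le> (\<Delta> n \<omega>)\<^sup>2" by (simp only: abs_le_square_iff)
          then show ?thesis using \<omega> by auto
        qed
      qed
    qed measurable
    also have "\<dots> \<le> measure (M n) {\<omega>\<in>space (M n). \<delta>\<^sup>2 \<le> (\<Delta> n \<omega>)\<^sup>2} + measure (M n) {\<omega>\<in>space (M n). e \<le> \<eta> * (1 + \<mu> n * (\<Delta> n \<omega>)\<^sup>2)}"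
      by (rule measure_Un_le) measurable
    finally show ?case using A Bb by simp
  qed
  then show "\<exists>no. \<forall>n\<ge>no. norm (measure (M n) {\<omega>\<in>space (M n). e < \<bar>D n \<omega>\<bar>} - 0) < r"
    by (simp add: eventually_sequentially)
qed

lemma C1_real:
  fixes f :: "real \<Rightarrow> real"
  assumes "f C1_differentiable_on UNIV"
  shows "(f has_real_derivative deriv f y) (at y)" "continuous_on UNIV (deriv f)" "continuous_on UNIV f"
proof -
  obtain D where D: "\<And>y. (f has_vector_derivative D y) (at y)" "continuous_on UNIV D"
    using assms by (auto simp: C1_differentiable_on_def)
  then have D': "(f has_real_derivative D y) (at y)" for y
    by (simp add: has_real_derivative_iff_has_vector_derivative)
  then have eq: "deriv f = D" by (intro ext DERIV_imp_deriv)
  show "(f has_real_derivative deriv f y) (at y)" "continuous_on UNIV (deriv f)" using D D' eq by auto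
  show "continuous_on UNIV f" using D' by (intro continuous_at_imp_continuous_on) (auto intro: DERIV_isCont)
qed

text \<open>The expansion is around \<open>z\<close>, but the derivative is frozen at the nearby point
  \<open>a\<close>: in the application \<open>z = x\<^sub>n\<close> moves with \<open>n\<close> and
  \<open>a\<close> is its limit.\<close>
lemma C1_increment:
  fixes f :: "real \<Rightarrow> real"
  assumes f: "f C1_differentiable_on UNIV" and \<eta>: "\<eta> > 0"
  obtains \<delta> where "\<delta> > 0" "\<And>y z. \<bar>y - a\<bar> \<le> \<delta> \<Longrightarrow> \<bar>z - a\<bar> \<le> \<delta> \<Longrightarrow> \<bar>f y - f z - deriv f a * (y - z)\<bar> \<le> \<eta> * \<bar>y - z\<bar>"
proof -
  have "isCont (deriv f) a" using C1_real(2)[OF f] by (simp add: continuous_on_eq_continuous_at)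
  from this[unfolded continuous_at_eps_delta, rule_format, OF \<eta>]
  obtain d where d: "d > 0" "\<And>y. \<bar>y - a\<bar> < d \<Longrightarrow> \<bar>deriv f y - deriv f a\<bar> < \<eta>" by (auto simp: dist_real_def)
  show ?thesis
  proof (rule that[of "d / 2"])
    show "d / 2 > 0" using d by simp
    fix y z assume yz: "\<bar>y - a\<bar> \<le> d / 2" "\<bar>z - a\<bar> \<le> d / 2"
    let ?g = "\<lambda>y. f y - deriv f a * y"
    have "norm (?g y - ?g z) \<le> \<eta> * norm (y - z)"
    proof (rule field_differentiable_bound[of "{a - d/2..a + d/2}"])
      show "(?g has_field_derivative deriv f u - deriv f a) (at u within {a - d/2..a + d/2})" for u
        by (auto intro!: derivative_eq_intros C1_real(1)[OF f, THEN DERIV_subset])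
      show "norm (deriv f u - deriv f a) \<le> \<eta>" if "u \<in> {a - d/2..a + d/2}" for u
        using d(2)[of u] d(1) that by (auto simp: abs_less_iff intro!: less_imp_le)
      show "y \<in> {a - d/2..a + d/2}" "z \<in> {a - d/2..a + d/2}"
        using yz unfolding atLeastAtMost_iff by linarith+
    qed simp
    then show "\<bar>f y - f z - deriv f a * (y - z)\<bar> \<le> \<eta> * \<bar>y - z\<bar>" by (simp add: algebra_simps)
  qed
qed

text \<open>The mean value inequality for the remainder as a function of \<open>y\<close>; its derivative is
  small by \<open>C1_increment\<close> for \<open>deriv f\<close>. The first derivative is taken at the moving
  point \<open>z\<close>: at \<open>a\<close> the error would only be of first order in \<open>y -
  z\<close>.\<close>
lemma C2_increment:
  fixes f :: "real \<Rightarrow> real"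
  assumes f: "f C1_differentiable_on UNIV" "deriv f C1_differentiable_on UNIV" and \<eta>: "\<eta> > 0"
  obtains \<delta> where "\<delta> > 0" "\<And>y z. \<bar>y - a\<bar> \<le> \<delta> \<Longrightarrow> \<bar>z - a\<bar> \<le> \<delta> \<Longrightarrow>
    \<bar>f y - f z - deriv f z * (y - z) - deriv (deriv f) a / 2 * (y - z)\<^sup>2\<bar> \<le> \<eta> * (y - z)\<^sup>2"
proof -
  obtain \<delta> where \<delta>: "\<delta> > 0" "\<And>y z. \<bar>y - a\<bar> \<le> \<delta> \<Longrightarrow> \<bar>z - a\<bar> \<le> \<delta> \<Longrightarrow> \<bar>deriv f y - deriv f z - deriv (deriv f) a * (y - z)\<bar> \<le> \<eta> * \<bar>y - z\<bar>"
    using C1_increment[OF f(2) \<eta>, of a] by metis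
  show ?thesis
  proof (rule that[OF \<delta>(1)])
    fix y z assume yz: "\<bar>y - a\<bar> \<le> \<delta>" "\<bar>z - a\<bar> \<le> \<delta>"
    let ?g = "\<lambda>y. f y - deriv f z * (y - z) - deriv (deriv f) a / 2 * (y - z)\<^sup>2"
    have "norm (?g y - ?g z) \<le> (\<eta> * \<bar>y - z\<bar>) * norm (y - z)"
    proof (rule field_differentiable_bound[of "closed_segment z y"])
      show "(?g has_field_derivative deriv f u - deriv f z - deriv (deriv f) a * (u - z)) (at u within closed_segment z y)" for u
        by (auto intro!: derivative_eq_intros C1_real(1)[OF f(1), THEN DERIV_subset])
      fix u assume u: "u \<in> closed_segment z y"
      then have "\<bar>u - a\<bar> \<le> \<delta>" "\<bar>u - z\<bar> \<le> \<bar>y - z\<bar>"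
        using yz by (auto simp: closed_segment_eq_real_ivl split: if_splits)
      then have "norm (deriv f u - deriv f z - deriv (deriv f) a * (u - z)) \<le> \<eta> * \<bar>u - z\<bar>"
        using \<delta>(2)[of u z] yz by simp
      also have "\<dots> \<le> \<eta> * \<bar>y - z\<bar>" using \<open>\<bar>u - z\<bar> \<le> \<bar>y - z\<bar>\<close> \<eta> by (intro mult_left_mono) auto
      finally show "norm (deriv f u - deriv f z - deriv (deriv f) a * (u - z)) \<le> \<eta> * \<bar>y - z\<bar>" .
    qed auto
    also have "\<dots> = \<eta> * (y - z)\<^sup>2" by (simp add: power2_eq_square abs_mult[symmetric] mult.assoc)
    finally show "\<bar>f y - f z - deriv f z * (y - z) - deriv (deriv f) a / 2 * (y - z)\<^sup>2\<bar> \<le> \<eta> * (y - z)\<^sup>2"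
      by (simp add: algebra_simps)
  qed
qed

text \<open>With \<open>s = r\<^sup>2/p\<close> this is \<open>s\<^sup>\<theta> \<le> 1 + s\<close>. It
  replaces Jensen's inequality: if \<open>r\<close> has second moment \<open>p\<close>, then
  \<open>r\<^bsup>2\<theta>\<^esup>\<close> has expectation at most \<open>2 p\<^sup>\<theta>\<close>.\<close>
lemma powr_le_affine_square:
  fixes r p \<theta> :: real
  assumes p: "0 < p" and \<theta>: "0 < \<theta>" "\<theta> \<le> 1" and r: "0 \<le> r"
  shows "(r powr \<theta>)\<^sup>2 \<le> p powr \<theta> * (1 + 1 / p * r\<^sup>2)"
proof -
  define s where "s = r\<^sup>2 / p"
  have s0: "0 \<le> s" using p by (simp add: s_def)
  have "(r powr \<theta>)\<^sup>2 = (r\<^sup>2) powr \<theta>"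
    by (simp add: power2_eq_square powr_mult r)
  also have "r\<^sup>2 = p * s" using p by (simp add: s_def)
  also have "(p * s) powr \<theta> = p powr \<theta> * s powr \<theta>" using p s0 by (simp add: powr_mult)
  also have "s powr \<theta> \<le> 1 + s"
  proof (cases "s \<le> 1")
    case True
    then have "s powr \<theta> \<le> 1 powr \<theta>" using s0 \<theta> by (intro powr_mono2) auto
    then show ?thesis using s0 by simp
  next
    case False
    then have "s powr \<theta> \<le> s powr 1" using \<theta> by (intro powr_mono) auto
    then show ?thesis using False by simp
  qed
  finally show ?thesis using p by (simp add: s_def mult_left_mono)
qed

lemma powr_le_affine:
  fixes r \<theta> :: real
  assumes \<theta>: "0 < \<theta>" "\<theta> \<le> 1" and r: "0 \<le> r"
  shows "r powr \<theta> \<le> 1 + r"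
proof (cases "r \<le> 1")
  case True
  then have "r powr \<theta> \<le> 1 powr \<theta>" using r \<theta> by (intro powr_mono2) auto
  then show ?thesis using r by simp
next
  case False
  then have "r powr \<theta> \<le> r powr 1" using \<theta> by (intro powr_mono) auto
  then show ?thesis using False by simp
qed

text \<open>If \<open>L\<close> were \<open>0\<close>, then \<open>\<kappa>\<close> would lose a factor
  \<open>2P\<close> whenever its argument \<open>1/n\<close> shrinks by the factor \<open>\<theta>\<close>.
  Iterating \<open>n \<mapsto> \<lceil>n/\<theta>\<rceil>\<close>, where rounding costs at most a factor
  \<open>2\<close>, the power lower bound loses at most a factor \<open>P\<close> in each step, so that
  \<open>\<kappa>\<close> eventually falls below it.\<close>
lemma energy_ratio_limit_positive:
  fixes \<kappa> :: "real \<Rightarrow> real"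
  assumes mono: "\<And>s t. 0 \<le> s \<Longrightarrow> s \<le> t \<Longrightarrow> \<kappa> s \<le> \<kappa> t"
    and lower: "\<And>t. 0 < t \<Longrightarrow> t \<le> 1 \<Longrightarrow> c * t powr g \<le> \<kappa> t" and c: "c > 0" and g: "g > 0" and \<theta>: "\<theta> > 0"
    and lim: "(\<lambda>n. inverse (\<kappa> (1 / real n)) * \<kappa> (\<theta> / real n)) \<longlonglongrightarrow> L"
  shows "L > 0"
proof (rule ccontr)
  assume "\<not> L > 0"
  have pos: "\<kappa> t > 0" if "t > 0" for t
  proof -
    have "0 < c * (min t 1) powr g" using c that by simp
    also have "\<dots> \<le> \<kappa> (min t 1)" using that by (intro lower) auto
    also have "\<dots> \<le> \<kappa> t" using that by (intro mono) auto
    finally show ?thesis .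
  qed
  (* a factor at most 1 makes n grow; replacing \<theta> by it only decreases the energy *)
  define \<theta>' where "\<theta>' = min \<theta> 1"
  have \<theta>': "0 < \<theta>'" "\<theta>' \<le> 1" "\<theta>' \<le> \<theta>" using \<theta> by (auto simp: \<theta>'_def)
  (* the power lower bound shrinks at most by this factor when n is replaced by \<lceil>n / \<theta>'\<rceil> *)
  define P where "P = (2 / \<theta>') powr g"
  have P: "P > 0" using \<theta>' by (simp add: P_def)
  have "\<forall>\<^sub>F n in sequentially. inverse (\<kappa> (1 / real n)) * \<kappa> (\<theta> / real n) < 1 / (2 * P)"
  proof (rule order_tendstoD(2)[OF lim])
    have "0 < 1 / (2 * P)" using P by simp
    then show "L < 1 / (2 * P)" using \<open>\<not> L > 0\<close> by linarith
  qed
  then obtain N where N: "\<And>n. n \<ge> N \<Longrightarrow> inverse (\<kappa> (1 / real n)) * \<kappa> (\<theta> / real n) < 1 / (2 * P)"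
    by (auto simp: eventually_sequentially)
  define n0 where "n0 = max N 1"
  have dec: "\<kappa> (\<theta>' / real n) \<le> 1 / (2 * P) * \<kappa> (1 / real n)" if "n \<ge> n0" for n
  proof -
    have n: "n \<ge> N" "real n > 0" using that by (auto simp: n0_def)
    have k1: "\<kappa> (1 / real n) > 0" using n by (intro pos) auto
    have "\<kappa> (\<theta>' / real n) \<le> \<kappa> (\<theta> / real n)" using n \<theta>' by (intro mono) (auto intro: divide_right_mono)
    also have "\<dots> = inverse (\<kappa> (1 / real n)) * \<kappa> (\<theta> / real n) * \<kappa> (1 / real n)" using k1 by simp
    also have "\<dots> \<le> 1 / (2 * P) * \<kappa> (1 / real n)" using N[OF n(1)] k1 by (intro mult_right_mono) auto
    finally show ?thesis .
  qed
  have ex: "\<exists>n\<ge>n0. real n \<le> (2 / \<theta>') ^ m * real n0 \<and> \<kappa> (1 / real n) \<le> (1 / (2 * P)) ^ m * \<kappa> (1 / real n0)" for m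
  proof (induction m)
    case 0
    show ?case by (intro exI[of _ n0]) simp
  next
    case (Suc m)
    then obtain n where n: "n \<ge> n0" "real n \<le> (2 / \<theta>') ^ m * real n0" "\<kappa> (1 / real n) \<le> (1 / (2 * P)) ^ m * \<kappa> (1 / real n0)" by blast
    have n1: "real n \<ge> 1" using n(1) by (auto simp: n0_def)
    define n' where "n' = nat \<lceil>real n / \<theta>'\<rceil>"
    have pos_q: "real n / \<theta>' > 0" using n1 \<theta>' by simp
    then have rn': "real n' = \<lceil>real n / \<theta>'\<rceil>" by (simp add: n'_def)
    have lo: "real n / \<theta>' \<le> real n'" and up: "real n' \<le> real n / \<theta>' + 1" unfolding rn' by linarith+
    have nn: "real n \<le> real n / \<theta>'" using n1 \<theta>' by (simp add: pos_le_divide_eq mult_left_le)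
    show ?case
    proof (intro exI[of _ n'] conjI)
      show "n0 \<le> n'" using nn lo n(1) by linarith
      have "real n' \<le> 2 / \<theta>' * real n" using up nn n1 by simp
      also have "\<dots> \<le> 2 / \<theta>' * ((2 / \<theta>') ^ m * real n0)" using n(2) \<theta>' by (intro mult_left_mono) auto
      finally show "real n' \<le> (2 / \<theta>') ^ Suc m * real n0" by (simp add: mult.assoc)
      have n'0: "real n' > 0" using lo pos_q by linarith
      have "1 / real n' \<le> \<theta>' / real n" using lo n'0 n1 \<theta>' by (simp add: field_simps)
      then have "\<kappa> (1 / real n') \<le> \<kappa> (\<theta>' / real n)" using n'0 by (intro mono) auto
      also have "\<dots> \<le> 1 / (2 * P) * \<kappa> (1 / real n)" by (rule dec[OF n(1)])
      also have "\<dots> \<le> 1 / (2 * P) * ((1 / (2 * P)) ^ m * \<kappa> (1 / real n0))" using n(3) P by (intro mult_left_mono) auto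
      finally show "\<kappa> (1 / real n') \<le> (1 / (2 * P)) ^ Suc m * \<kappa> (1 / real n0)" by (simp add: mult.assoc)
    qed
  qed
  have n0: "real n0 \<ge> 1" by (simp add: n0_def)
  have bound: "c * (1 / real n0) powr g * 2 ^ m \<le> \<kappa> (1 / real n0)" for m
  proof -
    obtain n where n: "n \<ge> n0" "real n \<le> (2 / \<theta>') ^ m * real n0" "\<kappa> (1 / real n) \<le> (1 / (2 * P)) ^ m * \<kappa> (1 / real n0)"
      using ex by blast
    have n1: "real n \<ge> 1" using n(1) n0 by linarith
    have Pm: "P ^ m = ((2 / \<theta>') ^ m) powr g" using \<theta>' unfolding P_def
      by (simp add: powr_realpow[symmetric] powr_powr mult.commute)
    have "real n powr g \<le> ((2 / \<theta>') ^ m * real n0) powr g" using n(2) n1 g by (intro powr_mono2) auto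
    also have "\<dots> = P ^ m * real n0 powr g" unfolding Pm using \<theta>' by (simp add: powr_mult)
    finally have up: "real n powr g \<le> P ^ m * real n0 powr g" .
    have npos: "real n powr g > 0" "real n0 powr g > 0" using n1 n0 by auto
    have "c * (1 / real n) powr g \<le> \<kappa> (1 / real n)" using n1 by (intro lower) auto
    then have "c * (1 / real n) powr g \<le> (1 / (2 * P)) ^ m * \<kappa> (1 / real n0)" using n(3) by linarith
    then have "c / real n powr g \<le> \<kappa> (1 / real n0) / (2 ^ m * P ^ m)"
      by (simp add: powr_divide power_divide power_mult_distrib)
    moreover have "c / (P ^ m * real n0 powr g) \<le> c / real n powr g"
      using up npos c P by (intro divide_left_mono) auto
    ultimately have "c / (P ^ m * real n0 powr g) \<le> \<kappa> (1 / real n0) / (2 ^ m * P ^ m)" by linarith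
    then have "c / real n0 powr g * 2 ^ m \<le> \<kappa> (1 / real n0)"
      using P npos by (simp add: field_simps)
    then show ?thesis by (simp add: powr_divide)
  qed
  have "c * (1 / real n0) powr g > 0" using c n0 by simp
  then obtain m where "\<kappa> (1 / real n0) / (c * (1 / real n0) powr g) < 2 ^ m" using real_arch_pow[of 2] by auto
  then show False using bound[of m] \<open>c * (1 / real n0) powr g > 0\<close> by (simp add: field_simps)
qed

lemma chi_square_1: "chi_square 1 = distr std_normal_distribution borel (\<lambda>z. z\<^sup>2)"
proof -
  let ?P = "\<Pi>\<^sub>M i\<in>{..<1::nat}. density lborel std_normal_density"
  have N: "prob_space std_normal_distribution" by (rule prob_space_normal_density) simp
  have m: "(\<lambda>z. z 0) \<in> measurable ?P borel"
  proof -
    have "(\<lambda>z. z 0) \<in> measurable ?P std_normal_distribution" by (rule measurable_component_singleton) simp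
    moreover have "measurable ?P borel = measurable ?P std_normal_distribution" by (rule measurable_cong_sets) auto
    ultimately show ?thesis by blast
  qed
  have "distr ?P std_normal_distribution (\<lambda>z. z 0) = std_normal_distribution"
    by (rule distr_PiM_component) (use N in auto)
  then have d: "distr ?P borel (\<lambda>z. z 0) = std_normal_distribution"
    by (metis (no_types, lifting) distr_cong sets_density sets_lborel)
  have "distr std_normal_distribution borel (\<lambda>z. z\<^sup>2) = distr (distr ?P borel (\<lambda>z. z 0)) borel (\<lambda>z. z\<^sup>2)"
    unfolding d ..
  also have "\<dots> = distr ?P borel ((\<lambda>z. z\<^sup>2) \<circ> (\<lambda>z. z 0))" by (rule distr_distr) (use m in auto)
  finally show ?thesis by (simp add: chi_square_def comp_def)
qed

text \<open>The phases \<open>d = 0\<close> and \<open>d = -\<pi>/2\<close> give the real and imaginary part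
  of the characteristic function of \<open>Y\<close>, which is that of a centred normal law with variance
  \<open>v\<close>.\<close>
lemma (in prob_space) square_law_if_gaussian:
  assumes Y: "Y \<in> borel_measurable M" and v: "v > 0"
    and cos: "\<And>a d. expectation (\<lambda>\<omega>. cos (a * Y \<omega> + d)) = cos d * exp (- (a\<^sup>2 * v) / 2)"
  shows "distr M borel (\<lambda>\<omega>. c * (Y \<omega>)\<^sup>2) = distr (chi_square 1) borel (\<lambda>z. c * v * z)"
proof -
  note [measurable] = Y
  have law: "distr M borel Y = distr std_normal_distribution borel (\<lambda>z. sqrt v * z)"
  proof (rule Levy_uniqueness)
    interpret N: real_distribution std_normal_distribution by (rule real_dist_normal_dist)
    show "real_distribution (distr M borel Y)" by (rule real_distribution_distr) measurable
    show "real_distribution (distr std_normal_distribution borel (\<lambda>z. sqrt v * z))"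
      by (rule N.real_distribution_distr) measurable
    show "char (distr M borel Y) = char (distr std_normal_distribution borel (\<lambda>z. sqrt v * z))"
    proof
      fix a
      have i: "complex_integrable M (\<lambda>\<omega>. iexp (a * Y \<omega>))"
        by (rule integrable_iexp) auto
      have "char (distr M borel Y) a = (CLINT \<omega>|M. iexp (a * Y \<omega>))"
        unfolding char_def by (subst integral_distr) auto
      also have "\<dots> = of_real (exp (- (a\<^sup>2 * v) / 2))"
      proof (rule complex_eqI)
        have "Re (CLINT \<omega>|M. iexp (a * Y \<omega>)) = expectation (\<lambda>\<omega>. Re (iexp (a * Y \<omega>)))" using i by (rule integral_Re[symmetric])
        also have "\<dots> = expectation (\<lambda>\<omega>. cos (a * Y \<omega> + 0))" by (simp add: Re_exp)
        also have "\<dots> = exp (- (a\<^sup>2 * v) / 2)" unfolding cos by simp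
        finally show "Re (CLINT \<omega>|M. iexp (a * Y \<omega>)) = Re (of_real (exp (- (a\<^sup>2 * v) / 2)))" by simp
        have "Im (CLINT \<omega>|M. iexp (a * Y \<omega>)) = expectation (\<lambda>\<omega>. Im (iexp (a * Y \<omega>)))" using i by (rule integral_Im[symmetric])
        also have "\<dots> = expectation (\<lambda>\<omega>. cos (a * Y \<omega> + - pi / 2))" by (simp add: Im_exp cos_add cos_diff)
        also have "\<dots> = 0" unfolding cos by simp
        finally show "Im (CLINT \<omega>|M. iexp (a * Y \<omega>)) = Im (of_real (exp (- (a\<^sup>2 * v) / 2)))" by simp
      qed
      also have "\<dots> = char std_normal_distribution (a * sqrt v)"
        using v by (simp add: char_std_normal_distribution power_mult_distrib)
      also have "\<dots> = char (distr std_normal_distribution borel (\<lambda>z. sqrt v * z)) a"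
        unfolding char_def by (subst integral_distr) (auto simp: mult_ac)
      finally show "char (distr M borel Y) a = char (distr std_normal_distribution borel (\<lambda>z. sqrt v * z)) a" .
    qed
  qed
  have "distr M borel (\<lambda>\<omega>. c * (Y \<omega>)\<^sup>2) = distr (distr M borel Y) borel (\<lambda>y. c * y\<^sup>2)"
    by (subst distr_distr) (auto simp: comp_def)
  also have "\<dots> = distr std_normal_distribution borel (\<lambda>z. c * v * z\<^sup>2)"
    unfolding law by (subst distr_distr) (use v in \<open>auto simp: comp_def power_mult_distrib mult.assoc\<close>)
  also have "\<dots> = distr (chi_square 1) borel (\<lambda>z. c * v * z)"
    unfolding chi_square_1 by (subst distr_distr) (auto simp: comp_def)
  finally show ?thesis .
qed

section \<open>Brownian increments\<close>

context filtered_prob_space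
begin

lemma space_F: "0 \<le> t \<Longrightarrow> space (F t) = space M"
  using subalgebra_F by (simp add: subalgebra_def)

lemma measurable_F_M: "0 \<le> t \<Longrightarrow> f \<in> measurable (F t) N \<Longrightarrow> f \<in> measurable M N"
  using measurable_from_subalg[OF subalgebra_F] .

lemma measurable_F_mono:
  assumes "0 \<le> s" "s \<le> t" "f \<in> measurable (F s) N"
  shows "f \<in> measurable (F t) N"
proof (rule measurable_from_subalg[OF _ assms(3)])
  show "subalgebra (F t) (F s)"
    using assms mono_F[of s t] by (simp add: subalgebra_def space_F)
qed

end

context brownian_motion
begin

lemma B_measurable_F: "0 \<le> s \<Longrightarrow> s \<le> t \<Longrightarrow> B s \<in> borel_measurable (F t)"
  using adapted_B measurable_F_mono[of s t "B s" borel] by (auto simp: adapted_def)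

lemma B_measurable: "0 \<le> s \<Longrightarrow> B s \<in> borel_measurable M"
  using B_measurable_F[of s s] measurable_F_M by auto

lemma indep_increment:
  assumes st: "0 \<le> s" "s < t" and Z: "Z \<in> borel_measurable (F s)"
  shows "indep_var borel Z borel (\<lambda>\<omega>. B t \<omega> - B s \<omega>)"
proof -
  have "indep_set (sets (F s)) (sets (vimage_algebra (space M) (\<lambda>\<omega>. B t \<omega> - B s \<omega>) borel))"
    by (rule indep_B[OF st])
  then have "indep_set (sigma_sets (space M) {Z -` A \<inter> space M | A. A \<in> sets borel})
     (sigma_sets (space M) {(\<lambda>\<omega>. B t \<omega> - B s \<omega>) -` A \<inter> space M | A. A \<in> sets borel})"
    unfolding indep_set_def
  proof (rule indep_sets_mono_sets)
    fix i :: bool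
    have "sigma_sets (space M) {Z -` A \<inter> space M | A. A \<in> sets borel} \<subseteq> sets (F s)"
      unfolding space_F[OF st(1), symmetric]
      by (rule sets.sigma_sets_subset) (use measurable_sets[OF Z] in auto)
    then show "(case i of True \<Rightarrow> sigma_sets (space M) {Z -` A \<inter> space M | A. A \<in> sets borel}
       | False \<Rightarrow> sigma_sets (space M) {(\<lambda>\<omega>. B t \<omega> - B s \<omega>) -` A \<inter> space M | A. A \<in> sets borel})
       \<subseteq> (case i of True \<Rightarrow> sets (F s) | False \<Rightarrow> sets (vimage_algebra (space M) (\<lambda>\<omega>. B t \<omega> - B s \<omega>) borel))"
      by (auto simp: sets_vimage_algebra split: bool.split)
  qed
  then show ?thesis unfolding indep_var_eq
    using st Z B_measurable measurable_F_M[OF st(1) Z] by auto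
qed

lemma increment_moments:
  assumes st: "0 \<le> s" "s < t"
  shows "integrable M (\<lambda>\<omega>. B t \<omega> - B s \<omega>)" "expectation (\<lambda>\<omega>. B t \<omega> - B s \<omega>) = 0"
    "integrable M (\<lambda>\<omega>. (B t \<omega> - B s \<omega>)\<^sup>2)" "expectation (\<lambda>\<omega>. (B t \<omega> - B s \<omega>)\<^sup>2) = t - s"
proof -
  note N = normal_B[OF st]
  have p: "0 < sqrt (t - s)" using st by simp
  show e: "expectation (\<lambda>\<omega>. B t \<omega> - B s \<omega>) = 0"
    using normal_distributed_expectation[OF p N] by simp
  have "integrable lborel (\<lambda>x. normal_density 0 (sqrt (t - s)) x * x ^ 1)"
    using integrable_normal_moment[OF p, of 0 1] by simp
  then show "integrable M (\<lambda>\<omega>. B t \<omega> - B s \<omega>)"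
    using distributed_integrable[OF N, of "\<lambda>x. x ^ 1"] by simp
  have "integrable lborel (\<lambda>x. normal_density 0 (sqrt (t - s)) x * x ^ 2)"
    using integrable_normal_moment[OF p, of 0 2] by simp
  then show "integrable M (\<lambda>\<omega>. (B t \<omega> - B s \<omega>)\<^sup>2)"
    using distributed_integrable[OF N, of "\<lambda>x. x ^ 2"] by simp
  show "expectation (\<lambda>\<omega>. (B t \<omega> - B s \<omega>)\<^sup>2) = t - s"
    using normal_distributed_variance[OF p N] st e by simp
qed

lemma expectation_iexp_increment:
  assumes st: "0 \<le> s" "s < t"
  shows "(CLINT \<omega>|M. iexp (c * (B t \<omega> - B s \<omega>))) = of_real (exp (- (c\<^sup>2 * (t - s)) / 2))"
proof -
  have p: "0 < sqrt (t - s)" using st by simp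
  let ?Y = "\<lambda>\<omega>. (B t \<omega> - B s \<omega>) / sqrt (t - s)"
  have N: "distributed M lborel ?Y std_normal_density"
    using normal_B[OF st] normal_standard_normal_convert[OF p, of "\<lambda>\<omega>. B t \<omega> - B s \<omega>" 0] by simp
  have [measurable]: "?Y \<in> borel_measurable M"
    using B_measurable st by auto
  have d: "distr M lborel ?Y = std_normal_distribution"
    using distributed_distr_eq_density[OF N] by simp
  have "(CLINT \<omega>|M. iexp (c * (B t \<omega> - B s \<omega>))) = (CLINT \<omega>|M. iexp ((c * sqrt (t - s)) * ?Y \<omega>))"
    using p by simp
  also have "\<dots> = (CLINT y|distr M lborel ?Y. iexp ((c * sqrt (t - s)) * y))"
    by (subst integral_distr) auto
  also have "\<dots> = char std_normal_distribution (c * sqrt (t - s))"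
    unfolding d char_def ..
  also have "\<dots> = exp (of_real (- ((c * sqrt (t - s))\<^sup>2) / 2))"
    by (simp add: char_std_normal_distribution flip: exp_of_real)
  finally show ?thesis using st by (simp add: power_mult_distrib flip: exp_of_real)
qed

end

section \<open>Grids of simple processes\<close>

text \<open>The value of a simple process at time \<open>s\<close> is this sum with the indicator of
  \<open>[s, \<infinity>)\<close> for \<open>\<phi>\<close>, and its stochastic integral up to
  \<open>t\<close> is the sum with the stopped Brownian path. A property proved for all \<open>\<phi>\<close>
  therefore holds for both at once.\<close>
fun step_sum :: "'a simple_code \<Rightarrow> (real \<Rightarrow> real) \<Rightarrow> 'a \<Rightarrow> real" where
  "step_sum (k, u, \<xi>) \<phi> \<omega> = (\<Sum>i<k. \<xi> i \<omega> * (\<phi> (u (Suc i)) - \<phi> (u i)))"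

lemma simple_integral_eq_step_sum:
  "simple_integral B S t \<omega> = step_sum S (\<lambda>r. B (min r t) \<omega>) \<omega>"
  by (cases S) simp

lemma simple_value_eq_step_sum:
  assumes "simple_process M F S"
  shows "simple_value S s \<omega> = step_sum S (indicator {s..}) \<omega>"
proof (cases S)
  case (fields k u \<xi>)
  have "u i \<le> u (Suc i)" if "i < k" for i using assms that by (auto simp: fields less_imp_le)
  then show ?thesis unfolding fields simple_value.simps step_sum.simps
    by (intro sum.cong refl) (force simp: indicator_def)
qed

lemma simple_process_mono_on:
  assumes "simple_process M F (k, u, \<xi>)" "i \<le> j" "j \<le> k"
  shows "u i \<le> u j" "0 \<le> u i"
proof -
  have "i \<le> j \<longrightarrow> j \<le> k \<longrightarrow> u i \<le> u j" for i j
  proof (induction j)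
    case (Suc j)
    show ?case
    proof (cases "i = Suc j \<or> \<not> Suc j \<le> k")
      case False
      then have "u j < u (Suc j)" using assms(1) by auto
      with Suc False show ?thesis by auto
    qed auto
  qed auto
  from this[of i j] this[of 0 i] show "u i \<le> u j" "0 \<le> u i" using assms by auto
qed

lemma simple_value_node:
  assumes S: "simple_process M F (k, u, \<xi>)" and i: "i < k" and s: "u i < s" "s \<le> u (Suc i)"
  shows "simple_value (k, u, \<xi>) s \<omega> = \<xi> i \<omega>"
proof -
  have "simple_value (k, u, \<xi>) s \<omega> = (\<Sum>j<k. if j = i then \<xi> i \<omega> else 0)"
    unfolding simple_value.simps
  proof (intro sum.cong refl)
    fix j assume j: "j \<in> {..<k}"
    have "s \<notin> {u j<..u (Suc j)}" if "j \<noteq> i"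
    proof (cases "j < i")
      case True
      then have "u (Suc j) \<le> u i" using simple_process_mono_on[OF S, of "Suc j" i] i by auto
      then show ?thesis using s by auto
    next
      case False
      then have "u (Suc i) \<le> u j" using that simple_process_mono_on[OF S, of "Suc i" j] j by auto
      then show ?thesis using s by auto
    qed
    then show "\<xi> j \<omega> * indicator {u j<..u (Suc j)} s = (if j = i then \<xi> i \<omega> else 0)"
      using s by auto
  qed
  then show ?thesis using i by simp
qed

lemma simple_value_bounded:
  assumes "simple_process M F S"
  shows "\<exists>c\<ge>0. \<forall>s. \<forall>\<omega>\<in>space M. \<bar>simple_value S s \<omega>\<bar> \<le> c"
proof (cases S)
  case (fields k u \<xi>)
  have "\<forall>i<k. \<exists>c. \<forall>\<omega>\<in>space M. \<bar>\<xi> i \<omega>\<bar> \<le> c" using assms fields by auto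
  then obtain c where c: "\<And>i \<omega>. i < k \<Longrightarrow> \<omega> \<in> space M \<Longrightarrow> \<bar>\<xi> i \<omega>\<bar> \<le> c i" by metis
  show ?thesis
  proof (intro exI[of _ "\<Sum>i<k. \<bar>c i\<bar>"] conjI allI ballI)
    fix s \<omega> assume \<omega>: "\<omega> \<in> space M"
    have "\<bar>simple_value S s \<omega>\<bar> \<le> (\<Sum>i<k. \<bar>\<xi> i \<omega> * indicator {u i<..u (Suc i)} s\<bar>)"
      unfolding fields simple_value.simps by (rule sum_abs)
    also have "\<dots> \<le> (\<Sum>i<k. \<bar>c i\<bar>)"
    proof (rule sum_mono)
      fix i assume "i \<in> {..<k}"
      then show "\<bar>\<xi> i \<omega> * indicator {u i<..u (Suc i)} s\<bar> \<le> \<bar>c i\<bar>"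
        using c[of i \<omega>] \<omega> by (auto simp: indicator_def)
    qed
    finally show "\<bar>simple_value S s \<omega>\<bar> \<le> (\<Sum>i<k. \<bar>c i\<bar>)" .
  qed (auto intro: sum_nonneg)
qed

context filtered_prob_space
begin

lemma simple_value_measurable_F:
  assumes S: "simple_process M F (k, u, \<xi>)" and r: "0 \<le> r"
    and nodes: "\<And>i. i \<le> k \<Longrightarrow> u i < s \<Longrightarrow> u i \<le> r"
  shows "simple_value (k, u, \<xi>) s \<in> borel_measurable (F r)"
  unfolding simple_value.simps
proof (rule borel_measurable_sum)
  fix i assume i: "i \<in> {..<k}"
  show "(\<lambda>\<omega>. \<xi> i \<omega> * indicator {u i<..u (Suc i)} s) \<in> borel_measurable (F r)"
  proof (cases "u i < s")
    case True
    then have "u i \<le> r" using nodes[of i] i by auto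
    moreover have "0 \<le> u i" using simple_process_mono_on[OF S, of i i] i by auto
    ultimately have "\<xi> i \<in> borel_measurable (F r)"
      using S i measurable_F_mono[of "u i" r "\<xi> i" borel] by auto
    then show ?thesis by simp
  qed simp
qed

text \<open>On a finer grid the coefficient of an interval is the value of the process at its right endpoint.
  It is nevertheless known at the left endpoint, because no node of the original grid lies strictly between
  the two.\<close>
lemma refine_to_grid:
  assumes S: "simple_process M F (k, u, \<xi>)" and P: "finite P" "P \<subseteq> {0..}" "u ` {..k} \<subseteq> P"
  defines "v \<equiv> (!) (sorted_list_of_set P)" and "l \<equiv> card P - 1"
  defines "\<zeta> \<equiv> \<lambda>j. simple_value (k, u, \<xi>) (v (Suc j))"
  shows "simple_process M F (l, v, \<zeta>)" "step_sum (l, v, \<zeta>) \<phi> \<omega> = step_sum (k, u, \<xi>) \<phi> \<omega>"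
proof -
  have ne: "P \<noteq> {}" using P(3) by auto
  have len: "length (sorted_list_of_set P) = Suc l"
    using ne P(1) by (simp add: l_def card_gt_0_iff)
  have less: "v a < v b" if "a < b" "b \<le> l" for a b
    using that len sorted_wrt_nth_less[OF strict_sorted_list_of_set[of P], of a b] by (auto simp: v_def)
  have less_iff: "v a < v b \<longleftrightarrow> a < b" if "a \<le> l" "b \<le> l" for a b
    using less[of a b] less[of b a] that by (metis less_asym less_irrefl linorder_neqE_nat)
  have inP: "v a \<in> P" if "a \<le> l" for a
    using that len P(1) nth_mem[of a "sorted_list_of_set P"] by (auto simp: v_def)
  have ex: "\<exists>a\<le>l. v a = p" if "p \<in> P" for p
    using that len P(1) by (metis in_set_conv_nth less_Suc_eq_le set_sorted_list_of_set v_def)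
  have next_node: "p \<le> v j" if pj: "p \<in> P" "p < v (Suc j)" "j < l" for p j
  proof -
    obtain a where a: "a \<le> l" "v a = p" using ex[OF pj(1)] by blast
    have "a < Suc j" using less_iff[of a "Suc j"] a pj(2,3) by simp
    moreover have "v j < v a \<longleftrightarrow> j < a" using less_iff[of j a] a(1) pj(3) by simp
    ultimately show ?thesis using a(2) by simp
  qed
  from simple_value_bounded[OF S]
  obtain c where c: "\<forall>s. \<forall>\<omega>\<in>space M. \<bar>simple_value (k, u, \<xi>) s \<omega>\<bar> \<le> c" by (elim exE conjE)
  show "simple_process M F (l, v, \<zeta>)"
    unfolding simple_process.simps
  proof (intro conjI allI impI)
    show "0 \<le> v 0" using inP[of 0] P(2) by auto
    fix j assume j: "j < l"
    show "v j < v (Suc j)" using less j by auto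
    show "\<zeta> j \<in> borel_measurable (F (v j))"
      unfolding \<zeta>_def using j inP[of j] P next_node[of _ j]
      by (intro simple_value_measurable_F[OF S]) auto
    show "\<exists>c. \<forall>\<omega>\<in>space M. \<bar>\<zeta> j \<omega>\<bar> \<le> c" using c unfolding \<zeta>_def by blast
  qed
  have tele: "(\<Sum>j<l. indicator {u i<..u (Suc i)} (v (Suc j)) * (\<phi> (v (Suc j)) - \<phi> (v j))) = \<phi> (u (Suc i)) - \<phi> (u i)"
    if i: "i < k" for i
  proof -
    have "u i \<in> P" "u (Suc i) \<in> P" using P(3) i by auto
    then obtain a b where ab: "a \<le> l" "v a = u i" "b \<le> l" "v b = u (Suc i)"
      using ex[of "u i"] ex[of "u (Suc i)"] by blast
    have "a < b" using S i ab less_iff[of a b] by auto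
    have "(\<Sum>j<l. indicator {u i<..u (Suc i)} (v (Suc j)) * (\<phi> (v (Suc j)) - \<phi> (v j)))
        = (\<Sum>j<l. if a \<le> j \<and> j < b then \<phi> (v (Suc j)) - \<phi> (v j) else 0)"
    proof (intro sum.cong refl)
      fix j assume "j \<in> {..<l}"
      then have "v a < v (Suc j) \<longleftrightarrow> a \<le> j" "v (Suc j) \<le> v b \<longleftrightarrow> j < b"
        using less_iff[of a "Suc j"] less_iff[of b "Suc j"] ab by (auto simp flip: not_less)
      then show "indicator {u i<..u (Suc i)} (v (Suc j)) * (\<phi> (v (Suc j)) - \<phi> (v j))
         = (if a \<le> j \<and> j < b then \<phi> (v (Suc j)) - \<phi> (v j) else 0)"
        using ab by (auto simp: indicator_def)
    qed
    also have "\<dots> = (\<Sum>j\<in>{a..<b}. \<phi> (v (Suc j)) - \<phi> (v j))"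
      using ab by (intro sum.mono_neutral_cong_right) auto
    also have "\<dots> = \<phi> (v b) - \<phi> (v a)"
      using \<open>a < b\<close> sum_Suc_diff'[of a b "\<lambda>j. \<phi> (v j)"] by simp
    finally show ?thesis using ab by simp
  qed
  have "step_sum (l, v, \<zeta>) \<phi> \<omega> = (\<Sum>j<l. \<Sum>i<k. \<xi> i \<omega> * (indicator {u i<..u (Suc i)} (v (Suc j)) * (\<phi> (v (Suc j)) - \<phi> (v j))))"
    by (simp only: step_sum.simps simple_value.simps \<zeta>_def sum_distrib_right mult.assoc)
  also have "\<dots> = (\<Sum>i<k. \<Sum>j<l. \<xi> i \<omega> * (indicator {u i<..u (Suc i)} (v (Suc j)) * (\<phi> (v (Suc j)) - \<phi> (v j))))"
    by (rule sum.swap)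
  also have "\<dots> = step_sum (k, u, \<xi>) \<phi> \<omega>"
    unfolding step_sum.simps sum_distrib_left[symmetric] by (intro sum.cong refl) (simp only: tele lessThan_iff)
  finally show "step_sum (l, v, \<zeta>) \<phi> \<omega> = step_sum (k, u, \<xi>) \<phi> \<omega>" .
qed

text \<open>Two simple processes are written on a common grid; multiples of \<open>\<delta>\<close> are added
  to it to bound the mesh up to time \<open>t\<close>.\<close>
lemma simple_process_diff:
  assumes S: "simple_process M F S" and S': "simple_process M F S'" and \<delta>: "\<delta> > 0"
  obtains l v \<zeta> where "simple_process M F (l, v, \<zeta>)"
    "\<And>s \<omega>. simple_value (l, v, \<zeta>) s \<omega> = simple_value S s \<omega> - simple_value S' s \<omega>"
    "\<And>r \<omega>. simple_integral B (l, v, \<zeta>) r \<omega> = simple_integral B S r \<omega> - simple_integral B S' r \<omega>"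
    "\<And>j. j < l \<Longrightarrow> min (v (Suc j)) t - min (v j) t \<le> \<delta>"
proof -
  obtain k u \<xi> where Seq: "S = (k, u, \<xi>)" by (cases S)
  obtain k' u' \<xi>' where S'eq: "S' = (k', u', \<xi>')" by (cases S')
  note S = S[unfolded Seq] and S' = S'[unfolded S'eq]
  define N where "N = nat \<lceil>t / \<delta>\<rceil>"
  define P where "P = u ` {..k} \<union> u' ` {..k'} \<union> (\<lambda>i. real i * \<delta>) ` {..N}"
  have P: "finite P" "P \<subseteq> {0..}" "u ` {..k} \<subseteq> P" "u' ` {..k'} \<subseteq> P"
    using simple_process_mono_on[OF S] simple_process_mono_on[OF S'] \<delta> by (auto simp: P_def)
  define v where "v = (!) (sorted_list_of_set P)"
  define l where "l = card P - 1"
  define \<zeta>1 where "\<zeta>1 = (\<lambda>j. simple_value (k, u, \<xi>) (v (Suc j)))"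
  define \<zeta>2 where "\<zeta>2 = (\<lambda>j. simple_value (k', u', \<xi>') (v (Suc j)))"
  note R1 = refine_to_grid[OF S P(1,2,3), folded v_def l_def, folded \<zeta>1_def]
  note R2 = refine_to_grid[OF S' P(1,2,4), folded v_def l_def, folded \<zeta>2_def]
  define \<zeta> where "\<zeta> = (\<lambda>j \<omega>. \<zeta>1 j \<omega> - \<zeta>2 j \<omega>)"
  have R: "simple_process M F (l, v, \<zeta>)"
    unfolding simple_process.simps
  proof (intro conjI allI impI)
    show "0 \<le> v 0" using R1(1) by simp
    fix j assume j: "j < l"
    show "v j < v (Suc j)" using R1(1) j by auto
    show "\<zeta> j \<in> borel_measurable (F (v j))"
      unfolding \<zeta>_def using R1(1) R2(1) j by (intro borel_measurable_diff) auto
    have "\<exists>c. \<forall>\<omega>\<in>space M. \<bar>\<zeta>1 j \<omega>\<bar> \<le> c" "\<exists>c. \<forall>\<omega>\<in>space M. \<bar>\<zeta>2 j \<omega>\<bar> \<le> c"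
      using R1(1) R2(1) j by simp_all
    then obtain c c' where "\<And>\<omega>. \<omega> \<in> space M \<Longrightarrow> \<bar>\<zeta>1 j \<omega>\<bar> \<le> c" "\<And>\<omega>. \<omega> \<in> space M \<Longrightarrow> \<bar>\<zeta>2 j \<omega>\<bar> \<le> c'"
      by blast
    then have "\<And>\<omega>. \<omega> \<in> space M \<Longrightarrow> \<bar>\<zeta> j \<omega>\<bar> \<le> c + c'"
      unfolding \<zeta>_def by (meson abs_triangle_ineq4 add_mono order_trans)
    then show "\<exists>c. \<forall>\<omega>\<in>space M. \<bar>\<zeta> j \<omega>\<bar> \<le> c" by blast
  qed
  have sumeq: "step_sum (l, v, \<zeta>) \<phi> \<omega> = step_sum S \<phi> \<omega> - step_sum S' \<phi> \<omega>" for \<phi> \<omega>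
    unfolding Seq S'eq R1(2)[symmetric] R2(2)[symmetric]
    by (simp add: \<zeta>_def left_diff_distrib sum_subtractf)
  show ?thesis
  proof (rule that[OF R])
    show "simple_value (l, v, \<zeta>) s \<omega> = simple_value S s \<omega> - simple_value S' s \<omega>" for s \<omega>
      unfolding simple_value_eq_step_sum[OF R] simple_value_eq_step_sum[OF assms(1)] simple_value_eq_step_sum[OF assms(2)]
      by (rule sumeq)
    show "simple_integral B (l, v, \<zeta>) r \<omega> = simple_integral B S r \<omega> - simple_integral B S' r \<omega>" for r \<omega>
      unfolding simple_integral_eq_step_sum by (rule sumeq)
    fix j assume j: "j < l"
    show "min (v (Suc j)) t - min (v j) t \<le> \<delta>"
    proof (cases "v j < t")
      case True
      have v0: "0 \<le> v j" using simple_process_mono_on[OF R, of j j] j by auto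
      (* the first multiple of \<delta> after v j is a node *)
      define i where "i = nat (\<lfloor>v j / \<delta>\<rfloor> + 1)"
      have ri: "real i = \<lfloor>v j / \<delta>\<rfloor> + 1" using v0 \<delta> by (simp add: i_def)
      have "v j / \<delta> < t / \<delta>" using True \<delta> by (simp add: divide_strict_right_mono)
      then have "\<lfloor>v j / \<delta>\<rfloor> < \<lceil>t / \<delta>\<rceil>" by linarith
      then have "i \<le> N" unfolding i_def N_def by linarith
      then have iP: "real i * \<delta> \<in> P" by (auto simp: P_def)
      have "v j / \<delta> < real i" "real i \<le> v j / \<delta> + 1" unfolding ri by linarith+
      then have i1: "v j < real i * \<delta>" and i2: "real i * \<delta> \<le> v j + \<delta>"
        using \<delta> by (simp_all add: field_simps)
      have len: "length (sorted_list_of_set P) = Suc l"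
      proof -
        have "card P > 0" using iP P(1) by (auto simp: card_gt_0_iff)
        then show ?thesis by (simp add: l_def)
      qed
      obtain a where a: "a \<le> l" "v a = real i * \<delta>"
        using iP len P(1) by (metis in_set_conv_nth less_Suc_eq_le set_sorted_list_of_set v_def)
      have "\<not> a \<le> j" using i1 a simple_process_mono_on[OF R, of a j] j by auto
      then have "v (Suc j) \<le> v a" using simple_process_mono_on[OF R, of "Suc j" a] a by auto
      then show ?thesis using a i2 True by auto
    next
      case False
      then have "v (Suc j) \<ge> t" using simple_process_mono_on(1)[OF R, of j "Suc j"] j by auto
      then show ?thesis using False \<delta> by auto
    qed
  qed
qed

end

section \<open>A localised Ito inequality\<close>

lemma simple_process_bound:
  "simple_process M F (k, u, \<xi>) \<Longrightarrow> i < k \<Longrightarrow> \<exists>c. \<forall>\<omega>\<in>space M. \<bar>\<xi> i \<omega>\<bar> \<le> c"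
  by simp

context filtered_prob_space
begin

lemma simple_value_measurable_pair:
  assumes S: "simple_process M F S"
  shows "(\<lambda>(s, \<omega>). simple_value S s \<omega>) \<in> borel_measurable (borel \<Otimes>\<^sub>M M)"
proof (cases S)
  case (fields k u \<xi>)
  have [measurable]: "\<xi> i \<in> borel_measurable M" if "i < k" for i
    using S that simple_process_mono_on(2)[of M F k u \<xi> i i] measurable_F_M[of "u i" "\<xi> i" borel]
    unfolding fields by auto
  have "(\<lambda>x. \<Sum>i<k. \<xi> i (snd x) * indicator {u i<..u (Suc i)} (fst x)) \<in> borel_measurable (borel \<Otimes>\<^sub>M M)"
    by (intro borel_measurable_sum borel_measurable_times measurable_compose[OF measurable_snd])
       (auto intro!: measurable_compose[OF measurable_fst])
  then show ?thesis by (simp add: fields case_prod_beta)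
qed

lemma progressive_measurable_pair:
  assumes H: "progressively_measurable_upto F H t" and t: "0 \<le> t"
  shows "(\<lambda>(s, \<omega>). H (max 0 (min s t)) \<omega>) \<in> borel_measurable (borel \<Otimes>\<^sub>M M)"
proof -
  have 1: "(\<lambda>(s, \<omega>). H s \<omega>) \<in> borel_measurable (restrict_space borel {0..t} \<Otimes>\<^sub>M F t)"
    using H t by (auto simp: progressively_measurable_upto_def)
  have id: "(\<lambda>\<omega>. \<omega>) \<in> measurable M (F t)"
    by (rule measurable_F_M[OF t]) simp
  have "(\<lambda>x. (max 0 (min (fst x) t), snd x)) \<in> measurable (borel \<Otimes>\<^sub>M M) (restrict_space borel {0..t} \<Otimes>\<^sub>M F t)"
  proof (rule measurable_Pair)
    show "(\<lambda>x. max 0 (min (fst x) t)) \<in> measurable (borel \<Otimes>\<^sub>M M) (restrict_space borel {0..t})"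
      by (rule measurable_restrict_space2) (use t in auto)
    show "snd \<in> measurable ((borel :: real measure) \<Otimes>\<^sub>M M) (F t)"
    proof -
      have "snd \<in> measurable ((borel :: real measure) \<Otimes>\<^sub>M M) M" by simp
      from measurable_compose[OF this id] show ?thesis .
    qed
  qed
  from measurable_compose[OF this 1] show ?thesis by (simp add: case_prod_beta)
qed

end

context brownian_motion
begin

lemma simple_integral_measurable_F:
  assumes S: "simple_process M F (k, u, \<xi>)" and t: "0 \<le> t" and r: "\<And>i. i \<le> k \<Longrightarrow> min (u i) t \<le> r" "u k \<le> r \<or> t \<le> r"
    "\<And>i. i < k \<Longrightarrow> u i \<le> r"
  shows "simple_integral B (k, u, \<xi>) t \<in> borel_measurable (F r)"
  unfolding simple_integral.simps
proof (rule borel_measurable_sum)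
  fix i assume i: "i \<in> {..<k}"
  have u: "0 \<le> u i" "0 \<le> u (Suc i)" using simple_process_mono_on(2)[OF S, of i i] simple_process_mono_on(2)[OF S, of "Suc i" "Suc i"] i by auto
  have "\<xi> i \<in> borel_measurable (F r)"
    using S i r(3)[of i] u measurable_F_mono[of "u i" r "\<xi> i" borel] by auto
  then show "(\<lambda>\<omega>. \<xi> i \<omega> * (B (min (u (Suc i)) t) \<omega> - B (min (u i) t) \<omega>)) \<in> borel_measurable (F r)"
    using i t u r(1)[of i] r(1)[of "Suc i"]
    by (intro borel_measurable_times borel_measurable_diff B_measurable_F) auto
qed

lemma simple_integral_measurable:
  assumes S: "simple_process M F S" and t: "0 \<le> t"
  shows "simple_integral B S t \<in> borel_measurable M"
proof (cases S)
  case (fields k u \<xi>)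
  note S = S[unfolded fields]
  have "u i \<le> u k" "0 \<le> u k" if "i \<le> k" for i using simple_process_mono_on[OF S that] simple_process_mono_on[OF S, of k k] by auto
  then have "simple_integral B (k, u, \<xi>) t \<in> borel_measurable (F (max (u k) t))"
    by (intro simple_integral_measurable_F[OF S t]) (auto simp: le_max_iff_disj)
  then show ?thesis unfolding fields using t by (intro measurable_F_M[of "max (u k) t"]) auto
qed

text \<open>The Ito isometry by induction on the number of intervals: the increment of Brownian motion over
  the last interval is centred and independent of everything that precedes it, so that the mixed term
  vanishes.\<close>
lemma simple_integral_isometry:
  assumes "simple_process M F (k, u, \<xi>)" and t: "0 \<le> t"
  shows "integrable M (\<lambda>\<omega>. (simple_integral B (k, u, \<xi>) t \<omega>)\<^sup>2) \<and>
    expectation (\<lambda>\<omega>. (simple_integral B (k, u, \<xi>) t \<omega>)\<^sup>2) =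
      (\<Sum>i<k. expectation (\<lambda>\<omega>. (\<xi> i \<omega>)\<^sup>2) * (min (u (Suc i)) t - min (u i) t))"
  using assms(1)
proof (induction k)
  case 0
  then show ?case by simp
next
  case (Suc k)
  have S: "simple_process M F (k, u, \<xi>)" using Suc.prems by auto
  let ?N = "simple_integral B (k, u, \<xi>) t"
  let ?D = "\<lambda>\<omega>. B (min (u (Suc k)) t) \<omega> - B (min (u k) t) \<omega>"
  have N2: "integrable M (\<lambda>\<omega>. (?N \<omega>)\<^sup>2)" and EN: "expectation (\<lambda>\<omega>. (?N \<omega>)\<^sup>2) =
      (\<Sum>i<k. expectation (\<lambda>\<omega>. (\<xi> i \<omega>)\<^sup>2) * (min (u (Suc i)) t - min (u i) t))"
    using Suc.IH[OF S] by auto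
  have eq: "simple_integral B (Suc k, u, \<xi>) t \<omega> = ?N \<omega> + \<xi> k \<omega> * ?D \<omega>" for \<omega> by simp
  have u0: "0 \<le> u k" "u k < u (Suc k)" using simple_process_mono_on(2)[OF S, of k k] Suc.prems by auto
  have \<xi>F: "\<xi> k \<in> borel_measurable (F (u k))" using Suc.prems by auto
  have \<xi>M [measurable]: "\<xi> k \<in> borel_measurable M" using measurable_F_M[OF u0(1) \<xi>F] .
  obtain c where c: "\<And>\<omega>. \<omega> \<in> space M \<Longrightarrow> \<bar>\<xi> k \<omega>\<bar> \<le> c"
    using simple_process_bound[OF Suc.prems, of k] by blast
  show ?case
  proof (cases "u k < t")
    case False
    then have "?D \<omega> = 0" "min (u (Suc k)) t - min (u k) t = 0" for \<omega> using u0 by (auto simp: min_def)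
    then show ?thesis unfolding eq using N2 EN by simp
  next
    case True
    define b where "b = min (u (Suc k)) t"
    have ab: "u k < b" using True u0 by (auto simp: b_def)
    have D: "?D = (\<lambda>\<omega>. B b \<omega> - B (u k) \<omega>)" using True by (auto simp: b_def)
    note mom = increment_moments[OF u0(1) ab]
    have NF: "?N \<in> borel_measurable (F (u k))"
      using simple_process_mono_on(1)[OF S, of _ k]
      by (intro simple_integral_measurable_F[OF S t]) (auto simp: min_le_iff_disj)
    have [measurable]: "?N \<in> borel_measurable M" by (rule measurable_F_M[OF u0(1) NF])
    have Nint: "integrable M ?N"
      by (rule square_integrable_imp_integrable[OF _ N2]) measurable
    have N\<xi>: "integrable M (\<lambda>\<omega>. ?N \<omega> * \<xi> k \<omega>)"
    proof (rule Bochner_Integration.integrable_bound[of M "\<lambda>\<omega>. c * ?N \<omega>"])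
      show "AE \<omega> in M. norm (?N \<omega> * \<xi> k \<omega>) \<le> norm (c * ?N \<omega>)"
      proof (rule AE_I2)
        fix \<omega> assume "\<omega> \<in> space M"
        then have "\<bar>\<xi> k \<omega>\<bar> \<le> \<bar>c\<bar>" using c[of \<omega>] by linarith
        then show "norm (?N \<omega> * \<xi> k \<omega>) \<le> norm (c * ?N \<omega>)"
          unfolding real_norm_def abs_mult by (subst mult.commute) (rule mult_right_mono, auto)
      qed
      show "integrable M (\<lambda>\<omega>. c * ?N \<omega>)" using Nint by (rule integrable_mult_right)
      show "(\<lambda>\<omega>. ?N \<omega> * \<xi> k \<omega>) \<in> borel_measurable M" by measurable
    qed
    have \<xi>2: "integrable M (\<lambda>\<omega>. (\<xi> k \<omega>)\<^sup>2)"
    proof (rule integrable_const_bound[of _ "c\<^sup>2"])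
      show "AE \<omega> in M. norm ((\<xi> k \<omega>)\<^sup>2) \<le> c\<^sup>2"
        using c by (intro AE_I2) (metis abs_ge_zero norm_power power2_abs power_mono real_norm_def)
    qed measurable
    have ND: "(\<lambda>\<omega>. ?N \<omega> * \<xi> k \<omega>) \<in> borel_measurable (F (u k))" using NF \<xi>F by measurable
    have iv1: "indep_var borel (\<lambda>\<omega>. ?N \<omega> * \<xi> k \<omega>) borel (\<lambda>\<omega>. B b \<omega> - B (u k) \<omega>)"
      by (rule indep_increment[OF u0(1) ab ND])
    have i1: "integrable M (\<lambda>\<omega>. ?N \<omega> * \<xi> k \<omega> * (B b \<omega> - B (u k) \<omega>))"
      and e1: "expectation (\<lambda>\<omega>. ?N \<omega> * \<xi> k \<omega> * (B b \<omega> - B (u k) \<omega>)) = 0"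
      using indep_var_integrable[OF iv1 N\<xi> mom(1)] indep_var_lebesgue_integral[OF iv1 N\<xi> mom(1)] mom(2) by auto
    have "indep_var borel ((\<lambda>x. x\<^sup>2) \<circ> \<xi> k) borel ((\<lambda>x. x\<^sup>2) \<circ> (\<lambda>\<omega>. B b \<omega> - B (u k) \<omega>))"
      by (rule indep_var_compose[OF indep_increment[OF u0(1) ab \<xi>F]]) auto
    then have iv2: "indep_var borel (\<lambda>\<omega>. (\<xi> k \<omega>)\<^sup>2) borel (\<lambda>\<omega>. (B b \<omega> - B (u k) \<omega>)\<^sup>2)"
      by (simp add: comp_def)
    have i2: "integrable M (\<lambda>\<omega>. (\<xi> k \<omega>)\<^sup>2 * (B b \<omega> - B (u k) \<omega>)\<^sup>2)"
      and e2: "expectation (\<lambda>\<omega>. (\<xi> k \<omega>)\<^sup>2 * (B b \<omega> - B (u k) \<omega>)\<^sup>2) = expectation (\<lambda>\<omega>. (\<xi> k \<omega>)\<^sup>2) * (b - u k)"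
      using indep_var_integrable[OF iv2 \<xi>2 mom(3)] indep_var_lebesgue_integral[OF iv2 \<xi>2 mom(3)] mom(4) by auto
    have sq: "(simple_integral B (Suc k, u, \<xi>) t \<omega>)\<^sup>2 =
       (?N \<omega>)\<^sup>2 + 2 * (?N \<omega> * \<xi> k \<omega> * (B b \<omega> - B (u k) \<omega>)) + (\<xi> k \<omega>)\<^sup>2 * (B b \<omega> - B (u k) \<omega>)\<^sup>2" for \<omega>
      unfolding eq using fun_cong[OF D, of \<omega>] by (simp only:) (simp add: power2_eq_square algebra_simps)
    show ?thesis unfolding sq using N2 i1 i2 EN e1 e2 True
      by (simp add: b_def min_absorb1 less_imp_le del: simple_integral.simps)
  qed
qed

end

text \<open>The sum is stopped before its partial sums exceed \<open>R\<close>.\<close>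
lemma sum_until_exceeding_le:
  fixes x :: "nat \<Rightarrow> real"
  assumes "\<And>i. i < k \<Longrightarrow> 0 \<le> x i" "0 \<le> R"
  shows "(\<Sum>i<k. x i * of_bool ((\<Sum>l\<le>i. x l) \<le> R)) \<le> min R (\<Sum>i<k. x i)"
  using assms
proof (induction k)
  case (Suc k)
  have IH: "(\<Sum>i<k. x i * of_bool ((\<Sum>l\<le>i. x l) \<le> R)) \<le> min R (\<Sum>i<k. x i)" using Suc by auto
  have "x k \<ge> 0" using Suc.prems by auto
  moreover have "(\<Sum>l\<le>k. x l) = (\<Sum>l<k. x l) + x k" by (simp add: lessThan_Suc_atMost[symmetric])
  ultimately show ?case using IH by (cases "(\<Sum>l\<le>k. x l) \<le> R") (auto simp: min_def split: if_splits)
qed auto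

context brownian_motion
begin

text \<open>The indicator of a stochastic interval that starts at \<open>0\<close>: an event, known at time
  \<open>s\<close>, that can only cease to hold as \<open>s\<close> grows. The maximum \<open>max 0 s\<close>
  is taken because values at negative times are arbitrary.\<close>
definition localizer :: "(real \<Rightarrow> 'a \<Rightarrow> bool) \<Rightarrow> bool" where
  "localizer G \<longleftrightarrow> (\<forall>s\<ge>0. {\<omega>\<in>space M. G s \<omega>} \<in> sets (F s)) \<and>
     (\<forall>\<omega>\<in>space M. \<forall>r s. 0 \<le> r \<longrightarrow> r \<le> s \<longrightarrow> G s \<omega> \<longrightarrow> G r \<omega>) \<and>
     (\<lambda>(s, \<omega>). of_bool (G (max 0 s) \<omega>) :: real) \<in> borel_measurable (borel \<Otimes>\<^sub>M M)"

lemma localizer_measurable_F: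
  assumes "localizer G" "0 \<le> r" "r \<le> s"
  shows "(\<lambda>\<omega>. of_bool (G r \<omega>) :: real) \<in> borel_measurable (F s)"
proof -
  have "{\<omega>\<in>space M. G r \<omega>} \<in> sets (F s)" using assms mono_F[of r s] by (auto simp: localizer_def)
  then have "(indicator {\<omega>\<in>space M. G r \<omega>} :: 'a \<Rightarrow> real) \<in> borel_measurable (F s)" by simp
  then show ?thesis by (subst measurable_cong[of _ _ "indicator {\<omega>\<in>space M. G r \<omega>}"]) (use assms in \<open>auto simp: space_F indicator_def\<close>)
qed

lemma localizer_measurable:
  assumes "localizer G" "0 \<le> r"
  shows "(\<lambda>\<omega>. of_bool (G r \<omega>) :: real) \<in> borel_measurable M"
  using localizer_measurable_F[OF assms order_refl] measurable_F_M[OF assms(2)] by blast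

text \<open>A coefficient is replaced by \<open>0\<close> as soon as \<open>G\<close> fails at the left
  endpoint or the quadratic variation accumulated so far exceeds \<open>R\<close>. Both conditions are known
  at the left endpoint, so that the isometry applies to the new process, and on the event in question the two
  integrals agree. The level \<open>R\<close> makes the right-hand side bounded.\<close>
lemma localized_simple_isometry:
  fixes R t :: real
  assumes S: "simple_process M F (k, u, \<xi>)" and t: "0 \<le> t" and G: "localizer G" and R: "0 \<le> R"
  defines "Q \<equiv> \<lambda>\<omega>. \<Sum>i<k. (\<xi> i \<omega>)\<^sup>2 * of_bool (G (u i) \<omega>) * (min (u (Suc i)) t - min (u i) t)"
  shows "(\<integral>\<^sup>+\<omega>. ennreal ((simple_integral B (k, u, \<xi>) t \<omega>)\<^sup>2 * of_bool (G t \<omega> \<and> Q \<omega> \<le> R)) \<partial>M) \<le> (\<integral>\<^sup>+\<omega>. ennreal (min R (Q \<omega>)) \<partial>M)"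
    "Q \<in> borel_measurable M"
proof -
  define d where "d = (\<lambda>i. min (u (Suc i)) t - min (u i) t)"
  define x where "x = (\<lambda>\<omega> i. (\<xi> i \<omega>)\<^sup>2 * of_bool (G (u i) \<omega>) * d i)"
  (* the summand l = i belongs to the interval that starts at u i, but is already known there *)
  define A where "A = (\<lambda>i \<omega>. G (u i) \<omega> \<and> (\<Sum>l\<le>i. x \<omega> l) \<le> R)"
  define \<zeta> where "\<zeta> = (\<lambda>i \<omega>. \<xi> i \<omega> * of_bool (A i \<omega>))"
  have d0: "0 \<le> d i" if "i < k" for i using S that by (auto simp: d_def intro!: min.mono less_imp_le)
  have u0: "0 \<le> u i" if "i \<le> k" for i using simple_process_mono_on(2)[OF S, of i i] that by auto
  have xF: "(\<lambda>\<omega>. x \<omega> l) \<in> borel_measurable (F (u i))" if "l \<le> i" "i < k" for l i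
  proof -
    have "u l \<le> u i" using simple_process_mono_on(1)[OF S, of l i] that by auto
    moreover have "\<xi> l \<in> borel_measurable (F (u l))" using S that by auto
    ultimately have "\<xi> l \<in> borel_measurable (F (u i))" "(\<lambda>\<omega>. of_bool (G (u l) \<omega>) :: real) \<in> borel_measurable (F (u i))"
      using u0[of l] that by (auto intro: measurable_F_mono[of "u l"] localizer_measurable_F[OF G])
    then show ?thesis unfolding x_def by measurable
  qed
  have Q: "Q \<omega> = (\<Sum>i<k. x \<omega> i)" for \<omega> by (simp add: Q_def x_def d_def)
  have xM: "(\<lambda>\<omega>. x \<omega> i) \<in> borel_measurable M" if "i < k" for i
    using xF[of i i] that u0[of i] measurable_F_M[of "u i"] by auto
  show QM: "Q \<in> borel_measurable M"
    unfolding Q using xM by (intro borel_measurable_sum) auto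
  have \<zeta>: "simple_process M F (k, u, \<zeta>)"
    unfolding simple_process.simps
  proof (intro conjI allI impI)
    show "0 \<le> u 0" using S by auto
    fix i assume i: "i < k"
    show "u i < u (Suc i)" using S i by auto
    have 1: "(\<lambda>\<omega>. \<Sum>l\<le>i. x \<omega> l) \<in> borel_measurable (F (u i))" using xF i by (intro borel_measurable_sum) auto
    have 2: "(\<lambda>\<omega>. of_bool (G (u i) \<omega>) :: real) \<in> borel_measurable (F (u i))"
      using localizer_measurable_F[OF G] u0[of i] i by auto
    have 3: "\<xi> i \<in> borel_measurable (F (u i))" using S i by auto
    have "(\<lambda>\<omega>. \<xi> i \<omega> * (of_bool (G (u i) \<omega>) * (if (\<Sum>l\<le>i. x \<omega> l) \<le> R then 1 else 0))) \<in> borel_measurable (F (u i))"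
      using 1 2 3 by measurable
    also have "(\<lambda>\<omega>. \<xi> i \<omega> * (of_bool (G (u i) \<omega>) * (if (\<Sum>l\<le>i. x \<omega> l) \<le> R then 1 else 0))) = \<zeta> i"
      by (auto simp: \<zeta>_def A_def)
    finally show "\<zeta> i \<in> borel_measurable (F (u i))" .
    obtain c where "\<And>\<omega>. \<omega> \<in> space M \<Longrightarrow> \<bar>\<xi> i \<omega>\<bar> \<le> c"
      using simple_process_bound[OF S i] by blast
    then have "\<bar>\<zeta> i \<omega>\<bar> \<le> c" if "\<omega> \<in> space M" for \<omega>
      using that abs_ge_zero[of "\<xi> i \<omega>"] by (fastforce simp: \<zeta>_def)
    then show "\<exists>c. \<forall>\<omega>\<in>space M. \<bar>\<zeta> i \<omega>\<bar> \<le> c" by blast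
  qed
  have \<zeta>int: "integrable M (\<lambda>\<omega>. (\<zeta> i \<omega>)\<^sup>2)" if i: "i < k" for i
  proof -
    obtain c where c: "\<And>\<omega>. \<omega> \<in> space M \<Longrightarrow> \<bar>\<zeta> i \<omega>\<bar> \<le> c"
      using simple_process_bound[OF \<zeta> i] by blast
    have [measurable]: "\<zeta> i \<in> borel_measurable M"
      using \<zeta> i measurable_F_M[OF u0[of i], of "\<zeta> i" borel] by auto
    show ?thesis
    proof (rule integrable_const_bound[of _ "c\<^sup>2"])
      show "AE \<omega> in M. norm ((\<zeta> i \<omega>)\<^sup>2) \<le> c\<^sup>2"
        using c by (intro AE_I2) (metis abs_ge_zero norm_power power2_abs power_mono real_norm_def)
    qed measurable
  qed
  note iso = simple_integral_isometry[OF \<zeta> t]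
  have "(\<integral>\<^sup>+\<omega>. ennreal ((simple_integral B (k, u, \<xi>) t \<omega>)\<^sup>2 * of_bool (G t \<omega> \<and> Q \<omega> \<le> R)) \<partial>M)
      \<le> (\<integral>\<^sup>+\<omega>. ennreal ((simple_integral B (k, u, \<zeta>) t \<omega>)\<^sup>2) \<partial>M)"
  proof (rule nn_integral_mono)
    fix \<omega> assume \<omega>: "\<omega> \<in> space M"
    show "ennreal ((simple_integral B (k, u, \<xi>) t \<omega>)\<^sup>2 * of_bool (G t \<omega> \<and> Q \<omega> \<le> R)) \<le> ennreal ((simple_integral B (k, u, \<zeta>) t \<omega>)\<^sup>2)"
    proof (cases "G t \<omega> \<and> Q \<omega> \<le> R")
      case True
      have "simple_integral B (k, u, \<xi>) t \<omega> = simple_integral B (k, u, \<zeta>) t \<omega>"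
        unfolding simple_integral.simps
      proof (intro sum.cong refl)
        fix i assume i: "i \<in> {..<k}"
        show "\<xi> i \<omega> * (B (min (u (Suc i)) t) \<omega> - B (min (u i) t) \<omega>) = \<zeta> i \<omega> * (B (min (u (Suc i)) t) \<omega> - B (min (u i) t) \<omega>)"
        proof (cases "u i < t")
          case ut: True
          have "G (u i) \<omega>" using G True \<omega> u0[of i] i ut unfolding localizer_def
            by (metis less_imp_le lessThan_iff)
          moreover have "(\<Sum>l\<le>i. x \<omega> l) \<le> Q \<omega>" unfolding Q
            using i d0 by (intro sum_mono2) (auto simp: x_def)
          ultimately show ?thesis using True by (simp add: \<zeta>_def A_def)
        next
          case False
          moreover have "u i < u (Suc i)" using S i by auto
          ultimately show ?thesis by (simp add: min_def)
        qed
      qed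
      then show ?thesis using True by simp
    next
      case False
      then show ?thesis by (simp only: of_bool_eq mult_zero_right ennreal_0 zero_le)
    qed
  qed
  also have "\<dots> = ennreal (\<Sum>i<k. expectation (\<lambda>\<omega>. (\<zeta> i \<omega>)\<^sup>2) * d i)"
    using iso by (subst nn_integral_eq_integral) (auto simp: d_def)
  also have "(\<Sum>i<k. expectation (\<lambda>\<omega>. (\<zeta> i \<omega>)\<^sup>2) * d i) = expectation (\<lambda>\<omega>. \<Sum>i<k. (\<zeta> i \<omega>)\<^sup>2 * d i)"
    using \<zeta>int by simp
  also have "ennreal \<dots> = (\<integral>\<^sup>+\<omega>. ennreal (\<Sum>i<k. (\<zeta> i \<omega>)\<^sup>2 * d i) \<partial>M)"
    using \<zeta>int d0 by (intro nn_integral_eq_integral[symmetric] AE_I2 sum_nonneg) auto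
  also have "\<dots> \<le> (\<integral>\<^sup>+\<omega>. ennreal (min R (Q \<omega>)) \<partial>M)"
  proof (intro nn_integral_mono ennreal_leI)
    fix \<omega>
    have "(\<Sum>i<k. (\<zeta> i \<omega>)\<^sup>2 * d i) = (\<Sum>i<k. x \<omega> i * of_bool ((\<Sum>l\<le>i. x \<omega> l) \<le> R))"
      by (intro sum.cong refl) (auto simp: \<zeta>_def A_def x_def)
    also have "\<dots> \<le> min R (Q \<omega>)"
      unfolding Q using d0 R by (intro sum_until_exceeding_le) (auto simp: x_def)
    finally show "(\<Sum>i<k. (\<zeta> i \<omega>)\<^sup>2 * d i) \<le> min R (Q \<omega>)" .
  qed
  finally show "(\<integral>\<^sup>+\<omega>. ennreal ((simple_integral B (k, u, \<xi>) t \<omega>)\<^sup>2 * of_bool (G t \<omega> \<and> Q \<omega> \<le> R)) \<partial>M) \<le> (\<integral>\<^sup>+\<omega>. ennreal (min R (Q \<omega>)) \<partial>M)" .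
qed

end

text \<open>Sampling a decreasing indicator at left instead of right endpoints changes the sum by a
  telescoping term, which is at most \<open>c\<^sup>2\<close> times the mesh. The sum over right endpoints
  lies below the integral, again because the indicator decreases.\<close>
lemma grid_square_sum_le:
  assumes S: "simple_process M F (k, u, \<xi>)" and t: "0 \<le> t" and \<omega>: "\<omega> \<in> space M"
    and anti: "\<And>r s. 0 \<le> r \<Longrightarrow> r \<le> s \<Longrightarrow> g s \<Longrightarrow> g r"
    and c: "\<And>s. \<bar>simple_value (k, u, \<xi>) s \<omega>\<bar> \<le> c"
    and mesh: "\<And>j. j < k \<Longrightarrow> min (u (Suc j)) t - min (u j) t \<le> \<delta>" and \<delta>: "0 \<le> \<delta>"
  shows "ennreal (\<Sum>i<k. (\<xi> i \<omega>)\<^sup>2 * of_bool (g (u i)) * (min (u (Suc i)) t - min (u i) t))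
    \<le> (\<integral>\<^sup>+s\<in>{0..t}. ennreal ((simple_value (k, u, \<xi>) s \<omega>)\<^sup>2 * of_bool (g s)) \<partial>lborel) + ennreal (c\<^sup>2 * \<delta>)"
proof -
  define d where "d = (\<lambda>i. min (u (Suc i)) t - min (u i) t)"
  have less: "u i < u (Suc i)" if "i < k" for i using S that by auto
  have u0: "0 \<le> u i" if "i \<le> k" for i using simple_process_mono_on(2)[OF S, of i i] that by auto
  have d0: "0 \<le> d i" if "i < k" for i using less[OF that] by (auto simp: d_def intro!: min.mono)
  have \<xi>c: "(\<xi> i \<omega>)\<^sup>2 \<le> c\<^sup>2" if "i < k" for i
    using simple_value_node[OF S that, of "u (Suc i)" \<omega>] less[OF that] c[of "u (Suc i)"]
    by (metis abs_ge_zero order_refl power2_abs power_mono)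
  have tele: "(\<Sum>i<m. of_bool (g (u i)) - of_bool (g (u (Suc i)))) \<le> (1::real)" for m
    using sum_lessThan_telescope'[of "\<lambda>i. of_bool (g (u i)) :: real" m] by simp
  have gd: "of_bool (g (u (Suc i))) \<le> (of_bool (g (u i)) :: real)" if "i < k" for i
    using anti[of "u i" "u (Suc i)"] less[OF that] u0[of i] that by auto
  have "(\<Sum>i<k. (\<xi> i \<omega>)\<^sup>2 * of_bool (g (u i)) * d i) - (\<Sum>i<k. (\<xi> i \<omega>)\<^sup>2 * of_bool (g (u (Suc i))) * d i)
     = (\<Sum>i<k. (\<xi> i \<omega>)\<^sup>2 * (of_bool (g (u i)) - of_bool (g (u (Suc i)))) * d i)"
    by (simp add: sum_subtractf[symmetric] algebra_simps)
  also have "\<dots> \<le> (\<Sum>i<k. c\<^sup>2 * (of_bool (g (u i)) - of_bool (g (u (Suc i)))) * \<delta>)"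
    using gd \<xi>c mesh d0 \<delta> by (intro sum_mono mult_mono) (auto simp: d_def)
  also have "\<dots> = c\<^sup>2 * \<delta> * (\<Sum>i<k. of_bool (g (u i)) - of_bool (g (u (Suc i))))"
    by (simp add: sum_distrib_left algebra_simps)
  also have "\<dots> \<le> c\<^sup>2 * \<delta> * 1" using \<delta> by (intro mult_left_mono tele) auto
  finally have 1: "(\<Sum>i<k. (\<xi> i \<omega>)\<^sup>2 * of_bool (g (u i)) * d i) \<le> (\<Sum>i<k. (\<xi> i \<omega>)\<^sup>2 * of_bool (g (u (Suc i))) * d i) + c\<^sup>2 * \<delta>"
    by simp
  have em: "emeasure lborel ({u i<..u (Suc i)} \<inter> {0..t}) = ennreal (d i)" if "i < k" for i
  proof -
    have "{u i<..u (Suc i)} \<inter> {0..t} = {min (u i) t<..min (u (Suc i)) t}"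
      using u0[of i] less[OF that] that t by (auto simp: min_def)
    then show ?thesis using less[OF that] by (simp add: d_def min.mono less_imp_le)
  qed
  have "ennreal (\<Sum>i<k. (\<xi> i \<omega>)\<^sup>2 * of_bool (g (u (Suc i))) * d i) =
     (\<Sum>i<k. ennreal ((\<xi> i \<omega>)\<^sup>2 * of_bool (g (u (Suc i)))) * emeasure lborel ({u i<..u (Suc i)} \<inter> {0..t}))"
    using d0 by (subst sum_ennreal[symmetric]) (auto simp: em ennreal_mult)
  also have "\<dots> = (\<integral>\<^sup>+s. (\<Sum>i<k. ennreal ((\<xi> i \<omega>)\<^sup>2 * of_bool (g (u (Suc i)))) * indicator ({u i<..u (Suc i)} \<inter> {0..t}) s) \<partial>lborel)"
    by (subst nn_integral_sum) (auto simp: nn_integral_cmult_indicator)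
  also have "\<dots> \<le> (\<integral>\<^sup>+s\<in>{0..t}. ennreal ((simple_value (k, u, \<xi>) s \<omega>)\<^sup>2 * of_bool (g s)) \<partial>lborel)"
  proof (rule nn_integral_mono)
    fix s
    show "(\<Sum>i<k. ennreal ((\<xi> i \<omega>)\<^sup>2 * of_bool (g (u (Suc i)))) * indicator ({u i<..u (Suc i)} \<inter> {0..t}) s)
      \<le> ennreal ((simple_value (k, u, \<xi>) s \<omega>)\<^sup>2 * of_bool (g s)) * indicator {0..t} s"
    proof (cases "\<exists>i<k. u i < s \<and> s \<le> u (Suc i)")
      case True
      then obtain i where i: "i < k" "u i < s" "s \<le> u (Suc i)" by blast
      have "(\<Sum>j<k. ennreal ((\<xi> j \<omega>)\<^sup>2 * of_bool (g (u (Suc j)))) * indicator ({u j<..u (Suc j)} \<inter> {0..t}) s)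
        = (\<Sum>j<k. if j = i then ennreal ((\<xi> j \<omega>)\<^sup>2 * of_bool (g (u (Suc j)))) * indicator {0..t} s else 0)"
      proof (intro sum.cong refl)
        fix j assume j: "j \<in> {..<k}"
        have "s \<notin> {u j<..u (Suc j)}" if "j \<noteq> i"
        proof (cases "j < i")
          case True
          then have "u (Suc j) \<le> u i" using simple_process_mono_on(1)[OF S, of "Suc j" i] i by auto
          then show ?thesis using i by auto
        next
          case False
          then have "u (Suc i) \<le> u j" using that simple_process_mono_on(1)[OF S, of "Suc i" j] j by auto
          then show ?thesis using i by auto
        qed
        then show "ennreal ((\<xi> j \<omega>)\<^sup>2 * of_bool (g (u (Suc j)))) * indicator ({u j<..u (Suc j)} \<inter> {0..t}) s =
          (if j = i then ennreal ((\<xi> j \<omega>)\<^sup>2 * of_bool (g (u (Suc j)))) * indicator {0..t} s else 0)"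
          using i by (auto simp: indicator_def)
      qed
      also have "\<dots> = ennreal ((\<xi> i \<omega>)\<^sup>2 * of_bool (g (u (Suc i)))) * indicator {0..t} s" using i by simp
      also have "\<dots> \<le> ennreal ((simple_value (k, u, \<xi>) s \<omega>)\<^sup>2 * of_bool (g s)) * indicator {0..t} s"
      proof (intro mult_right_mono ennreal_leI)
        have "g (u (Suc i)) \<Longrightarrow> g s" using anti[of s "u (Suc i)"] i u0[of i] by auto
        then show "(\<xi> i \<omega>)\<^sup>2 * of_bool (g (u (Suc i))) \<le> (simple_value (k, u, \<xi>) s \<omega>)\<^sup>2 * of_bool (g s)"
          unfolding simple_value_node[OF S i] by (intro mult_left_mono) auto
      qed auto
      finally show ?thesis .
    next
      case False
      then have "(\<Sum>i<k. ennreal ((\<xi> i \<omega>)\<^sup>2 * of_bool (g (u (Suc i)))) * indicator ({u i<..u (Suc i)} \<inter> {0..t}) s) = 0"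
        by (intro sum.neutral) (auto simp: indicator_def)
      then show ?thesis by simp
    qed
  qed
  finally have 2: "ennreal (\<Sum>i<k. (\<xi> i \<omega>)\<^sup>2 * of_bool (g (u (Suc i))) * d i) \<le> (\<integral>\<^sup>+s\<in>{0..t}. ennreal ((simple_value (k, u, \<xi>) s \<omega>)\<^sup>2 * of_bool (g s)) \<partial>lborel)" .
  have "ennreal (\<Sum>i<k. (\<xi> i \<omega>)\<^sup>2 * of_bool (g (u i)) * d i) \<le> ennreal ((\<Sum>i<k. (\<xi> i \<omega>)\<^sup>2 * of_bool (g (u (Suc i))) * d i) + c\<^sup>2 * \<delta>)"
    by (rule ennreal_leI[OF 1])
  also have "\<dots> = ennreal (\<Sum>i<k. (\<xi> i \<omega>)\<^sup>2 * of_bool (g (u (Suc i))) * d i) + ennreal (c\<^sup>2 * \<delta>)"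
    using d0 \<delta> by (intro ennreal_plus sum_nonneg) auto
  finally show ?thesis using add_right_mono[OF 2, of "ennreal (c\<^sup>2 * \<delta>)"] unfolding d_def by (rule order_trans)
qed

lemma square_add_le:
  fixes x y \<eta> :: real
  assumes "\<eta> > 0"
  shows "(x + y)\<^sup>2 \<le> (1 + \<eta>) * x\<^sup>2 + (1 + 1 / \<eta>) * y\<^sup>2"
proof -
  have "0 \<le> (sqrt \<eta> * x - y / sqrt \<eta>)\<^sup>2" by simp
  also have "\<dots> = \<eta> * x\<^sup>2 + y\<^sup>2 / \<eta> - 2 * x * y" using assms
    by (simp add: power2_diff power_mult_distrib power_divide)
  finally show ?thesis by (simp add: power2_sum algebra_simps)
qed

context brownian_motion
begin

text \<open>Outside the event that the approximation error \<open>e\<close> exceeds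
  \<open>\<eta>\<^sup>2/4\<close>, the quadratic variation \<open>Q\<close> of \<open>S - h\<close> along a
  fine grid satisfies \<open>Q \<le> (1 + \<eta>) a + \<eta> \<le> R + 1\<close>. Hence stopping at level
  \<open>R + 1\<close> in \<open>localized_simple_isometry\<close> has no effect there, while on the
  exceptional event the level bounds the contribution to the right-hand side.\<close>
lemma localized_bound_of_approximation:
  fixes R t \<eta> :: real
  assumes Hm: "(\<lambda>(s, \<omega>). H (max 0 (min s t)) \<omega>) \<in> borel_measurable (borel \<Otimes>\<^sub>M M)" and t: "0 \<le> t"
    and S: "simple_process M F S" and h: "simple_process M F h" and G: "localizer G"
    and R: "0 \<le> R" "\<And>\<omega>. \<omega> \<in> space M \<Longrightarrow> (\<integral>\<^sup>+s\<in>{0..t}. ennreal ((H s \<omega> - simple_value h s \<omega>)\<^sup>2 * of_bool (G s \<omega>)) \<partial>lborel) \<le> ennreal R"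
    and \<eta>: "0 < \<eta>" "\<eta> * (R + 1) \<le> 1"
  defines "a \<equiv> \<lambda>\<omega>. \<integral>\<^sup>+s\<in>{0..t}. ennreal ((H s \<omega> - simple_value h s \<omega>)\<^sup>2 * of_bool (G s \<omega>)) \<partial>lborel"
    and "e \<equiv> \<lambda>\<omega>. \<integral>\<^sup>+s\<in>{0..t}. ennreal ((H s \<omega> - simple_value S s \<omega>)\<^sup>2) \<partial>lborel"
  shows "a \<in> borel_measurable M" "e \<in> borel_measurable M"
    "(\<integral>\<^sup>+\<omega>. ennreal ((simple_integral B S t \<omega> - simple_integral B h t \<omega>)\<^sup>2) * of_bool (G t \<omega> \<and> e \<omega> \<le> ennreal (\<eta>\<^sup>2 / 4)) \<partial>M)
      \<le> ennreal (1 + \<eta>) * (\<integral>\<^sup>+\<omega>. a \<omega> \<partial>M) + ennreal \<eta> + ennreal (R + 1) * emeasure M {\<omega>\<in>space M. ennreal (\<eta>\<^sup>2 / 4) < e \<omega>}"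
proof -
  note [measurable] = Hm simple_value_measurable_pair[OF S] simple_value_measurable_pair[OF h]
  have Gm [measurable]: "(\<lambda>(s, \<omega>). of_bool (G (max 0 s) \<omega>) :: real) \<in> borel_measurable (borel \<Otimes>\<^sub>M M)"
    using G by (simp add: localizer_def)
  have a_eq: "a \<omega> = (\<integral>\<^sup>+s. ennreal ((H (max 0 (min s t)) \<omega> - simple_value h s \<omega>)\<^sup>2 * of_bool (G (max 0 s) \<omega>)) * indicator {0..t} s \<partial>lborel)" for \<omega>
    unfolding a_def by (intro nn_integral_cong) (auto simp: indicator_def max_def min_def)
  have e_eq: "e \<omega> = (\<integral>\<^sup>+s. ennreal ((H (max 0 (min s t)) \<omega> - simple_value S s \<omega>)\<^sup>2) * indicator {0..t} s \<partial>lborel)" for \<omega>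
    unfolding e_def by (intro nn_integral_cong) (auto simp: indicator_def max_def min_def)
  show am [measurable]: "a \<in> borel_measurable M" unfolding a_eq by measurable
  show em [measurable]: "e \<in> borel_measurable M" unfolding e_eq by measurable
  have "\<exists>c\<ge>0. \<forall>s. \<forall>\<omega>\<in>space M. \<bar>simple_value S s \<omega> - simple_value h s \<omega>\<bar> \<le> c"
  proof -
    obtain c1 where c1: "c1 \<ge> 0" "\<forall>s. \<forall>\<omega>\<in>space M. \<bar>simple_value S s \<omega>\<bar> \<le> c1"
      using simple_value_bounded[OF S] by (elim exE conjE)
    obtain c2 where c2: "c2 \<ge> 0" "\<forall>s. \<forall>\<omega>\<in>space M. \<bar>simple_value h s \<omega>\<bar> \<le> c2"
      using simple_value_bounded[OF h] by (elim exE conjE)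
    have "\<bar>simple_value S s \<omega> - simple_value h s \<omega>\<bar> \<le> c1 + c2" if "\<omega> \<in> space M" for s \<omega>
      using c1(2)[rule_format, OF that, of s] c2(2)[rule_format, OF that, of s] by linarith
    then show ?thesis using c1(1) c2(1) by (intro exI[of _ "c1 + c2"]) auto
  qed
  then obtain c where c: "c \<ge> 0" "\<forall>s. \<forall>\<omega>\<in>space M. \<bar>simple_value S s \<omega> - simple_value h s \<omega>\<bar> \<le> c" by (elim exE conjE)
  (* the mesh for which the sampling error c^2 \<delta> is at most \<eta> / 2 *)
  define \<delta> where "\<delta> = \<eta> / (2 * (c\<^sup>2 + 1))"
  have c1: "0 < 2 * (c\<^sup>2 + 1)" by (simp add: add_nonneg_pos)
  have \<delta>: "\<delta> > 0" unfolding \<delta>_def using \<eta>(1) c1 by (rule divide_pos_pos)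
  have c\<delta>: "c\<^sup>2 * \<delta> \<le> \<eta> / 2"
  proof -
    have "(c\<^sup>2 + 1) * \<delta> = \<eta> / 2" unfolding \<delta>_def using c1 by (simp add: field_simps)
    then show ?thesis using \<delta> by (simp add: algebra_simps)
  qed
  obtain l v \<zeta> where z: "simple_process M F (l, v, \<zeta>)"
    "\<And>s \<omega>. simple_value (l, v, \<zeta>) s \<omega> = simple_value S s \<omega> - simple_value h s \<omega>"
    "\<And>r \<omega>. simple_integral B (l, v, \<zeta>) r \<omega> = simple_integral B S r \<omega> - simple_integral B h r \<omega>"
    "\<And>j. j < l \<Longrightarrow> min (v (Suc j)) t - min (v j) t \<le> \<delta>"
    by (rule simple_process_diff[OF S h \<delta>, of B t]) (rule that)
  define Q where "Q = (\<lambda>\<omega>. \<Sum>i<l. (\<zeta> i \<omega>)\<^sup>2 * of_bool (G (v i) \<omega>) * (min (v (Suc i)) t - min (v i) t))"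
  have R1: "0 \<le> R + 1" using R by simp
  note L = localized_simple_isometry[OF z(1) t G R1]
  (* Young's inequality multiplies the approximation error by 1 + 1 / \<eta>, which the tolerance \<eta>^2 / 4 compensates *)
  have \<epsilon>: "(1 + 1 / \<eta>) * (\<eta>\<^sup>2 / 4) \<le> \<eta> / 2"
  proof -
    have "\<eta> * 1 \<le> \<eta> * (R + 1)" using \<eta> R by (intro mult_left_mono) auto
    then have "\<eta> \<le> 1" using \<eta>(2) by linarith
    then have "\<eta> * \<eta> \<le> \<eta>" using \<eta> by (simp add: mult_left_le)
    then show ?thesis using \<eta>(1) by (simp add: field_simps power2_eq_square)
  qed
  have Q_le: "ennreal (Q \<omega>) \<le> ennreal (1 + \<eta>) * a \<omega> + ennreal \<eta>" if \<omega>: "\<omega> \<in> space M" and e\<omega>: "e \<omega> \<le> ennreal (\<eta>\<^sup>2 / 4)" for \<omega>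
  proof -
    have "ennreal (Q \<omega>) \<le> (\<integral>\<^sup>+s\<in>{0..t}. ennreal ((simple_value (l, v, \<zeta>) s \<omega>)\<^sup>2 * of_bool (G s \<omega>)) \<partial>lborel) + ennreal (c\<^sup>2 * \<delta>)"
      unfolding Q_def
    proof (rule grid_square_sum_le[OF z(1) t \<omega>])
      show "\<And>r s. 0 \<le> r \<Longrightarrow> r \<le> s \<Longrightarrow> G s \<omega> \<Longrightarrow> G r \<omega>" using G \<omega> unfolding localizer_def by blast
      show "\<bar>simple_value (l, v, \<zeta>) s \<omega>\<bar> \<le> c" for s unfolding z(2) using c \<omega> by auto
    qed (use z(4) \<delta> in auto)
    also have "(\<integral>\<^sup>+s\<in>{0..t}. ennreal ((simple_value (l, v, \<zeta>) s \<omega>)\<^sup>2 * of_bool (G s \<omega>)) \<partial>lborel)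
      \<le> (\<integral>\<^sup>+s. ennreal (1 + \<eta>) * (ennreal ((H (max 0 (min s t)) \<omega> - simple_value h s \<omega>)\<^sup>2 * of_bool (G (max 0 s) \<omega>)) * indicator {0..t} s)
          + ennreal (1 + 1 / \<eta>) * (ennreal ((H (max 0 (min s t)) \<omega> - simple_value S s \<omega>)\<^sup>2) * indicator {0..t} s) \<partial>lborel)"
    proof (rule nn_integral_mono)
      fix s
      have "(simple_value S s \<omega> - simple_value h s \<omega>)\<^sup>2 \<le> (1 + \<eta>) * (H s \<omega> - simple_value h s \<omega>)\<^sup>2 + (1 + 1 / \<eta>) * (H s \<omega> - simple_value S s \<omega>)\<^sup>2"
        using square_add_le[OF \<eta>(1), of "H s \<omega> - simple_value h s \<omega>" "simple_value S s \<omega> - H s \<omega>"] by (simp add: power2_commute)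
      then have "ennreal ((simple_value S s \<omega> - simple_value h s \<omega>)\<^sup>2) \<le> ennreal (1 + \<eta>) * ennreal ((H s \<omega> - simple_value h s \<omega>)\<^sup>2) + ennreal (1 + 1 / \<eta>) * ennreal ((H s \<omega> - simple_value S s \<omega>)\<^sup>2)"
        using \<eta> by (simp add: ennreal_mult[symmetric] ennreal_plus[symmetric] del: ennreal_plus)
      then show "ennreal ((simple_value (l, v, \<zeta>) s \<omega>)\<^sup>2 * of_bool (G s \<omega>)) * indicator {0..t} s
        \<le> ennreal (1 + \<eta>) * (ennreal ((H (max 0 (min s t)) \<omega> - simple_value h s \<omega>)\<^sup>2 * of_bool (G (max 0 s) \<omega>)) * indicator {0..t} s)
          + ennreal (1 + 1 / \<eta>) * (ennreal ((H (max 0 (min s t)) \<omega> - simple_value S s \<omega>)\<^sup>2) * indicator {0..t} s)"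
        by (auto simp: z(2) indicator_def max_def min_def simp del: simple_value.simps)
    qed
    also have "\<dots> = ennreal (1 + \<eta>) * a \<omega> + ennreal (1 + 1 / \<eta>) * e \<omega>"
      unfolding a_eq e_eq using \<omega>
      by (subst nn_integral_add) (auto simp: nn_integral_cmult)
    also have "\<dots> \<le> ennreal (1 + \<eta>) * a \<omega> + ennreal (\<eta> / 2)"
    proof (rule add_left_mono)
      have "ennreal (1 + 1 / \<eta>) * e \<omega> \<le> ennreal (1 + 1 / \<eta>) * ennreal (\<eta>\<^sup>2 / 4)" by (intro mult_left_mono e\<omega>) auto
      also have "\<dots> \<le> ennreal (\<eta> / 2)" using \<epsilon> \<eta> by (subst ennreal_mult[symmetric]) (auto intro: ennreal_leI)
      finally show "ennreal (1 + 1 / \<eta>) * e \<omega> \<le> ennreal (\<eta> / 2)" .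
    qed
    finally have "ennreal (Q \<omega>) \<le> ennreal (1 + \<eta>) * a \<omega> + ennreal (\<eta> / 2) + ennreal (c\<^sup>2 * \<delta>)"
      by (simp add: add_right_mono)
    also have "\<dots> \<le> ennreal (1 + \<eta>) * a \<omega> + ennreal (\<eta> / 2) + ennreal (\<eta> / 2)"
      by (intro add_left_mono ennreal_leI c\<delta>)
    also have "\<dots> = ennreal (1 + \<eta>) * a \<omega> + ennreal \<eta>"
      using \<eta>(1) by (simp add: add.assoc flip: ennreal_plus)
    finally show ?thesis .
  qed
  have "(\<integral>\<^sup>+\<omega>. ennreal ((simple_integral B S t \<omega> - simple_integral B h t \<omega>)\<^sup>2) * of_bool (G t \<omega> \<and> e \<omega> \<le> ennreal (\<eta>\<^sup>2 / 4)) \<partial>M)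
     \<le> (\<integral>\<^sup>+\<omega>. ennreal ((simple_integral B (l, v, \<zeta>) t \<omega>)\<^sup>2 * of_bool (G t \<omega> \<and> Q \<omega> \<le> R + 1)) \<partial>M)"
  proof (rule nn_integral_mono)
    fix \<omega> assume \<omega>: "\<omega> \<in> space M"
    have "Q \<omega> \<le> R + 1" if "e \<omega> \<le> ennreal (\<eta>\<^sup>2 / 4)"
    proof -
      have "ennreal (Q \<omega>) \<le> ennreal (1 + \<eta>) * ennreal R + ennreal \<eta>"
      proof (rule order_trans[OF Q_le[OF \<omega> that]])
        have "a \<omega> \<le> ennreal R" unfolding a_def by (rule R(2)[OF \<omega>])
        then show "ennreal (1 + \<eta>) * a \<omega> + ennreal \<eta> \<le> ennreal (1 + \<eta>) * ennreal R + ennreal \<eta>"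
          by (intro add_right_mono mult_left_mono) simp_all
      qed
      also have "\<dots> = ennreal ((1 + \<eta>) * R + \<eta>)" using \<eta> R by (simp add: ennreal_mult ennreal_plus)
      also have "\<dots> \<le> ennreal (R + 1)" using \<eta> by (intro ennreal_leI) (simp add: algebra_simps)
      finally have "ennreal (Q \<omega>) \<le> ennreal (R + 1)" .
      then show ?thesis unfolding ennreal_le_iff[OF R1] .
    qed
    then show "ennreal ((simple_integral B S t \<omega> - simple_integral B h t \<omega>)\<^sup>2) * of_bool (G t \<omega> \<and> e \<omega> \<le> ennreal (\<eta>\<^sup>2 / 4))
      \<le> ennreal ((simple_integral B (l, v, \<zeta>) t \<omega>)\<^sup>2 * of_bool (G t \<omega> \<and> Q \<omega> \<le> R + 1))"
      unfolding z(3) by (cases "G t \<omega> \<and> e \<omega> \<le> ennreal (\<eta>\<^sup>2 / 4)") auto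
  qed
  also have "\<dots> \<le> (\<integral>\<^sup>+\<omega>. ennreal (min (R + 1) (Q \<omega>)) \<partial>M)"
    unfolding Q_def by (rule L(1))
  also have "\<dots> \<le> (\<integral>\<^sup>+\<omega>. ennreal (1 + \<eta>) * a \<omega> + ennreal \<eta> + ennreal (R + 1) * indicator {\<omega>\<in>space M. ennreal (\<eta>\<^sup>2 / 4) < e \<omega>} \<omega> \<partial>M)"
  proof (rule nn_integral_mono)
    fix \<omega> assume \<omega>: "\<omega> \<in> space M"
    show "ennreal (min (R + 1) (Q \<omega>)) \<le> ennreal (1 + \<eta>) * a \<omega> + ennreal \<eta> + ennreal (R + 1) * indicator {\<omega>\<in>space M. ennreal (\<eta>\<^sup>2 / 4) < e \<omega>} \<omega>"
    proof (cases "e \<omega> \<le> ennreal (\<eta>\<^sup>2 / 4)")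
      case True
      have "ennreal (min (R + 1) (Q \<omega>)) \<le> ennreal (Q \<omega>)" by (intro ennreal_leI) auto
      also note Q_le[OF \<omega> True]
      finally show ?thesis by (rule order_trans) simp
    next
      case False
      have "ennreal (min (R + 1) (Q \<omega>)) \<le> ennreal (R + 1)" by (intro ennreal_leI) auto
      then show ?thesis using False \<omega> by (simp add: add_increasing)
    qed
  qed
  also have "\<dots> = ennreal (1 + \<eta>) * (\<integral>\<^sup>+\<omega>. a \<omega> \<partial>M) + ennreal \<eta> + ennreal (R + 1) * emeasure M {\<omega>\<in>space M. ennreal (\<eta>\<^sup>2 / 4) < e \<omega>}"
    by (simp add: nn_integral_add nn_integral_cmult emeasure_space_1)
  finally show "(\<integral>\<^sup>+\<omega>. ennreal ((simple_integral B S t \<omega> - simple_integral B h t \<omega>)\<^sup>2) * of_bool (G t \<omega> \<and> e \<omega> \<le> ennreal (\<eta>\<^sup>2 / 4)) \<partial>M)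
      \<le> ennreal (1 + \<eta>) * (\<integral>\<^sup>+\<omega>. a \<omega> \<partial>M) + ennreal \<eta> + ennreal (R + 1) * emeasure M {\<omega>\<in>space M. ennreal (\<eta>\<^sup>2 / 4) < e \<omega>}" .
qed

text \<open>The simple integrals converge to \<open>I\<close> in probability only, so that the estimate is
  first proved for the square truncated at \<open>L\<close>, where exceptional events of small probability are
  harmless. Along the sequence of simple integrals, \<open>m \<rightarrow> \<infinity>\<close> removes the
  approximation error; then \<open>\<eta> \<rightarrow> 0\<close> removes the loss in Young's inequality, and
  finally \<open>L \<rightarrow> \<infinity>\<close> the truncation. For \<open>h = 0\<close> the result is
  one inequality of a localised Ito isometry; a general \<open>h\<close> allows the comparison with an
  explicit Gaussian variable.\<close>
lemma localized_ito_bound: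
  fixes R t :: real
  assumes I: "has_ito_integral M F B H t I" and t: "0 \<le> t"
    and h: "simple_process M F h" and G: "localizer G"
    and R: "\<And>\<omega>. \<omega> \<in> space M \<Longrightarrow> (\<integral>\<^sup>+s\<in>{0..t}. ennreal ((H s \<omega> - simple_value h s \<omega>)\<^sup>2 * of_bool (G s \<omega>)) \<partial>lborel) \<le> ennreal R"
  shows "(\<integral>\<^sup>+\<omega>. ennreal ((I \<omega> - simple_integral B h t \<omega>)\<^sup>2) * of_bool (G t \<omega>) \<partial>M)
    \<le> (\<integral>\<^sup>+\<omega>. (\<integral>\<^sup>+s\<in>{0..t}. ennreal ((H s \<omega> - simple_value h s \<omega>)\<^sup>2 * of_bool (G s \<omega>)) \<partial>lborel) \<partial>M)"
    (is "_ \<le> (\<integral>\<^sup>+\<omega>. ?a \<omega> \<partial>M)")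
proof -
  (* a negative R has the same effect as 0, because ennreal truncates *)
  define R' where "R' = max 0 R"
  have R'0: "0 \<le> R'" by (simp add: R'_def)
  have R': "?a \<omega> \<le> ennreal R'" if "\<omega> \<in> space M" for \<omega>
    using R[OF that] by (rule order_trans) (auto simp: R'_def intro: ennreal_leI)
  note Hm = progressive_measurable_pair[OF _ t, of H]
  have prog: "progressively_measurable_upto F H t" and Im [measurable]: "I \<in> borel_measurable M"
    using I by (auto simp: has_ito_integral_def)
  obtain S where S: "\<And>m. simple_process M F (S m)"
    and S1: "\<And>\<epsilon>. \<epsilon> > 0 \<Longrightarrow> (\<lambda>m. measure M {\<omega>\<in>space M. ennreal \<epsilon> < (\<integral>\<^sup>+s\<in>{0..t}. ennreal ((H s \<omega> - simple_value (S m) s \<omega>)\<^sup>2) \<partial>lborel)}) \<longlonglongrightarrow> 0"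
    and S2: "\<And>\<epsilon>. \<epsilon> > 0 \<Longrightarrow> (\<lambda>m. measure M {\<omega>\<in>space M. \<epsilon> < \<bar>I \<omega> - simple_integral B (S m) t \<omega>\<bar>}) \<longlonglongrightarrow> 0"
    using I unfolding has_ito_integral_def by blast
  define e where "e = (\<lambda>m \<omega>. \<integral>\<^sup>+s\<in>{0..t}. ennreal ((H s \<omega> - simple_value (S m) s \<omega>)\<^sup>2) \<partial>lborel)"
  define N where "N = (\<lambda>m \<omega>. simple_integral B (S m) t \<omega> - simple_integral B h t \<omega>)"
  define J where "J = (\<lambda>\<omega>. I \<omega> - simple_integral B h t \<omega>)"
  define \<alpha> where "\<alpha> = enn2real (\<integral>\<^sup>+\<omega>. ?a \<omega> \<partial>M)"
  have "(\<integral>\<^sup>+\<omega>. ?a \<omega> \<partial>M) \<le> (\<integral>\<^sup>+\<omega>. ennreal R' \<partial>M)" by (rule nn_integral_mono[OF R'])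
  then have afin: "(\<integral>\<^sup>+\<omega>. ?a \<omega> \<partial>M) < \<infinity>" by (simp add: emeasure_space_1 le_less_trans)
  then have a: "(\<integral>\<^sup>+\<omega>. ?a \<omega> \<partial>M) = ennreal \<alpha>" and \<alpha>0: "0 \<le> \<alpha>" by (auto simp: \<alpha>_def)
  have sm [measurable]: "simple_integral B h t \<in> borel_measurable M" "\<And>m. simple_integral B (S m) t \<in> borel_measurable M"
    using simple_integral_measurable t h S by auto
  have [measurable]: "J \<in> borel_measurable M" "\<And>m. N m \<in> borel_measurable M" unfolding J_def N_def by measurable
  have Gt: "{\<omega>\<in>space M. G t \<omega>} \<in> sets M"
    using G t subalgebra_F[OF t] by (auto simp: localizer_def subalgebra_def)
  have [measurable]: "(\<lambda>\<omega>. of_bool (G t \<omega>) :: ennreal) \<in> borel_measurable M"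
    by (subst measurable_cong[of _ _ "indicator {\<omega>\<in>space M. G t \<omega>}"]) (use Gt in \<open>auto simp: indicator_def\<close>)
  have trunc: "(\<integral>\<^sup>+\<omega>. ennreal (min L ((J \<omega>)\<^sup>2)) * of_bool (G t \<omega>) \<partial>M) \<le> ennreal ((1 + \<eta>) * ((1 + \<eta>) * \<alpha> + \<eta>) + (1 + 1 / \<eta>) * \<eta>\<^sup>2)"
    if L: "L \<ge> 0" and \<eta>: "0 < \<eta>" "\<eta> * (R' + 1) \<le> 1" for L \<eta> :: real
  proof -
    note A = localized_bound_of_approximation[OF progressive_measurable_pair[OF prog t] t S h G R'0 R' \<eta>, folded e_def, folded N_def]
    have [measurable]: "e m \<in> borel_measurable M" for m using A(2)[of m] unfolding e_def by simp
    define p where "p = (\<lambda>m. measure M {\<omega>\<in>space M. ennreal (\<eta>\<^sup>2 / 4) < e m \<omega>})"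
    define q where "q = (\<lambda>m. measure M {\<omega>\<in>space M. \<eta> < \<bar>I \<omega> - simple_integral B (S m) t \<omega>\<bar>})"
    have p0: "p \<longlonglongrightarrow> 0" using S1[of "\<eta>\<^sup>2 / 4"] \<eta>(1) by (simp add: p_def e_def)
    have q0: "q \<longlonglongrightarrow> 0" using S2[OF \<eta>(1)] by (simp add: q_def)
    have step: "(\<integral>\<^sup>+\<omega>. ennreal (min L ((J \<omega>)\<^sup>2)) * of_bool (G t \<omega>) \<partial>M)
        \<le> ennreal ((1 + \<eta>) * ((1 + \<eta>) * \<alpha> + \<eta> + (R' + 1) * p m) + (1 + 1 / \<eta>) * \<eta>\<^sup>2 + L * (p m + q m))" for m
    proof -
      let ?P = "{\<omega>\<in>space M. ennreal (\<eta>\<^sup>2 / 4) < e m \<omega>}"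
      let ?Q = "{\<omega>\<in>space M. \<eta> < \<bar>I \<omega> - simple_integral B (S m) t \<omega>\<bar>}"
      let ?n = "\<lambda>\<omega>. ennreal ((N m \<omega>)\<^sup>2) * of_bool (G t \<omega> \<and> e m \<omega> \<le> ennreal (\<eta>\<^sup>2 / 4))"
      have nm [measurable]: "?n \<in> borel_measurable M"
      proof -
        have "?n = (\<lambda>\<omega>. ennreal ((N m \<omega>)\<^sup>2) * of_bool (G t \<omega>) * (if e m \<omega> \<le> ennreal (\<eta>\<^sup>2 / 4) then 1 else 0))"
          by auto
        then show ?thesis by simp
      qed
      have "(\<integral>\<^sup>+\<omega>. ennreal (min L ((J \<omega>)\<^sup>2)) * of_bool (G t \<omega>) \<partial>M)
        \<le> (\<integral>\<^sup>+\<omega>. ennreal (1 + \<eta>) * ?n \<omega> + ennreal ((1 + 1 / \<eta>) * \<eta>\<^sup>2) + ennreal L * (indicator ?P \<omega> + indicator ?Q \<omega>) \<partial>M)"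
      proof (rule nn_integral_mono)
        fix \<omega> assume \<omega>: "\<omega> \<in> space M"
        show "ennreal (min L ((J \<omega>)\<^sup>2)) * of_bool (G t \<omega>)
          \<le> ennreal (1 + \<eta>) * ?n \<omega> + ennreal ((1 + 1 / \<eta>) * \<eta>\<^sup>2) + ennreal L * (indicator ?P \<omega> + indicator ?Q \<omega>)"
        proof (cases "G t \<omega> \<and> \<omega> \<notin> ?P \<and> \<omega> \<notin> ?Q")
          case True
          have "\<bar>J \<omega> - N m \<omega>\<bar> \<le> \<eta>" using True \<omega> by (simp add: J_def N_def)
          then have "(J \<omega> - N m \<omega>)\<^sup>2 \<le> \<eta>\<^sup>2" using \<eta>(1) by (simp add: abs_le_square_iff[symmetric])
          then have "(1 + 1 / \<eta>) * (J \<omega> - N m \<omega>)\<^sup>2 \<le> (1 + 1 / \<eta>) * \<eta>\<^sup>2" using \<eta>(1) by (intro mult_left_mono) auto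
          then have "(J \<omega>)\<^sup>2 \<le> (1 + \<eta>) * (N m \<omega>)\<^sup>2 + (1 + 1 / \<eta>) * \<eta>\<^sup>2"
            using square_add_le[OF \<eta>(1), of "N m \<omega>" "J \<omega> - N m \<omega>"] by simp
          then have "ennreal (min L ((J \<omega>)\<^sup>2)) \<le> ennreal ((1 + \<eta>) * (N m \<omega>)\<^sup>2 + (1 + 1 / \<eta>) * \<eta>\<^sup>2)"
            by (intro ennreal_leI) auto
          also have "\<dots> = ennreal (1 + \<eta>) * ennreal ((N m \<omega>)\<^sup>2) + ennreal ((1 + 1 / \<eta>) * \<eta>\<^sup>2)"
            using \<eta>(1) by (simp add: ennreal_mult[symmetric] ennreal_plus[symmetric] del: ennreal_plus)
          finally show ?thesis using True \<omega> by (simp add: not_less)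
        next
          case False
          show ?thesis
          proof (cases "G t \<omega>")
            case True
            have "ennreal (min L ((J \<omega>)\<^sup>2)) \<le> ennreal L * 1" by (simp add: ennreal_leI)
            also have "\<dots> \<le> ennreal L * (indicator ?P \<omega> + indicator ?Q \<omega>)"
              using False True by (intro mult_left_mono) (auto simp: indicator_def)
            finally show ?thesis using True by (simp add: add_increasing)
          qed simp
        qed
      qed
      also have "\<dots> = ennreal (1 + \<eta>) * (\<integral>\<^sup>+\<omega>. ?n \<omega> \<partial>M) + ennreal ((1 + 1 / \<eta>) * \<eta>\<^sup>2) + ennreal L * (emeasure M ?P + emeasure M ?Q)"
        by (simp add: nn_integral_add nn_integral_cmult emeasure_space_1 del: of_bool_conj)
      also have "\<dots> \<le> ennreal (1 + \<eta>) * (ennreal (1 + \<eta>) * ennreal \<alpha> + ennreal \<eta> + ennreal (R' + 1) * emeasure M ?P)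
          + ennreal ((1 + 1 / \<eta>) * \<eta>\<^sup>2) + ennreal L * (emeasure M ?P + emeasure M ?Q)"
        using A(3)[of m] unfolding a e_def N_def by (intro add_right_mono mult_left_mono) (auto simp del: simple_integral.simps)
      also have "\<dots> = ennreal ((1 + \<eta>) * ((1 + \<eta>) * \<alpha> + \<eta> + (R' + 1) * p m) + (1 + 1 / \<eta>) * \<eta>\<^sup>2 + L * (p m + q m))"
        using \<eta>(1) L \<alpha>0 R'0 unfolding emeasure_eq_measure p_def[symmetric] q_def[symmetric]
        by (simp add: ennreal_mult ennreal_plus p_def q_def)
      finally show ?thesis .
    qed
    have "(\<lambda>m. ennreal ((1 + \<eta>) * ((1 + \<eta>) * \<alpha> + \<eta> + (R' + 1) * p m) + (1 + 1 / \<eta>) * \<eta>\<^sup>2 + L * (p m + q m)))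
       \<longlonglongrightarrow> ennreal ((1 + \<eta>) * ((1 + \<eta>) * \<alpha> + \<eta> + (R' + 1) * 0) + (1 + 1 / \<eta>) * \<eta>\<^sup>2 + L * (0 + 0))"
      by (intro tendsto_ennrealI tendsto_intros p0 q0)
    from LIMSEQ_le_const[OF this] step show ?thesis by simp
  qed
  have bd: "(\<integral>\<^sup>+\<omega>. ennreal (min L ((J \<omega>)\<^sup>2)) * of_bool (G t \<omega>) \<partial>M) \<le> ennreal \<alpha>" if L: "L \<ge> 0" for L :: real
  proof -
    have lim: "((\<lambda>\<eta>. ennreal ((1 + \<eta>) * ((1 + \<eta>) * \<alpha> + \<eta>) + (\<eta>\<^sup>2 + \<eta>))) \<longlongrightarrow> ennreal ((1 + 0) * ((1 + 0) * \<alpha> + 0) + (0\<^sup>2 + 0))) (at_right 0)"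
      by (intro tendsto_ennrealI tendsto_intros)
    have "\<forall>\<^sub>F \<eta> in at_right 0. \<eta> \<in> {0<..<1 / (R' + 1)}"
      using R'0 by (intro eventually_at_right_real) simp
    then have "\<forall>\<^sub>F \<eta> in at_right 0. (\<integral>\<^sup>+\<omega>. ennreal (min L ((J \<omega>)\<^sup>2)) * of_bool (G t \<omega>) \<partial>M) \<le> ennreal ((1 + \<eta>) * ((1 + \<eta>) * \<alpha> + \<eta>) + (\<eta>\<^sup>2 + \<eta>))"
    proof eventually_elim
      case (elim \<eta>)
      have "(1 + 1 / \<eta>) * \<eta>\<^sup>2 = \<eta>\<^sup>2 + \<eta>" using elim by (simp add: field_simps power2_eq_square)
      moreover have "\<eta> * (R' + 1) \<le> 1" using elim R'0 by (simp add: field_simps)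
      ultimately show ?case using trunc[OF L, of \<eta>] elim by simp
    qed
    from tendsto_lowerbound[OF lim this] show ?thesis by simp
  qed
  have "(\<integral>\<^sup>+\<omega>. ennreal ((J \<omega>)\<^sup>2) * of_bool (G t \<omega>) \<partial>M) = (\<integral>\<^sup>+\<omega>. (SUP L::nat. ennreal (min (real L) ((J \<omega>)\<^sup>2)) * of_bool (G t \<omega>)) \<partial>M)"
  proof (rule nn_integral_cong, rule sym, rule LIMSEQ_unique[OF LIMSEQ_SUP])
    fix \<omega>
    show "incseq (\<lambda>L::nat. ennreal (min (real L) ((J \<omega>)\<^sup>2)) * of_bool (G t \<omega>))"
      by (auto intro!: incseq_SucI mult_right_mono ennreal_leI)
    obtain n :: nat where n: "(J \<omega>)\<^sup>2 \<le> n" using real_arch_simple by blast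
    show "(\<lambda>L::nat. ennreal (min (real L) ((J \<omega>)\<^sup>2)) * of_bool (G t \<omega>)) \<longlonglongrightarrow> ennreal ((J \<omega>)\<^sup>2) * of_bool (G t \<omega>)"
      by (rule tendsto_eventually, rule eventually_sequentiallyI[of n]) (use n in \<open>auto simp: min_def\<close>)
  qed
  also have "\<dots> = (SUP L::nat. \<integral>\<^sup>+\<omega>. ennreal (min (real L) ((J \<omega>)\<^sup>2)) * of_bool (G t \<omega>) \<partial>M)"
    by (rule nn_integral_monotone_convergence_SUP)
       (auto intro!: incseq_SucI le_funI mult_right_mono ennreal_leI)
  also have "\<dots> \<le> ennreal \<alpha>" by (rule SUP_least) (rule bd, simp)
  finally show ?thesis unfolding a J_def .
qed

end

section \<open>Integrals of deterministic step functions\<close>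

definition deterministic_code :: "nat \<Rightarrow> (nat \<Rightarrow> real) \<Rightarrow> (nat \<Rightarrow> real) \<Rightarrow> 'a simple_code" where
  "deterministic_code k u c = (k, u, \<lambda>i \<omega>. c i)"

definition grid :: "nat \<Rightarrow> (nat \<Rightarrow> real) \<Rightarrow> bool" where
  "grid k u \<longleftrightarrow> 0 \<le> u 0 \<and> (\<forall>i<k. u i < u (Suc i))"

lemma simple_value_deterministic: "simple_value (deterministic_code k u c) s \<omega> = step_function k u c s"
  by (simp add: deterministic_code_def step_function_def)

lemma square_integral_grid:
  assumes u: "grid k u"
  shows "(\<integral>s. (step_function k u c s)\<^sup>2 \<partial>lborel) = (\<Sum>i<k. (c i)\<^sup>2 * (u (Suc i) - u i))"
proof -
  define S where "S = (deterministic_code k u c :: unit simple_code)"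
  (* a one-point space suffices to apply the lemmas on simple processes to deterministic functions *)
  have S: "simple_process (count_space UNIV) (\<lambda>_. count_space UNIV) (k, u, \<lambda>i \<omega>::unit. c i)"
    using u by (auto simp: grid_def)
  have "(step_function k u c s)\<^sup>2 = (\<Sum>i<k. (c i)\<^sup>2 * indicator {u i<..u (Suc i)} s)" for s
  proof (cases "\<exists>i<k. u i < s \<and> s \<le> u (Suc i)")
    case True
    then obtain i where i: "i < k" "u i < s" "s \<le> u (Suc i)" by blast
    have S2: "simple_process (count_space UNIV) (\<lambda>_. count_space UNIV) (k, u, \<lambda>i \<omega>::unit. (c i)\<^sup>2)"
      using u by (auto simp: grid_def)
    show ?thesis using simple_value_node[OF S i, of "()"] simple_value_node[OF S2 i, of "()"]
      by (simp add: step_function_def)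
  next
    case False
    then have "indicator {u i<..u (Suc i)} s = (0::real)" if "i < k" for i using that by (auto simp: indicator_def)
    then show ?thesis by (simp add: step_function_def)
  qed
  moreover have "(\<integral>s. (\<Sum>i<k. (c i)\<^sup>2 * indicator {u i<..u (Suc i)} s) \<partial>lborel) = (\<Sum>i<k. (c i)\<^sup>2 * (u (Suc i) - u i))"
  proof (subst Bochner_Integration.integral_sum)
    fix i assume "i \<in> {..<k}"
    then show "integrable lborel (\<lambda>s. (c i)\<^sup>2 * indicator {u i<..u (Suc i)} s)"
      using u by (intro integrable_mult_right integrable_real_indicator) (auto simp: grid_def less_imp_le)
  next
    show "(\<Sum>i<k. \<integral>s. (c i)\<^sup>2 * indicator {u i<..u (Suc i)} s \<partial>lborel) = (\<Sum>i<k. (c i)\<^sup>2 * (u (Suc i) - u i))"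
      using u by (intro sum.cong refl) (auto simp: grid_def less_imp_le)
  qed
  ultimately show ?thesis by simp
qed

context brownian_motion
begin

lemma simple_process_deterministic: "grid k u \<Longrightarrow> simple_process M F (deterministic_code k u c)"
  by (auto simp: grid_def deterministic_code_def)

text \<open>Induction with the independence of the last increment from the past.\<close>
lemma expectation_iexp_increments:
  assumes "grid k v"
  shows "(CLINT \<omega>|M. iexp (\<Sum>i<k. c i * (B (v (Suc i)) \<omega> - B (v i) \<omega>))) =
    of_real (exp (- (\<Sum>i<k. (c i)\<^sup>2 * (v (Suc i) - v i)) / 2))"
  using assms
proof (induction k)
  case 0
  then show ?case by (simp add: prob_space)
next
  case (Suc k)
  have g: "grid k v" using Suc.prems by (auto simp: grid_def)
  have v: "0 \<le> v i" if "i \<le> Suc k" for i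
    using simple_process_mono_on(2)[OF simple_process_deterministic[OF Suc.prems, unfolded deterministic_code_def], of i i] that by simp
  have vm: "v i \<le> v k" if "i \<le> k" for i
    using simple_process_mono_on(1)[OF simple_process_deterministic[OF g, unfolded deterministic_code_def], of i k] that by simp
  have less: "v k < v (Suc k)" using Suc.prems by (auto simp: grid_def)
  let ?N = "\<lambda>\<omega>. \<Sum>i<k. c i * (B (v (Suc i)) \<omega> - B (v i) \<omega>)"
  let ?D = "\<lambda>\<omega>. B (v (Suc k)) \<omega> - B (v k) \<omega>"
  have NF: "?N \<in> borel_measurable (F (v k))"
    using v vm by (intro borel_measurable_sum borel_measurable_times borel_measurable_diff B_measurable_F) auto
  have Nm: "?N \<in> borel_measurable M" using NF measurable_F_M v[of k] by simp
  have Dm: "?D \<in> borel_measurable M" using B_measurable v by auto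
  have "indep_var borel (iexp \<circ> ?N) borel ((\<lambda>x. iexp (c k * x)) \<circ> ?D)"
    by (rule indep_var_compose[OF indep_increment[OF v less NF]]) auto
  then have iv: "indep_var borel (\<lambda>\<omega>. iexp (?N \<omega>)) borel (\<lambda>\<omega>. iexp (c k * ?D \<omega>))" by (simp only: comp_def)
  have "(CLINT \<omega>|M. iexp (\<Sum>i<Suc k. c i * (B (v (Suc i)) \<omega> - B (v i) \<omega>))) = (CLINT \<omega>|M. iexp (?N \<omega>) * iexp (c k * ?D \<omega>))"
    by (simp add: exp_add ring_distribs)
  also have "\<dots> = (CLINT \<omega>|M. iexp (?N \<omega>)) * (CLINT \<omega>|M. iexp (c k * ?D \<omega>))"
  proof (rule indep_var_lebesgue_integral[OF iv])
    show "integrable M (\<lambda>\<omega>. iexp (?N \<omega>))" by (rule integrable_iexp[OF measurable_compose[OF Nm borel_measurable_of_real]]) simp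
    show "integrable M (\<lambda>\<omega>. iexp (c k * ?D \<omega>))"
      by (rule integrable_iexp[OF measurable_compose[OF borel_measurable_times[OF borel_measurable_const Dm] borel_measurable_of_real]]) simp
  qed
  also have "\<dots> = of_real (exp (- (\<Sum>i<k. (c i)\<^sup>2 * (v (Suc i) - v i)) / 2)) * of_real (exp (- ((c k)\<^sup>2 * (v (Suc k) - v k)) / 2))"
    using Suc.IH[OF g] expectation_iexp_increment[OF v less, of "c k"] by simp
  also have "\<dots> = of_real (exp (- (\<Sum>i<Suc k. (c i)\<^sup>2 * (v (Suc i) - v i)) / 2))"
    by (simp flip: of_real_mult exp_add)
  finally show ?case .
qed

text \<open>The vector of integrals is Gaussian. All of them are written on one grid that contains every node
  and every endpoint \<open>t j\<close>; a linear combination is then a single sum of independent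
  increments.\<close>
lemma expectation_cos_simple_integrals:
  fixes a t :: "'n::finite \<Rightarrow> real" and k :: "'n \<Rightarrow> nat"
  assumes g: "\<And>j. grid (k j) (u j)" and t: "\<And>j. 0 \<le> t j"
  shows "expectation (\<lambda>\<omega>. cos ((\<Sum>j\<in>UNIV. a j * simple_integral B (deterministic_code (k j) (u j) (c j)) (t j) \<omega>) + d))
    = cos d * exp (- (\<integral>s. (\<Sum>j\<in>UNIV. a j * (step_function (k j) (u j) (c j) s * indicator {0..t j} s))\<^sup>2 \<partial>lborel) / 2)"
proof -
  define P where "P = (\<Union>j. u j ` {..k j}) \<union> range t"
  have S: "simple_process M F (k j, u j, \<lambda>i \<omega>. c j i)" for j
    using simple_process_deterministic[OF g, of j "c j"] by (simp add: deterministic_code_def)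
  have P: "finite P" "P \<subseteq> {0..}" "\<And>j. u j ` {..k j} \<subseteq> P" "\<And>j. t j \<in> P"
    using simple_process_mono_on(2)[OF S] t by (auto simp: P_def)
  define v where "v = (!) (sorted_list_of_set P)"
  define l where "l = card P - 1"
  have R: "simple_process M F (l, v, \<lambda>i. simple_value (k j, u j, \<lambda>i \<omega>. c j i) (v (Suc i)))" for j
    unfolding v_def l_def by (rule refine_to_grid(1)[OF S P(1,2,3)])
  have R2: "step_sum (l, v, \<lambda>i. simple_value (k j, u j, \<lambda>i \<omega>. c j i) (v (Suc i))) \<phi> \<omega> = step_sum (k j, u j, \<lambda>i \<omega>. c j i) \<phi> \<omega>" for j \<phi> and \<omega> :: 'a
    unfolding v_def l_def by (rule refine_to_grid(2)[OF S P(1,2,3)])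
  have gv: "grid l v" using R by (simp add: grid_def)
  have mono: "v i \<le> v i'" if "i \<le> i'" "i' \<le> l" for i i'
    using simple_process_mono_on(1)[OF R] that by blast
  have tnode: "t j \<le> v i \<or> v (Suc i) \<le> t j" if i: "i < l" for i j
  proof -
    have "P \<noteq> {}" using P(4) by auto
    then have len: "length (sorted_list_of_set P) = Suc l"
      using P(1) card_gt_0_iff[of P] by (simp add: l_def)
    obtain b where b: "b \<le> l" "v b = t j"
      using P(4)[of j] len P(1) by (metis in_set_conv_nth less_Suc_eq_le set_sorted_list_of_set v_def)
    show ?thesis
    proof (cases "b \<le> i")
      case True
      then show ?thesis using mono[of b i] b i by auto
    next
      case False
      then show ?thesis using mono[of "Suc i" b] b by auto
    qed
  qed
  (* as t j is a node, stopping at t j either keeps or removes an interval as a whole *)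
  define \<zeta> where "\<zeta> j i = step_function (k j) (u j) (c j) (v (Suc i)) * of_bool (v (Suc i) \<le> t j)" for j i
  define C where "C i = (\<Sum>j\<in>UNIV. a j * \<zeta> j i)" for i
  have int: "simple_integral B (deterministic_code (k j) (u j) (c j)) (t j) \<omega> = (\<Sum>i<l. \<zeta> j i * (B (v (Suc i)) \<omega> - B (v i) \<omega>))" for j \<omega>
  proof -
    have "simple_integral B (deterministic_code (k j) (u j) (c j)) (t j) \<omega> =
      step_sum (l, v, \<lambda>i. simple_value (k j, u j, \<lambda>i \<omega>. c j i) (v (Suc i))) (\<lambda>r. B (min r (t j)) \<omega>) \<omega>"
      unfolding R2 by (simp add: deterministic_code_def)
    also have "\<dots> = (\<Sum>i<l. \<zeta> j i * (B (v (Suc i)) \<omega> - B (v i) \<omega>))"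
      unfolding step_sum.simps
    proof (intro sum.cong refl)
      fix i assume i: "i \<in> {..<l}"
      have sv: "simple_value (k j, u j, \<lambda>i \<omega>. c j i) (v (Suc i)) \<omega> = step_function (k j) (u j) (c j) (v (Suc i))"
        using simple_value_deterministic[of "k j" "u j" "c j" "v (Suc i)" \<omega>] by (simp only: deterministic_code_def)
      have "v i < v (Suc i)" using gv i by (auto simp: grid_def)
      then show "simple_value (k j, u j, \<lambda>i \<omega>. c j i) (v (Suc i)) \<omega> * (B (min (v (Suc i)) (t j)) \<omega> - B (min (v i) (t j)) \<omega>)
        = \<zeta> j i * (B (v (Suc i)) \<omega> - B (v i) \<omega>)"
        unfolding \<zeta>_def sv using tnode[of i j] i by (auto simp: min_def)
    qed
    finally show ?thesis .
  qed
  have sumN: "(\<Sum>j\<in>UNIV. a j * simple_integral B (deterministic_code (k j) (u j) (c j)) (t j) \<omega>) = (\<Sum>i<l. C i * (B (v (Suc i)) \<omega> - B (v i) \<omega>))" for \<omega>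
    unfolding int C_def sum_distrib_left sum_distrib_right mult.assoc by (rule sum.swap)
  have stepf: "(\<Sum>j\<in>UNIV. a j * (step_function (k j) (u j) (c j) s * indicator {0..t j} s)) = step_function l v C s" for s
  proof -
    have val: "step_function (k j) (u j) (c j) s = (\<Sum>i<l. step_function (k j) (u j) (c j) (v (Suc i)) * indicator {v i<..v (Suc i)} s)" for j
    proof -
      have "step_function (k j) (u j) (c j) s = simple_value (k j, u j, \<lambda>i \<omega>. c j i) s (undefined :: 'a)"
        by (simp add: step_function_def)
      also have "\<dots> = step_sum (l, v, \<lambda>i. simple_value (k j, u j, \<lambda>i \<omega>. c j i) (v (Suc i))) (indicator {s..}) (undefined :: 'a)"
        unfolding R2 by (rule simple_value_eq_step_sum[OF S])
      also have "\<dots> = simple_value (l, v, \<lambda>i. simple_value (k j, u j, \<lambda>i \<omega>. c j i) (v (Suc i))) s (undefined :: 'a)"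
        by (rule simple_value_eq_step_sum[OF R, symmetric])
      finally show ?thesis by (simp add: step_function_def)
    qed
    have "(\<Sum>j\<in>UNIV. a j * (step_function (k j) (u j) (c j) s * indicator {0..t j} s)) =
      (\<Sum>j\<in>UNIV. \<Sum>i<l. a j * \<zeta> j i * indicator {v i<..v (Suc i)} s)"
    proof (intro sum.cong refl)
      fix j
      have "step_function (k j) (u j) (c j) s * indicator {0..t j} s = (\<Sum>i<l. \<zeta> j i * indicator {v i<..v (Suc i)} s)"
        unfolding val[of j] sum_distrib_right
      proof (intro sum.cong refl)
        fix i assume i: "i \<in> {..<l}"
        have "0 \<le> v i" using simple_process_mono_on(2)[OF R, of i i] i by simp
        then have "indicator {v i<..v (Suc i)} s * indicator {0..t j} s = (of_bool (v (Suc i) \<le> t j) * indicator {v i<..v (Suc i)} s :: real)"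
          using tnode[of i j] i by (auto simp: indicator_def)
        then show "step_function (k j) (u j) (c j) (v (Suc i)) * indicator {v i<..v (Suc i)} s * indicator {0..t j} s = \<zeta> j i * indicator {v i<..v (Suc i)} s"
          by (simp add: \<zeta>_def mult.assoc)
      qed
      then show "a j * (step_function (k j) (u j) (c j) s * indicator {0..t j} s) = (\<Sum>i<l. a j * \<zeta> j i * indicator {v i<..v (Suc i)} s)"
        by (simp only: sum_distrib_left mult.assoc)
    qed
    also have "\<dots> = (\<Sum>i<l. \<Sum>j\<in>UNIV. a j * \<zeta> j i * indicator {v i<..v (Suc i)} s)" by (rule sum.swap)
    also have "\<dots> = step_function l v C s" by (simp only: step_function_def C_def sum_distrib_right)
    finally show ?thesis .
  qed
  let ?N = "\<lambda>\<omega>. \<Sum>i<l. C i * (B (v (Suc i)) \<omega> - B (v i) \<omega>)"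
  have v0: "0 \<le> v i" if "i \<le> l" for i using simple_process_mono_on(2)[OF R, of i i] that by simp
  have Nm: "?N \<in> borel_measurable M"
    using v0 by (intro borel_measurable_sum borel_measurable_times borel_measurable_diff B_measurable) auto
  have pw: "cos (y + d) = Re (iexp d * iexp y)" for y :: real
    unfolding cis_conv_exp[symmetric] by (simp add: cos_add mult.commute)
  have "expectation (\<lambda>\<omega>. cos (?N \<omega> + d)) = expectation (\<lambda>\<omega>. Re (iexp d * iexp (?N \<omega>)))"
    unfolding pw ..
  also have "\<dots> = Re (CLINT \<omega>|M. iexp d * iexp (?N \<omega>))"
    by (intro integral_Re integrable_mult_right integrable_iexp[OF measurable_compose[OF Nm borel_measurable_of_real]]) simp
  also have "(CLINT \<omega>|M. iexp d * iexp (?N \<omega>)) = iexp d * of_real (exp (- (\<Sum>i<l. (C i)\<^sup>2 * (v (Suc i) - v i)) / 2))"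
    using expectation_iexp_increments[OF gv, of C] by simp
  also have "Re \<dots> = cos d * exp (- (\<Sum>i<l. (C i)\<^sup>2 * (v (Suc i) - v i)) / 2)"
    by (simp add: cis_conv_exp[symmetric])
  finally show ?thesis unfolding sumN stepf square_integral_grid[OF gv] .
qed

end

section \<open>Kernels and continuous processes\<close>

text \<open>Cauchy--Schwarz. The case of a function that is not integrable is harmless, since the integral on
  the left is \<open>0\<close> by convention.\<close>
lemma square_set_integral_le:
  fixes g :: "real \<Rightarrow> real"
  assumes g [measurable]: "(\<lambda>s. indicator {0..t} s * g s) \<in> borel_measurable borel" and t: "0 \<le> t"
  shows "ennreal ((LBINT s:{0..t}. g s)\<^sup>2) \<le> ennreal t * (\<integral>\<^sup>+s\<in>{0..t}. ennreal ((g s)\<^sup>2) \<partial>lborel)"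
proof (cases "integrable lborel (\<lambda>s. indicator {0..t} s * g s)")
  case True
  have "ennreal ((LBINT s:{0..t}. g s)\<^sup>2) = (ennreal \<bar>LBINT s:{0..t}. g s\<bar>)\<^sup>2"
    by (simp add: ennreal_power)
  also have "ennreal \<bar>LBINT s:{0..t}. g s\<bar> \<le> (\<integral>\<^sup>+s. ennreal \<bar>indicator {0..t} s * g s\<bar> \<partial>lborel)"
    using integral_norm_bound_ennreal[OF True] by (simp add: set_lebesgue_integral_def)
  also have "(\<integral>\<^sup>+s. ennreal \<bar>indicator {0..t} s * g s\<bar> \<partial>lborel) = (\<integral>\<^sup>+s. indicator {0..t} s * ennreal \<bar>indicator {0..t} s * g s\<bar> \<partial>lborel)"
    by (intro nn_integral_cong) (auto simp: indicator_def)
  also have "\<dots>\<^sup>2 \<le> (\<integral>\<^sup>+s. (indicator {0..t} s)\<^sup>2 \<partial>lborel) * (\<integral>\<^sup>+s. (ennreal \<bar>indicator {0..t} s * g s\<bar>)\<^sup>2 \<partial>lborel)"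
    by (rule Cauchy_Schwarz_nn_integral) measurable
  also have "(\<integral>\<^sup>+s. (indicator {0..t} s)\<^sup>2 \<partial>lborel) = (\<integral>\<^sup>+s. indicator {0..t} s \<partial>lborel)"
    by (intro nn_integral_cong) (auto simp: indicator_def)
  also have "\<dots> = ennreal t" using t by simp
  also have "(\<integral>\<^sup>+s. (ennreal \<bar>indicator {0..t} s * g s\<bar>)\<^sup>2 \<partial>lborel) = (\<integral>\<^sup>+s\<in>{0..t}. ennreal ((g s)\<^sup>2) \<partial>lborel)"
    by (intro nn_integral_cong) (auto simp: indicator_def ennreal_power)
  finally show ?thesis by (simp add: power_mono)
next
  case False
  then show ?thesis by (simp add: set_lebesgue_integral_def not_integrable_integral_eq)
qed

lemma L2_loc_measurable: "L2_loc K \<Longrightarrow> (\<lambda>s. indicator {0..} s * K s) \<in> borel_measurable borel"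
  by (simp add: L2_loc_def set_borel_measurable_def)

lemma L2_loc_reflected_measurable:
  assumes "L2_loc K"
  shows "(\<lambda>s. indicator {0..t} s * K (t - s)) \<in> borel_measurable borel"
proof -
  note [measurable] = L2_loc_measurable[OF assms]
  have "(\<lambda>s. indicator {0..t} s * (indicator {0..} (t - s) * K (t - s))) \<in> borel_measurable borel" by measurable
  also have "(\<lambda>s. indicator {0..t} s * (indicator {0..} (t - s) * K (t - s))) = (\<lambda>s. indicator {0..t} s * K (t - s))"
    by (auto simp: indicator_def)
  finally show ?thesis .
qed

text \<open>Reversal of time.\<close>
lemma L2_loc_nn_integral:
  assumes K: "L2_loc K" and t: "0 \<le> t"
  shows "(\<integral>\<^sup>+s\<in>{0..t}. ennreal ((K (t - s))\<^sup>2) \<partial>lborel) = ennreal (LBINT s:{0..t}. (K s)\<^sup>2)"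
proof -
  have m: "(\<lambda>s. ennreal ((indicator {0..t} s * (indicator {0..} s * K s))\<^sup>2)) \<in> borel_measurable borel"
    using L2_loc_measurable[OF K] by measurable
  have i: "integrable lborel (\<lambda>s. indicator {0..t} s * (K s)\<^sup>2)"
    using K t by (auto simp: L2_loc_def set_integrable_def)
  have "ennreal (LBINT s:{0..t}. (K s)\<^sup>2) = (\<integral>\<^sup>+s. ennreal (indicator {0..t} s * (K s)\<^sup>2) \<partial>lborel)"
    using nn_integral_eq_integral[OF i] by (simp add: set_lebesgue_integral_def)
  also have "\<dots> = (\<integral>\<^sup>+s. ennreal ((indicator {0..t} s * (indicator {0..} s * K s))\<^sup>2) \<partial>lborel)"
    by (intro nn_integral_cong) (auto simp: indicator_def)
  also have "\<dots> = (\<integral>\<^sup>+s. ennreal ((indicator {0..t} (t - s) * (indicator {0..} (t - s) * K (t - s)))\<^sup>2) \<partial>lborel)"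
    by (subst nn_integral_real_affine[OF m, of "-1" t]) auto
  also have "\<dots> = (\<integral>\<^sup>+s\<in>{0..t}. ennreal ((K (t - s))\<^sup>2) \<partial>lborel)"
    by (intro nn_integral_cong) (auto simp: indicator_def)
  finally show ?thesis ..
qed

lemma L2_loc_energy_mono:
  assumes K: "L2_loc K" and st: "0 \<le> s" "s \<le> t"
  shows "(LBINT r:{0..s}. (K r)\<^sup>2) \<le> (LBINT r:{0..t}. (K r)\<^sup>2)"
  using K st unfolding L2_loc_def set_integrable_def set_lebesgue_integral_def
  by (intro integral_mono) (auto simp: indicator_def)

definition kernel_at :: "(real \<Rightarrow> real) \<Rightarrow> real \<Rightarrow> real \<Rightarrow> real" where
  "kernel_at K t s = indicator {0..t} s * K (t - s)"

lemma square_integrable_kernel_at: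
  assumes K: "L2_loc K" and t: "0 \<le> t"
  shows "square_integrable (kernel_at K t)"
proof -
  have m [measurable]: "kernel_at K t \<in> borel_measurable borel"
    using L2_loc_reflected_measurable[OF K, of t] by (simp add: kernel_at_def[abs_def])
  have "(\<integral>\<^sup>+s. ennreal ((kernel_at K t s)\<^sup>2) \<partial>lborel) = (\<integral>\<^sup>+s\<in>{0..t}. ennreal ((K (t - s))\<^sup>2) \<partial>lborel)"
    by (intro nn_integral_cong) (auto simp: kernel_at_def indicator_def)
  then have "(\<integral>\<^sup>+s. ennreal ((kernel_at K t s)\<^sup>2) \<partial>lborel) < \<infinity>" by (simp add: L2_loc_nn_integral[OF K t])
  then have "integrable lborel (\<lambda>s. (kernel_at K t s)\<^sup>2)" by (intro integrableI_bounded) auto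
  then show ?thesis using m by (simp add: square_integrable_def)
qed

context prob_space
begin

text \<open>Time is approximated from above by multiples of \<open>1/(n + 1)\<close>. For such times the
  process takes countably many measurable forms, and continuity of the paths gives the limit.\<close>
lemma continuous_process_measurable_pair:
  fixes X :: "real \<Rightarrow> 'a \<Rightarrow> real"
  assumes X: "\<And>s. 0 \<le> s \<Longrightarrow> X s \<in> borel_measurable M" and cont: "\<And>\<omega>. \<omega> \<in> space M \<Longrightarrow> continuous_on {0..} (\<lambda>s. X s \<omega>)"
  shows "(\<lambda>(s, \<omega>). X (max 0 s) \<omega>) \<in> borel_measurable (borel \<Otimes>\<^sub>M M)"
proof -
  define g where "g n s = nat \<lceil>real (Suc n) * max 0 s\<rceil>" for n :: nat and s :: real
  have 1: "(\<lambda>x. X (real (g n (fst x)) / real (Suc n)) (snd x)) \<in> borel_measurable (borel \<Otimes>\<^sub>M M)" for n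
  proof (rule measurable_compose_countable[where f = "\<lambda>i x. X (real i / real (Suc n)) (snd x)" and g = "\<lambda>x. g n (fst x)"])
    show "(\<lambda>x. X (real i / real (Suc n)) (snd x)) \<in> borel_measurable (borel \<Otimes>\<^sub>M M)" for i
      by (rule measurable_compose[OF measurable_snd X]) simp
    show "(\<lambda>x. g n (fst x)) \<in> borel \<Otimes>\<^sub>M M \<rightarrow>\<^sub>M count_space UNIV"
      unfolding g_def by measurable
  qed
  have "(\<lambda>x. X (max 0 (fst x)) (snd x)) \<in> borel_measurable (borel \<Otimes>\<^sub>M M)"
  proof (rule borel_measurable_LIMSEQ_metric[OF 1])
    fix x :: "real \<times> 'a" assume "x \<in> space (borel \<Otimes>\<^sub>M M)"
    then have \<omega>: "snd x \<in> space M" by (auto simp: space_pair_measure)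
    let ?s = "max 0 (fst x)"
    have "(\<lambda>n. real (g n (fst x)) / real (Suc n)) \<longlonglongrightarrow> ?s"
    proof (rule tendsto_sandwich)
      have b: "real (Suc n) * ?s \<le> real (g n (fst x))" "real (g n (fst x)) \<le> real (Suc n) * ?s + 1" for n
      proof -
        have "0 \<le> real (Suc n) * ?s" by simp
        then have "0 \<le> \<lceil>real (Suc n) * ?s\<rceil>" by linarith
        then have "real (g n (fst x)) = \<lceil>real (Suc n) * ?s\<rceil>" by (simp add: g_def)
        then show "real (Suc n) * ?s \<le> real (g n (fst x))" "real (g n (fst x)) \<le> real (Suc n) * ?s + 1" by linarith+
      qed
      show "\<forall>\<^sub>F n in sequentially. ?s \<le> real (g n (fst x)) / real (Suc n)"
      proof (intro always_eventually allI)
        fix n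
        show "?s \<le> real (g n (fst x)) / real (Suc n)"
          using b(1)[of n] by (simp only: pos_le_divide_eq of_nat_0_less_iff zero_less_Suc mult.commute)
      qed
      have "real (g n (fst x)) / real (Suc n) \<le> ?s + 1 / real (Suc n)" for n
      proof -
        have "real (g n (fst x)) / real (Suc n) \<le> (real (Suc n) * ?s + 1) / real (Suc n)"
          by (rule divide_right_mono[OF b(2)]) simp
        also have "\<dots> = ?s + 1 / real (Suc n)" by (simp add: field_simps)
        finally show ?thesis .
      qed
      then show "\<forall>\<^sub>F n in sequentially. real (g n (fst x)) / real (Suc n) \<le> ?s + 1 / real (Suc n)"
        by (intro always_eventually allI)
      show "(\<lambda>n. ?s + 1 / real (Suc n)) \<longlonglongrightarrow> ?s"
        using tendsto_add[OF tendsto_const[of ?s] LIMSEQ_inverse_real_of_nat] by (simp add: inverse_eq_divide)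
    qed auto
    then show "(\<lambda>n. X (real (g n (fst x)) / real (Suc n)) (snd x)) \<longlonglongrightarrow> X ?s (snd x)"
      by (intro continuous_on_tendsto_compose[OF cont[OF \<omega>]]) (auto intro!: always_eventually)
  qed
  then show ?thesis by (simp add: case_prod_beta)
qed

end

lemma rat_dense_unit_interval_bound:
  fixes f :: "real \<Rightarrow> real"
  assumes f: "continuous_on {0..s} f" and s: "0 \<le> s"
    and rat: "\<And>q :: rat. 0 \<le> q \<Longrightarrow> q \<le> 1 \<Longrightarrow> f (of_rat q * s) \<le> m" and y: "0 \<le> y" "y \<le> s"
  shows "f y \<le> m"
proof -
  define Q where "Q = (\<lambda>q::rat. of_rat q * s) ` {0..1}"
  have Qs: "Q \<subseteq> {0..s}" using s by (auto simp: Q_def mult_left_le_one_le)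
  have "y \<in> closure Q"
  proof (cases "y = s")
    case True
    have "s \<in> Q" unfolding Q_def by (rule image_eqI[of _ _ 1]) auto
    then show ?thesis using True closure_subset by auto
  next
    case False
    then have s0: "s > 0" "y < s" using y by auto
    show ?thesis unfolding closure_approachable
    proof (intro allI impI)
      fix e :: real assume e: "e > 0"
      have "y / s < min 1 ((y + e) / s)" using s0 e by (simp add: divide_strict_right_mono)
      then obtain q where q: "y / s < of_rat q" "of_rat q < min 1 ((y + e) / s)" using of_rat_dense by blast
      have "0 \<le> y / s" using y s0 by simp
      then have "(0::real) < of_rat q" "of_rat q < (1::real)" using q by linarith+
      then have "of_rat q * s \<in> Q" by (auto simp: Q_def)
      moreover have "dist (of_rat q * s) y < e"
        using q s0 by (simp add: dist_real_def field_simps)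
      ultimately show "\<exists>y'\<in>Q. dist y' y < e" by blast
    qed
  qed
  moreover have "closure Q \<subseteq> {0..s}" using Qs by (simp add: closure_minimal)
  then have "continuous_on (closure Q) f" using f continuous_on_subset by blast
  moreover have "f z \<le> m" if "z \<in> Q" for z using that rat by (auto simp: Q_def)
  ultimately show ?thesis
    using continuous_le_on_closure[of Q f y m] by blast
qed

context brownian_motion
begin

text \<open>By continuity this says that the path is within distance \<open>m\<close> of \<open>x\<close> on
  \<open>[0, s]\<close>. The restriction to rational multiples of \<open>s\<close> makes it a countable
  intersection of events known at time \<open>s\<close>.\<close>
definition stays_within :: "(real \<Rightarrow> 'a \<Rightarrow> real) \<Rightarrow> real \<Rightarrow> real \<Rightarrow> real \<Rightarrow> 'a \<Rightarrow> bool" where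
  "stays_within X x m s \<omega> \<longleftrightarrow> (\<forall>q::rat\<in>{0..1}. \<bar>X (of_rat q * s) \<omega> - x\<bar> \<le> m)"

lemma stays_within_iff:
  assumes "continuous_on {0..} (\<lambda>s. X s \<omega>)" "0 \<le> s"
  shows "stays_within X x m s \<omega> \<longleftrightarrow> (\<forall>y\<in>{0..s}. \<bar>X y \<omega> - x\<bar> \<le> m)"
proof
  assume L: "stays_within X x m s \<omega>"
  show "\<forall>y\<in>{0..s}. \<bar>X y \<omega> - x\<bar> \<le> m"
  proof
    fix y assume y: "y \<in> {0..s}"
    have "continuous_on {0..s} (\<lambda>s. \<bar>X s \<omega> - x\<bar>)"
      by (intro continuous_intros continuous_on_subset[OF assms(1)]) auto
    then show "\<bar>X y \<omega> - x\<bar> \<le> m"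
      by (rule rat_dense_unit_interval_bound) (use L assms(2) y in \<open>auto simp: stays_within_def\<close>)
  qed
next
  assume R: "\<forall>y\<in>{0..s}. \<bar>X y \<omega> - x\<bar> \<le> m"
  show "stays_within X x m s \<omega>" unfolding stays_within_def
  proof
    fix q :: rat assume "q \<in> {0..1}"
    then show "\<bar>X (of_rat q * s) \<omega> - x\<bar> \<le> m" using assms(2) R by (auto simp: mult_left_le_one_le)
  qed
qed

lemma localizer_stays_within:
  assumes ad: "adapted F X" and cont: "\<And>\<omega>. \<omega> \<in> space M \<Longrightarrow> continuous_on {0..} (\<lambda>s. X s \<omega>)"
  shows "localizer (stays_within X x m)"
  unfolding localizer_def
proof (intro conjI allI impI ballI)
  fix s :: real assume s: "0 \<le> s"
  have X: "X (of_rat q * s) \<in> borel_measurable (F s)" if "q \<in> {0..1}" for q :: rat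
  proof -
    have "0 \<le> of_rat q * s" "of_rat q * s \<le> s" using that s by (auto simp: mult_left_le_one_le)
    then show ?thesis using ad measurable_F_mono[of "of_rat q * s" s "X (of_rat q * s)" borel] by (auto simp: adapted_def)
  qed
  have "Measurable.pred (F s) (\<lambda>\<omega>. stays_within X x m s \<omega>)"
    unfolding stays_within_def
  proof (rule pred_intros_countable_bounded(3))
    fix q :: rat assume "q \<in> {0..1}"
    note [measurable] = X[OF this]
    show "Measurable.pred (F s) (\<lambda>\<omega>. \<bar>X (of_rat q * s) \<omega> - x\<bar> \<le> m)" by measurable
  qed
  then show "{\<omega>\<in>space M. stays_within X x m s \<omega>} \<in> sets (F s)" using space_F[OF s] by (simp add: pred_def)
next
  fix \<omega> r s assume \<omega>: "\<omega> \<in> space M" and rs: "0 \<le> r" "r \<le> s" "stays_within X x m s \<omega>"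
  then show "stays_within X x m r \<omega>"
    using stays_within_iff[of X \<omega> r x m] stays_within_iff[of X \<omega> s x m] cont[OF \<omega>] by auto
next
  have XM: "X s \<in> borel_measurable M" if "0 \<le> s" for s
    using ad that measurable_F_M[OF that] by (auto simp: adapted_def)
  note [measurable] = continuous_process_measurable_pair[of X, OF XM cont]
  have "Measurable.pred (borel \<Otimes>\<^sub>M M) (\<lambda>z. stays_within X x m (max 0 (fst z)) (snd z))"
    unfolding stays_within_def
  proof (rule pred_intros_countable_bounded(3))
    fix q :: rat assume q: "q \<in> {0..1}"
    have max_eq: "max 0 (of_rat q * max 0 y) = of_rat q * max 0 y" for y :: real
      using q by (intro max_absorb2 mult_nonneg_nonneg) auto
    have "Measurable.pred (borel \<Otimes>\<^sub>M M) (\<lambda>z. \<bar>X (max 0 (of_rat q * max 0 (fst z))) (snd z) - x\<bar> \<le> m)" by measurable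
    then show "Measurable.pred (borel \<Otimes>\<^sub>M M) (\<lambda>z. \<bar>X (of_rat q * max 0 (fst z)) (snd z) - x\<bar> \<le> m)"
      by (simp only: max_eq)
  qed
  then have "(\<lambda>z. if stays_within X x m (max 0 (fst z)) (snd z) then 1 else 0 :: real) \<in> borel_measurable (borel \<Otimes>\<^sub>M M)"
    by measurable
  then show "(\<lambda>(s, \<omega>). of_bool (stays_within X x m (max 0 s) \<omega>) :: real) \<in> borel_measurable (borel \<Otimes>\<^sub>M M)"
    by (simp add: case_prod_beta of_bool_def)
qed

end

section \<open>Second moments of solutions for small times\<close>

lemma ennreal_of_bool: "ennreal (of_bool P) = of_bool P"
  by (cases P) simp_all

locale volterra_solution = brownian_motion M F B
  for M :: "'a measure" and F :: "real \<Rightarrow> 'a measure" and B :: "real \<Rightarrow> 'a \<Rightarrow> real" +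
  fixes K b \<sigma> :: "real \<Rightarrow> real" and x :: real and X :: "real \<Rightarrow> 'a \<Rightarrow> real" and A :: real
  assumes K: "L2_loc K" and sol: "continuous_weak_solution K b \<sigma> x M F B X"
    and b_meas: "b \<in> borel_measurable borel" and \<sigma>_meas: "\<sigma> \<in> borel_measurable borel"
    and growth: "\<And>y. (b y)\<^sup>2 + (\<sigma> y)\<^sup>2 \<le> A * (1 + (y - x)\<^sup>2)"
begin

lemma A_nonneg: "0 \<le> A"
  using growth[of x] by (smt (verit) diff_self mult_cancel_left1 zero_le_power2 zero_power2)

lemma adapted_X: "adapted F X" and continuous_X: "\<omega> \<in> space M \<Longrightarrow> continuous_on {0..} (\<lambda>s. X s \<omega>)"
  using sol by (auto simp: continuous_weak_solution_def)

lemma X_measurable: "0 \<le> s \<Longrightarrow> X s \<in> borel_measurable M"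
  using adapted_X measurable_F_M by (auto simp: adapted_def)

lemma X_measurable_pair: "(\<lambda>(s, \<omega>). X (max 0 s) \<omega>) \<in> borel_measurable (borel \<Otimes>\<^sub>M M)"
  using continuous_process_measurable_pair[OF X_measurable continuous_X] .

abbreviation stays :: "real \<Rightarrow> real \<Rightarrow> 'a \<Rightarrow> bool" where
  "stays \<equiv> stays_within X x"

lemma localizer_stays: "localizer (stays m)"
  by (rule localizer_stays_within[OF adapted_X continuous_X])

lemma stays_iff: "\<omega> \<in> space M \<Longrightarrow> 0 \<le> s \<Longrightarrow> stays m s \<omega> \<longleftrightarrow> (\<forall>y\<in>{0..s}. \<bar>X y \<omega> - x\<bar> \<le> m)"
  using stays_within_iff[OF continuous_X] .

lemma stays_measurable: "0 \<le> s \<Longrightarrow> (\<lambda>\<omega>. of_bool (stays m s \<omega>) :: ennreal) \<in> borel_measurable M"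
proof -
  assume s: "0 \<le> s"
  have "(\<lambda>\<omega>. ennreal (of_bool (stays m s \<omega>))) \<in> borel_measurable M"
    using localizer_measurable[OF localizer_stays s] by simp
  then show ?thesis by (simp only: ennreal_of_bool)
qed

text \<open>Continuous paths are bounded on \<open>[0, t]\<close>, so that the events exhaust the space as
  \<open>m\<close> grows, and monotone convergence applies.\<close>
lemma nn_integral_le_if_stays:
  assumes t: "0 \<le> t" and f [measurable]: "f \<in> borel_measurable M"
    and bd: "\<And>m :: nat. (\<integral>\<^sup>+\<omega>. f \<omega> * of_bool (stays (real m) t \<omega>) \<partial>M) \<le> c"
  shows "(\<integral>\<^sup>+\<omega>. f \<omega> \<partial>M) \<le> c"
proof -
  note [measurable] = stays_measurable[OF t]
  have mono: "stays (real m) t \<omega> \<Longrightarrow> m \<le> m' \<Longrightarrow> stays (real m') t \<omega>" for m m' \<omega>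
    unfolding stays_within_def by (meson of_nat_le_iff order_trans)
  have "(\<integral>\<^sup>+\<omega>. f \<omega> \<partial>M) = (\<integral>\<^sup>+\<omega>. (SUP m. f \<omega> * of_bool (stays (real m) t \<omega>)) \<partial>M)"
  proof (rule nn_integral_cong, rule sym, rule LIMSEQ_unique[OF LIMSEQ_SUP])
    fix \<omega> assume \<omega>: "\<omega> \<in> space M"
    show "incseq (\<lambda>m. f \<omega> * of_bool (stays (real m) t \<omega>))"
      unfolding incseq_def using mono[of _ \<omega>] by (auto intro!: mult_left_mono)
    have "bounded ((\<lambda>s. X s \<omega>) ` {0..t})"
      by (intro compact_imp_bounded compact_continuous_image continuous_on_subset[OF continuous_X[OF \<omega>]]) auto
    then obtain c where c: "\<forall>s\<in>{0..t}. \<bar>X s \<omega>\<bar> \<le> c" by (auto simp only: bounded_iff ball_simps real_norm_def)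
    obtain n :: nat where n: "c + \<bar>x\<bar> \<le> n" using real_arch_simple by blast
    have "stays (real m) t \<omega>" if "n \<le> m" for m
      unfolding stays_iff[OF \<omega> t]
    proof
      fix y assume "y \<in> {0..t}"
      then have "\<bar>X y \<omega>\<bar> \<le> c" using c by blast
      moreover have "real n \<le> real m" using that by simp
      ultimately show "\<bar>X y \<omega> - x\<bar> \<le> real m" using n by linarith
    qed
    then show "(\<lambda>m. f \<omega> * of_bool (stays (real m) t \<omega>)) \<longlonglongrightarrow> f \<omega>"
      by (intro tendsto_eventually eventually_sequentiallyI[of n]) simp
  qed
  also have "\<dots> = (SUP m. \<integral>\<^sup>+\<omega>. f \<omega> * of_bool (stays (real m) t \<omega>) \<partial>M)"
  proof (rule nn_integral_monotone_convergence_SUP)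
    show "incseq (\<lambda>m \<omega>. f \<omega> * of_bool (stays (real m) t \<omega>))"
      unfolding incseq_def le_fun_def using mono by (auto intro!: mult_left_mono)
  qed measurable
  also have "\<dots> \<le> c" by (rule SUP_least) (rule bd)
  finally show ?thesis .
qed

lemma stays_measurable_pair: "(\<lambda>(s, \<omega>). of_bool (stays m (max 0 s) \<omega>) :: real) \<in> borel_measurable (borel \<Otimes>\<^sub>M M)"
  using localizer_stays by (simp add: localizer_def)

lemma fubini_stays:
  fixes f :: "real \<Rightarrow> real"
  assumes f [measurable]: "f \<in> borel_measurable borel" and t: "0 \<le> t"
  shows "(\<integral>\<^sup>+\<omega>. (\<integral>\<^sup>+s\<in>{0..t}. ennreal ((K (t - s))\<^sup>2) * ennreal (f (X s \<omega>)) * of_bool (stays m s \<omega>) \<partial>lborel) \<partial>M) =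
    (\<integral>\<^sup>+s\<in>{0..t}. ennreal ((K (t - s))\<^sup>2) * (\<integral>\<^sup>+\<omega>. ennreal (f (X s \<omega>)) * of_bool (stays m s \<omega>) \<partial>M) \<partial>lborel)"
proof -
  interpret P: pair_sigma_finite lborel M ..
  note [measurable] = L2_loc_reflected_measurable[OF K, of t] X_measurable_pair stays_measurable_pair[of m] stays_measurable
  define k where "k = (\<lambda>s. ennreal ((indicator {0..t} s * K (t - s))\<^sup>2))"
  have [measurable]: "k \<in> borel_measurable borel" unfolding k_def by measurable
  have keq: "k s = ennreal ((K (t - s))\<^sup>2) * indicator {0..t} s" for s by (simp add: k_def indicator_def)
  have mf: "(\<lambda>(s, \<omega>). k s * (ennreal (f (X (max 0 s) \<omega>)) * ennreal (of_bool (stays m (max 0 s) \<omega>)))) \<in> borel_measurable (lborel \<Otimes>\<^sub>M M)"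
    by measurable
  have "(\<integral>\<^sup>+\<omega>. (\<integral>\<^sup>+s\<in>{0..t}. ennreal ((K (t - s))\<^sup>2) * ennreal (f (X s \<omega>)) * of_bool (stays m s \<omega>) \<partial>lborel) \<partial>M)
      = (\<integral>\<^sup>+\<omega>. (\<integral>\<^sup>+s. k s * (ennreal (f (X (max 0 s) \<omega>)) * ennreal (of_bool (stays m (max 0 s) \<omega>))) \<partial>lborel) \<partial>M)"
    by (intro nn_integral_cong) (auto simp: keq indicator_def max_def mult_ac)
  also have "\<dots> = (\<integral>\<^sup>+s. (\<integral>\<^sup>+\<omega>. k s * (ennreal (f (X (max 0 s) \<omega>)) * ennreal (of_bool (stays m (max 0 s) \<omega>))) \<partial>M) \<partial>lborel)"
    by (rule P.Fubini'[OF mf])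
  also have "\<dots> = (\<integral>\<^sup>+s\<in>{0..t}. ennreal ((K (t - s))\<^sup>2) * (\<integral>\<^sup>+\<omega>. ennreal (f (X s \<omega>)) * of_bool (stays m s \<omega>) \<partial>M) \<partial>lborel)"
  proof (rule nn_integral_cong)
    fix s
    have [measurable]: "X (max 0 s) \<in> borel_measurable M" "(\<lambda>\<omega>. of_bool (stays m (max 0 s) \<omega>) :: ennreal) \<in> borel_measurable M"
      using X_measurable[of "max 0 s"] stays_measurable[of "max 0 s"] by auto
    have "(\<integral>\<^sup>+\<omega>. k s * (ennreal (f (X (max 0 s) \<omega>)) * ennreal (of_bool (stays m (max 0 s) \<omega>))) \<partial>M)
       = k s * (\<integral>\<^sup>+\<omega>. ennreal (f (X (max 0 s) \<omega>)) * of_bool (stays m (max 0 s) \<omega>) \<partial>M)"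
      unfolding ennreal_of_bool by (rule nn_integral_cmult) measurable
    then show "(\<integral>\<^sup>+\<omega>. k s * (ennreal (f (X (max 0 s) \<omega>)) * ennreal (of_bool (stays m (max 0 s) \<omega>))) \<partial>M) =
       ennreal ((K (t - s))\<^sup>2) * (\<integral>\<^sup>+\<omega>. ennreal (f (X s \<omega>)) * of_bool (stays m s \<omega>) \<partial>M) * indicator {0..t} s"
      by (cases "s \<in> {0..t}") (auto simp: keq max_def)
  qed
  finally show ?thesis .
qed

text \<open>The drift is estimated by Cauchy--Schwarz and the martingale part by
  \<open>localized_ito_bound\<close>. The latter needs a deterministic bound for the energy of the integrand;
  linear growth provides it as long as the path stays within \<open>m\<close>.\<close>
lemma localized_increment_bound:
  assumes t: "0 \<le> t" and h: "simple_process M F h" and hd: "\<And>s \<omega>. simple_value h s \<omega> = \<eta> s" and \<eta>: "square_integrable \<eta>"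
  shows "(\<integral>\<^sup>+\<omega>. ennreal ((X t \<omega> - x - simple_integral B h t \<omega>)\<^sup>2) * of_bool (stays m t \<omega>) \<partial>M) \<le>
    2 * (ennreal t * (\<integral>\<^sup>+\<omega>. (\<integral>\<^sup>+s\<in>{0..t}. ennreal ((K (t - s))\<^sup>2) * ennreal ((b (X s \<omega>))\<^sup>2) * of_bool (stays m s \<omega>) \<partial>lborel) \<partial>M))
    + 2 * (\<integral>\<^sup>+\<omega>. (\<integral>\<^sup>+s\<in>{0..t}. ennreal ((K (t - s) * \<sigma> (X s \<omega>) - \<eta> s)\<^sup>2 * of_bool (stays m s \<omega>)) \<partial>lborel) \<partial>M)"
proof -
  note [measurable] = b_meas \<sigma>_meas L2_loc_reflected_measurable[OF K, of t] X_measurable_pair stays_measurable_pair[of m] stays_measurable[OF t] X_measurable[OF t]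
    simple_integral_measurable[OF h t]
  obtain I where I: "has_ito_integral M F B (\<lambda>s \<omega>. K (t - s) * \<sigma> (X s \<omega>)) t I"
    and Xeq: "AE \<omega> in M. X t \<omega> = x + (LBINT s:{0..t}. K (t - s) * b (X s \<omega>)) + I \<omega>"
    using sol t unfolding continuous_weak_solution_def by blast
  have [measurable]: "I \<in> borel_measurable M" using I by (simp add: has_ito_integral_def)
  define k where "k = (\<lambda>s. indicator {0..t} s * K (t - s))"
  have [measurable]: "k \<in> borel_measurable borel" unfolding k_def by measurable
  define d where "d = (\<lambda>\<omega>. \<integral>\<^sup>+s\<in>{0..t}. ennreal ((K (t - s))\<^sup>2) * ennreal ((b (X s \<omega>))\<^sup>2) * of_bool (stays m s \<omega>) \<partial>lborel)"
  have d_eq: "d \<omega> = (\<integral>\<^sup>+s. ennreal ((k s)\<^sup>2) * (ennreal ((b (X (max 0 s) \<omega>))\<^sup>2) * ennreal (of_bool (stays m (max 0 s) \<omega>))) \<partial>lborel)" for \<omega>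
    unfolding d_def k_def by (intro nn_integral_cong) (auto simp: indicator_def max_def mult_ac)
  have [measurable]: "d \<in> borel_measurable M" unfolding d_eq by measurable
  define R where "R = 2 * (A * (1 + m\<^sup>2)) * (LBINT s:{0..t}. (K s)\<^sup>2) + 2 * (\<integral>s. (\<eta> s)\<^sup>2 \<partial>lborel)"
  have ito: "(\<integral>\<^sup>+\<omega>. ennreal ((I \<omega> - simple_integral B h t \<omega>)\<^sup>2) * of_bool (stays m t \<omega>) \<partial>M)
    \<le> (\<integral>\<^sup>+\<omega>. (\<integral>\<^sup>+s\<in>{0..t}. ennreal ((K (t - s) * \<sigma> (X s \<omega>) - \<eta> s)\<^sup>2 * of_bool (stays m s \<omega>)) \<partial>lborel) \<partial>M)"
    unfolding hd[symmetric]
  proof (rule localized_ito_bound[OF I t h localizer_stays, of m R, unfolded hd])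
    fix \<omega> assume \<omega>: "\<omega> \<in> space M"
    have "(\<integral>\<^sup>+s\<in>{0..t}. ennreal ((K (t - s) * \<sigma> (X s \<omega>) - \<eta> s)\<^sup>2 * of_bool (stays m s \<omega>)) \<partial>lborel)
      \<le> (\<integral>\<^sup>+s. ennreal (2 * (A * (1 + m\<^sup>2))) * (ennreal ((K (t - s))\<^sup>2) * indicator {0..t} s) + 2 * ennreal ((\<eta> s)\<^sup>2) \<partial>lborel)"
    proof (rule nn_integral_mono)
      fix s
      show "ennreal ((K (t - s) * \<sigma> (X s \<omega>) - \<eta> s)\<^sup>2 * of_bool (stays m s \<omega>)) * indicator {0..t} s
        \<le> ennreal (2 * (A * (1 + m\<^sup>2))) * (ennreal ((K (t - s))\<^sup>2) * indicator {0..t} s) + 2 * ennreal ((\<eta> s)\<^sup>2)"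
      proof (cases "s \<in> {0..t} \<and> stays m s \<omega>")
        case True
        then have "\<bar>X s \<omega> - x\<bar> \<le> m" using stays_iff[OF \<omega>, of s m] by auto
        then have "(X s \<omega> - x)\<^sup>2 \<le> m\<^sup>2" using abs_le_square_iff[of "X s \<omega> - x" m] by linarith
        then have "A * (1 + (X s \<omega> - x)\<^sup>2) \<le> A * (1 + m\<^sup>2)" using A_nonneg by (intro mult_left_mono) auto
        then have s2: "(\<sigma> (X s \<omega>))\<^sup>2 \<le> A * (1 + m\<^sup>2)" using growth[of "X s \<omega>"] zero_le_power2[of "b (X s \<omega>)"] by linarith
        have "(K (t - s) * \<sigma> (X s \<omega>) - \<eta> s)\<^sup>2 \<le> 2 * (K (t - s) * \<sigma> (X s \<omega>))\<^sup>2 + 2 * (\<eta> s)\<^sup>2"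
          using sum_squares_bound[of "K (t - s) * \<sigma> (X s \<omega>)" "- \<eta> s"] by (simp add: power2_diff)
        also have "(K (t - s) * \<sigma> (X s \<omega>))\<^sup>2 \<le> (K (t - s))\<^sup>2 * (A * (1 + m\<^sup>2))"
          unfolding power_mult_distrib by (intro mult_left_mono s2) auto
        finally have "(K (t - s) * \<sigma> (X s \<omega>) - \<eta> s)\<^sup>2 \<le> 2 * (A * (1 + m\<^sup>2)) * (K (t - s))\<^sup>2 + 2 * (\<eta> s)\<^sup>2" by (simp add: algebra_simps)
        then have "ennreal ((K (t - s) * \<sigma> (X s \<omega>) - \<eta> s)\<^sup>2) \<le> ennreal (2 * (A * (1 + m\<^sup>2)) * (K (t - s))\<^sup>2 + 2 * (\<eta> s)\<^sup>2)" by (rule ennreal_leI)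
        also have "\<dots> = ennreal (2 * (A * (1 + m\<^sup>2))) * ennreal ((K (t - s))\<^sup>2) + 2 * ennreal ((\<eta> s)\<^sup>2)"
          using A_nonneg by (simp add: ennreal_plus ennreal_mult)
        finally show ?thesis using True by simp
      qed auto
    qed
    also have "\<dots> = ennreal (2 * (A * (1 + m\<^sup>2))) * (\<integral>\<^sup>+s\<in>{0..t}. ennreal ((K (t - s))\<^sup>2) \<partial>lborel) + 2 * (\<integral>\<^sup>+s. ennreal ((\<eta> s)\<^sup>2) \<partial>lborel)"
    proof -
      have [measurable]: "(\<lambda>s. ennreal ((K (t - s))\<^sup>2) * indicator {0..t} s) \<in> borel_measurable borel"
      proof -
        have "(\<lambda>s. ennreal ((k s)\<^sup>2)) \<in> borel_measurable borel" by measurable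
        also have "(\<lambda>s. ennreal ((k s)\<^sup>2)) = (\<lambda>s. ennreal ((K (t - s))\<^sup>2) * indicator {0..t} s)" by (auto simp: k_def indicator_def)
        finally show ?thesis .
      qed
      have [measurable]: "\<eta> \<in> borel_measurable borel" using \<eta> by (simp add: square_integrable_def)
      show ?thesis by (simp add: nn_integral_add nn_integral_cmult)
    qed
    also have "\<dots> = ennreal R"
    proof -
      have "(\<integral>\<^sup>+s. ennreal ((\<eta> s)\<^sup>2) \<partial>lborel) = ennreal (\<integral>s. (\<eta> s)\<^sup>2 \<partial>lborel)"
        using \<eta> by (intro nn_integral_eq_integral) (auto simp: square_integrable_def)
      moreover have "0 \<le> (LBINT s:{0..t}. (K s)\<^sup>2)" by (simp add: set_lebesgue_integral_def)
      ultimately show ?thesis unfolding L2_loc_nn_integral[OF K t] R_def using A_nonneg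
        by (simp add: ennreal_plus ennreal_mult)
    qed
    finally show "(\<integral>\<^sup>+s\<in>{0..t}. ennreal ((K (t - s) * \<sigma> (X s \<omega>) - \<eta> s)\<^sup>2 * of_bool (stays m s \<omega>)) \<partial>lborel) \<le> ennreal R" .
  qed
  have "(\<integral>\<^sup>+\<omega>. ennreal ((X t \<omega> - x - simple_integral B h t \<omega>)\<^sup>2) * of_bool (stays m t \<omega>) \<partial>M)
     \<le> (\<integral>\<^sup>+\<omega>. 2 * (ennreal t * d \<omega>) + 2 * (ennreal ((I \<omega> - simple_integral B h t \<omega>)\<^sup>2) * of_bool (stays m t \<omega>)) \<partial>M)"
  proof (rule nn_integral_mono_AE)
    show "AE \<omega> in M. ennreal ((X t \<omega> - x - simple_integral B h t \<omega>)\<^sup>2) * of_bool (stays m t \<omega>)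
       \<le> 2 * (ennreal t * d \<omega>) + 2 * (ennreal ((I \<omega> - simple_integral B h t \<omega>)\<^sup>2) * of_bool (stays m t \<omega>))"
      using Xeq AE_space
    proof eventually_elim
      case (elim \<omega>)
      show ?case
      proof (cases "stays m t \<omega>")
        case True
        let ?D = "LBINT s:{0..t}. K (t - s) * b (X s \<omega>)"
        have "(\<lambda>s. k s * b (X (max 0 s) \<omega>)) \<in> borel_measurable borel"
        proof -
          have "(\<lambda>s. X (max 0 s) \<omega>) \<in> borel_measurable borel"
            using measurable_compose[OF measurable_Pair2'[OF elim(2), of borel] X_measurable_pair]
            by (simp add: case_prod_beta)
          then show ?thesis by measurable
        qed
        also have "(\<lambda>s. k s * b (X (max 0 s) \<omega>)) = (\<lambda>s. indicator {0..t} s * (K (t - s) * b (X s \<omega>)))"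
          by (auto simp: k_def indicator_def max_def)
        finally have mk: "(\<lambda>s. indicator {0..t} s * (K (t - s) * b (X s \<omega>))) \<in> borel_measurable borel" .
        have "ennreal (?D\<^sup>2) \<le> ennreal t * (\<integral>\<^sup>+s\<in>{0..t}. ennreal ((K (t - s) * b (X s \<omega>))\<^sup>2) \<partial>lborel)"
          by (rule square_set_integral_le[OF mk t])
        also have "(\<integral>\<^sup>+s\<in>{0..t}. ennreal ((K (t - s) * b (X s \<omega>))\<^sup>2) \<partial>lborel) = d \<omega>"
          unfolding d_def
        proof (intro nn_integral_cong)
          fix s
          have "stays m s \<omega>" if "s \<in> {0..t}"
            using True that stays_iff[OF elim(2), of s m] stays_iff[OF elim(2) t, of m] by auto
          then show "ennreal ((K (t - s) * b (X s \<omega>))\<^sup>2) * indicator {0..t} s =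
            ennreal ((K (t - s))\<^sup>2) * ennreal ((b (X s \<omega>))\<^sup>2) * of_bool (stays m s \<omega>) * indicator {0..t} s"
            by (auto simp: indicator_def power_mult_distrib ennreal_mult)
        qed
        finally have D: "ennreal (?D\<^sup>2) \<le> ennreal t * d \<omega>" .
        have "(X t \<omega> - x - simple_integral B h t \<omega>)\<^sup>2 = (?D + (I \<omega> - simple_integral B h t \<omega>))\<^sup>2"
          unfolding elim(1) by (simp add: algebra_simps)
        also have "\<dots> \<le> 2 * ?D\<^sup>2 + 2 * (I \<omega> - simple_integral B h t \<omega>)\<^sup>2"
          using sum_squares_bound[of ?D "I \<omega> - simple_integral B h t \<omega>"] by (simp add: power2_sum)
        finally have "ennreal ((X t \<omega> - x - simple_integral B h t \<omega>)\<^sup>2) \<le> ennreal (2 * ?D\<^sup>2 + 2 * (I \<omega> - simple_integral B h t \<omega>)\<^sup>2)"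
          by (rule ennreal_leI)
        also have "\<dots> = 2 * ennreal (?D\<^sup>2) + 2 * ennreal ((I \<omega> - simple_integral B h t \<omega>)\<^sup>2)"
          by (simp add: ennreal_plus ennreal_mult)
        also have "\<dots> \<le> 2 * (ennreal t * d \<omega>) + 2 * ennreal ((I \<omega> - simple_integral B h t \<omega>)\<^sup>2)"
          by (intro add_right_mono mult_left_mono D) auto
        finally show ?thesis using True by simp
      qed simp
    qed
  qed
  also have "\<dots> = 2 * (ennreal t * (\<integral>\<^sup>+\<omega>. d \<omega> \<partial>M)) + 2 * (\<integral>\<^sup>+\<omega>. ennreal ((I \<omega> - simple_integral B h t \<omega>)\<^sup>2) * of_bool (stays m t \<omega>) \<partial>M)"
    by (simp add: nn_integral_add nn_integral_cmult)
  also have "\<dots> \<le> 2 * (ennreal t * (\<integral>\<^sup>+\<omega>. d \<omega> \<partial>M)) + 2 * (\<integral>\<^sup>+\<omega>. (\<integral>\<^sup>+s\<in>{0..t}. ennreal ((K (t - s) * \<sigma> (X s \<omega>) - \<eta> s)\<^sup>2 * of_bool (stays m s \<omega>)) \<partial>lborel) \<partial>M)"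
    by (intro add_left_mono mult_left_mono ito) auto
  finally show ?thesis unfolding d_def .
qed

text \<open>A pointwise quadratic bound for \<open>f\<close> turns a second moment \<open>p\<close> of the
  solution into a bound for the kernel-weighted integral of \<open>f(X)\<close>. It serves for
  \<open>b\<^sup>2\<close>, for \<open>\<sigma>\<^sup>2\<close> and for \<open>(\<sigma>(X) -
  \<sigma>(x))\<^sup>2\<close>.\<close>
lemma fubini_growth_bound:
  fixes f :: "real \<Rightarrow> real"
  assumes f [measurable]: "f \<in> borel_measurable borel" and fb: "\<And>y. f y \<le> w * (1 + c * (y - x)\<^sup>2)"
    and wc: "0 \<le> w" "0 \<le> c" and t: "0 \<le> t" and p: "0 \<le> p"
    and mom: "\<And>s. 0 \<le> s \<Longrightarrow> s \<le> t \<Longrightarrow> (\<integral>\<^sup>+\<omega>. ennreal ((X s \<omega> - x)\<^sup>2) * of_bool (stays m s \<omega>) \<partial>M) \<le> ennreal p"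
  shows "(\<integral>\<^sup>+\<omega>. (\<integral>\<^sup>+s\<in>{0..t}. ennreal ((K (t - s))\<^sup>2) * ennreal (f (X s \<omega>)) * of_bool (stays m s \<omega>) \<partial>lborel) \<partial>M)
    \<le> ennreal (w * (1 + c * p) * (LBINT s:{0..t}. (K s)\<^sup>2))"
proof -
  note [measurable] = L2_loc_reflected_measurable[OF K, of t]
  have inner: "(\<integral>\<^sup>+\<omega>. ennreal (f (X s \<omega>)) * of_bool (stays m s \<omega>) \<partial>M) \<le> ennreal (w * (1 + c * p))" if s: "0 \<le> s" "s \<le> t" for s
  proof -
    note [measurable] = X_measurable[OF s(1)] stays_measurable[OF s(1)]
    have "(\<integral>\<^sup>+\<omega>. ennreal (f (X s \<omega>)) * of_bool (stays m s \<omega>) \<partial>M)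
      \<le> (\<integral>\<^sup>+\<omega>. ennreal w + ennreal (w * c) * (ennreal ((X s \<omega> - x)\<^sup>2) * of_bool (stays m s \<omega>)) \<partial>M)"
    proof (rule nn_integral_mono)
      fix \<omega>
      have "ennreal (f (X s \<omega>)) \<le> ennreal (w + w * c * (X s \<omega> - x)\<^sup>2)"
        using fb[of "X s \<omega>"] by (intro ennreal_leI) (simp add: algebra_simps)
      also have "\<dots> = ennreal w + ennreal (w * c) * ennreal ((X s \<omega> - x)\<^sup>2)"
        using wc by (simp add: ennreal_plus ennreal_mult)
      finally show "ennreal (f (X s \<omega>)) * of_bool (stays m s \<omega>) \<le> ennreal w + ennreal (w * c) * (ennreal ((X s \<omega> - x)\<^sup>2) * of_bool (stays m s \<omega>))"
        by (cases "stays m s \<omega>") auto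
    qed
    also have "\<dots> = ennreal w + ennreal (w * c) * (\<integral>\<^sup>+\<omega>. ennreal ((X s \<omega> - x)\<^sup>2) * of_bool (stays m s \<omega>) \<partial>M)"
      by (simp add: nn_integral_add nn_integral_cmult emeasure_space_1)
    also have "\<dots> \<le> ennreal w + ennreal (w * c) * ennreal p"
      by (intro add_left_mono mult_left_mono mom s) auto
    also have "\<dots> = ennreal (w * (1 + c * p))" using wc p by (simp add: ennreal_plus ennreal_mult algebra_simps)
    finally show ?thesis .
  qed
  have "(\<integral>\<^sup>+\<omega>. (\<integral>\<^sup>+s\<in>{0..t}. ennreal ((K (t - s))\<^sup>2) * ennreal (f (X s \<omega>)) * of_bool (stays m s \<omega>) \<partial>lborel) \<partial>M)
    = (\<integral>\<^sup>+s\<in>{0..t}. ennreal ((K (t - s))\<^sup>2) * (\<integral>\<^sup>+\<omega>. ennreal (f (X s \<omega>)) * of_bool (stays m s \<omega>) \<partial>M) \<partial>lborel)"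
    by (rule fubini_stays[OF f t])
  also have "\<dots> \<le> (\<integral>\<^sup>+s. ennreal (w * (1 + c * p)) * ennreal ((indicator {0..t} s * K (t - s))\<^sup>2) \<partial>lborel)"
  proof (rule nn_integral_mono)
    fix s
    show "ennreal ((K (t - s))\<^sup>2) * (\<integral>\<^sup>+\<omega>. ennreal (f (X s \<omega>)) * of_bool (stays m s \<omega>) \<partial>M) * indicator {0..t} s
      \<le> ennreal (w * (1 + c * p)) * ennreal ((indicator {0..t} s * K (t - s))\<^sup>2)"
    proof (cases "s \<in> {0..t}")
      case True
      then have "ennreal ((K (t - s))\<^sup>2) * (\<integral>\<^sup>+\<omega>. ennreal (f (X s \<omega>)) * of_bool (stays m s \<omega>) \<partial>M) \<le> ennreal ((K (t - s))\<^sup>2) * ennreal (w * (1 + c * p))"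
        by (intro mult_left_mono inner) auto
      then show ?thesis using True by (simp add: mult.commute)
    qed simp
  qed
  also have "\<dots> = ennreal (w * (1 + c * p)) * (\<integral>\<^sup>+s. ennreal ((indicator {0..t} s * K (t - s))\<^sup>2) \<partial>lborel)"
    by (rule nn_integral_cmult) measurable
  also have "(\<integral>\<^sup>+s. ennreal ((indicator {0..t} s * K (t - s))\<^sup>2) \<partial>lborel) = (\<integral>\<^sup>+s\<in>{0..t}. ennreal ((K (t - s))\<^sup>2) \<partial>lborel)"
    by (intro nn_integral_cong) (auto simp: indicator_def)
  also have "\<dots> = ennreal (LBINT s:{0..t}. (K s)\<^sup>2)" by (rule L2_loc_nn_integral[OF K t])
  also have "ennreal (w * (1 + c * p)) * ennreal (LBINT s:{0..t}. (K s)\<^sup>2) = ennreal (w * (1 + c * p) * (LBINT s:{0..t}. (K s)\<^sup>2))"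
    using wc p by (subst ennreal_mult) (auto simp: set_lebesgue_integral_def)
  finally show ?thesis .
qed

text \<open>Let \<open>\<Phi>\<close> be the supremum of the left-hand sides over \<open>t \<le> T\<close>. It
  is finite, at most \<open>m\<^sup>2\<close>, by localisation, and the equation gives \<open>\<Phi> \<le>
  4A\<kappa> (1 + \<Phi>)\<close>. For small \<open>\<kappa>\<close> the term with \<open>\<Phi>\<close> is
  absorbed, and the result no longer depends on \<open>m\<close>.\<close>
lemma localized_second_moment_bound:
  fixes m :: nat and T :: real
  defines "\<kappa> \<equiv> LBINT r:{0..T}. (K r)\<^sup>2"
  assumes T: "0 \<le> T" "T \<le> 1" and \<kappa>: "8 * A * \<kappa> \<le> 1" and t: "0 \<le> t" "t \<le> T"
  shows "(\<integral>\<^sup>+\<omega>. ennreal ((X t \<omega> - x)\<^sup>2) * of_bool (stays m t \<omega>) \<partial>M) \<le> ennreal (8 * A * \<kappa>)"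
proof -
  define \<phi> where "\<phi> = (\<lambda>s. \<integral>\<^sup>+\<omega>. ennreal ((X s \<omega> - x)\<^sup>2) * of_bool (stays m s \<omega>) \<partial>M)"
  have \<phi>m: "\<phi> s \<le> ennreal ((real m)\<^sup>2)" if s: "0 \<le> s" for s
  proof -
    have "\<phi> s \<le> (\<integral>\<^sup>+\<omega>. ennreal ((real m)\<^sup>2) \<partial>M)"
      unfolding \<phi>_def
    proof (rule nn_integral_mono)
      fix \<omega> assume \<omega>: "\<omega> \<in> space M"
      show "ennreal ((X s \<omega> - x)\<^sup>2) * of_bool (stays m s \<omega>) \<le> ennreal ((real m)\<^sup>2)"
      proof (cases "stays m s \<omega>")
        case True
        then have "\<bar>X s \<omega> - x\<bar> \<le> \<bar>real m\<bar>" using stays_iff[OF \<omega> s] s by auto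
        then have "(X s \<omega> - x)\<^sup>2 \<le> (real m)\<^sup>2" by (simp only: abs_le_square_iff)
        then show ?thesis using True by (simp add: ennreal_leI)
      qed simp
    qed
    then show ?thesis by (simp add: emeasure_space_1)
  qed
  define \<Phi> where "\<Phi> = (SUP s\<in>{0..T}. \<phi> s)"
  have "\<Phi> \<le> ennreal ((real m)\<^sup>2)" unfolding \<Phi>_def using \<phi>m by (intro SUP_least) auto
  then have "\<Phi> < \<infinity>" by (simp add: le_less_trans)
  then obtain p where p: "\<Phi> = ennreal p" "0 \<le> p" by (cases \<Phi>) auto
  have \<kappa>0: "0 \<le> \<kappa>" by (simp add: \<kappa>_def set_lebesgue_integral_def)
  have step: "\<phi> s \<le> ennreal (4 * A * \<kappa> * (1 + p))" if s: "0 \<le> s" "s \<le> T" for s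
  proof -
    have mom: "(\<integral>\<^sup>+\<omega>. ennreal ((X r \<omega> - x)\<^sup>2) * of_bool (stays m r \<omega>) \<partial>M) \<le> ennreal p" if "0 \<le> r" "r \<le> s" for r
      unfolding p(1)[symmetric] \<Phi>_def using that s by (intro SUP_upper2[of r]) (auto simp: \<phi>_def)
    have gb: "(b y)\<^sup>2 \<le> A * (1 + 1 * (y - x)\<^sup>2)" and gs: "(\<sigma> y)\<^sup>2 \<le> A * (1 + 1 * (y - x)\<^sup>2)" for y
      using growth[of y] zero_le_power2[of "b y"] zero_le_power2[of "\<sigma> y"] unfolding mult_1 by linarith+
    have mb: "(\<lambda>y. (b y)\<^sup>2) \<in> borel_measurable borel" "(\<lambda>y. (\<sigma> y)\<^sup>2) \<in> borel_measurable borel"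
      using b_meas \<sigma>_meas by auto
    have ks: "(LBINT r:{0..s}. (K r)\<^sup>2) \<le> \<kappa>" unfolding \<kappa>_def by (rule L2_loc_energy_mono[OF K s])
    have Ap: "A * (1 + 1 * p) * (LBINT r:{0..s}. (K r)\<^sup>2) \<le> A * (1 + p) * \<kappa>"
      using A_nonneg p(2) ks by (simp add: mult_left_mono)
    (* the zero process *)
    let ?h = "deterministic_code 0 (\<lambda>_. 0) (\<lambda>_. 0) :: 'a simple_code"
    have "\<phi> s \<le> 2 * (ennreal s * (\<integral>\<^sup>+\<omega>. (\<integral>\<^sup>+r\<in>{0..s}. ennreal ((K (s - r))\<^sup>2) * ennreal ((b (X r \<omega>))\<^sup>2) * of_bool (stays m r \<omega>) \<partial>lborel) \<partial>M))
      + 2 * (\<integral>\<^sup>+\<omega>. (\<integral>\<^sup>+r\<in>{0..s}. ennreal ((K (s - r) * \<sigma> (X r \<omega>) - 0)\<^sup>2 * of_bool (stays m r \<omega>)) \<partial>lborel) \<partial>M)"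
      unfolding \<phi>_def
      using localized_increment_bound[OF s(1), of ?h "\<lambda>_. 0" m]
      by (simp add: deterministic_code_def square_integrable_def)
    also have "(\<integral>\<^sup>+\<omega>. (\<integral>\<^sup>+r\<in>{0..s}. ennreal ((K (s - r) * \<sigma> (X r \<omega>) - 0)\<^sup>2 * of_bool (stays m r \<omega>)) \<partial>lborel) \<partial>M)
      = (\<integral>\<^sup>+\<omega>. (\<integral>\<^sup>+r\<in>{0..s}. ennreal ((K (s - r))\<^sup>2) * ennreal ((\<sigma> (X r \<omega>))\<^sup>2) * of_bool (stays m r \<omega>) \<partial>lborel) \<partial>M)"
      by (simp add: power_mult_distrib ennreal_mult ennreal_of_bool)
    also have "\<dots> \<le> ennreal (A * (1 + 1 * p) * (LBINT r:{0..s}. (K r)\<^sup>2))"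
      by (rule fubini_growth_bound[OF mb(2) gs A_nonneg _ s(1) p(2) mom]) auto
    also have "\<dots> \<le> ennreal (A * (1 + p) * \<kappa>)" by (rule ennreal_leI[OF Ap])
    also have "(\<integral>\<^sup>+\<omega>. (\<integral>\<^sup>+r\<in>{0..s}. ennreal ((K (s - r))\<^sup>2) * ennreal ((b (X r \<omega>))\<^sup>2) * of_bool (stays m r \<omega>) \<partial>lborel) \<partial>M)
      \<le> ennreal (A * (1 + 1 * p) * (LBINT r:{0..s}. (K r)\<^sup>2))"
      by (rule fubini_growth_bound[OF mb(1) gb A_nonneg _ s(1) p(2) mom]) auto
    also have "\<dots> \<le> ennreal (A * (1 + p) * \<kappa>)" by (rule ennreal_leI[OF Ap])
    also have "ennreal s \<le> ennreal 1" using s T by (intro ennreal_leI) auto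
    finally have "\<phi> s \<le> 2 * (ennreal 1 * ennreal (A * (1 + p) * \<kappa>)) + 2 * ennreal (A * (1 + p) * \<kappa>)"
      by (simp add: mult_left_mono mult_right_mono add_mono)
    also have "\<dots> = ennreal (4 * A * \<kappa> * (1 + p))"
    proof -
      have "2 * ennreal y + 2 * ennreal y = ennreal (4 * y)" if "0 \<le> y" for y
        using that ennreal_plus[of "2 * y" "2 * y"] ennreal_mult[of 2 y] by simp
      from this[of "A * (1 + p) * \<kappa>"] show ?thesis using A_nonneg p(2) \<kappa>0 by (simp add: mult_ac)
    qed
    finally show ?thesis .
  qed
  have "\<Phi> \<le> ennreal (4 * A * \<kappa> * (1 + p))" unfolding \<Phi>_def using step by (intro SUP_least) auto
  then have "p \<le> 4 * A * \<kappa> * (1 + p)"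
    unfolding p(1) using A_nonneg \<kappa>0 p(2) by (subst (asm) ennreal_le_iff) auto
  moreover have "4 * A * \<kappa> * p \<le> 1/2 * p" using \<kappa> p(2) by (intro mult_right_mono) auto
  ultimately have "p \<le> 8 * A * \<kappa>" by (simp add: algebra_simps)
  moreover have "\<phi> t \<le> ennreal p" unfolding p(1)[symmetric] \<Phi>_def using t by (intro SUP_upper) auto
  ultimately show ?thesis unfolding \<phi>_def by (meson ennreal_leI order_trans)
qed

lemma second_moment_bound:
  fixes T :: real
  defines "\<kappa> \<equiv> LBINT r:{0..T}. (K r)\<^sup>2"
  assumes T: "0 \<le> T" "T \<le> 1" and \<kappa>: "8 * A * \<kappa> \<le> 1" and t: "0 \<le> t" "t \<le> T"
  shows "(\<integral>\<^sup>+\<omega>. ennreal ((X t \<omega> - x)\<^sup>2) \<partial>M) \<le> ennreal (8 * A * \<kappa>)"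
proof (rule nn_integral_le_if_stays[OF t(1)])
  show "(\<lambda>\<omega>. ennreal ((X t \<omega> - x)\<^sup>2)) \<in> borel_measurable M" using X_measurable[OF t(1)] by measurable
  show "(\<integral>\<^sup>+\<omega>. ennreal ((X t \<omega> - x)\<^sup>2) * of_bool (stays m t \<omega>) \<partial>M) \<le> ennreal (8 * A * \<kappa>)" for m :: nat
    unfolding \<kappa>_def by (rule localized_second_moment_bound[OF T \<kappa>[unfolded \<kappa>_def] t])
qed

text \<open>The increment is close to the Brownian integral of a step function. The three terms come from the
  drift, from replacing \<open>\<sigma>(X)\<close> by \<open>\<sigma>(x)\<close>, and from replacing the
  kernel by the step function. The bound for \<open>\<sigma>(y) - \<sigma>(x)\<close> is measured in units of
  the second moment \<open>8A\<kappa>\<close>, so that the expectation of its square is at most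
  \<open>2w\<close>.\<close>
lemma increment_approximation:
  fixes T :: real
  defines "\<kappa> \<equiv> LBINT r:{0..T}. (K r)\<^sup>2"
  assumes T: "0 \<le> T" "T \<le> 1" and \<kappa>: "8 * A * \<kappa> \<le> 1" "0 < 8 * A * \<kappa>" and t: "0 \<le> t" "t \<le> T"
    and w: "0 \<le> w" "\<And>y. (\<sigma> y - \<sigma> x)\<^sup>2 \<le> w * (1 + 1 / (8 * A * \<kappa>) * (y - x)\<^sup>2)"
    and g: "grid k u"
  shows "(\<integral>\<^sup>+\<omega>. ennreal ((X t \<omega> - x - simple_integral B (deterministic_code k u c) t \<omega>)\<^sup>2) \<partial>M) \<le>
    ennreal (4 * A * \<kappa> * t + 8 * w * \<kappa> + 4 * (\<integral>s. (\<sigma> x * (indicator {0..t} s * K (t - s)) - step_function k u c s)\<^sup>2 \<partial>lborel))"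
proof -
  define p where "p = 8 * A * \<kappa>"
  have p0: "0 < p" "p \<le> 1" using \<kappa> by (auto simp: p_def)
  have \<kappa>0: "0 \<le> \<kappa>" by (simp add: \<kappa>_def set_lebesgue_integral_def)
  have kt: "(LBINT r:{0..t}. (K r)\<^sup>2) \<le> \<kappa>" unfolding \<kappa>_def by (rule L2_loc_energy_mono[OF K t])
  have kt0: "0 \<le> (LBINT r:{0..t}. (K r)\<^sup>2)" by (simp add: set_lebesgue_integral_def)
  define \<eta> where "\<eta> = step_function k u c"
  have \<eta>: "square_integrable \<eta>" unfolding \<eta>_def by (rule square_integrable_step_function)
  let ?h = "deterministic_code k u c :: 'a simple_code"
  have h: "simple_process M F ?h" by (rule simple_process_deterministic[OF g])
  define D where "D = (\<integral>s. (\<sigma> x * (indicator {0..t} s * K (t - s)) - \<eta> s)\<^sup>2 \<partial>lborel)"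
  note [measurable] = b_meas \<sigma>_meas L2_loc_reflected_measurable[OF K, of t] X_measurable_pair X_measurable[OF t(1)]
    simple_integral_measurable[OF h t(1)]
  have [measurable]: "\<eta> \<in> borel_measurable borel" using \<eta> by (simp add: square_integrable_def)
  define kk where "kk = kernel_at K t"
  have kk: "kk s = indicator {0..t} s * K (t - s)" for s by (simp add: kk_def kernel_at_def)
  have kks: "square_integrable kk" unfolding kk_def by (rule square_integrable_kernel_at[OF K t(1)])
  then have [measurable]: "kk \<in> borel_measurable borel" by (simp add: square_integrable_def)
  have Dnn: "(\<integral>\<^sup>+s. ennreal ((\<sigma> x * kk s - \<eta> s)\<^sup>2) \<partial>lborel) = ennreal D"
    unfolding D_def kk[symmetric]
    using square_integrable_diff[OF square_integrable_cmult[OF kks, of "\<sigma> x"] \<eta>]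
    by (subst nn_integral_eq_integral[symmetric]) (auto simp: square_integrable_def)
  have D0: "0 \<le> D" by (simp add: D_def)
  have "(\<integral>\<^sup>+\<omega>. ennreal ((X t \<omega> - x - simple_integral B ?h t \<omega>)\<^sup>2) \<partial>M) \<le> ennreal (4 * A * \<kappa> * t + 8 * w * \<kappa> + 4 * D)"
  proof (rule nn_integral_le_if_stays[OF t(1)])
    fix m :: nat
    note [measurable] = stays_measurable_pair[of "real m"]
    have mom: "(\<integral>\<^sup>+\<omega>. ennreal ((X s \<omega> - x)\<^sup>2) * of_bool (stays m s \<omega>) \<partial>M) \<le> ennreal p" if "0 \<le> s" "s \<le> t" for s
      unfolding p_def \<kappa>_def
      by (rule localized_second_moment_bound[OF T \<kappa>(1)[unfolded \<kappa>_def] that(1) order_trans[OF that(2) t(2)]])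
    define d where "d = (\<lambda>\<omega>. \<integral>\<^sup>+s\<in>{0..t}. ennreal ((K (t - s))\<^sup>2) * ennreal ((\<sigma> (X s \<omega>) - \<sigma> x)\<^sup>2) * of_bool (stays m s \<omega>) \<partial>lborel)"
    have d_eq: "d \<omega> = (\<integral>\<^sup>+s. ennreal ((kk s)\<^sup>2) * (ennreal ((\<sigma> (X (max 0 s) \<omega>) - \<sigma> x)\<^sup>2) * ennreal (of_bool (stays m (max 0 s) \<omega>))) \<partial>lborel)" for \<omega>
      unfolding d_def kk by (intro nn_integral_cong) (auto simp: indicator_def max_def mult_ac)
    have [measurable]: "d \<in> borel_measurable M" unfolding d_eq by measurable
    have dle: "(\<integral>\<^sup>+\<omega>. d \<omega> \<partial>M) \<le> ennreal (w * (1 + 1 / p * p) * (LBINT r:{0..t}. (K r)\<^sup>2))"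
      unfolding d_def
    proof (rule fubini_growth_bound[where f = "\<lambda>y. (\<sigma> y - \<sigma> x)\<^sup>2", OF _ _ w(1) _ t(1) _ mom])
      show "(\<sigma> y - \<sigma> x)\<^sup>2 \<le> w * (1 + 1 / p * (y - x)\<^sup>2)" for y using w(2)[of y] by (simp only: p_def)
    qed (use p0 in auto)
    also have "\<dots> \<le> ennreal (2 * w * \<kappa>)"
      using p0 mult_left_mono[OF kt w(1)] by (intro ennreal_leI) (simp add: mult.commute)
    finally have dle: "(\<integral>\<^sup>+\<omega>. d \<omega> \<partial>M) \<le> ennreal (2 * w * \<kappa>)" .
    have gb: "(b y)\<^sup>2 \<le> A * (1 + 1 * (y - x)\<^sup>2)" for y
      using growth[of y] zero_le_power2[of "\<sigma> y"] unfolding mult_1 by linarith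
    have drift: "(\<integral>\<^sup>+\<omega>. (\<integral>\<^sup>+s\<in>{0..t}. ennreal ((K (t - s))\<^sup>2) * ennreal ((b (X s \<omega>))\<^sup>2) * of_bool (stays m s \<omega>) \<partial>lborel) \<partial>M)
      \<le> ennreal (A * (1 + 1 * p) * (LBINT r:{0..t}. (K r)\<^sup>2))"
      by (rule fubini_growth_bound[where f = "\<lambda>y. (b y)\<^sup>2", OF _ gb A_nonneg _ t(1) _ mom]) (use p0 in auto)
    also have "\<dots> \<le> ennreal (2 * A * \<kappa>)"
    proof (rule ennreal_leI)
      have "A * (1 + 1 * p) * (LBINT r:{0..t}. (K r)\<^sup>2) \<le> (A * 2) * \<kappa>"
        using A_nonneg p0 kt kt0 by (intro mult_mono mult_left_mono) auto
      then show "A * (1 + 1 * p) * (LBINT r:{0..t}. (K r)\<^sup>2) \<le> 2 * A * \<kappa>" by simp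
    qed
    finally have drift: "(\<integral>\<^sup>+\<omega>. (\<integral>\<^sup>+s\<in>{0..t}. ennreal ((K (t - s))\<^sup>2) * ennreal ((b (X s \<omega>))\<^sup>2) * of_bool (stays m s \<omega>) \<partial>lborel) \<partial>M) \<le> ennreal (2 * A * \<kappa>)" .
    have diff: "(\<integral>\<^sup>+\<omega>. (\<integral>\<^sup>+s\<in>{0..t}. ennreal ((K (t - s) * \<sigma> (X s \<omega>) - \<eta> s)\<^sup>2 * of_bool (stays m s \<omega>)) \<partial>lborel) \<partial>M)
      \<le> (\<integral>\<^sup>+\<omega>. 2 * d \<omega> + 2 * ennreal D \<partial>M)"
    proof (rule nn_integral_mono)
      fix \<omega> assume \<omega>: "\<omega> \<in> space M"
      have [measurable]: "(\<lambda>s. X (max 0 s) \<omega>) \<in> borel_measurable borel" "(\<lambda>s. of_bool (stays m (max 0 s) \<omega>) :: real) \<in> borel_measurable borel"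
        using measurable_compose[OF measurable_Pair2'[OF \<omega>, of borel] X_measurable_pair]
          measurable_compose[OF measurable_Pair2'[OF \<omega>, of borel] stays_measurable_pair[of m]]
        by (auto simp: case_prod_beta)
      have "(\<integral>\<^sup>+s\<in>{0..t}. ennreal ((K (t - s) * \<sigma> (X s \<omega>) - \<eta> s)\<^sup>2 * of_bool (stays m s \<omega>)) \<partial>lborel)
        \<le> (\<integral>\<^sup>+s. 2 * (ennreal ((kk s)\<^sup>2) * (ennreal ((\<sigma> (X (max 0 s) \<omega>) - \<sigma> x)\<^sup>2) * ennreal (of_bool (stays m (max 0 s) \<omega>)))) + 2 * ennreal ((\<sigma> x * kk s - \<eta> s)\<^sup>2) \<partial>lborel)"
      proof (rule nn_integral_mono)
        fix s
        show "ennreal ((K (t - s) * \<sigma> (X s \<omega>) - \<eta> s)\<^sup>2 * of_bool (stays m s \<omega>)) * indicator {0..t} s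
          \<le> 2 * (ennreal ((kk s)\<^sup>2) * (ennreal ((\<sigma> (X (max 0 s) \<omega>) - \<sigma> x)\<^sup>2) * ennreal (of_bool (stays m (max 0 s) \<omega>)))) + 2 * ennreal ((\<sigma> x * kk s - \<eta> s)\<^sup>2)"
        proof (cases "s \<in> {0..t} \<and> stays m s \<omega>")
          case True
          let ?u = "K (t - s) * (\<sigma> (X s \<omega>) - \<sigma> x)" and ?v = "\<sigma> x * K (t - s) - \<eta> s"
          have "(K (t - s) * \<sigma> (X s \<omega>) - \<eta> s)\<^sup>2 = (?u + ?v)\<^sup>2" by (simp add: algebra_simps)
          also have "\<dots> \<le> 2 * ?u\<^sup>2 + 2 * ?v\<^sup>2" using sum_squares_bound[of ?u ?v] power2_sum[of ?u ?v] by linarith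
          finally have "ennreal ((K (t - s) * \<sigma> (X s \<omega>) - \<eta> s)\<^sup>2) \<le> ennreal (2 * ?u\<^sup>2 + 2 * ?v\<^sup>2)" by (rule ennreal_leI)
          also have "\<dots> = 2 * (ennreal ((K (t - s))\<^sup>2) * ennreal ((\<sigma> (X s \<omega>) - \<sigma> x)\<^sup>2)) + 2 * ennreal (?v\<^sup>2)"
            by (simp add: ennreal_plus ennreal_mult power_mult_distrib)
          finally show ?thesis using True by (simp add: kk)
        qed auto
      qed
      also have "\<dots> = 2 * d \<omega> + 2 * ennreal D"
        unfolding d_eq Dnn[symmetric] by (subst nn_integral_add) (auto simp: nn_integral_cmult)
      finally show "(\<integral>\<^sup>+s\<in>{0..t}. ennreal ((K (t - s) * \<sigma> (X s \<omega>) - \<eta> s)\<^sup>2 * of_bool (stays m s \<omega>)) \<partial>lborel) \<le> 2 * d \<omega> + 2 * ennreal D" .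
    qed
    also have "\<dots> = 2 * (\<integral>\<^sup>+\<omega>. d \<omega> \<partial>M) + 2 * ennreal D"
      by (simp add: nn_integral_add nn_integral_cmult emeasure_space_1)
    also have "\<dots> \<le> 2 * ennreal (2 * w * \<kappa>) + 2 * ennreal D"
      by (intro add_right_mono mult_left_mono dle) auto
    finally have diff: "(\<integral>\<^sup>+\<omega>. (\<integral>\<^sup>+s\<in>{0..t}. ennreal ((K (t - s) * \<sigma> (X s \<omega>) - \<eta> s)\<^sup>2 * of_bool (stays m s \<omega>)) \<partial>lborel) \<partial>M)
      \<le> 2 * ennreal (2 * w * \<kappa>) + 2 * ennreal D" .
    have "(\<integral>\<^sup>+\<omega>. ennreal ((X t \<omega> - x - simple_integral B ?h t \<omega>)\<^sup>2) * of_bool (stays m t \<omega>) \<partial>M)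
      \<le> 2 * (ennreal t * ennreal (2 * A * \<kappa>)) + 2 * (2 * ennreal (2 * w * \<kappa>) + 2 * ennreal D)"
    proof (rule order_trans[OF localized_increment_bound[OF t(1) h _ \<eta>, of "real m"]])
      show "simple_value ?h s \<omega> = \<eta> s" for s \<omega> by (simp only: simple_value_deterministic \<eta>_def)
    qed (intro add_mono mult_left_mono drift diff; simp)
    also have "\<dots> = ennreal (4 * A * \<kappa> * t + 8 * w * \<kappa> + 4 * D)"
    proof -
      have e: "2 * (ennreal t * ennreal u) + 2 * (2 * ennreal v + 2 * ennreal D) = ennreal (2 * (t * u) + 2 * (2 * v + 2 * D))"
        if "0 \<le> u" "0 \<le> v" for u v
        using that D0 t(1) by (simp add: ennreal_plus ennreal_mult)
      have eq: "2 * (t * (2 * A * \<kappa>)) + 2 * (2 * (2 * w * \<kappa>) + 2 * D) = 4 * A * \<kappa> * t + 8 * w * \<kappa> + 4 * D" by simp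
      show ?thesis unfolding eq[symmetric] using A_nonneg \<kappa>0 w(1) by (intro e) auto
    qed
    finally show "(\<integral>\<^sup>+\<omega>. ennreal ((X t \<omega> - x - simple_integral B ?h t \<omega>)\<^sup>2) * of_bool (stays m t \<omega>) \<partial>M) \<le> ennreal (4 * A * \<kappa> * t + 8 * w * \<kappa> + 4 * D)" .
  qed measurable
  then show ?thesis by (simp add: D_def \<eta>_def)
qed

end

section \<open>Ito integrals of kernels are Gaussian\<close>

text \<open>Substituting \<open>s - r\<close> for \<open>r\<close> turns the covariance of two Ito integrals
  into the form in which the limit of the kernels is prescribed.\<close>
lemma kernel_at_inner:
  assumes "0 \<le> s" "s \<le> t"
  shows "(\<integral>r. kernel_at K s r * kernel_at K t r \<partial>lborel) = (LBINT r:{0..s}. K (t - s + r) * K r)"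
proof -
  have "(\<integral>r. kernel_at K s r * kernel_at K t r \<partial>lborel) = (\<integral>r. kernel_at K s (s + -1 * r) * kernel_at K t (s + -1 * r) \<partial>lborel)"
    by (subst lborel_integral_real_affine[of "-1" _ s]) auto
  also have "\<dots> = (LBINT r:{0..s}. K (t - s + r) * K r)"
    unfolding set_lebesgue_integral_def
    by (intro Bochner_Integration.integral_cong) (use assms in \<open>auto simp: kernel_at_def indicator_def algebra_simps\<close>)
  finally show ?thesis .
qed

lemma kernel_at_step_approximation:
  assumes K: "L2_loc K" and t: "0 < t" and e: "0 < e"
  shows "\<exists>k u c. grid k u \<and> (\<integral>s. (\<alpha> * kernel_at K t s - step_function k u c s)\<^sup>2 \<partial>lborel) < e"
proof -
  have f: "square_integrable (\<lambda>s. \<alpha> * kernel_at K t s)"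
    using t by (intro square_integrable_cmult square_integrable_kernel_at[OF K]) auto
  obtain k u c where "u 0 = 0" "\<And>i. i < k \<Longrightarrow> u i < u (Suc i)" "(\<integral>s. (\<alpha> * kernel_at K t s - step_function k u c s)\<^sup>2 \<partial>lborel) < e"
  proof (rule step_function_dense[OF f t _ e])
    show "\<alpha> * kernel_at K t s = 0" if "s \<notin> {0..t}" for s using that by (simp add: kernel_at_def)
  qed (rule that)
  then show ?thesis by (intro exI[of _ k] exI[of _ u] exI[of _ c]) (auto simp: grid_def)
qed

text \<open>A simple integral up to time \<open>t\<close> sees the step function on \<open>[0, t]\<close>
  only. As the kernel vanishes outside this interval, the restriction does not increase the distance to
  it.\<close>
lemma kernel_at_restricted_step:
  assumes K: "L2_loc K" and t: "0 \<le> t"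
  shows "square_integrable (\<lambda>s. step_function k u c s * indicator {0..t} s)"
    "(\<integral>s. (\<alpha> * kernel_at K t s - step_function k u c s * indicator {0..t} s)\<^sup>2 \<partial>lborel)
      \<le> (\<integral>s. (\<alpha> * kernel_at K t s - step_function k u c s)\<^sup>2 \<partial>lborel)"
proof -
  have st: "square_integrable (step_function k u c)" by (rule square_integrable_step_function)
  then have [measurable]: "step_function k u c \<in> borel_measurable borel" by (simp add: square_integrable_def)
  have "integrable lborel (\<lambda>s. (step_function k u c s * indicator {0..t} s)\<^sup>2)"
    by (rule Bochner_Integration.integrable_bound[of lborel "\<lambda>s. (step_function k u c s)\<^sup>2"])
       (use st in \<open>auto simp: square_integrable_def indicator_def\<close>)
  then show st': "square_integrable (\<lambda>s. step_function k u c s * indicator {0..t} s)"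
    by (simp add: square_integrable_def)
  have f: "square_integrable (\<lambda>s. \<alpha> * kernel_at K t s)"
    by (intro square_integrable_cmult square_integrable_kernel_at K t)
  show "(\<integral>s. (\<alpha> * kernel_at K t s - step_function k u c s * indicator {0..t} s)\<^sup>2 \<partial>lborel)
      \<le> (\<integral>s. (\<alpha> * kernel_at K t s - step_function k u c s)\<^sup>2 \<partial>lborel)"
    using square_integrable_diff[OF f st] square_integrable_diff[OF f st']
    by (intro integral_mono) (auto simp: square_integrable_def kernel_at_def indicator_def)
qed

lemma square_integral_linear_combination:
  fixes f :: "'n::finite \<Rightarrow> real \<Rightarrow> real" and a :: "'n \<Rightarrow> real"
  assumes "\<And>j. square_integrable (f j)"
  shows "(\<integral>s. (\<Sum>j\<in>UNIV. a j * f j s)\<^sup>2 \<partial>lborel) = (\<Sum>i\<in>UNIV. \<Sum>j\<in>UNIV. a i * a j * (\<integral>s. f i s * f j s \<partial>lborel))"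
proof -
  have i: "integrable lborel (\<lambda>s. f i s * f j s)" for i j using assms by (intro square_integrable_mult)
  have "(\<integral>s. (\<Sum>j\<in>UNIV. a j * f j s)\<^sup>2 \<partial>lborel) = (\<integral>s. (\<Sum>i\<in>UNIV. \<Sum>j\<in>UNIV. a i * a j * (f i s * f j s)) \<partial>lborel)"
    by (simp add: power2_eq_square sum_product mult_ac)
  also have "\<dots> = (\<Sum>i\<in>UNIV. \<Sum>j\<in>UNIV. a i * a j * (\<integral>s. f i s * f j s \<partial>lborel))"
    using i by simp
  finally show ?thesis .
qed

lemma square_integral_linear_combination_le:
  fixes f :: "'n::finite \<Rightarrow> real \<Rightarrow> real" and a :: "'n \<Rightarrow> real" and q :: real
  assumes f: "\<And>j. square_integrable (f j)" and q: "\<And>j. (\<integral>s. (f j s)\<^sup>2 \<partial>lborel) \<le> q"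
  shows "(\<integral>s. (\<Sum>j\<in>UNIV. a j * f j s)\<^sup>2 \<partial>lborel) \<le> (\<Sum>j\<in>UNIV. (a j)\<^sup>2) * (CARD('n) * q)"
proof -
  have i: "integrable lborel (\<lambda>s. (f j s)\<^sup>2)" for j using f by (simp add: square_integrable_def)
  have s: "square_integrable (\<lambda>s. \<Sum>j\<in>UNIV. a j * f j s)" by (intro square_integrable_sum square_integrable_cmult f)
  have "(\<integral>s. (\<Sum>j\<in>UNIV. a j * f j s)\<^sup>2 \<partial>lborel) \<le> (\<integral>s. (\<Sum>j\<in>UNIV. (a j)\<^sup>2) * (\<Sum>j\<in>UNIV. (f j s)\<^sup>2) \<partial>lborel)"
    using s i by (intro integral_mono Cauchy_Schwarz_ineq_sum) (auto simp: square_integrable_def)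
  also have "\<dots> = (\<Sum>j\<in>UNIV. (a j)\<^sup>2) * (\<Sum>j\<in>UNIV. \<integral>s. (f j s)\<^sup>2 \<partial>lborel)" using i by simp
  also have "\<dots> \<le> (\<Sum>j\<in>UNIV. (a j)\<^sup>2) * (\<Sum>j\<in>(UNIV::'n set). q)"
    by (intro mult_left_mono sum_mono q sum_nonneg) auto
  finally show ?thesis by simp
qed

lemma abs_cos_diff_le: "\<bar>cos u - cos v\<bar> \<le> \<bar>u - v :: real\<bar>"
proof -
  have "\<bar>cos u - cos v\<bar> = 2 * \<bar>sin ((u + v) / 2)\<bar> * \<bar>sin ((v - u) / 2)\<bar>"
    unfolding cos_diff_cos abs_mult by simp
  also have "\<dots> \<le> 2 * 1 * \<bar>(v - u) / 2\<bar>"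
    by (intro mult_mono abs_sin_x_le_abs_x) auto
  finally show ?thesis by simp
qed

lemma (in prob_space) expectation_cos_diff_le:
  assumes [measurable]: "N \<in> borel_measurable M" "N' \<in> borel_measurable M"
    and q: "(\<integral>\<^sup>+\<omega>. ennreal ((N \<omega> - N' \<omega>)\<^sup>2) \<partial>M) \<le> ennreal q" "0 \<le> q"
  shows "\<bar>expectation (\<lambda>\<omega>. cos (N \<omega> + d)) - expectation (\<lambda>\<omega>. cos (N' \<omega> + d))\<bar> \<le> sqrt q"
proof -
  have i2: "integrable M (\<lambda>\<omega>. \<bar>N \<omega> - N' \<omega>\<bar>\<^sup>2)" using q by (intro integrableI_bounded) (auto simp: le_less_trans)
  have i1: "integrable M (\<lambda>\<omega>. \<bar>N \<omega> - N' \<omega>\<bar>)" by (rule square_integrable_imp_integrable[OF _ i2]) measurable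
  have c: "integrable M (\<lambda>\<omega>. cos (N \<omega> + d))" "integrable M (\<lambda>\<omega>. cos (N' \<omega> + d))"
    by (rule integrable_const_bound[of _ 1]; simp)+
  have E2: "expectation (\<lambda>\<omega>. \<bar>N \<omega> - N' \<omega>\<bar>\<^sup>2) \<le> q"
  proof -
    have "ennreal (expectation (\<lambda>\<omega>. \<bar>N \<omega> - N' \<omega>\<bar>\<^sup>2)) = (\<integral>\<^sup>+\<omega>. ennreal (\<bar>N \<omega> - N' \<omega>\<bar>\<^sup>2) \<partial>M)"
      using i2 by (intro nn_integral_eq_integral[symmetric]) auto
    also have "\<dots> \<le> ennreal q" using q by simp
    finally show ?thesis using q(2) by (subst (asm) ennreal_le_iff) auto
  qed
  have "\<bar>expectation (\<lambda>\<omega>. cos (N \<omega> + d)) - expectation (\<lambda>\<omega>. cos (N' \<omega> + d))\<bar> = \<bar>expectation (\<lambda>\<omega>. cos (N \<omega> + d) - cos (N' \<omega> + d))\<bar>"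
    using c by simp
  also have "\<dots> \<le> expectation (\<lambda>\<omega>. \<bar>cos (N \<omega> + d) - cos (N' \<omega> + d)\<bar>)" by (rule integral_abs_bound)
  also have "\<dots> \<le> expectation (\<lambda>\<omega>. \<bar>N \<omega> - N' \<omega>\<bar>)"
  proof (rule integral_mono)
    show "\<bar>cos (N \<omega> + d) - cos (N' \<omega> + d)\<bar> \<le> \<bar>N \<omega> - N' \<omega>\<bar>" for \<omega>
      using abs_cos_diff_le[of "N \<omega> + d" "N' \<omega> + d"] by simp
  qed (use c i1 in auto)
  also have "\<dots> \<le> sqrt q"
  proof (rule real_le_rsqrt)
    have "0 \<le> expectation (\<lambda>\<omega>. \<bar>N \<omega> - N' \<omega>\<bar>\<^sup>2) - (expectation (\<lambda>\<omega>. \<bar>N \<omega> - N' \<omega>\<bar>))\<^sup>2"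
      using variance_positive[of "\<lambda>\<omega>. \<bar>N \<omega> - N' \<omega>\<bar>"] variance_eq[OF i1 i2] by simp
    then show "(expectation (\<lambda>\<omega>. \<bar>N \<omega> - N' \<omega>\<bar>))\<^sup>2 \<le> q" using E2 by linarith
  qed
  finally show ?thesis .
qed

context brownian_motion
begin

text \<open>The energy of a deterministic integrand is a constant, so that the event that always holds can
  serve as localiser.\<close>
lemma ito_integral_step_error:
  assumes K: "L2_loc K" and t: "0 \<le> t" and J: "has_ito_integral M F B (\<lambda>s \<omega>. K (t - s)) t J" and g: "grid k u"
  shows "(\<integral>\<^sup>+\<omega>. ennreal ((J \<omega> - simple_integral B (deterministic_code k u c) t \<omega>)\<^sup>2) \<partial>M)
    \<le> ennreal (\<integral>s. (kernel_at K t s - step_function k u c s)\<^sup>2 \<partial>lborel)"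
proof -
  have sq: "square_integrable (\<lambda>s. kernel_at K t s - step_function k u c s)"
    by (intro square_integrable_diff square_integrable_kernel_at K t square_integrable_step_function)
  have le: "(\<integral>\<^sup>+s\<in>{0..t}. ennreal ((K (t - s) - step_function k u c s)\<^sup>2) \<partial>lborel) \<le> ennreal (\<integral>s. (kernel_at K t s - step_function k u c s)\<^sup>2 \<partial>lborel)"
    using sq by (subst nn_integral_eq_integral[symmetric])
      (auto simp: square_integrable_def kernel_at_def indicator_def intro!: nn_integral_mono)
  have G: "localizer (\<lambda>_ _. True)" by (auto simp: localizer_def space_F[symmetric])
  have h: "simple_process M F (deterministic_code k u c)" by (rule simple_process_deterministic[OF g])
  have "(\<integral>\<^sup>+\<omega>. ennreal ((J \<omega> - simple_integral B (deterministic_code k u c) t \<omega>)\<^sup>2) * of_bool True \<partial>M)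
    \<le> (\<integral>\<^sup>+\<omega>. (\<integral>\<^sup>+s\<in>{0..t}. ennreal ((K (t - s) - simple_value (deterministic_code k u c) s \<omega>)\<^sup>2 * of_bool True) \<partial>lborel) \<partial>M)"
    by (rule localized_ito_bound[OF J t h G]) (use le in \<open>simp add: simple_value_deterministic\<close>)
  also have "\<dots> \<le> (\<integral>\<^sup>+\<omega>. ennreal (\<integral>s. (kernel_at K t s - step_function k u c s)\<^sup>2 \<partial>lborel) \<partial>M)"
    using le by (intro nn_integral_mono) (simp add: simple_value_deterministic)
  also have "\<dots> = ennreal (\<integral>s. (kernel_at K t s - step_function k u c s)\<^sup>2 \<partial>lborel)" by (simp add: emeasure_space_1)
  finally show ?thesis by simp
qed

lemma nn_integral_linear_combination_le:
  fixes D :: "'n::finite \<Rightarrow> 'a \<Rightarrow> real" and a :: "'n \<Rightarrow> real" and q :: real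
  assumes [measurable]: "\<And>j. D j \<in> borel_measurable M" and q: "\<And>j. (\<integral>\<^sup>+\<omega>. ennreal ((D j \<omega>)\<^sup>2) \<partial>M) \<le> ennreal q" "0 \<le> q"
  shows "(\<integral>\<^sup>+\<omega>. ennreal ((\<Sum>j\<in>UNIV. a j * D j \<omega>)\<^sup>2) \<partial>M) \<le> ennreal ((\<Sum>j\<in>UNIV. (a j)\<^sup>2) * (CARD('n) * q))"
proof -
  have "(\<integral>\<^sup>+\<omega>. ennreal ((\<Sum>j\<in>UNIV. a j * D j \<omega>)\<^sup>2) \<partial>M) \<le> (\<integral>\<^sup>+\<omega>. ennreal (\<Sum>j\<in>UNIV. (a j)\<^sup>2) * (\<Sum>j\<in>UNIV. ennreal ((D j \<omega>)\<^sup>2)) \<partial>M)"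
    by (intro nn_integral_mono) (auto simp: ennreal_mult[symmetric] sum_nonneg intro!: ennreal_leI Cauchy_Schwarz_ineq_sum)
  also have "\<dots> = ennreal (\<Sum>j\<in>UNIV. (a j)\<^sup>2) * (\<Sum>j\<in>UNIV. \<integral>\<^sup>+\<omega>. ennreal ((D j \<omega>)\<^sup>2) \<partial>M)"
    by (simp add: nn_integral_cmult nn_integral_sum del: sum_ennreal)
  also have "\<dots> \<le> ennreal (\<Sum>j\<in>UNIV. (a j)\<^sup>2) * (\<Sum>j\<in>(UNIV::'n set). ennreal q)"
    by (intro mult_left_mono sum_mono q) auto
  also have "\<dots> = ennreal ((\<Sum>j\<in>UNIV. (a j)\<^sup>2) * (CARD('n) * q))"
    using q(2) by (simp add: ennreal_mult sum_nonneg ennreal_of_nat_eq_real_of_nat)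
  finally show ?thesis .
qed

text \<open>The kernels are approximated in L2 by step functions. By \<open>ito_integral_step_error\<close>
  the integrals are then close in mean square, and both the expectations of the cosines and the variances
  converge.\<close>
lemma ito_integrals_gaussian:
  fixes J :: "'n::finite \<Rightarrow> 'a \<Rightarrow> real" and t a :: "'n \<Rightarrow> real"
  assumes K: "L2_loc K" and t: "\<And>j. 0 < t j" and J: "\<And>j. has_ito_integral M F B (\<lambda>s \<omega>. K (t j - s)) (t j) (J j)"
  shows "expectation (\<lambda>\<omega>. cos ((\<Sum>j\<in>UNIV. a j * J j \<omega>) + d)) = cos d * exp (- (\<integral>s. (\<Sum>j\<in>UNIV. a j * kernel_at K (t j) s)\<^sup>2 \<partial>lborel) / 2)"
proof -
  have t0: "0 \<le> t j" for j using t[of j] by simp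
  have Jm [measurable]: "J j \<in> borel_measurable M" for j using J by (simp add: has_ito_integral_def)
  define good where "good m j z \<longleftrightarrow> (case z of (k, u, c) \<Rightarrow> grid k u \<and>
      (\<integral>s. (1 * kernel_at K (t j) s - step_function k u c s)\<^sup>2 \<partial>lborel) < 1 / real (Suc m))" for m j z
  define z where "z m j = (SOME z. good m j z)" for m j
  have good: "good m j (z m j)" for m j
  proof -
    have "\<exists>k u c. grid k u \<and> (\<integral>s. (1 * kernel_at K (t j) s - step_function k u c s)\<^sup>2 \<partial>lborel) < 1 / real (Suc m)"
      by (rule kernel_at_step_approximation[OF K t]) simp
    then have "\<exists>z. good m j z" by (auto simp: good_def)
    then show ?thesis unfolding z_def by (rule someI_ex)
  qed
  define k where "k m j = fst (z m j)" for m j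
  define u where "u m j = fst (snd (z m j))" for m j
  define c where "c m j = snd (snd (z m j))" for m j
  have g: "grid (k m j) (u m j)" and err: "(\<integral>s. (1 * kernel_at K (t j) s - step_function (k m j) (u m j) (c m j) s)\<^sup>2 \<partial>lborel) < 1 / real (Suc m)" for m j
    using good[of m j] by (auto simp: good_def k_def u_def c_def split: prod.splits)
  define I where "I m j = simple_integral B (deterministic_code (k m j) (u m j) (c m j)) (t j)" for m j
  have Im [measurable]: "I m j \<in> borel_measurable M" for m j
    unfolding I_def by (rule simple_integral_measurable[OF simple_process_deterministic[OF g] t0])
  define S where "S = (\<Sum>j\<in>UNIV. (a j)\<^sup>2)"
  have S0: "0 \<le> S" by (simp add: S_def sum_nonneg)
  have inv0: "(\<lambda>m. 1 / real (Suc m)) \<longlonglongrightarrow> 0" using LIMSEQ_inverse_real_of_nat by (simp add: inverse_eq_divide)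
  have close: "\<bar>expectation (\<lambda>\<omega>. cos ((\<Sum>j\<in>UNIV. a j * J j \<omega>) + d)) - expectation (\<lambda>\<omega>. cos ((\<Sum>j\<in>UNIV. a j * I m j \<omega>) + d))\<bar> \<le> sqrt (S * (CARD('n) * (1 / real (Suc m))))" for m
  proof (rule expectation_cos_diff_le)
    have "(\<integral>\<^sup>+\<omega>. ennreal ((J j \<omega> - I m j \<omega>)\<^sup>2) \<partial>M) \<le> ennreal (1 / real (Suc m))" for j
    proof -
      have "(\<integral>s. (kernel_at K (t j) s - step_function (k m j) (u m j) (c m j) s)\<^sup>2 \<partial>lborel) \<le> 1 / real (Suc m)"
        using err[of j m] by (simp only: mult_1 less_imp_le)
      then show ?thesis unfolding I_def
        by (rule order_trans[OF ito_integral_step_error[OF K t0 J g] ennreal_leI])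
    qed
    then have "(\<integral>\<^sup>+\<omega>. ennreal ((\<Sum>j\<in>UNIV. a j * (J j \<omega> - I m j \<omega>))\<^sup>2) \<partial>M) \<le> ennreal (S * (CARD('n) * (1 / real (Suc m))))"
      unfolding S_def by - (rule nn_integral_linear_combination_le[where D = "\<lambda>j \<omega>. J j \<omega> - I m j \<omega>"]; simp)
    then show "(\<integral>\<^sup>+\<omega>. ennreal (((\<Sum>j\<in>UNIV. a j * J j \<omega>) - (\<Sum>j\<in>UNIV. a j * I m j \<omega>))\<^sup>2) \<partial>M) \<le> ennreal (S * (CARD('n) * (1 / real (Suc m))))"
      by (simp add: right_diff_distrib sum_subtractf)
    show "0 \<le> S * (real CARD('n) * (1 / real (Suc m)))" using S0 by simp
  qed measurable
  have "(\<lambda>m. S * (real CARD('n) * (1 / real (Suc m)))) \<longlonglongrightarrow> 0"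
    by (intro tendsto_mult_right_zero inv0)
  from tendsto_real_sqrt[OF this] have sq0: "(\<lambda>m. sqrt (S * (real CARD('n) * (1 / real (Suc m))))) \<longlonglongrightarrow> 0"
    by (simp only: real_sqrt_zero)
  have "(\<lambda>m. expectation (\<lambda>\<omega>. cos ((\<Sum>j\<in>UNIV. a j * J j \<omega>) + d)) - expectation (\<lambda>\<omega>. cos ((\<Sum>j\<in>UNIV. a j * I m j \<omega>) + d))) \<longlonglongrightarrow> 0"
  proof (rule Lim_null_comparison[OF _ sq0], rule always_eventually, rule allI)
    fix m
    show "norm (expectation (\<lambda>\<omega>. cos ((\<Sum>j\<in>UNIV. a j * J j \<omega>) + d)) - expectation (\<lambda>\<omega>. cos ((\<Sum>j\<in>UNIV. a j * I m j \<omega>) + d)))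
      \<le> sqrt (S * (real CARD('n) * (1 / real (Suc m))))"
      unfolding real_norm_def by (rule close)
  qed
  from tendsto_diff[OF tendsto_const this, of "expectation (\<lambda>\<omega>. cos ((\<Sum>j\<in>UNIV. a j * J j \<omega>) + d))"]
  have lim1: "(\<lambda>m. expectation (\<lambda>\<omega>. cos ((\<Sum>j\<in>UNIV. a j * I m j \<omega>) + d))) \<longlonglongrightarrow> expectation (\<lambda>\<omega>. cos ((\<Sum>j\<in>UNIV. a j * J j \<omega>) + d))"
    by (simp only: diff_zero diff_diff_eq2 add_diff_cancel_left')
  define h where "h m j s = step_function (k m j) (u m j) (c m j) s * indicator {0..t j} s" for m j s
  have hs: "square_integrable (h m j)" for m j
    unfolding h_def[abs_def] by (rule kernel_at_restricted_step(1)[OF K t0])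
  have herr: "(\<integral>s. (h m j s - kernel_at K (t j) s)\<^sup>2 \<partial>lborel) \<le> 1 / real (Suc m)" for m j
    using kernel_at_restricted_step(2)[OF K t0, of 1 j "k m j" "u m j" "c m j"] err[of j m]
    by (simp add: h_def power2_commute)
  have ks: "square_integrable (kernel_at K (t j))" for j by (rule square_integrable_kernel_at[OF K t0])
  have "(\<lambda>m. \<integral>s. (\<Sum>j\<in>UNIV. a j * h m j s)\<^sup>2 \<partial>lborel) \<longlonglongrightarrow> (\<integral>s. (\<Sum>j\<in>UNIV. a j * kernel_at K (t j) s)\<^sup>2 \<partial>lborel)"
  proof (rule square_integral_tendsto[where g = "\<lambda>m s. \<Sum>j\<in>UNIV. a j * kernel_at K (t j) s"])
    show "(\<lambda>m. \<integral>s. ((\<Sum>j\<in>UNIV. a j * h m j s) - (\<Sum>j\<in>UNIV. a j * kernel_at K (t j) s))\<^sup>2 \<partial>lborel) \<longlonglongrightarrow> 0"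
    proof (rule tendsto_sandwich[where f = "\<lambda>_. 0" and h = "\<lambda>m. S * (CARD('n) * (1 / real (Suc m)))"])
      have "(\<integral>s. (\<Sum>j\<in>UNIV. a j * (h m j s - kernel_at K (t j) s))\<^sup>2 \<partial>lborel) \<le> S * (CARD('n) * (1 / real (Suc m)))" for m
        unfolding S_def by (intro square_integral_linear_combination_le square_integrable_diff hs ks herr)
      then show "\<forall>\<^sub>F m in sequentially. (\<integral>s. ((\<Sum>j\<in>UNIV. a j * h m j s) - (\<Sum>j\<in>UNIV. a j * kernel_at K (t j) s))\<^sup>2 \<partial>lborel) \<le> S * (CARD('n) * (1 / real (Suc m)))"
        by (intro always_eventually allI) (simp add: right_diff_distrib sum_subtractf)
      show "(\<lambda>m. S * (CARD('n) * (1 / real (Suc m)))) \<longlonglongrightarrow> 0"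
        by (intro tendsto_mult_right_zero inv0)
    qed auto
  qed (auto intro!: always_eventually square_integrable_sum square_integrable_cmult hs ks)
  then have lim2: "(\<lambda>m. cos d * exp (- (\<integral>s. (\<Sum>j\<in>UNIV. a j * h m j s)\<^sup>2 \<partial>lborel) / 2)) \<longlonglongrightarrow> cos d * exp (- (\<integral>s. (\<Sum>j\<in>UNIV. a j * kernel_at K (t j) s)\<^sup>2 \<partial>lborel) / 2)"
    by (intro tendsto_intros) auto
  have eq: "expectation (\<lambda>\<omega>. cos ((\<Sum>j\<in>UNIV. a j * I m j \<omega>) + d)) = cos d * exp (- (\<integral>s. (\<Sum>j\<in>UNIV. a j * h m j s)\<^sup>2 \<partial>lborel) / 2)" for m
    unfolding I_def h_def by (rule expectation_cos_simple_integrals[OF g t0])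
  show ?thesis by (rule LIMSEQ_unique[OF lim1 lim2[folded eq]])
qed

lemma ito_integral_square_integrable:
  assumes K: "L2_loc K" and t: "0 \<le> t" and J: "has_ito_integral M F B (\<lambda>s \<omega>. K (t - s)) t J"
  shows "integrable M (\<lambda>\<omega>. (J \<omega>)\<^sup>2)"
proof -
  have g: "grid 0 (\<lambda>_. 0)" by (simp add: grid_def)
  have [measurable]: "J \<in> borel_measurable M" using J by (simp add: has_ito_integral_def)
  have "(\<integral>\<^sup>+\<omega>. ennreal ((J \<omega>)\<^sup>2) \<partial>M) \<le> ennreal (\<integral>s. (kernel_at K t s - step_function 0 (\<lambda>_. 0) (\<lambda>_. 0) s)\<^sup>2 \<partial>lborel)"
    using ito_integral_step_error[OF K t J g, of "\<lambda>_. 0"] by (simp add: deterministic_code_def)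
  then show ?thesis by (intro integrableI_bounded) (auto simp: le_less_trans)
qed

end

section \<open>The small-time limit\<close>

lemma le_one_plus_square: "(r::real) \<le> 1 + r\<^sup>2"
proof -
  have "2 * r \<le> 1 + r\<^sup>2" using sum_squares_bound[of 1 r] by simp
  then show ?thesis using zero_le_power2[of r] by linarith
qed

text \<open>Fixing the data once allows quantities that depend on nearly all of them, such as the growth
  constant \<open>A\<close>, the bounds \<open>q\<close> and \<open>\<rho>\<close> and the Gaussian
  approximation \<open>V\<close>, to be named without parameters.\<close>
locale small_time_setting =
  fixes b \<sigma> K Kbar :: "real \<Rightarrow> real"
    and C Cstar chi_b chi_\<sigma> \<gamma> \<gamma>star :: real
    and x :: "nat \<Rightarrow> real" and xbar :: real
    and M :: "nat \<Rightarrow> 'a measure" and F :: "nat \<Rightarrow> real \<Rightarrow> 'a measure"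
    and B X :: "nat \<Rightarrow> real \<Rightarrow> 'a \<Rightarrow> real"
    and \<tau> :: "'n::{finite, linorder} \<Rightarrow> real"
    and M' :: "'b measure" and F' :: "real \<Rightarrow> 'b measure"
    and W Y J :: "real \<Rightarrow> 'b \<Rightarrow> real"
  assumes K: "L2_loc K"
    and constants: "C > 0" "Cstar > 0" "\<gamma> > 0" "\<gamma>star > 0"
      "0 < chi_b" "chi_b \<le> 1" "0 < chi_\<sigma>" "chi_\<sigma> \<le> 1"
    and hoelder_b: "\<And>y z. \<bar>b y - b z\<bar> \<le> C * \<bar>y - z\<bar> powr chi_b"
    and hoelder_\<sigma>: "\<And>y z. \<bar>\<sigma> y - \<sigma> z\<bar> \<le> C * \<bar>y - z\<bar> powr chi_\<sigma>"
    and K_lower: "\<And>t. 0 < t \<Longrightarrow> t \<le> 1 \<Longrightarrow>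
      Cstar * t powr (2 * \<gamma>star) \<le> (LBINT s:{0..t}. (K s)\<^sup>2)"
    and K_upper: "\<And>t. 0 < t \<Longrightarrow> t \<le> 1 \<Longrightarrow>
      (LBINT s:{0..t}. (K s)\<^sup>2) \<le> C * t powr (2 * \<gamma>)"
    and x: "x \<longlonglongrightarrow> xbar" and \<sigma>_nz: "\<sigma> xbar \<noteq> 0"
    and X: "\<And>n. n \<ge> 1 \<Longrightarrow> continuous_weak_solution K b \<sigma> (x n) (M n) (F n) (B n) (X n)"
    and \<tau>: "\<And>j. 0 < \<tau> j"
    and Kbar: "L2_loc Kbar"
    and K_limit: "\<And>s t. 0 \<le> s \<Longrightarrow> s \<le> t \<Longrightarrow> t \<le> max 1 (Max (range \<tau>)) \<Longrightarrow>
        (\<lambda>n. scale_rate K n * (LBINT r:{0..s / real n}. K ((t - s) / real n + r) * K r))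
          \<longlonglongrightarrow> (LBINT r:{0..s}. Kbar (t - s + r) * Kbar r)"
    and W: "brownian_motion M' F' W"
    and J: "\<And>t. 0 \<le> t \<Longrightarrow> has_ito_integral M' F' W (\<lambda>s \<omega>. Kbar (t - s)) t (J t)"
    and Y: "\<And>t \<omega>. Y t \<omega> = \<sigma> xbar * J t \<omega>"
begin

definition energy :: "real \<Rightarrow> real" where "energy t = (LBINT s:{0..t}. (K s)\<^sup>2)"

definition T :: real where "T = Max (range \<tau>)"

lemma \<tau>_le_T: "\<tau> j \<le> T" by (simp add: T_def)

lemma T_pos: "0 < T" using \<tau>_le_T \<tau> less_le_trans by blast

lemma energy_mono: "0 \<le> s \<Longrightarrow> s \<le> t \<Longrightarrow> energy s \<le> energy t"
  unfolding energy_def by (rule L2_loc_energy_mono[OF K])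

lemma energy_pos: "0 < t \<Longrightarrow> 0 < energy t"
proof -
  assume t: "0 < t"
  have "0 < Cstar * (min t 1) powr (2 * \<gamma>star)" using constants t by simp
  also have "\<dots> \<le> energy (min t 1)" using t unfolding energy_def by (intro K_lower) auto
  also have "\<dots> \<le> energy t" using t by (intro energy_mono) auto
  finally show ?thesis .
qed

lemma scale_rate_energy: "scale_rate K n = inverse (energy (1 / real n))"
  by (simp add: scale_rate_def energy_def)

lemma scale_rate_nonneg: "0 \<le> scale_rate K n"
  by (cases "n = 0") (auto simp: scale_rate_energy energy_def set_lebesgue_integral_def)

lemma scale_rate_limit:
  assumes "0 \<le> s" "s \<le> max 1 T"
  shows "(\<lambda>n. scale_rate K n * energy (s / real n)) \<longlonglongrightarrow> (LBINT r:{0..s}. (Kbar r)\<^sup>2)"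
  using K_limit[of s s] assms by (simp add: energy_def power2_eq_square T_def)

lemma energy_scaled_tendsto_0: "(\<lambda>n. energy (T / real n)) \<longlonglongrightarrow> 0"
proof (rule tendsto_sandwich[where f = "\<lambda>_. 0"])
  have Tn: "(\<lambda>n. T / real n) \<longlonglongrightarrow> 0" by (rule tendsto_divide_0[OF tendsto_const]) (rule filterlim_real_at_infinity_sequentially)
  have "(\<lambda>n. (T / real n) powr (2 * \<gamma>)) \<longlonglongrightarrow> 0 powr (2 * \<gamma>)"
    by (rule tendsto_powr'[OF Tn tendsto_const]) (use constants T_pos in auto)
  then have "(\<lambda>n. (T / real n) powr (2 * \<gamma>)) \<longlonglongrightarrow> 0" by simp
  from tendsto_mult_right_zero[OF this] show "(\<lambda>n. C * (T / real n) powr (2 * \<gamma>)) \<longlonglongrightarrow> 0" .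
  have "\<forall>\<^sub>F n in sequentially. T / real n < 1" using order_tendstoD(2)[OF Tn] by simp
  then show "\<forall>\<^sub>F n in sequentially. energy (T / real n) \<le> C * (T / real n) powr (2 * \<gamma>)"
    using eventually_gt_at_top[of 0]
  proof eventually_elim
    case (elim n)
    then show ?case using T_pos K_upper[of "T / real n"] by (simp add: energy_def)
  qed
  show "\<forall>\<^sub>F n in sequentially. 0 \<le> energy (T / real n)"
    by (intro always_eventually) (simp add: energy_def set_lebesgue_integral_def)
qed auto

lemma hoelder_continuous:
  fixes f :: "real \<Rightarrow> real"
  assumes \<theta>: "0 < \<theta>" and f: "\<And>y z. \<bar>f y - f z\<bar> \<le> C * \<bar>y - z\<bar> powr \<theta>"
  shows "continuous_on UNIV f"
proof (intro continuous_at_imp_continuous_on ballI)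
  fix z
  have "((\<lambda>y. C * \<bar>y - z\<bar> powr \<theta>) \<longlongrightarrow> C * \<bar>z - z\<bar> powr \<theta>) (at z)"
    by (intro tendsto_intros tendsto_powr') (use \<theta> in auto)
  then have "((\<lambda>y. C * \<bar>y - z\<bar> powr \<theta>) \<longlongrightarrow> 0) (at z)" using \<theta> by simp
  then have "((\<lambda>y. f y - f z) \<longlongrightarrow> 0) (at z)"
    by (rule Lim_null_comparison[rotated]) (use f in auto)
  then show "isCont f z" unfolding isCont_def using LIM_zero_iff by blast
qed

lemma continuous_b: "continuous_on UNIV b"
  using hoelder_continuous[OF constants(5) hoelder_b] .

lemma continuous_\<sigma>: "continuous_on UNIV \<sigma>"
  using hoelder_continuous[OF constants(7) hoelder_\<sigma>] .

lemma tendsto_continuous_x: "continuous_on UNIV f \<Longrightarrow> (\<lambda>n. f (x n)) \<longlonglongrightarrow> f xbar"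
  by (rule continuous_on_tendsto_compose[OF _ x]) auto

text \<open>Hoelder continuity with exponent at most \<open>1\<close> implies linear growth; the constant is
  uniform in \<open>n\<close> because the starting points \<open>x n\<close> converge.\<close>
lemma hoelder_growth:
  fixes f :: "real \<Rightarrow> real"
  assumes \<theta>: "0 < \<theta>" "\<theta> \<le> 1" and f: "\<And>y z. \<bar>f y - f z\<bar> \<le> C * \<bar>y - z\<bar> powr \<theta>"
  shows "\<exists>A>0. \<forall>n y. (f y)\<^sup>2 \<le> A * (1 + (y - x n)\<^sup>2)"
proof -
  have "convergent (\<lambda>n. f (x n))"
    using tendsto_continuous_x[OF hoelder_continuous[OF \<theta>(1) f]] by (rule convergentI)
  then obtain \<beta> where \<beta>: "\<beta> > 0" "\<And>n. \<bar>f (x n)\<bar> \<le> \<beta>"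
    using convergent_imp_Bseq[of "\<lambda>n. f (x n)"] by (auto simp: Bseq_def)
  show ?thesis
  proof (intro exI[of _ "2 * (\<beta> + C)\<^sup>2"] conjI allI)
    show "0 < 2 * (\<beta> + C)\<^sup>2" using \<beta>(1) constants by simp
    fix n y
    let ?r = "\<bar>y - x n\<bar>"
    have "\<bar>f y\<bar> \<le> \<beta> + C * ?r powr \<theta>" using f[of y "x n"] \<beta>(2)[of n] by linarith
    also have "\<dots> \<le> \<beta> + C * (1 + ?r)" using constants powr_le_affine[OF \<theta>, of ?r] by (intro add_left_mono mult_left_mono) auto
    also have "\<dots> \<le> (\<beta> + C) * (1 + ?r)" using \<beta>(1) by (simp add: algebra_simps)
    finally have "\<bar>f y\<bar> \<le> \<bar>(\<beta> + C) * (1 + ?r)\<bar>" by linarith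
    then have "(f y)\<^sup>2 \<le> ((\<beta> + C) * (1 + ?r))\<^sup>2" by (simp only: abs_le_square_iff)
    also have "\<dots> = (\<beta> + C)\<^sup>2 * (1 + ?r)\<^sup>2" by (simp add: power_mult_distrib)
    also have "\<dots> \<le> (\<beta> + C)\<^sup>2 * (2 * (1 + ?r\<^sup>2))"
    proof (rule mult_left_mono)
      show "(1 + ?r)\<^sup>2 \<le> 2 * (1 + ?r\<^sup>2)" using sum_squares_bound[of 1 ?r] by (simp add: power2_sum)
    qed simp
    finally show "(f y)\<^sup>2 \<le> 2 * (\<beta> + C)\<^sup>2 * (1 + (y - x n)\<^sup>2)" by (simp only: power2_abs mult_ac)
  qed
qed

lemma growth_constant: "\<exists>A>0. \<forall>n y. (b y)\<^sup>2 + (\<sigma> y)\<^sup>2 \<le> A * (1 + (y - x n)\<^sup>2)"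
proof -
  obtain A1 where A1: "A1 > 0" "\<And>n y. (b y)\<^sup>2 \<le> A1 * (1 + (y - x n)\<^sup>2)"
    using hoelder_growth[OF constants(5,6) hoelder_b] by blast
  obtain A2 where A2: "A2 > 0" "\<And>n y. (\<sigma> y)\<^sup>2 \<le> A2 * (1 + (y - x n)\<^sup>2)"
    using hoelder_growth[OF constants(7,8) hoelder_\<sigma>] by blast
  have "(b y)\<^sup>2 + (\<sigma> y)\<^sup>2 \<le> (A1 + A2) * (1 + (y - x n)\<^sup>2)" for n y
    unfolding distrib_right[of A1] by (rule add_mono[OF A1(2) A2(2)])
  moreover have "0 < A1 + A2" using A1(1) A2(1) by simp
  ultimately show ?thesis by blast
qed

definition A :: real where "A = (SOME A. 0 < A \<and> (\<forall>n y. (b y)\<^sup>2 + (\<sigma> y)\<^sup>2 \<le> A * (1 + (y - x n)\<^sup>2)))"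

lemma A: "0 < A" "(b y)\<^sup>2 + (\<sigma> y)\<^sup>2 \<le> A * (1 + (y - x n)\<^sup>2)"
  using someI_ex[OF growth_constant] unfolding A_def by blast+

lemma solution: "n \<ge> 1 \<Longrightarrow> volterra_solution (M n) (F n) (B n) K b \<sigma> (x n) (X n) A"
proof -
  assume n: "n \<ge> 1"
  interpret brownian_motion "M n" "F n" "B n" using X[OF n] by (simp add: continuous_weak_solution_def)
  show ?thesis
    by unfold_locales (use K X[OF n] A(2) continuous_b continuous_\<sigma> in \<open>auto intro: borel_measurable_continuous_onI\<close>)
qed

text \<open>The bound of \<open>second_moment_bound\<close> on \<open>[0, T/n]\<close>.\<close>
definition q :: "nat \<Rightarrow> real" where "q n = 8 * A * energy (T / real n)"

lemma q_tendsto_0: "q \<longlonglongrightarrow> 0"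
  unfolding q_def[abs_def] by (rule tendsto_mult_right_zero[OF energy_scaled_tendsto_0])

lemma q_pos: "n \<ge> 1 \<Longrightarrow> 0 < q n"
  using A(1) T_pos by (simp add: q_def energy_pos)

lemma eventually_good: "\<forall>\<^sub>F n in sequentially. n \<ge> 1 \<and> T / real n \<le> 1 \<and> q n \<le> 1"
proof -
  have Tn: "(\<lambda>n. T / real n) \<longlonglongrightarrow> 0" by (rule tendsto_divide_0[OF tendsto_const]) (rule filterlim_real_at_infinity_sequentially)
  have "\<forall>\<^sub>F n in sequentially. T / real n < 1" using order_tendstoD(2)[OF Tn] by simp
  moreover have "\<forall>\<^sub>F n in sequentially. q n < 1" using order_tendstoD(2)[OF q_tendsto_0] by simp
  ultimately show ?thesis using eventually_ge_at_top[of 1] by eventually_elim auto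
qed

abbreviation \<Delta> :: "nat \<Rightarrow> 'n \<Rightarrow> 'a \<Rightarrow> real" where
  "\<Delta> n j \<omega> \<equiv> X n (\<tau> j / real n) \<omega> - x n"

abbreviation target :: "nat \<Rightarrow> 'n \<Rightarrow> real \<Rightarrow> real" where
  "target n j s \<equiv> \<sigma> (x n) * kernel_at K (\<tau> j / real n) s"

lemma increment_moment:
  assumes n: "n \<ge> 1" "T / real n \<le> 1" "q n \<le> 1"
  shows "(\<integral>\<^sup>+\<omega>. ennreal ((\<Delta> n j \<omega>)\<^sup>2) \<partial>M n) \<le> ennreal (q n)"
proof -
  interpret volterra_solution "M n" "F n" "B n" K b \<sigma> "x n" "X n" A by (rule solution[OF n(1)])
  have "0 \<le> T / real n" "0 \<le> \<tau> j / real n" "\<tau> j / real n \<le> T / real n"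
    using n(1) T_pos \<tau>[of j] \<tau>_le_T[of j] by (auto simp: divide_right_mono)
  then show ?thesis using second_moment_bound[of "T / real n" "\<tau> j / real n"] n(2,3) unfolding q_def energy_def by auto
qed

lemma X_measurable_at: "n \<ge> 1 \<Longrightarrow> X n (\<tau> j / real n) \<in> borel_measurable (M n)"
proof -
  assume n: "n \<ge> 1"
  interpret volterra_solution "M n" "F n" "B n" K b \<sigma> "x n" "X n" A by (rule solution[OF n])
  show ?thesis using \<tau>[of j] n by (intro X_measurable) (auto simp: less_imp_le)
qed

lemma prob_space_M: "n \<ge> 1 \<Longrightarrow> prob_space (M n)"
proof -
  assume n: "n \<ge> 1"
  interpret volterra_solution "M n" "F n" "B n" K b \<sigma> "x n" "X n" A by (rule solution[OF n])
  show ?thesis by unfold_locales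
qed

text \<open>The assumption on \<open>Kbar\<close> for equal times implies that \<open>energy (T/n) / energy
  (1/n)\<close> converges.\<close>
lemma scaled_q_bounded: "\<exists>Q\<ge>0. \<forall>\<^sub>F n in sequentially. scale_rate K n * q n \<le> Q"
proof -
  have "(\<lambda>n. 8 * A * (scale_rate K n * energy (T / real n))) \<longlonglongrightarrow> 8 * A * (LBINT r:{0..T}. (Kbar r)\<^sup>2)"
    using T_pos by (intro tendsto_mult tendsto_const scale_rate_limit) auto
  then have lim: "(\<lambda>n. scale_rate K n * q n) \<longlonglongrightarrow> 8 * A * (LBINT r:{0..T}. (Kbar r)\<^sup>2)"
    by (simp add: q_def mult_ac)
  have "0 \<le> 8 * A * (LBINT r:{0..T}. (Kbar r)\<^sup>2)" using A(1) by (simp add: set_lebesgue_integral_def)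
  moreover have "\<forall>\<^sub>F n in sequentially. scale_rate K n * q n < 8 * A * (LBINT r:{0..T}. (Kbar r)\<^sup>2) + 1"
    by (rule order_tendstoD(2)[OF lim]) simp
  then have "\<forall>\<^sub>F n in sequentially. scale_rate K n * q n \<le> 8 * A * (LBINT r:{0..T}. (Kbar r)\<^sup>2) + 1"
    by eventually_elim simp
  ultimately show ?thesis by (intro exI[of _ "8 * A * (LBINT r:{0..T}. (Kbar r)\<^sup>2) + 1"]) auto
qed

text \<open>The tolerance is \<open>1/(n \<lambda>(n))\<close>, that is \<open>1/n\<close> after rescaling. A
  step function is preferred to the kernel itself since its Brownian integral is a finite sum, which exists on
  every space without further construction.\<close>
definition approximates :: "nat \<Rightarrow> 'n \<Rightarrow> nat \<times> (nat \<Rightarrow> real) \<times> (nat \<Rightarrow> real) \<Rightarrow> bool" where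
  "approximates n j z \<longleftrightarrow> (case z of (k, u, c) \<Rightarrow> grid k u \<and>
     (\<integral>s. (target n j s - step_function k u c s)\<^sup>2 \<partial>lborel) < energy (1 / real n) / real n)"

definition code :: "nat \<Rightarrow> 'n \<Rightarrow> nat \<times> (nat \<Rightarrow> real) \<times> (nat \<Rightarrow> real)" where
  "code n j = (SOME z. approximates n j z)"

definition pieces where "pieces n j = fst (code n j)"
definition grid_points where "grid_points n j = fst (snd (code n j))"
definition heights where "heights n j = snd (snd (code n j))"

abbreviation step where "step n j \<equiv> step_function (pieces n j) (grid_points n j) (heights n j)"

abbreviation stopped_step where "stopped_step n j s \<equiv> step n j s * indicator {0..\<tau> j / real n} s"

text \<open>The Gaussian approximation of the rescaled increments \<open>Z\<close> below.\<close>
definition V :: "nat \<Rightarrow> 'n \<Rightarrow> 'a \<Rightarrow> real" where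
  "V n j \<omega> = sqrt (scale_rate K n) *
     simple_integral (B n) (deterministic_code (pieces n j) (grid_points n j) (heights n j)) (\<tau> j / real n) \<omega>"

lemma code_approximates:
  assumes n: "n \<ge> 1"
  shows "grid (pieces n j) (grid_points n j)"
    "(\<integral>s. (target n j s - step n j s)\<^sup>2 \<partial>lborel) < energy (1 / real n) / real n"
proof -
  have "\<exists>k u c. grid k u \<and> (\<integral>s. (target n j s - step_function k u c s)\<^sup>2 \<partial>lborel) < energy (1 / real n) / real n"
    by (rule kernel_at_step_approximation[OF K]) (use n \<tau>[of j] energy_pos[of "1 / real n"] in auto)
  then have "\<exists>z. approximates n j z" by (auto simp: approximates_def)
  then have "approximates n j (code n j)" unfolding code_def by (rule someI_ex)
  then show "grid (pieces n j) (grid_points n j)"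
    "(\<integral>s. (target n j s - step n j s)\<^sup>2 \<partial>lborel) < energy (1 / real n) / real n"
    by (auto simp: approximates_def pieces_def grid_points_def heights_def split: prod.splits)
qed

lemma scaled_approximation_error:
  assumes n: "n \<ge> 1"
  shows "scale_rate K n * (\<integral>s. (target n j s - step n j s)\<^sup>2 \<partial>lborel) \<le> 1 / real n"
proof -
  have e: "energy (1 / real n) > 0" using n by (intro energy_pos) auto
  have "scale_rate K n * (\<integral>s. (target n j s - step n j s)\<^sup>2 \<partial>lborel) \<le> scale_rate K n * (energy (1 / real n) / real n)"
    using code_approximates(2)[OF n, of j] by (intro mult_left_mono scale_rate_nonneg) auto
  also have "\<dots> = 1 / real n" using e by (simp add: scale_rate_energy)
  finally show ?thesis .
qed

lemma V_measurable: "n \<ge> 1 \<Longrightarrow> V n j \<in> borel_measurable (M n)"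
proof -
  assume n: "n \<ge> 1"
  interpret volterra_solution "M n" "F n" "B n" K b \<sigma> "x n" "X n" A by (rule solution[OF n])
  have "simple_integral (B n) (deterministic_code (pieces n j) (grid_points n j) (heights n j)) (\<tau> j / real n) \<in> borel_measurable (M n)"
    using \<tau>[of j] by (intro simple_integral_measurable simple_process_deterministic code_approximates(1)[OF n]) auto
  then show ?thesis unfolding V_def[abs_def] by measurable
qed

definition Z :: "nat \<Rightarrow> 'n \<Rightarrow> 'a \<Rightarrow> real" where
  "Z n j \<omega> = sqrt (scale_rate K n) * (\<Delta> n j \<omega>)"

text \<open>A bound for the squared L2 distance of \<open>Z\<close> and \<open>V\<close>. Its terms come from
  the drift, from freezing \<open>\<sigma>\<close> at \<open>x n\<close>, and from the step function.\<close>
definition \<rho> :: "nat \<Rightarrow> real" where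
  "\<rho> n = scale_rate K n * q n * (T / real n) + scale_rate K n * q n * (C\<^sup>2 / A) * q n powr chi_\<sigma> + 4 / real n"

lemma \<rho>_tendsto_0: "\<rho> \<longlonglongrightarrow> 0"
proof -
  obtain Q where Q: "Q \<ge> 0" "\<forall>\<^sub>F n in sequentially. scale_rate K n * q n \<le> Q" using scaled_q_bounded by blast
  have Tn: "(\<lambda>n. T / real n) \<longlonglongrightarrow> 0" by (rule tendsto_divide_0[OF tendsto_const]) (rule filterlim_real_at_infinity_sequentially)
  have n4: "(\<lambda>n. 4 / real n) \<longlonglongrightarrow> 0" by (rule tendsto_divide_0[OF tendsto_const]) (rule filterlim_real_at_infinity_sequentially)
  have "(\<lambda>n. q n powr chi_\<sigma>) \<longlonglongrightarrow> 0 powr chi_\<sigma>"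
    by (rule tendsto_powr'[OF q_tendsto_0 tendsto_const])
      (use constants A(1) in \<open>auto simp: q_def energy_def set_lebesgue_integral_def\<close>)
  then have qp: "(\<lambda>n. q n powr chi_\<sigma>) \<longlonglongrightarrow> 0" by simp
  show ?thesis
  proof (rule tendsto_sandwich[where f = "\<lambda>_. 0"])
    have "(\<lambda>n. Q * (T / real n) + Q * (C\<^sup>2 / A) * q n powr chi_\<sigma> + 4 / real n) \<longlonglongrightarrow> Q * 0 + Q * (C\<^sup>2 / A) * 0 + 0"
      by (intro tendsto_intros Tn qp n4)
    then show "(\<lambda>n. Q * (T / real n) + Q * (C\<^sup>2 / A) * q n powr chi_\<sigma> + 4 / real n) \<longlonglongrightarrow> 0" by simp
    have q0: "0 \<le> scale_rate K n * q n" for n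
      using scale_rate_nonneg[of n] A(1) by (simp add: q_def energy_def set_lebesgue_integral_def)
    show "\<forall>\<^sub>F n in sequentially. 0 \<le> \<rho> n"
      using T_pos A(1) q0 by (intro always_eventually allI) (simp add: \<rho>_def)
    show "\<forall>\<^sub>F n in sequentially. \<rho> n \<le> Q * (T / real n) + Q * (C\<^sup>2 / A) * q n powr chi_\<sigma> + 4 / real n"
      using Q(2)
    proof eventually_elim
      case (elim n)
      then show ?case unfolding \<rho>_def using T_pos A(1)
        by (intro add_mono mult_right_mono order_refl) auto
    qed
  qed auto
qed

text \<open>Since \<open>\<bar>X - x\<^sub>n\<bar>\<close> is at most of order \<open>sqrt (q n)\<close>, the
  Hoelder condition makes \<open>(\<sigma>(X) - \<sigma>(x\<^sub>n))\<^sup>2\<close> of order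
  \<open>q(n)\<^sup>\<chi>\<close>; \<open>powr_le_affine_square\<close> with \<open>p = q n\<close> brings it
  into the form that \<open>increment_approximation\<close> asks for.\<close>
lemma Z_V_distance:
  assumes n: "n \<ge> 1" "T / real n \<le> 1" "q n \<le> 1"
  shows "(\<integral>\<^sup>+\<omega>. ennreal ((Z n j \<omega> - V n j \<omega>)\<^sup>2) \<partial>M n) \<le> ennreal (\<rho> n)"
proof -
  interpret volterra_solution "M n" "F n" "B n" K b \<sigma> "x n" "X n" A by (rule solution[OF n(1)])
  let ?t = "\<tau> j / real n" and ?e = "energy (T / real n)"
  let ?I = "simple_integral (B n) (deterministic_code (pieces n j) (grid_points n j) (heights n j)) ?t"
  define D where "D = (\<integral>s. (\<sigma> (x n) * kernel_at K ?t s - step n j s)\<^sup>2 \<partial>lborel)"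
  define w where "w = C\<^sup>2 * q n powr chi_\<sigma>"
  have t: "0 \<le> T / real n" "0 \<le> ?t" "?t \<le> T / real n"
    using n(1) T_pos \<tau>[of j] \<tau>_le_T[of j] by (auto simp: divide_right_mono)
  have g: "grid (pieces n j) (grid_points n j)" by (rule code_approximates(1)[OF n(1)])
  have e0: "0 \<le> ?e" by (simp add: energy_def set_lebesgue_integral_def)
  have \<sigma>w: "(\<sigma> y - \<sigma> (x n))\<^sup>2 \<le> w * (1 + 1 / (8 * A * ?e) * (y - x n)\<^sup>2)" for y
  proof -
    have "(\<sigma> y - \<sigma> (x n))\<^sup>2 = \<bar>\<sigma> y - \<sigma> (x n)\<bar>\<^sup>2" by simp
    also have "\<dots> \<le> (C * \<bar>y - x n\<bar> powr chi_\<sigma>)\<^sup>2" by (intro power_mono hoelder_\<sigma>) auto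
    also have "\<dots> = C\<^sup>2 * (\<bar>y - x n\<bar> powr chi_\<sigma>)\<^sup>2" by (simp add: power_mult_distrib)
    also have "\<dots> \<le> C\<^sup>2 * (q n powr chi_\<sigma> * (1 + 1 / q n * \<bar>y - x n\<bar>\<^sup>2))"
      by (intro mult_left_mono powr_le_affine_square q_pos n(1) constants) auto
    finally show ?thesis by (simp add: w_def q_def mult.assoc)
  qed
  have main: "(\<integral>\<^sup>+\<omega>. ennreal ((X n ?t \<omega> - x n - ?I \<omega>)\<^sup>2) \<partial>M n) \<le> ennreal (4 * A * ?e * ?t + 8 * w * ?e + 4 * D)"
    unfolding D_def kernel_at_def energy_def
    by (rule increment_approximation[OF t(1) n(2) _ _ t(2,3) _ _ g])
      (use n(3) q_pos[OF n(1)] \<sigma>w in \<open>auto simp: q_def energy_def w_def\<close>)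
  have I: "?I \<in> borel_measurable (M n)"
    using t by (intro simple_integral_measurable simple_process_deterministic g) auto
  note [measurable] = I X_measurable_at[OF n(1), of j]
  have "(\<integral>\<^sup>+\<omega>. ennreal ((Z n j \<omega> - V n j \<omega>)\<^sup>2) \<partial>M n) = (\<integral>\<^sup>+\<omega>. ennreal (scale_rate K n) * ennreal ((X n ?t \<omega> - x n - ?I \<omega>)\<^sup>2) \<partial>M n)"
    using scale_rate_nonneg[of n]
    by (intro nn_integral_cong) (simp add: Z_def V_def right_diff_distrib[symmetric] power_mult_distrib ennreal_mult)
  also have "\<dots> = ennreal (scale_rate K n) * (\<integral>\<^sup>+\<omega>. ennreal ((X n ?t \<omega> - x n - ?I \<omega>)\<^sup>2) \<partial>M n)"
    by (rule nn_integral_cmult) measurable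
  also have "\<dots> \<le> ennreal (scale_rate K n) * ennreal (4 * A * ?e * ?t + 8 * w * ?e + 4 * D)"
    by (intro mult_left_mono main) auto
  also have "\<dots> = ennreal (scale_rate K n * (4 * A * ?e * ?t + 8 * w * ?e + 4 * D))"
  proof (rule ennreal_mult[symmetric, OF scale_rate_nonneg])
    have "0 \<le> w" "0 \<le> D" by (auto simp: w_def D_def)
    then show "0 \<le> 4 * A * ?e * ?t + 8 * w * ?e + 4 * D"
      using A(1) e0 t(2) by (intro add_nonneg_nonneg mult_nonneg_nonneg) auto
  qed
  also have "\<dots> \<le> ennreal (\<rho> n)"
  proof (rule ennreal_leI)
    let ?l = "scale_rate K n"
    have D: "?l * D \<le> 1 / real n" unfolding D_def by (rule scaled_approximation_error[OF n(1)])
    have "?l * (4 * A * ?e * ?t) \<le> ?l * (8 * A * ?e * (T / real n))"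
      using scale_rate_nonneg[of n] A(1) e0 t by (intro mult_left_mono mult_mono) auto
    moreover have "?l * (8 * w * ?e) = ?l * q n * (C\<^sup>2 / A) * q n powr chi_\<sigma>"
      using A(1) by (simp add: w_def q_def field_simps)
    moreover have "?l * (4 * A * ?e * ?t + 8 * w * ?e + 4 * D) = ?l * (4 * A * ?e * ?t) + ?l * (8 * w * ?e) + 4 * (?l * D)"
      by (simp add: algebra_simps)
    moreover have "?l * (8 * A * ?e * (T / real n)) = ?l * q n * (T / real n)" by (simp add: q_def)
    ultimately show "?l * (4 * A * ?e * ?t + 8 * w * ?e + 4 * D) \<le> \<rho> n" using D unfolding \<rho>_def by linarith
  qed
  finally show ?thesis .
qed

lemma V_square_integrable:
  "\<exists>m. \<forall>\<^sub>F n in sequentially. \<forall>j. integrable (M n) (\<lambda>\<omega>. (V n j \<omega>)\<^sup>2) \<and> (\<integral>\<omega>. (V n j \<omega>)\<^sup>2 \<partial>M n) \<le> m"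
proof -
  obtain Q where Q: "Q \<ge> 0" "\<forall>\<^sub>F n in sequentially. scale_rate K n * q n \<le> Q" using scaled_q_bounded by blast
  have "\<forall>\<^sub>F n in sequentially. \<rho> n < 1" using order_tendstoD(2)[OF \<rho>_tendsto_0] by simp
  then have "\<forall>\<^sub>F n in sequentially. \<forall>j. integrable (M n) (\<lambda>\<omega>. (V n j \<omega>)\<^sup>2) \<and> (\<integral>\<omega>. (V n j \<omega>)\<^sup>2 \<partial>M n) \<le> 2 + 2 * Q"
    using eventually_good Q(2)
  proof eventually_elim
    case (elim n)
    then have n: "n \<ge> 1" "T / real n \<le> 1" "q n \<le> 1" by auto
    show ?case
    proof
      fix j
      note [measurable] = V_measurable[OF n(1), of j] X_measurable_at[OF n(1), of j]
      have [measurable]: "Z n j \<in> borel_measurable (M n)" unfolding Z_def[abs_def] by measurable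
      have "(\<integral>\<^sup>+\<omega>. ennreal ((V n j \<omega>)\<^sup>2) \<partial>M n) \<le>
        (\<integral>\<^sup>+\<omega>. 2 * ennreal ((Z n j \<omega> - V n j \<omega>)\<^sup>2) + ennreal (2 * scale_rate K n) * ennreal ((\<Delta> n j \<omega>)\<^sup>2) \<partial>M n)"
      proof (rule nn_integral_mono)
        fix \<omega>
        have "(V n j \<omega>)\<^sup>2 \<le> 2 * (Z n j \<omega> - V n j \<omega>)\<^sup>2 + 2 * (Z n j \<omega>)\<^sup>2"
          using sum_squares_bound[of "V n j \<omega> - Z n j \<omega>" "Z n j \<omega>"] power2_sum[of "V n j \<omega> - Z n j \<omega>" "Z n j \<omega>"]
          by (simp add: power2_commute)
        also have "(Z n j \<omega>)\<^sup>2 = scale_rate K n * (\<Delta> n j \<omega>)\<^sup>2"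
          using scale_rate_nonneg[of n] by (simp add: Z_def power_mult_distrib)
        finally have "ennreal ((V n j \<omega>)\<^sup>2) \<le> ennreal (2 * (Z n j \<omega> - V n j \<omega>)\<^sup>2 + 2 * scale_rate K n * (\<Delta> n j \<omega>)\<^sup>2)"
          by (intro ennreal_leI) (simp add: mult.assoc)
        also have "\<dots> = 2 * ennreal ((Z n j \<omega> - V n j \<omega>)\<^sup>2) + ennreal (2 * scale_rate K n) * ennreal ((\<Delta> n j \<omega>)\<^sup>2)"
          using scale_rate_nonneg[of n] by (simp add: ennreal_plus ennreal_mult)
        finally show "ennreal ((V n j \<omega>)\<^sup>2) \<le> 2 * ennreal ((Z n j \<omega> - V n j \<omega>)\<^sup>2) + ennreal (2 * scale_rate K n) * ennreal ((\<Delta> n j \<omega>)\<^sup>2)" .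
      qed
      also have "\<dots> = 2 * (\<integral>\<^sup>+\<omega>. ennreal ((Z n j \<omega> - V n j \<omega>)\<^sup>2) \<partial>M n) + ennreal (2 * scale_rate K n) * (\<integral>\<^sup>+\<omega>. ennreal ((\<Delta> n j \<omega>)\<^sup>2) \<partial>M n)"
        by (simp add: nn_integral_add nn_integral_cmult)
      also have "\<dots> \<le> 2 * ennreal 1 + ennreal (2 * scale_rate K n) * ennreal (q n)"
        using Z_V_distance[OF n, of j] elim(1)
        by (intro add_mono mult_left_mono increment_moment n) (auto elim!: order_trans intro!: ennreal_leI)
      also have "\<dots> = ennreal (2 + 2 * (scale_rate K n * q n))"
        using scale_rate_nonneg[of n] q_pos[OF n(1)] by (simp add: ennreal_plus ennreal_mult mult.assoc)
      also have "\<dots> \<le> ennreal (2 + 2 * Q)" using elim(3) by (intro ennreal_leI) simp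
      finally have b: "(\<integral>\<^sup>+\<omega>. ennreal ((V n j \<omega>)\<^sup>2) \<partial>M n) \<le> ennreal (2 + 2 * Q)" .
      then have i: "integrable (M n) (\<lambda>\<omega>. (V n j \<omega>)\<^sup>2)"
        by (intro integrableI_bounded) (auto simp: le_less_trans)
      have "ennreal (\<integral>\<omega>. (V n j \<omega>)\<^sup>2 \<partial>M n) \<le> ennreal (2 + 2 * Q)"
        using b nn_integral_eq_integral[OF i] by simp
      then have "(\<integral>\<omega>. (V n j \<omega>)\<^sup>2 \<partial>M n) \<le> 2 + 2 * Q" using Q(1) by (subst (asm) ennreal_le_iff) auto
      with i show "integrable (M n) (\<lambda>\<omega>. (V n j \<omega>)\<^sup>2) \<and> (\<integral>\<omega>. (V n j \<omega>)\<^sup>2 \<partial>M n) \<le> 2 + 2 * Q" ..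
    qed
  qed
  then show ?thesis ..
qed

text \<open>The assumption on \<open>Kbar\<close> covers ordered pairs of times; the other pairs follow by
  symmetry.\<close>
lemma kernel_covariance_limit:
  "(\<lambda>n. scale_rate K n * (\<integral>s. kernel_at K (\<tau> i / real n) s * kernel_at K (\<tau> j / real n) s \<partial>lborel))
    \<longlonglongrightarrow> (\<integral>s. kernel_at Kbar (\<tau> i) s * kernel_at Kbar (\<tau> j) s \<partial>lborel)"
proof -
  have le: "(\<lambda>n. scale_rate K n * (\<integral>s. kernel_at K (\<tau> i / real n) s * kernel_at K (\<tau> j / real n) s \<partial>lborel))
    \<longlonglongrightarrow> (\<integral>s. kernel_at Kbar (\<tau> i) s * kernel_at Kbar (\<tau> j) s \<partial>lborel)" if ij: "\<tau> i \<le> \<tau> j" for i j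
  proof -
    have "(\<integral>s. kernel_at K (\<tau> i / real n) s * kernel_at K (\<tau> j / real n) s \<partial>lborel)
      = (LBINT r:{0..\<tau> i / real n}. K ((\<tau> j - \<tau> i) / real n + r) * K r)" for n
      using \<tau>[of i] ij by (subst kernel_at_inner) (auto simp: divide_right_mono diff_divide_distrib)
    moreover have "(\<integral>s. kernel_at Kbar (\<tau> i) s * kernel_at Kbar (\<tau> j) s \<partial>lborel) = (LBINT r:{0..\<tau> i}. Kbar (\<tau> j - \<tau> i + r) * Kbar r)"
      using \<tau>[of i] ij by (intro kernel_at_inner) auto
    moreover have "\<tau> j \<le> max 1 (Max (range \<tau>))" using \<tau>_le_T[of j] unfolding T_def by linarith
    ultimately show ?thesis
      using K_limit[OF less_imp_le[OF \<tau>] ij] by simp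
  qed
  show ?thesis
  proof (cases "\<tau> i \<le> \<tau> j")
    case False
    then show ?thesis using le[of j i] by (simp add: mult.commute)
  qed (rule le)
qed

text \<open>The step functions may be replaced by the kernels, whose quadratic form is a combination of the
  covariances of \<open>kernel_covariance_limit\<close>; the factor \<open>\<sigma>(x\<^sub>n)\<close>
  converges by continuity.\<close>
lemma V_variance_limit:
  fixes a :: "'n \<Rightarrow> real"
  shows "(\<lambda>n. \<integral>s. (\<Sum>j\<in>UNIV. a j * sqrt (scale_rate K n) * (stopped_step n j s))\<^sup>2 \<partial>lborel)
    \<longlonglongrightarrow> (\<integral>s. (\<Sum>j\<in>UNIV. a j * \<sigma> xbar * kernel_at Kbar (\<tau> j) s)\<^sup>2 \<partial>lborel)"
proof -
  define S where "S = (\<Sum>j\<in>UNIV. (a j)\<^sup>2)"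
  have S0: "0 \<le> S" by (simp add: S_def sum_nonneg)
  have tn: "0 \<le> \<tau> j / real n" for j n using \<tau>[of j] by simp
  have ks: "square_integrable (kernel_at K (\<tau> j / real n))" for j n by (rule square_integrable_kernel_at[OF K tn])
  have kbs: "square_integrable (kernel_at Kbar (\<tau> j))" for j
    by (rule square_integrable_kernel_at[OF Kbar less_imp_le[OF \<tau>]])
  define h where "h = (\<lambda>n j s. stopped_step n j s)"
  have hs: "square_integrable (h n j)" for n j unfolding h_def by (rule kernel_at_restricted_step(1)[OF K tn])
  define f where "f = (\<lambda>n s. \<Sum>j\<in>UNIV. a j * sqrt (scale_rate K n) * h n j s)"
  define g where "g = (\<lambda>n s. \<Sum>j\<in>UNIV. a j * sqrt (scale_rate K n) * (target n j s))"
  have fs: "square_integrable (f n)" for n unfolding f_def by (intro square_integrable_sum square_integrable_cmult hs)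
  have gs: "square_integrable (g n)" for n unfolding g_def by (intro square_integrable_sum square_integrable_cmult ks)
  have "(\<lambda>n. \<integral>s. (f n s)\<^sup>2 \<partial>lborel) \<longlonglongrightarrow> (\<integral>s. (\<Sum>j\<in>UNIV. a j * \<sigma> xbar * kernel_at Kbar (\<tau> j) s)\<^sup>2 \<partial>lborel)"
  proof (rule square_integral_tendsto[where g = g])
    show "\<forall>\<^sub>F n in sequentially. square_integrable (f n)" "\<forall>\<^sub>F n in sequentially. square_integrable (g n)"
      using fs gs by (auto intro: always_eventually)
    show "(\<lambda>n. \<integral>s. (f n s - g n s)\<^sup>2 \<partial>lborel) \<longlonglongrightarrow> 0"
    proof (rule tendsto_sandwich[where f = "\<lambda>_. 0" and h = "\<lambda>n. S * (real CARD('n) * (1 / real n))"])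
      have "(\<lambda>n. 1 / real n) \<longlonglongrightarrow> 0" by (rule tendsto_divide_0[OF tendsto_const]) (rule filterlim_real_at_infinity_sequentially)
      then show "(\<lambda>n. S * (real CARD('n) * (1 / real n))) \<longlonglongrightarrow> 0" by (intro tendsto_mult_right_zero)
      show "\<forall>\<^sub>F n in sequentially. (\<integral>s. (f n s - g n s)\<^sup>2 \<partial>lborel) \<le> S * (real CARD('n) * (1 / real n))"
        using eventually_ge_at_top[of 1]
      proof eventually_elim
        case (elim n)
        have fg: "f n s - g n s = (\<Sum>j\<in>UNIV. a j * (sqrt (scale_rate K n) * (h n j s - target n j s)))" for s
          by (simp add: f_def g_def sum_subtractf[symmetric] algebra_simps)
        show ?case unfolding fg S_def
        proof (rule square_integral_linear_combination_le)
          fix j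
          show "square_integrable (\<lambda>s. sqrt (scale_rate K n) * (h n j s - target n j s))"
            by (intro square_integrable_cmult square_integrable_diff hs ks)
          have "(\<integral>s. (sqrt (scale_rate K n) * (h n j s - target n j s))\<^sup>2 \<partial>lborel)
            = scale_rate K n * (\<integral>s. (target n j s - h n j s)\<^sup>2 \<partial>lborel)"
            using scale_rate_nonneg[of n] by (simp add: power_mult_distrib power2_commute)
          also have "\<dots> \<le> scale_rate K n * (\<integral>s. (target n j s - step n j s)\<^sup>2 \<partial>lborel)"
            unfolding h_def by (intro mult_left_mono kernel_at_restricted_step(2)[OF K tn] scale_rate_nonneg)
          also have "\<dots> \<le> 1 / real n" by (rule scaled_approximation_error[OF elim])
          finally show "(\<integral>s. (sqrt (scale_rate K n) * (h n j s - target n j s))\<^sup>2 \<partial>lborel) \<le> 1 / real n" .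
        qed
      qed
    qed (auto intro: always_eventually)
    have eq: "(\<integral>s. (g n s)\<^sup>2 \<partial>lborel) = (\<Sum>i\<in>UNIV. \<Sum>j\<in>UNIV. a i * a j * (\<sigma> (x n))\<^sup>2 *
        (scale_rate K n * (\<integral>s. kernel_at K (\<tau> i / real n) s * kernel_at K (\<tau> j / real n) s \<partial>lborel)))" for n
    proof -
      have g_eq: "g n s = (\<Sum>j\<in>UNIV. (a j * sqrt (scale_rate K n) * \<sigma> (x n)) * kernel_at K (\<tau> j / real n) s)" for s
        by (simp add: g_def mult.assoc)
      have sq: "sqrt (scale_rate K n) * sqrt (scale_rate K n) = scale_rate K n" using scale_rate_nonneg[of n] by simp
      have c: "a i * sqrt (scale_rate K n) * \<sigma> (x n) * (a j * sqrt (scale_rate K n) * \<sigma> (x n)) * y = a i * a j * (\<sigma> (x n))\<^sup>2 * (scale_rate K n * y)" for i j y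
      proof -
        have "u * r * z * (u' * r * z) * y = u * u' * z\<^sup>2 * ((r * r) * y)" for u u' r z :: real
          by (simp only: power2_eq_square mult_ac)
        from this[of "a i" "sqrt (scale_rate K n)" "\<sigma> (x n)" "a j"] show ?thesis by (simp only: sq)
      qed
      show ?thesis unfolding g_eq by (subst square_integral_linear_combination[OF ks]) (simp only: c)
    qed
    have lim: "(\<integral>s. (\<Sum>j\<in>UNIV. a j * \<sigma> xbar * kernel_at Kbar (\<tau> j) s)\<^sup>2 \<partial>lborel) =
       (\<Sum>i\<in>UNIV. \<Sum>j\<in>UNIV. a i * a j * (\<sigma> xbar)\<^sup>2 * (\<integral>s. kernel_at Kbar (\<tau> i) s * kernel_at Kbar (\<tau> j) s \<partial>lborel))"
      by (subst square_integral_linear_combination[OF kbs]) (simp add: power2_eq_square mult_ac)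
    show "(\<lambda>n. \<integral>s. (g n s)\<^sup>2 \<partial>lborel) \<longlonglongrightarrow> (\<integral>s. (\<Sum>j\<in>UNIV. a j * \<sigma> xbar * kernel_at Kbar (\<tau> j) s)\<^sup>2 \<partial>lborel)"
      unfolding eq lim by (intro tendsto_intros tendsto_continuous_x[OF continuous_\<sigma>] kernel_covariance_limit)
  qed
  then show ?thesis by (simp only: f_def h_def)
qed

lemma Y_gaussian:
  fixes a :: "'n \<Rightarrow> real"
  shows "(\<integral>\<omega>. cos ((\<Sum>j\<in>UNIV. a j * Y (\<tau> j) \<omega>) + d) \<partial>M') = cos d * exp (- (\<integral>s. (\<Sum>j\<in>UNIV. a j * \<sigma> xbar * kernel_at Kbar (\<tau> j) s)\<^sup>2 \<partial>lborel) / 2)"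
proof -
  interpret W: brownian_motion M' F' W by (rule W)
  show ?thesis
    using W.ito_integrals_gaussian[OF Kbar \<tau> J[OF less_imp_le[OF \<tau>]], where a = "\<lambda>j. a j * \<sigma> xbar" and d = d]
    by (simp add: Y mult.assoc)
qed

lemma V_gaussian:
  fixes a :: "'n \<Rightarrow> real"
  assumes n: "n \<ge> 1"
  shows "(\<integral>\<omega>. cos ((\<Sum>j\<in>UNIV. a j * V n j \<omega>) + d) \<partial>M n) =
    cos d * exp (- (\<integral>s. (\<Sum>j\<in>UNIV. a j * sqrt (scale_rate K n) * (stopped_step n j s))\<^sup>2 \<partial>lborel) / 2)"
proof -
  interpret volterra_solution "M n" "F n" "B n" K b \<sigma> "x n" "X n" A by (rule solution[OF n])
  have "0 \<le> \<tau> j / real n" for j using \<tau>[of j] by simp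
  from expectation_cos_simple_integrals[where t = "\<lambda>j. \<tau> j / real n" and a = "\<lambda>j. a j * sqrt (scale_rate K n)" and d = d, OF code_approximates(1)[OF n] this]
  show ?thesis by (simp only: V_def mult.assoc)
qed

lemma Y_measurable: "Y (\<tau> j) \<in> borel_measurable M'"
proof -
  have "J (\<tau> j) \<in> borel_measurable M'" using J[OF less_imp_le[OF \<tau>]] by (simp add: has_ito_integral_def)
  then show ?thesis unfolding Y[abs_def] by measurable
qed

lemma inner_vec_lambda: "(v :: real^'m) \<bullet> (\<chi> j. f j) = (\<Sum>j\<in>UNIV. v $ j * f j)"
  by (simp add: inner_vec_def)

lemma V_converges: "converges_in_distribution M (\<lambda>n \<omega>. \<chi> j. V n j \<omega>) M' (\<lambda>\<omega>. \<chi> j. Y (\<tau> j) \<omega>)"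
proof -
  interpret W: brownian_motion M' F' W by (rule W)
  obtain m where m: "\<forall>\<^sub>F n in sequentially. \<forall>j. integrable (M n) (\<lambda>\<omega>. (V n j \<omega>)\<^sup>2) \<and> (\<integral>\<omega>. (V n j \<omega>)\<^sup>2 \<partial>M n) \<le> m"
    using V_square_integrable by blast
  show ?thesis
  proof (rule converges_in_distribution_if_cos)
    show "\<forall>\<^sub>F n in sequentially. prob_space (M n) \<and> (\<lambda>\<omega>. \<chi> j. V n j \<omega>) \<in> borel_measurable (M n)"
      using eventually_ge_at_top[of 1] by eventually_elim (intro conjI prob_space_M borel_measurable_vec_lambda V_measurable)
    show "prob_space M'" by unfold_locales
    show "(\<lambda>\<omega>. \<chi> j. Y (\<tau> j) \<omega>) \<in> borel_measurable M'" by (intro borel_measurable_vec_lambda Y_measurable)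
    show "\<forall>\<^sub>F n in sequentially. \<forall>j. integrable (M n) (\<lambda>\<omega>. ((\<chi> j. V n j \<omega>) $ j)\<^sup>2) \<and> (\<integral>\<omega>. ((\<chi> j. V n j \<omega>) $ j)\<^sup>2 \<partial>M n) \<le> m"
      using m by simp
    show "integrable M' (\<lambda>\<omega>. ((\<chi> j. Y (\<tau> j) \<omega>) $ j)\<^sup>2)" for j
      using W.ito_integral_square_integrable[OF Kbar less_imp_le[OF \<tau>] J[OF less_imp_le[OF \<tau>]], of j]
      by (simp add: Y power_mult_distrib)
    fix a :: "(real, 'n) vec" and d
    have "(\<lambda>n. cos d * exp (- (\<integral>s. (\<Sum>j\<in>UNIV. a $ j * sqrt (scale_rate K n) * (stopped_step n j s))\<^sup>2 \<partial>lborel) / 2))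
      \<longlonglongrightarrow> cos d * exp (- (\<integral>s. (\<Sum>j\<in>UNIV. a $ j * \<sigma> xbar * kernel_at Kbar (\<tau> j) s)\<^sup>2 \<partial>lborel) / 2)"
      by (intro tendsto_mult tendsto_const tendsto_exp tendsto_divide tendsto_minus V_variance_limit) simp
    moreover have "\<forall>\<^sub>F n in sequentially. cos d * exp (- (\<integral>s. (\<Sum>j\<in>UNIV. a $ j * sqrt (scale_rate K n) * (stopped_step n j s))\<^sup>2 \<partial>lborel) / 2)
      = (\<integral>\<omega>. cos (a \<bullet> (\<chi> j. V n j \<omega>) + d) \<partial>M n)"
      using eventually_ge_at_top[of 1]
    proof eventually_elim
      case (elim n)
      then show ?case unfolding inner_vec_lambda by (rule V_gaussian[symmetric])
    qed
    ultimately have "(\<lambda>n. \<integral>\<omega>. cos (a \<bullet> (\<chi> j. V n j \<omega>) + d) \<partial>M n)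
      \<longlonglongrightarrow> cos d * exp (- (\<integral>s. (\<Sum>j\<in>UNIV. a $ j * \<sigma> xbar * kernel_at Kbar (\<tau> j) s)\<^sup>2 \<partial>lborel) / 2)"
      by (rule Lim_transform_eventually)
    then show "(\<lambda>n. \<integral>\<omega>. cos (a \<bullet> (\<chi> j. V n j \<omega>) + d) \<partial>M n) \<longlonglongrightarrow> (\<integral>\<omega>. cos (a \<bullet> (\<chi> j. Y (\<tau> j) \<omega>) + d) \<partial>M')"
      unfolding inner_vec_lambda Y_gaussian .
  qed
qed

lemma Z_measurable: "n \<ge> 1 \<Longrightarrow> Z n j \<in> borel_measurable (M n)"
  unfolding Z_def[abs_def] using X_measurable_at by measurable

lemma Z_converges: "converges_in_distribution M (\<lambda>n \<omega>. \<chi> j. Z n j \<omega>) M' (\<lambda>\<omega>. \<chi> j. Y (\<tau> j) \<omega>)"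
proof (rule slutsky[OF V_converges])
  show "\<forall>\<^sub>F n in sequentially. (\<lambda>\<omega>. \<chi> j. Z n j \<omega>) \<in> borel_measurable (M n)"
    using eventually_ge_at_top[of 1] by eventually_elim (intro borel_measurable_vec_lambda Z_measurable)
  fix e :: real assume e: "e > 0"
  have "(\<lambda>n. measure (M n) {\<omega>\<in>space (M n). e < norm (\<chi> j. Z n j \<omega> - V n j \<omega>)}) \<longlonglongrightarrow> 0"
  proof (rule in_probability_vec[OF _ _ e])
    show "\<forall>\<^sub>F n in sequentially. prob_space (M n) \<and> (\<forall>j. (\<lambda>\<omega>. Z n j \<omega> - V n j \<omega>) \<in> borel_measurable (M n))"
      using eventually_ge_at_top[of 1]
      by eventually_elim (intro conjI allI prob_space_M borel_measurable_diff Z_measurable V_measurable)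
    fix j and e' :: real assume e': "e' > 0"
    show "(\<lambda>n. measure (M n) {\<omega>\<in>space (M n). e' < \<bar>Z n j \<omega> - V n j \<omega>\<bar>}) \<longlonglongrightarrow> 0"
    (* with D = \<Delta> and \<mu> = 0 the lemma is Chebyshev's inequality *)
    proof (rule in_probability_if_quadratic_remainder[where \<Delta> = "\<lambda>n \<omega>. Z n j \<omega> - V n j \<omega>" and \<mu> = "\<lambda>_. 0" and Q = 0, OF _ \<rho>_tendsto_0 _ _ e'])
      show "\<forall>\<^sub>F n in sequentially. prob_space (M n) \<and> (\<lambda>\<omega>. Z n j \<omega> - V n j \<omega>) \<in> borel_measurable (M n) \<and> (\<lambda>\<omega>. Z n j \<omega> - V n j \<omega>) \<in> borel_measurable (M n)
       \<and> (\<integral>\<^sup>+\<omega>. ennreal ((Z n j \<omega> - V n j \<omega>)\<^sup>2) \<partial>M n) \<le> ennreal (\<rho> n) \<and> 0 \<le> \<rho> n \<and> 0 \<le> (0::real) \<and> 0 * \<rho> n \<le> 0"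
        using eventually_good
      proof eventually_elim
        case (elim n)
        have "0 \<le> \<rho> n" using scale_rate_nonneg[of n] q_pos[of n] A(1) T_pos elim by (auto simp: \<rho>_def intro!: add_nonneg_nonneg mult_nonneg_nonneg)
        then show ?case using elim
          by (intro conjI prob_space_M borel_measurable_diff Z_measurable V_measurable Z_V_distance) simp_all
      qed
      show "\<exists>\<delta>>0. \<forall>\<^sub>F n in sequentially. \<forall>\<omega>\<in>space (M n). \<bar>Z n j \<omega> - V n j \<omega>\<bar> \<le> \<delta> \<longrightarrow> \<bar>Z n j \<omega> - V n j \<omega>\<bar> \<le> \<eta> * (1 + 0 * (Z n j \<omega> - V n j \<omega>)\<^sup>2)" if "\<eta> > 0" for \<eta>
        using that by (intro exI[of _ \<eta>]) auto
    qed simp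
  qed
  then show "(\<lambda>n. measure (M n) {\<omega>\<in>space (M n). e < norm ((\<chi> j. Z n j \<omega>) - (\<chi> j. V n j \<omega>))}) \<longlonglongrightarrow> 0"
    by (simp add: vec_eq_iff minus_vec_def)
qed

text \<open>The rescaled increments converge and so does their image under \<open>\<phi>\<close>. A statistic
  \<open>U\<close> with a Taylor expansion in \<open>\<Delta>\<close> has the same limit, because the
  remainder vanishes in probability. The remainder \<open>\<eta> (1 + \<lambda>(n) \<Delta>\<^sup>2)\<close>
  covers expansions of first and of second order.\<close>
lemma delta_method:
  fixes \<phi> :: "real \<Rightarrow> real" and U :: "nat \<Rightarrow> 'n \<Rightarrow> 'a \<Rightarrow> real"
  assumes \<phi>: "continuous_on UNIV \<phi>" and U: "\<And>n j. n \<ge> 1 \<Longrightarrow> U n j \<in> borel_measurable (M n)"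
    and rem: "\<And>\<eta> j. \<eta> > 0 \<Longrightarrow> \<exists>\<delta>>0. \<forall>\<^sub>F n in sequentially. \<forall>\<omega>\<in>space (M n). \<bar>\<Delta> n j \<omega>\<bar> \<le> \<delta> \<longrightarrow>
      \<bar>U n j \<omega> - \<phi> (Z n j \<omega>)\<bar> \<le> \<eta> * (1 + scale_rate K n * (\<Delta> n j \<omega>)\<^sup>2)"
  shows "converges_in_distribution M (\<lambda>n \<omega>. \<chi> j. U n j \<omega>) M' (\<lambda>\<omega>. \<chi> j. \<phi> (Y (\<tau> j) \<omega>))"
proof -
  obtain Q where Q: "Q \<ge> 0" "\<forall>\<^sub>F n in sequentially. scale_rate K n * q n \<le> Q" using scaled_q_bounded by blast
  have \<phi>m [measurable]: "\<phi> \<in> borel_measurable borel" using \<phi> by (rule borel_measurable_continuous_onI)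
  have "continuous_on UNIV (\<lambda>v::(real, 'n) vec. \<chi> j. \<phi> (v $ j))"
    by (intro continuous_on_vec_lambda continuous_on_compose2[OF \<phi>] continuous_intros) auto
  from converges_in_distribution_continuous_map[OF Z_converges this]
  have conv: "converges_in_distribution M (\<lambda>n \<omega>. \<chi> j. \<phi> (Z n j \<omega>)) M' (\<lambda>\<omega>. \<chi> j. \<phi> (Y (\<tau> j) \<omega>))" by simp
  have D: "(\<lambda>\<omega>. U n j \<omega> - \<phi> (Z n j \<omega>)) \<in> borel_measurable (M n)" if "n \<ge> 1" for n j
    using U[OF that, of j] Z_measurable[OF that, of j] by measurable
  show ?thesis
  proof (rule slutsky[OF conv])
    show "\<forall>\<^sub>F n in sequentially. (\<lambda>\<omega>. \<chi> j. U n j \<omega>) \<in> borel_measurable (M n)"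
      using eventually_ge_at_top[of 1] by eventually_elim (intro borel_measurable_vec_lambda U)
    fix e :: real assume e: "e > 0"
    have "(\<lambda>n. measure (M n) {\<omega>\<in>space (M n). e < norm (\<chi> j. U n j \<omega> - \<phi> (Z n j \<omega>))}) \<longlonglongrightarrow> 0"
    proof (rule in_probability_vec[OF _ _ e])
      show "\<forall>\<^sub>F n in sequentially. prob_space (M n) \<and> (\<forall>j. (\<lambda>\<omega>. U n j \<omega> - \<phi> (Z n j \<omega>)) \<in> borel_measurable (M n))"
        using eventually_ge_at_top[of 1] by eventually_elim (intro conjI allI prob_space_M D)
      fix j and e' :: real assume e': "e' > 0"
      show "(\<lambda>n. measure (M n) {\<omega>\<in>space (M n). e' < \<bar>U n j \<omega> - \<phi> (Z n j \<omega>)\<bar>}) \<longlonglongrightarrow> 0"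
      proof (rule in_probability_if_quadratic_remainder[where \<Delta> = "\<lambda>n \<omega>. \<Delta> n j \<omega>" and \<mu> = "scale_rate K", OF _ q_tendsto_0 Q(1) rem e'])
        show "\<forall>\<^sub>F n in sequentially. prob_space (M n) \<and> (\<lambda>\<omega>. \<Delta> n j \<omega>) \<in> borel_measurable (M n) \<and> (\<lambda>\<omega>. U n j \<omega> - \<phi> (Z n j \<omega>)) \<in> borel_measurable (M n)
          \<and> (\<integral>\<^sup>+\<omega>. ennreal ((\<Delta> n j \<omega>)\<^sup>2) \<partial>M n) \<le> ennreal (q n) \<and> 0 \<le> q n \<and> 0 \<le> scale_rate K n \<and> scale_rate K n * q n \<le> Q"
          using eventually_good Q(2)
        proof eventually_elim
          case (elim n)
          then show ?case
            by (intro conjI prob_space_M borel_measurable_diff borel_measurable_const X_measurable_at D increment_moment scale_rate_nonneg less_imp_le[OF q_pos]) simp_all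
        qed
      qed
    qed
    then show "(\<lambda>n. measure (M n) {\<omega>\<in>space (M n). e < norm ((\<chi> j. U n j \<omega>) - (\<chi> j. \<phi> (Z n j \<omega>)))}) \<longlonglongrightarrow> 0"
      by (simp add: vec_eq_iff minus_vec_def)
  qed
qed

lemma x_near: "\<delta> > 0 \<Longrightarrow> \<forall>\<^sub>F n in sequentially. \<bar>x n - xbar\<bar> \<le> \<delta>"
  using tendstoD[OF x, of \<delta>] by (auto simp: dist_real_def elim!: eventually_mono)

text \<open>The Taylor remainder \<open>\<eta> \<bar>\<Delta>\<bar>\<close> is multiplied by \<open>sqrt
  \<lambda>(n)\<close> and bounded through \<open>r \<le> 1 + r\<^sup>2\<close> with \<open>r = sqrt
  \<lambda>(n) \<bar>\<Delta>\<bar>\<close>.\<close>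
lemma first_order_limit:
  fixes f :: "real \<Rightarrow> real"
  assumes f: "f C1_differentiable_on UNIV"
  shows "converges_in_distribution
    M (\<lambda>n \<omega>. \<chi> j. sqrt (scale_rate K n) * (f (X n (\<tau> j / real n) \<omega>) - f (x n)))
    M' (\<lambda>\<omega>. \<chi> j. deriv f xbar * Y (\<tau> j) \<omega>)"
proof (rule delta_method[where \<phi> = "\<lambda>z. deriv f xbar * z"])
  show "continuous_on UNIV (\<lambda>z. deriv f xbar * z)" by (intro continuous_intros)
  have [measurable]: "f \<in> borel_measurable borel" using C1_real(3)[OF f] by (rule borel_measurable_continuous_onI)
  show "(\<lambda>\<omega>. sqrt (scale_rate K n) * (f (X n (\<tau> j / real n) \<omega>) - f (x n))) \<in> borel_measurable (M n)" if "n \<ge> 1" for n j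
    using X_measurable_at[OF that, of j] by measurable
  fix \<eta> :: real and j assume \<eta>: "\<eta> > 0"
  obtain \<delta> where \<delta>: "\<delta> > 0" "\<And>y z. \<bar>y - xbar\<bar> \<le> \<delta> \<Longrightarrow> \<bar>z - xbar\<bar> \<le> \<delta> \<Longrightarrow> \<bar>f y - f z - deriv f xbar * (y - z)\<bar> \<le> \<eta> * \<bar>y - z\<bar>"
    using C1_increment[OF f \<eta>, of xbar] by metis
  show "\<exists>\<delta>>0. \<forall>\<^sub>F n in sequentially. \<forall>\<omega>\<in>space (M n). \<bar>\<Delta> n j \<omega>\<bar> \<le> \<delta> \<longrightarrow>
      \<bar>sqrt (scale_rate K n) * (f (X n (\<tau> j / real n) \<omega>) - f (x n)) - deriv f xbar * Z n j \<omega>\<bar> \<le> \<eta> * (1 + scale_rate K n * (\<Delta> n j \<omega>)\<^sup>2)"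
  proof (intro exI[of _ "\<delta> / 2"] conjI)
    show "\<delta> / 2 > 0" using \<delta>(1) by simp
    show "\<forall>\<^sub>F n in sequentially. \<forall>\<omega>\<in>space (M n). \<bar>\<Delta> n j \<omega>\<bar> \<le> \<delta> / 2 \<longrightarrow>
      \<bar>sqrt (scale_rate K n) * (f (X n (\<tau> j / real n) \<omega>) - f (x n)) - deriv f xbar * Z n j \<omega>\<bar> \<le> \<eta> * (1 + scale_rate K n * (\<Delta> n j \<omega>)\<^sup>2)"
      using x_near[OF \<open>\<delta> / 2 > 0\<close>]
    proof eventually_elim
      case (elim n)
      show ?case
      proof (intro ballI impI)
        fix \<omega> assume d: "\<bar>\<Delta> n j \<omega>\<bar> \<le> \<delta> / 2"
        let ?y = "X n (\<tau> j / real n) \<omega>" and ?l = "sqrt (scale_rate K n)"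
        have "\<bar>?y - xbar\<bar> \<le> \<delta>" "\<bar>x n - xbar\<bar> \<le> \<delta>" using d elim \<delta>(1) by linarith+
        then have *: "\<bar>f ?y - f (x n) - deriv f xbar * (?y - x n)\<bar> \<le> \<eta> * \<bar>?y - x n\<bar>" by (rule \<delta>(2))
        have l0: "0 \<le> ?l" using scale_rate_nonneg[of n] by simp
        have "\<bar>?l * (f ?y - f (x n)) - deriv f xbar * Z n j \<omega>\<bar> = ?l * \<bar>f ?y - f (x n) - deriv f xbar * (?y - x n)\<bar>"
        proof -
          have "?l * (f ?y - f (x n)) - deriv f xbar * Z n j \<omega> = ?l * (f ?y - f (x n) - deriv f xbar * (?y - x n))"
            by (simp add: Z_def algebra_simps)
          then show ?thesis using l0 by (simp add: abs_mult)
        qed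
        also have "\<dots> \<le> ?l * (\<eta> * \<bar>?y - x n\<bar>)" by (intro mult_left_mono * l0)
        also have "\<dots> = \<eta> * (?l * \<bar>?y - x n\<bar>)" by simp
        also have "\<dots> \<le> \<eta> * (1 + (?l * \<bar>?y - x n\<bar>)\<^sup>2)"
        proof (rule mult_left_mono)
          show "?l * \<bar>?y - x n\<bar> \<le> 1 + (?l * \<bar>?y - x n\<bar>)\<^sup>2"
            by (rule le_one_plus_square)
        qed (use \<eta> in simp)
        also have "(?l * \<bar>?y - x n\<bar>)\<^sup>2 = scale_rate K n * (?y - x n)\<^sup>2" using scale_rate_nonneg[of n] by (simp add: power_mult_distrib)
        finally show "\<bar>?l * (f ?y - f (x n)) - deriv f xbar * Z n j \<omega>\<bar> \<le> \<eta> * (1 + scale_rate K n * (?y - x n)\<^sup>2)" .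
      qed
    qed
  qed
qed

text \<open>After multiplication by \<open>\<lambda>(n)\<close> the linear term is the product of \<open>sqrt
  \<lambda>(n) f'(x\<^sub>n)\<close>, which vanishes by assumption, and \<open>r = sqrt \<lambda>(n)
  \<bar>\<Delta>\<bar>\<close>; the Taylor remainder is a small multiple of \<open>r\<^sup>2\<close>.\<close>
lemma second_order_limit:
  fixes f :: "real \<Rightarrow> real"
  assumes f: "f C1_differentiable_on UNIV" "deriv f C1_differentiable_on UNIV"
    and slope: "(\<lambda>n. sqrt (scale_rate K n) * deriv f (x n)) \<longlonglongrightarrow> 0"
  shows "converges_in_distribution
    M (\<lambda>n \<omega>. \<chi> j. scale_rate K n * (f (X n (\<tau> j / real n) \<omega>) - f (x n)))
    M' (\<lambda>\<omega>. \<chi> j. deriv (deriv f) xbar / 2 * (Y (\<tau> j) \<omega>)\<^sup>2)"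
proof (rule delta_method[where \<phi> = "\<lambda>z. deriv (deriv f) xbar / 2 * z\<^sup>2"])
  show "continuous_on UNIV (\<lambda>z. deriv (deriv f) xbar / 2 * z\<^sup>2)" by (intro continuous_intros)
  have [measurable]: "f \<in> borel_measurable borel" using C1_real(3)[OF f(1)] by (rule borel_measurable_continuous_onI)
  show "(\<lambda>\<omega>. scale_rate K n * (f (X n (\<tau> j / real n) \<omega>) - f (x n))) \<in> borel_measurable (M n)" if "n \<ge> 1" for n j
    using X_measurable_at[OF that, of j] by measurable
  fix \<eta> :: real and j assume \<eta>: "\<eta> > 0"
  then have \<eta>2: "\<eta> / 2 > 0" by simp
  obtain \<delta> where \<delta>: "\<delta> > 0" "\<And>y z. \<bar>y - xbar\<bar> \<le> \<delta> \<Longrightarrow> \<bar>z - xbar\<bar> \<le> \<delta> \<Longrightarrow>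
    \<bar>f y - f z - deriv f z * (y - z) - deriv (deriv f) xbar / 2 * (y - z)\<^sup>2\<bar> \<le> \<eta> / 2 * (y - z)\<^sup>2"
    using C2_increment[OF f \<eta>2, of xbar] by metis
  show "\<exists>\<delta>>0. \<forall>\<^sub>F n in sequentially. \<forall>\<omega>\<in>space (M n). \<bar>\<Delta> n j \<omega>\<bar> \<le> \<delta> \<longrightarrow>
      \<bar>scale_rate K n * (f (X n (\<tau> j / real n) \<omega>) - f (x n)) - deriv (deriv f) xbar / 2 * (Z n j \<omega>)\<^sup>2\<bar> \<le> \<eta> * (1 + scale_rate K n * (\<Delta> n j \<omega>)\<^sup>2)"
  proof (intro exI[of _ "\<delta> / 2"] conjI)
    show "\<delta> / 2 > 0" using \<delta>(1) by simp
    have "\<forall>\<^sub>F n in sequentially. \<bar>sqrt (scale_rate K n) * deriv f (x n)\<bar> < \<eta> / 2"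
      using tendstoD[OF slope \<eta>2] by (simp add: dist_real_def)
    then show "\<forall>\<^sub>F n in sequentially. \<forall>\<omega>\<in>space (M n). \<bar>\<Delta> n j \<omega>\<bar> \<le> \<delta> / 2 \<longrightarrow>
      \<bar>scale_rate K n * (f (X n (\<tau> j / real n) \<omega>) - f (x n)) - deriv (deriv f) xbar / 2 * (Z n j \<omega>)\<^sup>2\<bar> \<le> \<eta> * (1 + scale_rate K n * (\<Delta> n j \<omega>)\<^sup>2)"
      using x_near[OF \<open>\<delta> / 2 > 0\<close>]
    proof eventually_elim
      case (elim n)
      show ?case
      proof (intro ballI impI)
        fix \<omega> assume d: "\<bar>\<Delta> n j \<omega>\<bar> \<le> \<delta> / 2"
        let ?y = "X n (\<tau> j / real n) \<omega>" and ?l = "scale_rate K n"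
        let ?g = "f ?y - f (x n) - deriv f (x n) * (?y - x n) - deriv (deriv f) xbar / 2 * (?y - x n)\<^sup>2"
        define r where "r = sqrt ?l * \<bar>?y - x n\<bar>"
        have l0: "0 \<le> ?l" by (rule scale_rate_nonneg)
        have r2: "r\<^sup>2 = ?l * (?y - x n)\<^sup>2" using l0 by (simp add: r_def power_mult_distrib)
        have Z2: "(Z n j \<omega>)\<^sup>2 = ?l * (?y - x n)\<^sup>2" using l0 by (simp add: Z_def power_mult_distrib)
        have "\<bar>?y - xbar\<bar> \<le> \<delta>" "\<bar>x n - xbar\<bar> \<le> \<delta>" using d elim(2) \<delta>(1) by linarith+
        then have *: "\<bar>?g\<bar> \<le> \<eta> / 2 * (?y - x n)\<^sup>2" by (rule \<delta>(2))
        have "?l * (f ?y - f (x n)) - deriv (deriv f) xbar / 2 * (Z n j \<omega>)\<^sup>2 = ?l * (deriv f (x n) * (?y - x n)) + ?l * ?g"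
          unfolding Z2 by (simp add: algebra_simps)
        then have "\<bar>?l * (f ?y - f (x n)) - deriv (deriv f) xbar / 2 * (Z n j \<omega>)\<^sup>2\<bar> \<le> \<bar>?l * (deriv f (x n) * (?y - x n))\<bar> + ?l * \<bar>?g\<bar>"
          using abs_triangle_ineq[of "?l * (deriv f (x n) * (?y - x n))" "?l * ?g"] l0 by (simp only: abs_mult abs_of_nonneg)
        also have "\<bar>?l * (deriv f (x n) * (?y - x n))\<bar> = \<bar>sqrt ?l * deriv f (x n)\<bar> * r"
        proof -
          have "?l = sqrt ?l * sqrt ?l" using l0 by simp
          then have "?l * (deriv f (x n) * (?y - x n)) = (sqrt ?l * deriv f (x n)) * (sqrt ?l * (?y - x n))"
            by (metis mult.assoc mult.left_commute)
          then show ?thesis using l0 by (simp add: abs_mult r_def)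
        qed
        also have "\<dots> \<le> \<eta> / 2 * r" using elim(1) l0 by (intro mult_right_mono) (auto simp: r_def)
        also have "?l * \<bar>?g\<bar> \<le> ?l * (\<eta> / 2 * (?y - x n)\<^sup>2)" by (intro mult_left_mono * l0)
        also have "\<dots> = \<eta> / 2 * r\<^sup>2" unfolding r2 by simp
        finally have "\<bar>?l * (f ?y - f (x n)) - deriv (deriv f) xbar / 2 * (Z n j \<omega>)\<^sup>2\<bar> \<le> \<eta> / 2 * r + \<eta> / 2 * r\<^sup>2" by simp
        also have "\<dots> = \<eta> / 2 * (r + r\<^sup>2)" by (simp add: algebra_simps)
        also have "\<dots> \<le> \<eta> / 2 * (2 * (1 + r\<^sup>2))"
        proof (rule mult_left_mono)
          show "r + r\<^sup>2 \<le> 2 * (1 + r\<^sup>2)" using add_right_mono[OF le_one_plus_square[of r], of "r\<^sup>2"] by simp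
        qed (use \<eta> in simp)
        also have "\<dots> = \<eta> * (1 + r\<^sup>2)" by simp
        finally show "\<bar>?l * (f ?y - f (x n)) - deriv (deriv f) xbar / 2 * (Z n j \<omega>)\<^sup>2\<bar> \<le> \<eta> * (1 + ?l * (?y - x n)\<^sup>2)"
          unfolding r2 .
      qed
    qed
  qed
qed

text \<open>The integral is the limit of \<open>energy (\<tau>\<^sub>j/n) / energy (1/n)\<close>.\<close>
lemma limit_variance_pos: "0 < (LBINT r:{0..\<tau> j}. (Kbar r)\<^sup>2)"
proof (rule energy_ratio_limit_positive[where \<kappa> = energy and c = Cstar and g = "2 * \<gamma>star" and \<theta> = "\<tau> j"])
  show "Cstar * t powr (2 * \<gamma>star) \<le> energy t" if "0 < t" "t \<le> 1" for t
    using K_lower[OF that] by (simp add: energy_def)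
  show "(\<lambda>n. inverse (energy (1 / real n)) * energy (\<tau> j / real n)) \<longlonglongrightarrow> (LBINT r:{0..\<tau> j}. (Kbar r)\<^sup>2)"
    using scale_rate_limit[of "\<tau> j"] \<tau>[of j] \<tau>_le_T[of j] by (simp add: scale_rate_energy)
qed (use constants \<tau> energy_mono in auto)

text \<open>The law of \<open>Y\<close> at a single time is obtained from \<open>Y_gaussian\<close> with all
  but one coefficient equal to \<open>0\<close>.\<close>
lemma limit_square_law:
  "\<exists>c>0. distr M' borel (\<lambda>\<omega>. \<alpha> * (Y (\<tau> j) \<omega>)\<^sup>2) = distr (chi_square 1) borel (\<lambda>z. \<alpha> * c * z)"
proof -
  interpret W: brownian_motion M' F' W by (rule W)
  define v where "v = (\<sigma> xbar)\<^sup>2 * (LBINT r:{0..\<tau> j}. (Kbar r)\<^sup>2)"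
  have v: "v > 0" using limit_variance_pos \<sigma>_nz by (simp add: v_def)
  have cos: "W.expectation (\<lambda>\<omega>. cos (a * Y (\<tau> j) \<omega> + d)) = cos d * exp (- (a\<^sup>2 * v) / 2)" for a d
  proof -
    let ?a = "\<lambda>i. if i = j then a else 0"
    have s: "(\<Sum>i\<in>UNIV. ?a i * y i) = a * y j" for y :: "'n \<Rightarrow> real"
      by (simp add: if_distrib[of "\<lambda>u. u * _"] cong: if_cong)
    have "(\<integral>s. (a * \<sigma> xbar * kernel_at Kbar (\<tau> j) s)\<^sup>2 \<partial>lborel) = a\<^sup>2 * v"
    proof -
      have "(\<integral>s. (a * \<sigma> xbar * kernel_at Kbar (\<tau> j) s)\<^sup>2 \<partial>lborel) = (a * \<sigma> xbar)\<^sup>2 * (\<integral>s. kernel_at Kbar (\<tau> j) s * kernel_at Kbar (\<tau> j) s \<partial>lborel)"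
        by (simp only: power_mult_distrib[of "a * \<sigma> xbar"] power2_eq_square[of "kernel_at _ _ _"] integral_mult_right_zero)
      also have "(\<integral>s. kernel_at Kbar (\<tau> j) s * kernel_at Kbar (\<tau> j) s \<partial>lborel) = (LBINT r:{0..\<tau> j}. (Kbar r)\<^sup>2)"
        using \<tau>[of j] by (subst kernel_at_inner) (auto simp: power2_eq_square)
      finally show ?thesis by (simp add: v_def power_mult_distrib)
    qed
    then show ?thesis using Y_gaussian[of ?a d] by (simp only: s mult.assoc)
  qed
  show ?thesis using W.square_law_if_gaussian[OF Y_measurable v cos, of \<alpha>] v by blast
qed

end

theorem corollary2p4:
  fixes b \<sigma> K Kbar :: "real \<Rightarrow> real"
    and C Cstar chi_b chi_\<sigma> \<gamma> \<gamma>star :: real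
    and x :: "nat \<Rightarrow> real" and xbar :: real
    and M :: "nat \<Rightarrow> 'a measure" and F :: "nat \<Rightarrow> real \<Rightarrow> 'a measure"
    and B X :: "nat \<Rightarrow> real \<Rightarrow> 'a \<Rightarrow> real"
    and \<tau> :: "'n::{finite, linorder} \<Rightarrow> real"
    and M' :: "'b measure" and F' :: "real \<Rightarrow> 'b measure"
    and W Y J :: "real \<Rightarrow> 'b \<Rightarrow> real"
  assumes K: "L2_loc K"
    and constants: "C > 0" "Cstar > 0" "\<gamma> > 0" "\<gamma>star > 0"
      "0 < chi_b" "chi_b \<le> 1" "0 < chi_\<sigma>" "chi_\<sigma> \<le> 1"
    and hoelder_b: "\<And>y z. \<bar>b y - b z\<bar> \<le> C * \<bar>y - z\<bar> powr chi_b"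
    and hoelder_\<sigma>: "\<And>y z. \<bar>\<sigma> y - \<sigma> z\<bar> \<le> C * \<bar>y - z\<bar> powr chi_\<sigma>"
    and K_lower: "\<And>t. 0 < t \<Longrightarrow> t \<le> 1 \<Longrightarrow>
      Cstar * t powr (2 * \<gamma>star) \<le> (LBINT s:{0..t}. (K s)\<^sup>2)"
    and K_upper: "\<And>t. 0 < t \<Longrightarrow> t \<le> 1 \<Longrightarrow>
      (LBINT s:{0..t}. (K s)\<^sup>2) \<le> C * t powr (2 * \<gamma>)"
    and x: "x \<longlonglongrightarrow> xbar" and \<sigma>_nz: "\<sigma> xbar \<noteq> 0"
    and X: "\<And>n. n \<ge> 1 \<Longrightarrow> continuous_weak_solution K b \<sigma> (x n) (M n) (F n) (B n) (X n)"
    and \<tau>: "strict_mono \<tau>" "\<And>j. 0 < \<tau> j"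
    and i: "\<gamma>star < min (\<gamma> + 1 / 2) (\<gamma> * (1 + chi_\<sigma>))"
    and ii: "L2_loc Kbar"
      "\<And>s t. 0 \<le> s \<Longrightarrow> s \<le> t \<Longrightarrow> t \<le> max 1 (Max (range \<tau>)) \<Longrightarrow>
        (\<lambda>n. scale_rate K n * (LBINT r:{0..s / real n}. K ((t - s) / real n + r) * K r))
          \<longlonglongrightarrow> (LBINT r:{0..s}. Kbar (t - s + r) * Kbar r)"
    and W: "brownian_motion M' F' W"
    and J: "\<And>t. 0 \<le> t \<Longrightarrow> has_ito_integral M' F' W (\<lambda>s \<omega>. Kbar (t - s)) t (J t)"
    and Y: "\<And>t \<omega>. Y t \<omega> = \<sigma> xbar * J t \<omega>"
  shows
    "(\<forall>f :: real \<Rightarrow> real. f C1_differentiable_on UNIV \<longrightarrow>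
        converges_in_distribution
          M (\<lambda>n \<omega>. \<chi> j. sqrt (scale_rate K n) * (f (X n (\<tau> j / real n) \<omega>) - f (x n)))
          M' (\<lambda>\<omega>. \<chi> j. deriv f xbar * Y (\<tau> j) \<omega>)) \<and>
     (\<forall>f :: real \<Rightarrow> real.
        f C1_differentiable_on UNIV \<and> deriv f C1_differentiable_on UNIV \<and>
        deriv f xbar = 0 \<and> (\<lambda>n. sqrt (scale_rate K n) * deriv f (x n)) \<longlonglongrightarrow> 0 \<longrightarrow>
        converges_in_distribution
          M (\<lambda>n \<omega>. \<chi> j. scale_rate K n * (f (X n (\<tau> j / real n) \<omega>) - f (x n)))
          M' (\<lambda>\<omega>. \<chi> j. deriv (deriv f) xbar / 2 * (Y (\<tau> j) \<omega>)\<^sup>2) \<and>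
        (\<forall>j. \<exists>c>0. distr M' borel (\<lambda>\<omega>. deriv (deriv f) xbar / 2 * (Y (\<tau> j) \<omega>)\<^sup>2)
               = distr (chi_square 1) borel (\<lambda>z. deriv (deriv f) xbar / 2 * c * z)))"
proof -
  interpret small_time_setting b \<sigma> K Kbar C Cstar chi_b chi_\<sigma> \<gamma> \<gamma>star x xbar M F B X \<tau> M' F' W Y J
    by (rule small_time_setting.intro; fact)
  show ?thesis
  proof (intro conjI allI impI)
    fix f :: "real \<Rightarrow> real" assume "f C1_differentiable_on UNIV"
    then show "converges_in_distribution
          M (\<lambda>n \<omega>. \<chi> j. sqrt (scale_rate K n) * (f (X n (\<tau> j / real n) \<omega>) - f (x n)))
          M' (\<lambda>\<omega>. \<chi> j. deriv f xbar * Y (\<tau> j) \<omega>)"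
      by (rule first_order_limit)
  next
    fix f :: "real \<Rightarrow> real"
    assume "f C1_differentiable_on UNIV \<and> deriv f C1_differentiable_on UNIV \<and>
        deriv f xbar = 0 \<and> (\<lambda>n. sqrt (scale_rate K n) * deriv f (x n)) \<longlonglongrightarrow> 0"
    then show "converges_in_distribution
          M (\<lambda>n \<omega>. \<chi> j. scale_rate K n * (f (X n (\<tau> j / real n) \<omega>) - f (x n)))
          M' (\<lambda>\<omega>. \<chi> j. deriv (deriv f) xbar / 2 * (Y (\<tau> j) \<omega>)\<^sup>2)"
      by (intro second_order_limit) auto
  next
    fix f :: "real \<Rightarrow> real" and j
    show "\<exists>c>0. distr M' borel (\<lambda>\<omega>. deriv (deriv f) xbar / 2 * (Y (\<tau> j) \<omega>)\<^sup>2)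
               = distr (chi_square 1) borel (\<lambda>z. deriv (deriv f) xbar / 2 * c * z)"
      by (rule limit_square_law)
  qed
qed

end
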